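(* Let $\Bbbk$ be a field, and let $A$ and $B$ be two commutative Noetherian $\Bbbk$-algebras such that $A\otimes_\Bbbk B$ is Noetherian. Let $I$ be an ideal of $A$ and $J$ an ideal of $B$, and let $L$ and $N$ be nonzero finitely generated modules over $A$ and $B$, respectively. Suppose $IL\neq L$ and $JN\neq N$. Then $L\otimes_\Bbbk N$ is Cohen--Macaulay with respect to $I\otimes_\Bbbk B+A\otimes_\Bbbk J$ if and only if $L$ and $N$ are Cohen--Macaulay with respect to $I$ and $J$, respectively.
   Context: $I\otimes_\Bbbk B+A\otimes_\Bbbk J$ is regarded as an ideal of $A\otimes_\Bbbk B$, and $L\otimes_\Bbbk N$ as an $A\otimes_\Bbbk B$-module. For a Noetherian ring $R$, an ideal $\mathfrak a$ and a finitely generated $R$-module $M$: $\operatorname{grade}(\mathfrak a,M)=\inf\{i: H^i_{\mathfrak a}(M)\neq 0\}$ and $\operatorname{cd}(\mathfrak a,M)=\sup\{i: H^i_{\mathfrak a}(M)\neq 0\}$, where $H^i_{\mathfrak a}$ is local cohomology. For $\mathfrak a$ proper, $M$ is Cohen--Macaulay with respect to $\mathfrak a$ if either $M=\mathfrak aM$, or $M\neq\mathfrak aM$ and $\operatorname{grade}(\mathfrak a,M)=\operatorname{cd}(\mathfrak a,M)$. *)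

theory Defs
  imports "HOL-Algebra.Algebra" "HOL-Library.Extended_Real"
begin

section \<open>Modules\<close>

definition module_hom ::
  "('a, 'x) ring_scheme \<Rightarrow> ('a, 'm, 'y) module_scheme \<Rightarrow> ('a, 'n, 'z) module_scheme \<Rightarrow> ('m \<Rightarrow> 'n) set"
  where "module_hom R M N =
    {f \<in> carrier M \<rightarrow> carrier N.
       (\<forall>x\<in>carrier M. \<forall>y\<in>carrier M. f (x \<oplus>\<^bsub>M\<^esub> y) = f x \<oplus>\<^bsub>N\<^esub> f y) \<and>
       (\<forall>r\<in>carrier R. \<forall>x\<in>carrier M. f (r \<odot>\<^bsub>M\<^esub> x) = r \<odot>\<^bsub>N\<^esub> f x)}"

definition fin_gen_module :: "('a, 'x) ring_scheme \<Rightarrow> ('a, 'm, 'y) module_scheme \<Rightarrow> bool"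
  where "fin_gen_module R M \<longleftrightarrow>
    module R M \<and>
    (\<exists>S. finite S \<and> S \<subseteq> carrier M \<and>
         carrier M = {finsum M (\<lambda>s. c s \<odot>\<^bsub>M\<^esub> s) S | c. c \<in> S \<rightarrow> carrier R})"

text \<open>The submodule \<open>IM\<close>.\<close>

definition ideal_smult :: "'a set \<Rightarrow> ('a, 'm, 'y) module_scheme \<Rightarrow> 'm set"
  where "ideal_smult I M =
    generate (add_monoid M) {r \<odot>\<^bsub>M\<^esub> m | r m. r \<in> I \<and> m \<in> carrier M}"

text \<open>The record type of modules extends that of rings; the fields \<open>mult\<close> and \<open>one\<close> are
  irrelevant for a module and are left unspecified here and below.\<close>

definition quotient_module :: "('a, 'm, 'y) module_scheme \<Rightarrow> 'm set \<Rightarrow> ('a, 'm set) module"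
  where "quotient_module M H =
    \<lparr>carrier = a_rcosets\<^bsub>M\<^esub> H, monoid.mult = undefined, one = undefined, ring.zero = H,
     add = set_add M,
     smult = (\<lambda>r C. \<Union>x\<in>C. H +>\<^bsub>M\<^esub> (r \<odot>\<^bsub>M\<^esub> x))\<rparr>"

definition restrict_scalars ::
  "('k, 'a, 'x) module_scheme \<Rightarrow> ('a, 'm, 'y) module_scheme \<Rightarrow> ('k, 'm) module"
  where "restrict_scalars A M =
    \<lparr>carrier = carrier M, monoid.mult = undefined, one = undefined, ring.zero = \<zero>\<^bsub>M\<^esub>,
     add = add M,
     smult = (\<lambda>c m. (c \<odot>\<^bsub>A\<^esub> \<one>\<^bsub>A\<^esub>) \<odot>\<^bsub>M\<^esub> m)\<rparr>"


section \<open>Tensor products\<close>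

text \<open>\<open>M \<otimes>\<^sub>K N\<close> is the free abelian group on \<open>M \<times> N\<close> modulo the subgroup generated by the
  biadditivity and \<open>K\<close>-balancedness relations.\<close>

definition tensor_relations ::
  "('k, 'x) ring_scheme \<Rightarrow> ('k, 'm, 'y) module_scheme \<Rightarrow> ('k, 'n, 'z) module_scheme
     \<Rightarrow> ('m \<times> 'n \<Rightarrow>\<^sub>0 int) set"
  where "tensor_relations K M N =
    generate (free_Abelian_group (carrier M \<times> carrier N))
      ({frag_of (x \<oplus>\<^bsub>M\<^esub> x', y) - frag_of (x, y) - frag_of (x', y) | x x' y.
          x \<in> carrier M \<and> x' \<in> carrier M \<and> y \<in> carrier N} \<union>
       {frag_of (x, y \<oplus>\<^bsub>N\<^esub> y') - frag_of (x, y) - frag_of (x, y') | x y y'.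
          x \<in> carrier M \<and> y \<in> carrier N \<and> y' \<in> carrier N} \<union>
       {frag_of (c \<odot>\<^bsub>M\<^esub> x, y) - frag_of (x, c \<odot>\<^bsub>N\<^esub> y) | c x y.
          c \<in> carrier K \<and> x \<in> carrier M \<and> y \<in> carrier N})"

definition tensor_group ::
  "('k, 'x) ring_scheme \<Rightarrow> ('k, 'm, 'y) module_scheme \<Rightarrow> ('k, 'n, 'z) module_scheme
     \<Rightarrow> ('m \<times> 'n \<Rightarrow>\<^sub>0 int) set monoid"
  where "tensor_group K M N =
    free_Abelian_group (carrier M \<times> carrier N) Mod tensor_relations K M N"

definition tensor_class ::
  "('k, 'x) ring_scheme \<Rightarrow> ('k, 'm, 'y) module_scheme \<Rightarrow> ('k, 'n, 'z) module_scheme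
     \<Rightarrow> ('m \<times> 'n \<Rightarrow>\<^sub>0 int) \<Rightarrow> ('m \<times> 'n \<Rightarrow>\<^sub>0 int) set"
  where "tensor_class K M N u =
    tensor_relations K M N #>\<^bsub>free_Abelian_group (carrier M \<times> carrier N)\<^esub> u"

text \<open>The biadditive extension of \<open>(a, b) \<cdot> (x, y) = (a x, b y)\<close> to formal sums.\<close>

definition frag_mult ::
  "('a \<Rightarrow> 'm \<Rightarrow> 'm) \<Rightarrow> ('b \<Rightarrow> 'n \<Rightarrow> 'n) \<Rightarrow> ('a \<times> 'b \<Rightarrow>\<^sub>0 int) \<Rightarrow> ('m \<times> 'n \<Rightarrow>\<^sub>0 int) \<Rightarrow> ('m \<times> 'n \<Rightarrow>\<^sub>0 int)"
  where "frag_mult f g u v =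
    frag_extend (\<lambda>(a, b). frag_extend (\<lambda>(x, y). frag_of (f a x, g b y)) v) u"

definition tensor_algebra ::
  "('k, 'x) ring_scheme \<Rightarrow> ('k, 'a, 'y) module_scheme \<Rightarrow> ('k, 'b, 'z) module_scheme
     \<Rightarrow> ('k, ('a \<times> 'b \<Rightarrow>\<^sub>0 int) set) module"
  where "tensor_algebra K A B =
    \<lparr>carrier = carrier (tensor_group K A B),
     monoid.mult = (\<lambda>U V. \<Union>u\<in>U. \<Union>v\<in>V. tensor_class K A B
                (frag_mult (monoid.mult A) (monoid.mult B) u v)),
     one = tensor_class K A B (frag_of (\<one>\<^bsub>A\<^esub>, \<one>\<^bsub>B\<^esub>)),
     ring.zero = \<one>\<^bsub>tensor_group K A B\<^esub>,
     add = monoid.mult (tensor_group K A B),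
     smult = (\<lambda>c U. \<Union>u\<in>U. tensor_class K A B
                (frag_extend (\<lambda>(a, b). frag_of (c \<odot>\<^bsub>A\<^esub> a, b)) u))\<rparr>"

text \<open>For an \<open>A\<close>-module \<open>L\<close> and a \<open>B\<close>-module \<open>N\<close>: \<open>L \<otimes>\<^sub>K N\<close> as a module over \<open>A \<otimes>\<^sub>K B\<close>.\<close>

definition tensor_module ::
  "('k, 'x) ring_scheme \<Rightarrow> ('k, 'a, 'y) module_scheme \<Rightarrow> ('k, 'b, 'z) module_scheme
     \<Rightarrow> ('a, 'l, 'v) module_scheme \<Rightarrow> ('b, 'n, 'w) module_scheme
     \<Rightarrow> (('a \<times> 'b \<Rightarrow>\<^sub>0 int) set, ('l \<times> 'n \<Rightarrow>\<^sub>0 int) set) module"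
  where "tensor_module K A B L N =
    (let L' = restrict_scalars A L; N' = restrict_scalars B N in
     \<lparr>carrier = carrier (tensor_group K L' N'),
      monoid.mult = undefined, one = undefined,
      ring.zero = \<one>\<^bsub>tensor_group K L' N'\<^esub>,
      add = monoid.mult (tensor_group K L' N'),
      smult = (\<lambda>U V. \<Union>u\<in>U. \<Union>v\<in>V. tensor_class K L' N' (frag_mult (smult L) (smult N) u v))\<rparr>)"

text \<open>The image of \<open>S \<otimes>\<^sub>K T\<close> in \<open>A \<otimes>\<^sub>K B\<close>, for \<open>K\<close>-subspaces \<open>S\<close> of \<open>A\<close> and \<open>T\<close> of \<open>B\<close>
  (isomorphic to \<open>S \<otimes>\<^sub>K T\<close>, as \<open>K\<close> will be a field).\<close>

definition tensor_image ::
  "('k, 'x) ring_scheme \<Rightarrow> ('k, 'a, 'y) module_scheme \<Rightarrow> ('k, 'b, 'z) module_scheme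
     \<Rightarrow> 'a set \<Rightarrow> 'b set \<Rightarrow> ('a \<times> 'b \<Rightarrow>\<^sub>0 int) set set"
  where "tensor_image K A B S T =
    generate (add_monoid (tensor_algebra K A B))
      {tensor_class K A B (frag_of (s, t)) | s t. s \<in> S \<and> t \<in> T}"

text \<open>\<open>I \<otimes>\<^sub>K B + A \<otimes>\<^sub>K J\<close>\<close>

definition tensor_ideal ::
  "('k, 'x) ring_scheme \<Rightarrow> ('k, 'a, 'y) module_scheme \<Rightarrow> ('k, 'b, 'z) module_scheme
     \<Rightarrow> 'a set \<Rightarrow> 'b set \<Rightarrow> ('a \<times> 'b \<Rightarrow>\<^sub>0 int) set set"
  where "tensor_ideal K A B I J =
    tensor_image K A B I (carrier B) <+>\<^bsub>tensor_algebra K A B\<^esub> tensor_image K A B (carrier A) J"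


section \<open>Local cohomology\<close>

text \<open>The extension property is required for all monomorphisms between modules carried by the
  type of \<open>E\<close> itself.  If that type admits an injection from the type of the ring, then all
  ideals of the ring have copies among these modules, so by Baer's criterion this is injectivity
  with respect to all monomorphisms of \<open>R\<close>-modules.\<close>

definition injective_module :: "('a, 'x) ring_scheme \<Rightarrow> ('a, 'e) module \<Rightarrow> bool"
  where "injective_module R E \<longleftrightarrow>
    module R E \<and>
    (\<forall>(P :: ('a, 'e) module) (Q :: ('a, 'e) module) i f.
       module R P \<and> module R Q \<and> i \<in> module_hom R P Q \<and> inj_on i (carrier P) \<and>
       f \<in> module_hom R P E \<longrightarrow>
       (\<exists>g\<in>module_hom R Q E. \<forall>x\<in>carrier P. g (i x) = f x))"

text \<open>Exactness of \<open>0 \<rightarrow> M \<rightarrow> E 0 \<rightarrow> E 1 \<rightarrow> \<dots>\<close> with all \<open>E i\<close> injective; \<open>e\<close> is the augmentation.\<close>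

definition injective_resolution ::
  "('a, 'x) ring_scheme \<Rightarrow> ('a, 'm, 'y) module_scheme
     \<Rightarrow> (nat \<Rightarrow> ('a, 'e) module) \<Rightarrow> ('m \<Rightarrow> 'e) \<Rightarrow> (nat \<Rightarrow> 'e \<Rightarrow> 'e) \<Rightarrow> bool"
  where "injective_resolution R M E e d \<longleftrightarrow>
    (\<forall>i. injective_module R (E i)) \<and>
    e \<in> module_hom R M (E 0) \<and> inj_on e (carrier M) \<and>
    (\<forall>i. d i \<in> module_hom R (E i) (E (Suc i))) \<and>
    e ` carrier M = a_kernel (E 0) (E 1) (d 0) \<and>
    (\<forall>i. d i ` carrier (E i) = a_kernel (E (Suc i)) (E (Suc (Suc i))) (d (Suc i)))"

text \<open>The torsion functor \<open>\<Gamma>\<^sub>\<aa>(M) = {m. \<aa>\<^sup>n m = 0 for some n}\<close>; ideal powers are powers in the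
  multiplicative monoid of ideals.\<close>

definition torsion_part ::
  "('a, 'x) ring_scheme \<Rightarrow> 'a set \<Rightarrow> ('a, 'm, 'y) module_scheme \<Rightarrow> 'm set"
  where "torsion_part R \<aa> M =
    {m \<in> carrier M. \<exists>n::nat. \<forall>r \<in> \<aa> [^]\<^bsub>ideals_set R\<^esub> n. r \<odot>\<^bsub>M\<^esub> m = \<zero>\<^bsub>M\<^esub>}"

definition torsion_cocycles ::
  "('a, 'x) ring_scheme \<Rightarrow> 'a set \<Rightarrow> (nat \<Rightarrow> ('a, 'e) module) \<Rightarrow> (nat \<Rightarrow> 'e \<Rightarrow> 'e) \<Rightarrow> nat \<Rightarrow> 'e set"
  where "torsion_cocycles R \<aa> E d i =
    {x \<in> torsion_part R \<aa> (E i). d i x = \<zero>\<^bsub>E (Suc i)\<^esub>}"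

definition torsion_coboundaries ::
  "('a, 'x) ring_scheme \<Rightarrow> 'a set \<Rightarrow> (nat \<Rightarrow> ('a, 'e) module) \<Rightarrow> (nat \<Rightarrow> 'e \<Rightarrow> 'e) \<Rightarrow> nat \<Rightarrow> 'e set"
  where "torsion_coboundaries R \<aa> E d i =
    (case i of 0 \<Rightarrow> {\<zero>\<^bsub>E 0\<^esub>} | Suc j \<Rightarrow> d j ` torsion_part R \<aa> (E j))"

text \<open>\<open>H\<^sup>i\<^sub>\<aa>(M)\<close>, the \<open>i\<close>-th right derived functor of \<open>\<Gamma>\<^sub>\<aa>\<close>, computed from a chosen injective
  resolution; up to isomorphism it does not depend on the choice.

  The carrier type \<open>('a \<times> 'm) list set\<close> of the terms is large enough for a resolution of \<open>M\<close> to
  exist: its cardinality \<open>\<lambda>\<close> is two to the power of the infinite cardinality of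
  \<open>('a \<times> 'm) list\<close>, so \<open>|M| \<le> \<lambda>\<close> and \<open>\<lambda>\<^sup>|\<^sup>R\<^sup>| = \<lambda>\<close>.  A module with at most \<open>\<lambda>\<close> elements embeds,
  as an abelian group, into a divisible group \<open>D\<close> with at most \<open>\<lambda>\<close> elements, and hence, as a
  module, into the injective module \<open>Hom\<^sub>\<int>(R, D)\<close>, which again has at most \<open>\<lambda>\<close> elements; this
  applies repeatedly to the cokernels.\<close>

definition local_cohomology ::
  "('a, 'x) ring_scheme \<Rightarrow> 'a set \<Rightarrow> ('a, 'm, 'y) module_scheme \<Rightarrow> nat
     \<Rightarrow> ('a, ('a \<times> 'm) list set set) module"
  where "local_cohomology R \<aa> M i =
    (let (E, e, d) =
       (SOME (E :: nat \<Rightarrow> ('a, ('a \<times> 'm) list set) module, e, d). injective_resolution R M E e d)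
     in quotient_module ((E i)\<lparr>carrier := torsion_cocycles R \<aa> E d i\<rparr>)
          (torsion_coboundaries R \<aa> E d i))"

definition nonvanishing_degrees ::
  "('a, 'x) ring_scheme \<Rightarrow> 'a set \<Rightarrow> ('a, 'm, 'y) module_scheme \<Rightarrow> nat set"
  where "nonvanishing_degrees R \<aa> M =
    {i. carrier (local_cohomology R \<aa> M i) \<noteq> {\<zero>\<^bsub>local_cohomology R \<aa> M i\<^esub>}}"

text \<open>In the extended reals the infimum and supremum of the empty set are \<open>\<infinity>\<close> and \<open>-\<infinity>\<close>.\<close>

definition grade :: "('a, 'x) ring_scheme \<Rightarrow> 'a set \<Rightarrow> ('a, 'm, 'y) module_scheme \<Rightarrow> ereal"
  where "grade R \<aa> M = (INF i\<in>nonvanishing_degrees R \<aa> M. ereal (real i))"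

definition cohomological_dim ::
  "('a, 'x) ring_scheme \<Rightarrow> 'a set \<Rightarrow> ('a, 'm, 'y) module_scheme \<Rightarrow> ereal"
  where "cohomological_dim R \<aa> M = (SUP i\<in>nonvanishing_degrees R \<aa> M. ereal (real i))"

text \<open>To be used for a Noetherian ring \<open>R\<close>, a proper ideal \<open>\<aa>\<close> and a finitely generated module
  \<open>M\<close>.\<close>

definition relative_Cohen_Macaulay ::
  "('a, 'x) ring_scheme \<Rightarrow> 'a set \<Rightarrow> ('a, 'm, 'y) module_scheme \<Rightarrow> bool"
  where "relative_Cohen_Macaulay R \<aa> M \<longleftrightarrow>
    carrier M = ideal_smult \<aa> M \<or>
    carrier M \<noteq> ideal_smult \<aa> M \<and> grade R \<aa> M = cohomological_dim R \<aa> M"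

end

theory Submission
  imports Defs
begin

text \<open>For a module \<open>M \<noteq> \<aa>M\<close> being Cohen--Macaulay with respect to \<open>\<aa>\<close> means that \<open>H\<^sup>n(M) \<noteq> 0\<close> for exactly
  one \<open>n\<close>.  So it suffices that the set of these degrees for \<open>L \<otimes> N\<close> is the sumset of the sets for
  \<open>L\<close> and \<open>N\<close>: a sumset is a singleton if and only if both summands are.

  Call \<open>M\<close> acyclic for \<open>x\<^sub>1, \<dots>, x\<^sub>r\<close> if \<open>M = x\<^sub>1 M + \<Gamma> M\<close>, where \<open>\<Gamma>\<close> is the \<open>x\<^sub>1\<close>-torsion, and \<open>\<Gamma> M\<close> is
  acyclic for \<open>x\<^sub>2, \<dots>, x\<^sub>r\<close>.  Exact complexes of acyclic modules, bounded from below, remain exact after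
  taking \<open>(x\<^sub>1, \<dots>, x\<^sub>r)\<close>-torsion, so local cohomology vanishes in the same degrees for any resolution by
  acyclic modules.  Injective modules over a Noetherian ring are acyclic.  If \<open>P\<close> and \<open>Q\<close> are injective
  resolutions of \<open>L\<close> and \<open>N\<close>, then the total complex of \<open>P \<otimes> Q\<close> is a resolution of \<open>L \<otimes> N\<close>; its terms are
  acyclic for the joint generators of \<open>I\<close> and \<open>J\<close>, with torsion \<open>\<Gamma>\<^sub>I P \<otimes> \<Gamma>\<^sub>J Q\<close>.  Since \<open>K\<close> is a field, the
  differentials have \<open>K\<close>-linear generalized inverses, and these give the Kuenneth statement that
  \<open>\<Gamma>\<^sub>I P \<otimes> \<Gamma>\<^sub>J Q\<close> is exact in degree \<open>n\<close> if and only if, for all \<open>i + j = n\<close>, \<open>\<Gamma>\<^sub>I P\<close> is exact at \<open>i\<close> or \<open>\<Gamma>\<^sub>J Q\<close>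
  is exact at \<open>j\<close>.\<close>

section \<open>Baer's criterion\<close>

text \<open>Over A \<otimes> B the terms P_i \<otimes> Q_j need not be injective, so the total
  complex is not a resolution that the definition of local cohomology could choose. Acyclicity is
  therefore phrased one generator at a time: every step concerns a single element acting on a single
  factor, where multiplication by x^k has a K-linear generalized inverse and torsion can be computed
  inside the factor.

  The other obstacle is typing. \<open>injective_module\<close> tests only modules carried by one
  type, and \<open>local_cohomology\<close> chooses a resolution in one fixed type.
  \<open>baer\<close> is the form of injectivity that does not depend on a type, and the choice is
  meaningful only after a resolution has been built inside that type. Because K is a field, Hom_K(A,
  M) is injective for every A-module M, so it can take the place of the modules obtained from
  divisible groups.

  For the same reason the terms of a complex are collected in one product module. The total complex
  then lives inside a single tensor product, and its degrees are cut out as subgroups.\<close>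

lemma module_homI:
  assumes "\<And>x. x \<in> carrier M \<Longrightarrow> f x \<in> carrier N"
    and "\<And>x y. \<lbrakk>x \<in> carrier M; y \<in> carrier M\<rbrakk> \<Longrightarrow> f (x \<oplus>\<^bsub>M\<^esub> y) = f x \<oplus>\<^bsub>N\<^esub> f y"
    and "\<And>r x. \<lbrakk>r \<in> carrier R; x \<in> carrier M\<rbrakk> \<Longrightarrow> f (r \<odot>\<^bsub>M\<^esub> x) = r \<odot>\<^bsub>N\<^esub> f x"
  shows "f \<in> module_hom R M N"
  using assms by (auto simp: module_hom_def)

lemma module_homD:
  assumes "f \<in> module_hom R M N"
  shows "x \<in> carrier M \<Longrightarrow> f x \<in> carrier N"
    and "\<lbrakk>x \<in> carrier M; y \<in> carrier M\<rbrakk> \<Longrightarrow> f (x \<oplus>\<^bsub>M\<^esub> y) = f x \<oplus>\<^bsub>N\<^esub> f y"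
    and "\<lbrakk>r \<in> carrier R; x \<in> carrier M\<rbrakk> \<Longrightarrow> f (r \<odot>\<^bsub>M\<^esub> x) = r \<odot>\<^bsub>N\<^esub> f x"
  using assms by (auto simp: module_hom_def)

lemma module_hom_zero:
  assumes "module R M" "module R N" "f \<in> module_hom R M N"
  shows "f \<zero>\<^bsub>M\<^esub> = \<zero>\<^bsub>N\<^esub>"
proof -
  interpret M: module R M by fact
  interpret N: module R N by fact
  have "f (\<zero>\<^bsub>R\<^esub> \<odot>\<^bsub>M\<^esub> \<zero>\<^bsub>M\<^esub>) = \<zero>\<^bsub>R\<^esub> \<odot>\<^bsub>N\<^esub> f \<zero>\<^bsub>M\<^esub>"
    by (rule module_homD(3)[OF assms(3)]) simp_all
  thus ?thesis using module_homD(1)[OF assms(3)] by simp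
qed

lemma module_hom_neg:
  assumes "module R M" "module R N" "f \<in> module_hom R M N" "x \<in> carrier M"
  shows "f (\<ominus>\<^bsub>M\<^esub> x) = \<ominus>\<^bsub>N\<^esub> f x"
proof -
  interpret M: module R M by fact
  interpret N: module R N by fact
  have "f ((\<ominus>\<^bsub>R\<^esub> \<one>\<^bsub>R\<^esub>) \<odot>\<^bsub>M\<^esub> x) = (\<ominus>\<^bsub>R\<^esub> \<one>\<^bsub>R\<^esub>) \<odot>\<^bsub>N\<^esub> f x"
    using module_homD[OF assms(3)] assms(4) by simp
  thus ?thesis
    using module_homD(1)[OF assms(3)] assms(4) by (simp add: M.smult_l_minus N.smult_l_minus)
qed

lemma module_hom_diff:
  assumes "module R M" "module R N" "f \<in> module_hom R M N" "x \<in> carrier M" "y \<in> carrier M"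
  shows "f (x \<ominus>\<^bsub>M\<^esub> y) = f x \<ominus>\<^bsub>N\<^esub> f y"
proof -
  interpret M: module R M by fact
  show ?thesis
    using module_homD[OF assms(3)] assms by (simp add: a_minus_def module_hom_neg)
qed

lemma module_hom_comp:
  assumes "f \<in> module_hom R M N" "g \<in> module_hom R N Q"
  shows "(\<lambda>x. g (f x)) \<in> module_hom R M Q"
  using assms by (auto simp: module_hom_def Pi_iff)

lemma (in abelian_group) add_diff_add:
  assumes "a \<in> carrier G" "b \<in> carrier G" "c \<in> carrier G" "d \<in> carrier G"
  shows "(a \<oplus> b) \<ominus> (c \<oplus> d) = (a \<ominus> c) \<oplus> (b \<ominus> d)"
  using assms by (simp add: a_minus_def minus_add a_ac)

lemma (in module) diff_zero_iff:
  assumes "x \<in> carrier M" "y \<in> carrier M"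
  shows "x \<ominus>\<^bsub>M\<^esub> y = \<zero>\<^bsub>M\<^esub> \<longleftrightarrow> x = y"
  using assms by (metis M.add.inv_closed M.add.m_closed M.l_neg M.minus_minus M.minus_equality M.r_neg a_minus_def)

lemma (in module) diff_add_cancel:
  assumes "x \<in> carrier M" "y \<in> carrier M"
  shows "(x \<ominus>\<^bsub>M\<^esub> y) \<oplus>\<^bsub>M\<^esub> y = x"
  using assms by (simp add: a_minus_def M.a_assoc M.l_neg)

lemma (in module) diff_zero_right:
  assumes "x \<in> carrier M"
  shows "x \<ominus>\<^bsub>M\<^esub> \<zero>\<^bsub>M\<^esub> = x"
  using diff_add_cancel[of x "\<zero>\<^bsub>M\<^esub>"] assms by simp

lemma (in module) neg_eq_smult:
  assumes "x \<in> carrier M"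
  shows "\<ominus>\<^bsub>M\<^esub> x = (\<ominus> \<one>) \<odot>\<^bsub>M\<^esub> x"
  using assms by (simp add: smult_l_minus)

text \<open>Closure under negatives follows from that under scalars, by multiplying with minus
  one.\<close>

lemma (in module) submoduleI':
  assumes "H \<subseteq> carrier M" "\<zero>\<^bsub>M\<^esub> \<in> H"
    and "\<And>a b. \<lbrakk>a \<in> H; b \<in> H\<rbrakk> \<Longrightarrow> a \<oplus>\<^bsub>M\<^esub> b \<in> H"
    and "\<And>r x. \<lbrakk>r \<in> carrier R; x \<in> H\<rbrakk> \<Longrightarrow> r \<odot>\<^bsub>M\<^esub> x \<in> H"
  shows "submodule H R M"
proof (rule submoduleI)
  fix a assume "a \<in> H"
  thus "\<ominus>\<^bsub>M\<^esub> a \<in> H" using assms(1) assms(4)[of "\<ominus> \<one>" a] neg_eq_smult[of a] by auto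
qed (use assms in auto)

text \<open>Only ideals of \<open>R\<close> and functions on them are quantified, so unlike
  \<open>injective_module\<close> this condition does not depend on the carrier type of test
  modules. A map on an ideal is kept as a plain function, which avoids making \<open>b\<close> a
  module.\<close>

definition baer :: "('a, 'x) ring_scheme \<Rightarrow> ('a, 'e, 'y) module_scheme \<Rightarrow> bool"
  where "baer R E \<longleftrightarrow> module R E \<and>
    (\<forall>b f. ideal b R \<and> f \<in> b \<rightarrow> carrier E \<and>
       (\<forall>r\<in>b. \<forall>s\<in>b. f (r \<oplus>\<^bsub>R\<^esub> s) = f r \<oplus>\<^bsub>E\<^esub> f s) \<and>
       (\<forall>r\<in>carrier R. \<forall>s\<in>b. f (r \<otimes>\<^bsub>R\<^esub> s) = r \<odot>\<^bsub>E\<^esub> f s) \<longrightarrow>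
       (\<exists>e\<in>carrier E. \<forall>r\<in>b. f r = r \<odot>\<^bsub>E\<^esub> e))"

text \<open>A partial homomorphism is represented by its graph; single-valuedness only has to be required
  at \<open>0\<close>.\<close>

definition partial_hom ::
  "('a, 'x) ring_scheme \<Rightarrow> ('a, 'q, 'y) module_scheme \<Rightarrow> ('a, 'e, 'z) module_scheme \<Rightarrow> ('q \<times> 'e) set \<Rightarrow> bool"
  where "partial_hom R Q E G \<longleftrightarrow> G \<subseteq> carrier Q \<times> carrier E \<and>
    (\<forall>x y x' y'. (x, y) \<in> G \<and> (x', y') \<in> G \<longrightarrow> (x \<oplus>\<^bsub>Q\<^esub> x', y \<oplus>\<^bsub>E\<^esub> y') \<in> G) \<and>
    (\<forall>r x y. r \<in> carrier R \<and> (x, y) \<in> G \<longrightarrow> (r \<odot>\<^bsub>Q\<^esub> x, r \<odot>\<^bsub>E\<^esub> y) \<in> G) \<and>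
    (\<forall>y. (\<zero>\<^bsub>Q\<^esub>, y) \<in> G \<longrightarrow> y = \<zero>\<^bsub>E\<^esub>)"

text \<open>The difference of the two pairs is (0, y - y'), and single-valuedness at 0 applies to
  it.\<close>

lemma partial_hom_unique:
  assumes "module R Q" "module R E" "partial_hom R Q E G" "(x, y) \<in> G" "(x, y') \<in> G"
  shows "y = y'"
proof -
  interpret Q: module R Q by fact
  interpret E: module R E by fact
  have c: "x \<in> carrier Q" "y \<in> carrier E" "y' \<in> carrier E"
    using assms(3-5) by (auto simp: partial_hom_def)
  have "((\<ominus>\<^bsub>R\<^esub> \<one>\<^bsub>R\<^esub>) \<odot>\<^bsub>Q\<^esub> x, (\<ominus>\<^bsub>R\<^esub> \<one>\<^bsub>R\<^esub>) \<odot>\<^bsub>E\<^esub> y') \<in> G"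
    using assms(3,5) by (simp add: partial_hom_def)
  hence "(\<ominus>\<^bsub>Q\<^esub> x, \<ominus>\<^bsub>E\<^esub> y') \<in> G" using c by (simp add: Q.neg_eq_smult E.neg_eq_smult)
  hence "(x \<oplus>\<^bsub>Q\<^esub> \<ominus>\<^bsub>Q\<^esub> x, y \<oplus>\<^bsub>E\<^esub> \<ominus>\<^bsub>E\<^esub> y') \<in> G"
    using assms(3,4) unfolding partial_hom_def by blast
  hence "y \<ominus>\<^bsub>E\<^esub> y' = \<zero>\<^bsub>E\<^esub>"
    using assms(3) c by (simp add: partial_hom_def Q.r_neg a_minus_def)
  thus ?thesis using c E.diff_zero_iff by simp
qed

text \<open>The coefficients r with r q in the domain of \<open>G\<close> form an ideal
  \<open>b\<close>, on which r is sent to the value at r q. By Baer's condition this map is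
  multiplication into some e, so e is a consistent value at q.\<close>

lemma partial_hom_extend:
  assumes "baer R E" "module R Q" "partial_hom R Q E G" "G \<noteq> {}" "q \<in> carrier Q"
  shows "\<exists>G' y. partial_hom R Q E G' \<and> G \<subseteq> G' \<and> (q, y) \<in> G'"
proof -
  interpret E: module R E using assms(1) by (simp add: baer_def)
  interpret Q: module R Q by fact
  note G = assms(3)[unfolded partial_hom_def]
  have Gc: "x \<in> carrier Q" "y \<in> carrier E" if "(x, y) \<in> G" for x y using G that by auto
  have Ga: "(x \<oplus>\<^bsub>Q\<^esub> x', y \<oplus>\<^bsub>E\<^esub> y') \<in> G" if "(x, y) \<in> G" "(x', y') \<in> G" for x x' y y'
    using G that by blast
  have Gs: "(r \<odot>\<^bsub>Q\<^esub> x, r \<odot>\<^bsub>E\<^esub> y) \<in> G" if "(x, y) \<in> G" "r \<in> carrier R" for r x y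
    using G that by blast
  have Gu: "y = y'" if "(x, y) \<in> G" "(x, y') \<in> G" for x y y'
    using partial_hom_unique[OF Q.module_axioms E.module_axioms assms(3) that] .
  have G0: "(\<zero>\<^bsub>Q\<^esub>, \<zero>\<^bsub>E\<^esub>) \<in> G"
  proof -
    obtain x y where xy: "(x, y) \<in> G" using assms(4) by auto
    show ?thesis using Gs[OF xy, of "\<zero>\<^bsub>R\<^esub>"] Gc[OF xy] by simp
  qed
  define b where "b = {r \<in> carrier R. \<exists>y. (r \<odot>\<^bsub>Q\<^esub> q, y) \<in> G}"
  define f where "f r = (SOME y. (r \<odot>\<^bsub>Q\<^esub> q, y) \<in> G)" for r
  have fG: "(r \<odot>\<^bsub>Q\<^esub> q, f r) \<in> G" if "r \<in> b" for r
    using that unfolding b_def f_def by (auto intro: someI)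
  have b_add: "(r \<oplus>\<^bsub>R\<^esub> s) \<in> b \<and> f (r \<oplus>\<^bsub>R\<^esub> s) = f r \<oplus>\<^bsub>E\<^esub> f s" if "r \<in> b" "s \<in> b" for r s
  proof -
    have "((r \<oplus>\<^bsub>R\<^esub> s) \<odot>\<^bsub>Q\<^esub> q, f r \<oplus>\<^bsub>E\<^esub> f s) \<in> G"
      using Ga[OF fG fG, OF that] that assms(5) by (simp add: b_def Q.smult_l_distr)
    moreover from this have "r \<oplus>\<^bsub>R\<^esub> s \<in> b" using that by (auto simp: b_def)
    ultimately show ?thesis using fG Gu by blast
  qed
  have b_mult: "(r \<otimes>\<^bsub>R\<^esub> s) \<in> b \<and> f (r \<otimes>\<^bsub>R\<^esub> s) = r \<odot>\<^bsub>E\<^esub> f s" if "r \<in> carrier R" "s \<in> b" for r s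
  proof -
    have "((r \<otimes>\<^bsub>R\<^esub> s) \<odot>\<^bsub>Q\<^esub> q, r \<odot>\<^bsub>E\<^esub> f s) \<in> G"
      using Gs[OF fG, OF that(2,1)] that assms(5) by (simp add: b_def Q.smult_assoc1)
    moreover from this have "r \<otimes>\<^bsub>R\<^esub> s \<in> b" using that by (auto simp: b_def)
    ultimately show ?thesis using fG Gu by blast
  qed
  have b_sub: "b \<subseteq> carrier R" by (auto simp: b_def)
  have "ideal b R"
  proof (rule idealI)
    show "ring R" by (rule E.R.ring_axioms)
    show "subgroup b (add_monoid R)"
    proof
      show "b \<subseteq> carrier (add_monoid R)" using b_sub by simp
      show "\<And>x y. \<lbrakk>x \<in> b; y \<in> b\<rbrakk> \<Longrightarrow> x \<otimes>\<^bsub>add_monoid R\<^esub> y \<in> b" using b_add by simp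
      show "\<one>\<^bsub>add_monoid R\<^esub> \<in> b" using G0 assms(5) by (auto simp: b_def)
      fix x assume x: "x \<in> b"
      have "(\<ominus>\<^bsub>R\<^esub> \<one>\<^bsub>R\<^esub>) \<otimes>\<^bsub>R\<^esub> x \<in> b" using b_mult x by blast
      thus "inv\<^bsub>add_monoid R\<^esub> x \<in> b" using x b_sub by (auto simp: E.R.l_minus a_inv_def[symmetric])
    qed
    show "\<And>a x. \<lbrakk>a \<in> b; x \<in> carrier R\<rbrakk> \<Longrightarrow> x \<otimes>\<^bsub>R\<^esub> a \<in> b" using b_mult by blast
    show "\<And>a x. \<lbrakk>a \<in> b; x \<in> carrier R\<rbrakk> \<Longrightarrow> a \<otimes>\<^bsub>R\<^esub> x \<in> b"
      using b_mult b_sub E.R.m_comm by (metis subsetD)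
  qed
  moreover have "f \<in> b \<rightarrow> carrier E" using fG Gc by blast
  ultimately obtain e where e: "e \<in> carrier E" "\<And>r. r \<in> b \<Longrightarrow> f r = r \<odot>\<^bsub>E\<^esub> e"
    using assms(1) b_add b_mult unfolding baer_def by metis
  define G' where "G' = {(x \<oplus>\<^bsub>Q\<^esub> r \<odot>\<^bsub>Q\<^esub> q, y \<oplus>\<^bsub>E\<^esub> r \<odot>\<^bsub>E\<^esub> e) | x y r. (x, y) \<in> G \<and> r \<in> carrier R}"
  have "partial_hom R Q E G'"
    unfolding partial_hom_def
  proof (intro conjI allI impI)
    show "G' \<subseteq> carrier Q \<times> carrier E" using Gc e assms(5) by (auto simp: G'_def)
  next
    fix u v u' v' assume "(u, v) \<in> G' \<and> (u', v') \<in> G'"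
    then obtain x y r x' y' r' where *: "u = x \<oplus>\<^bsub>Q\<^esub> r \<odot>\<^bsub>Q\<^esub> q" "v = y \<oplus>\<^bsub>E\<^esub> r \<odot>\<^bsub>E\<^esub> e" "(x, y) \<in> G"
        "r \<in> carrier R" "u' = x' \<oplus>\<^bsub>Q\<^esub> r' \<odot>\<^bsub>Q\<^esub> q" "v' = y' \<oplus>\<^bsub>E\<^esub> r' \<odot>\<^bsub>E\<^esub> e" "(x', y') \<in> G"
        "r' \<in> carrier R"
      by (auto simp: G'_def)
    have "u \<oplus>\<^bsub>Q\<^esub> u' = (x \<oplus>\<^bsub>Q\<^esub> x') \<oplus>\<^bsub>Q\<^esub> (r \<oplus>\<^bsub>R\<^esub> r') \<odot>\<^bsub>Q\<^esub> q"
      "v \<oplus>\<^bsub>E\<^esub> v' = (y \<oplus>\<^bsub>E\<^esub> y') \<oplus>\<^bsub>E\<^esub> (r \<oplus>\<^bsub>R\<^esub> r') \<odot>\<^bsub>E\<^esub> e"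
      using * Gc assms(5) e by (simp_all add: Q.smult_l_distr E.smult_l_distr Q.a_ac E.a_ac)
    thus "(u \<oplus>\<^bsub>Q\<^esub> u', v \<oplus>\<^bsub>E\<^esub> v') \<in> G'"
      using Ga[OF *(3,7)] *(4,8) unfolding G'_def by blast
  next
    fix a u v assume "a \<in> carrier R \<and> (u, v) \<in> G'"
    then obtain x y r where *: "a \<in> carrier R" "u = x \<oplus>\<^bsub>Q\<^esub> r \<odot>\<^bsub>Q\<^esub> q" "v = y \<oplus>\<^bsub>E\<^esub> r \<odot>\<^bsub>E\<^esub> e"
        "(x, y) \<in> G" "r \<in> carrier R"
      by (auto simp: G'_def)
    have "a \<odot>\<^bsub>Q\<^esub> u = (a \<odot>\<^bsub>Q\<^esub> x) \<oplus>\<^bsub>Q\<^esub> (a \<otimes>\<^bsub>R\<^esub> r) \<odot>\<^bsub>Q\<^esub> q" "a \<odot>\<^bsub>E\<^esub> v = (a \<odot>\<^bsub>E\<^esub> y) \<oplus>\<^bsub>E\<^esub> (a \<otimes>\<^bsub>R\<^esub> r) \<odot>\<^bsub>E\<^esub> e"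
      using * Gc assms(5) e
      by (simp_all add: Q.smult_r_distr E.smult_r_distr Q.smult_assoc1 E.smult_assoc1)
    thus "(a \<odot>\<^bsub>Q\<^esub> u, a \<odot>\<^bsub>E\<^esub> v) \<in> G'"
      using Gs[OF *(4,1)] *(1,5) unfolding G'_def by blast
  next
    \<comment> \<open>If x + r q = 0, then r q = -x lies in the domain, so r is in \<open>b\<close>
      and its value -y equals r e. Here the choice of e enters.\<close>
    fix v assume "(\<zero>\<^bsub>Q\<^esub>, v) \<in> G'"
    then obtain x y r where *: "\<zero>\<^bsub>Q\<^esub> = x \<oplus>\<^bsub>Q\<^esub> r \<odot>\<^bsub>Q\<^esub> q" "v = y \<oplus>\<^bsub>E\<^esub> r \<odot>\<^bsub>E\<^esub> e"
        "(x, y) \<in> G" "r \<in> carrier R"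
      by (auto simp: G'_def)
    note c = Gc[OF *(3)]
    have "r \<odot>\<^bsub>Q\<^esub> q = \<ominus>\<^bsub>Q\<^esub> x" using *(1,4) c assms(5)
      by (metis Q.M.a_comm Q.M.minus_equality Q.smult_closed)
    moreover have "(\<ominus>\<^bsub>Q\<^esub> x, \<ominus>\<^bsub>E\<^esub> y) \<in> G"
      using Gs[OF *(3), of "\<ominus>\<^bsub>R\<^esub> \<one>\<^bsub>R\<^esub>"] c by (simp add: Q.neg_eq_smult E.neg_eq_smult)
    ultimately have rG: "(r \<odot>\<^bsub>Q\<^esub> q, \<ominus>\<^bsub>E\<^esub> y) \<in> G" by simp
    hence rb: "r \<in> b" using *(4) by (auto simp: b_def)
    have "\<ominus>\<^bsub>E\<^esub> y = r \<odot>\<^bsub>E\<^esub> e" using Gu[OF rG fG[OF rb]] e(2)[OF rb] by simp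
    thus "v = \<zero>\<^bsub>E\<^esub>" using *(2) c by (metis E.M.r_neg)
  qed
  moreover have "G \<subseteq> G'"
  proof
    fix z assume "z \<in> G"
    then obtain x y where z: "z = (x, y)" "(x, y) \<in> G" by (cases z) auto
    have "z = (x \<oplus>\<^bsub>Q\<^esub> \<zero>\<^bsub>R\<^esub> \<odot>\<^bsub>Q\<^esub> q, y \<oplus>\<^bsub>E\<^esub> \<zero>\<^bsub>R\<^esub> \<odot>\<^bsub>E\<^esub> e)"
      using z Gc e assms(5) by simp
    thus "z \<in> G'" using z unfolding G'_def by blast
  qed
  moreover have "(q, e) \<in> G'"
  proof -
    have "(q, e) = (\<zero>\<^bsub>Q\<^esub> \<oplus>\<^bsub>Q\<^esub> \<one>\<^bsub>R\<^esub> \<odot>\<^bsub>Q\<^esub> q, \<zero>\<^bsub>E\<^esub> \<oplus>\<^bsub>E\<^esub> \<one>\<^bsub>R\<^esub> \<odot>\<^bsub>E\<^esub> e)"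
      using e assms(5) by simp
    thus ?thesis using G0 unfolding G'_def by blast
  qed
  ultimately show ?thesis by blast
qed

text \<open>Injectivity for monomorphisms is the case of an injective \<open>u\<close>.\<close>

theorem baer_factor:
  assumes "baer R E" "module R P" "module R Q"
    and u: "u \<in> module_hom R P Q" and h: "h \<in> module_hom R P E"
    and ker: "\<And>p. \<lbrakk>p \<in> carrier P; u p = \<zero>\<^bsub>Q\<^esub>\<rbrakk> \<Longrightarrow> h p = \<zero>\<^bsub>E\<^esub>"
  shows "\<exists>g \<in> module_hom R Q E. \<forall>p \<in> carrier P. g (u p) = h p"
proof -
  interpret E: module R E using assms(1) by (simp add: baer_def)
  interpret P: module R P by fact
  interpret Q: module R Q by fact
  \<comment> \<open>The map that is forced on the image of \<open>u\<close>; \<open>ker\<close>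
    makes it single-valued at 0, hence everywhere.\<close>
  define G0 where "G0 = {(u p, h p) | p. p \<in> carrier P}"
  have G0: "partial_hom R Q E G0"
    unfolding partial_hom_def
  proof (intro conjI allI impI)
    show "G0 \<subseteq> carrier Q \<times> carrier E" using module_homD[OF u] module_homD[OF h] by (auto simp: G0_def)
  next
    fix x y x' y' assume "(x, y) \<in> G0 \<and> (x', y') \<in> G0"
    then obtain p p' where "p \<in> carrier P" "p' \<in> carrier P" "x = u p" "y = h p" "x' = u p'" "y' = h p'"
      by (auto simp: G0_def)
    hence "p \<oplus>\<^bsub>P\<^esub> p' \<in> carrier P" "x \<oplus>\<^bsub>Q\<^esub> x' = u (p \<oplus>\<^bsub>P\<^esub> p')" "y \<oplus>\<^bsub>E\<^esub> y' = h (p \<oplus>\<^bsub>P\<^esub> p')"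
      using module_homD[OF u] module_homD[OF h] by auto
    thus "(x \<oplus>\<^bsub>Q\<^esub> x', y \<oplus>\<^bsub>E\<^esub> y') \<in> G0" unfolding G0_def by blast
  next
    fix r x y assume "r \<in> carrier R \<and> (x, y) \<in> G0"
    then obtain p where "r \<in> carrier R" "p \<in> carrier P" "x = u p" "y = h p"
      by (auto simp: G0_def)
    hence "r \<odot>\<^bsub>P\<^esub> p \<in> carrier P" "r \<odot>\<^bsub>Q\<^esub> x = u (r \<odot>\<^bsub>P\<^esub> p)" "r \<odot>\<^bsub>E\<^esub> y = h (r \<odot>\<^bsub>P\<^esub> p)"
      using module_homD[OF u] module_homD[OF h] by auto
    thus "(r \<odot>\<^bsub>Q\<^esub> x, r \<odot>\<^bsub>E\<^esub> y) \<in> G0" unfolding G0_def by blast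
  next
    fix y assume "(\<zero>\<^bsub>Q\<^esub>, y) \<in> G0"
    thus "y = \<zero>\<^bsub>E\<^esub>" using ker by (auto simp: G0_def)
  qed
  \<comment> \<open>Zorn's lemma yields a maximal extension, and by
    \<open>partial_hom_extend\<close> its domain is all of \<open>Q\<close>.\<close>
  define \<F> where "\<F> = {G. partial_hom R Q E G \<and> G0 \<subseteq> G}"
  have "\<exists>Y\<in>\<F>. \<forall>H\<in>\<F>. Y \<subseteq> H \<longrightarrow> H = Y"
  proof (rule subset_Zorn_nonempty)
    show "\<F> \<noteq> {}" using G0 by (auto simp: \<F>_def)
  next
    fix \<C> assume ne: "\<C> \<noteq> {}" and chain: "subset.chain \<F> \<C>"
    have C: "\<And>G. G \<in> \<C> \<Longrightarrow> partial_hom R Q E G \<and> G0 \<subseteq> G"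
      using chain by (auto simp: subset_chain_def \<F>_def)
    have "partial_hom R Q E (\<Union>\<C>)"
      unfolding partial_hom_def
    proof (intro conjI allI impI)
      show "\<Union>\<C> \<subseteq> carrier Q \<times> carrier E" using C unfolding partial_hom_def by blast
    next
      fix x y x' y' assume "(x, y) \<in> \<Union>\<C> \<and> (x', y') \<in> \<Union>\<C>"
      then obtain G G' where "G \<in> \<C>" "G' \<in> \<C>" "(x, y) \<in> G" "(x', y') \<in> G'" by blast
      moreover have "G \<subseteq> G' \<or> G' \<subseteq> G" using chain \<open>G \<in> \<C>\<close> \<open>G' \<in> \<C>\<close> by (auto simp: subset_chain_def)
      ultimately obtain H where "H \<in> \<C>" "(x, y) \<in> H" "(x', y') \<in> H" by blast
      thus "(x \<oplus>\<^bsub>Q\<^esub> x', y \<oplus>\<^bsub>E\<^esub> y') \<in> \<Union>\<C>" using C[of H] unfolding partial_hom_def by blast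
    next
      fix r x y assume "r \<in> carrier R \<and> (x, y) \<in> \<Union>\<C>"
      thus "(r \<odot>\<^bsub>Q\<^esub> x, r \<odot>\<^bsub>E\<^esub> y) \<in> \<Union>\<C>" using C unfolding partial_hom_def by blast
    next
      fix y assume "(\<zero>\<^bsub>Q\<^esub>, y) \<in> \<Union>\<C>"
      thus "y = \<zero>\<^bsub>E\<^esub>" using C unfolding partial_hom_def by blast
    qed
    thus "\<Union>\<C> \<in> \<F>" using ne C by (auto simp: \<F>_def)
  qed
  then obtain G where GF: "G \<in> \<F>" and GM: "\<forall>H\<in>\<F>. G \<subseteq> H \<longrightarrow> H = G" by (rule bexE)
  have G: "partial_hom R Q E G" "G0 \<subseteq> G" using GF by (simp_all add: \<F>_def)
  have max: "H = G" if "partial_hom R Q E H" "G \<subseteq> H" for H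
  proof -
    have "H \<in> \<F>" using that G(2) by (simp add: \<F>_def)
    thus ?thesis using GM that(2) by simp
  qed
  \<comment> \<open>\<open>partial_hom_extend\<close> takes a nonempty graph, from which it produces
    the pair (0, 0).\<close>
  have "(u \<zero>\<^bsub>P\<^esub>, h \<zero>\<^bsub>P\<^esub>) \<in> G" using G(2) by (auto simp: G0_def)
  hence "G \<noteq> {}" by blast
  have total: "\<exists>y. (q, y) \<in> G" if "q \<in> carrier Q" for q
    using partial_hom_extend[OF assms(1,3) G(1) \<open>G \<noteq> {}\<close> that] max by blast
  define g where "g q = (SOME y. (q, y) \<in> G)" for q
  have gG: "(q, g q) \<in> G" if "q \<in> carrier Q" for q
    using total[OF that] unfolding g_def by (rule someI_ex)
  have gu: "g q = y" if "(q, y) \<in> G" for q y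
  proof -
    have "q \<in> carrier Q" using that G(1) by (auto simp: partial_hom_def)
    thus ?thesis using partial_hom_unique[OF Q.module_axioms E.module_axioms G(1)] gG that by blast
  qed
  have "g \<in> module_hom R Q E"
  proof (rule module_homI)
    fix x assume "x \<in> carrier Q"
    thus "g x \<in> carrier E" using gG G(1) by (auto simp: partial_hom_def)
  next
    fix x y assume "x \<in> carrier Q" "y \<in> carrier Q"
    thus "g (x \<oplus>\<^bsub>Q\<^esub> y) = g x \<oplus>\<^bsub>E\<^esub> g y" using G(1) by (intro gu) (simp add: partial_hom_def gG)
  next
    fix r x assume "r \<in> carrier R" "x \<in> carrier Q"
    thus "g (r \<odot>\<^bsub>Q\<^esub> x) = r \<odot>\<^bsub>E\<^esub> g x" using G(1) by (intro gu) (simp add: partial_hom_def gG)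
  qed
  moreover have "g (u p) = h p" if "p \<in> carrier P" for p
    using G(2) that by (intro gu) (auto simp: G0_def)
  ultimately show ?thesis by blast
qed

section \<open>Linear algebra over a field\<close>

text \<open>A field has only the two trivial ideals, and a map on the whole field is multiplication
  into its value at 1. Extending linear maps from subspaces thus becomes an instance of
  \<open>baer_factor\<close>, without bases.\<close>

lemma baer_field:
  assumes "field K" "module K V"
  shows "baer K V"
proof -
  interpret K: field K by fact
  interpret V: module K V by fact
  show ?thesis
    unfolding baer_def
  proof (intro conjI allI impI)
    show "module K V" by fact
    fix b f assume *: "ideal b K \<and> f \<in> b \<rightarrow> carrier V \<and>
       (\<forall>r\<in>b. \<forall>s\<in>b. f (r \<oplus>\<^bsub>K\<^esub> s) = f r \<oplus>\<^bsub>V\<^esub> f s) \<and>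
       (\<forall>r\<in>carrier K. \<forall>s\<in>b. f (r \<otimes>\<^bsub>K\<^esub> s) = r \<odot>\<^bsub>V\<^esub> f s)"
    hence "b = {\<zero>\<^bsub>K\<^esub>} \<or> b = carrier K" using K.all_ideals by auto
    thus "\<exists>e\<in>carrier V. \<forall>r\<in>b. f r = r \<odot>\<^bsub>V\<^esub> e"
    proof
      assume b: "b = {\<zero>\<^bsub>K\<^esub>}"
      have "f (\<zero>\<^bsub>K\<^esub> \<otimes>\<^bsub>K\<^esub> \<zero>\<^bsub>K\<^esub>) = \<zero>\<^bsub>K\<^esub> \<odot>\<^bsub>V\<^esub> f \<zero>\<^bsub>K\<^esub>" using * b by blast
      moreover have "f \<zero>\<^bsub>K\<^esub> \<in> carrier V" using * b by blast
      ultimately have "f \<zero>\<^bsub>K\<^esub> = \<zero>\<^bsub>V\<^esub>" by simp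
      thus ?thesis using b by (intro bexI[of _ "\<zero>\<^bsub>V\<^esub>"]) auto
    next
      assume b: "b = carrier K"
      have "f r = r \<odot>\<^bsub>V\<^esub> f \<one>\<^bsub>K\<^esub>" if "r \<in> carrier K" for r
      proof -
        have "f (r \<otimes>\<^bsub>K\<^esub> \<one>\<^bsub>K\<^esub>) = r \<odot>\<^bsub>V\<^esub> f \<one>\<^bsub>K\<^esub>" using * b that by blast
        thus ?thesis using that by simp
      qed
      moreover have "f \<one>\<^bsub>K\<^esub> \<in> carrier V" using * b by blast
      ultimately show ?thesis using b by blast
    qed
  qed
qed

lemma submodule_module:
  assumes "submodule S R M" "module R M"
  shows "module R (M\<lparr>carrier := S\<rparr>)"
  using submodule.submodule_is_module[OF assms] .

text \<open>A linear map between subspaces has a generalized inverse: retract \<open>S\<close> onto the kernel of \<open>f\<close>;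
  then \<open>f s \<mapsto> s - \<rho> s\<close> is well defined on the image, and extends.\<close>

lemma pseudo_inverse:
  assumes "field K" "module K V" "module K W" "submodule S K V" "submodule S' K W"
    and f: "f \<in> module_hom K (V\<lparr>carrier := S\<rparr>) (W\<lparr>carrier := S'\<rparr>)"
  obtains g where "g \<in> module_hom K W V" "\<And>w. w \<in> S' \<Longrightarrow> g w \<in> S" "\<And>v. v \<in> S \<Longrightarrow> f (g (f v)) = f v"
proof -
  let ?S = "V\<lparr>carrier := S\<rparr>" and ?S' = "W\<lparr>carrier := S'\<rparr>"
  interpret V: module K V by fact
  interpret W: module K W by fact
  interpret S: module K ?S by (rule submodule_module) fact+
  interpret S': module K ?S' by (rule submodule_module) fact+
  have SV: "S \<subseteq> carrier V" "S' \<subseteq> carrier W"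
    using V.submoduleE(1)[OF assms(4)] W.submoduleE(1)[OF assms(5)] by auto
  define Z where "Z = {s \<in> S. f s = \<zero>\<^bsub>W\<^esub>}"
  have f0: "f \<zero>\<^bsub>V\<^esub> = \<zero>\<^bsub>W\<^esub>" using module_hom_zero[OF S.module_axioms S'.module_axioms f] by simp
  have "submodule Z K ?S"
    using module_homD[OF f] f0 SV S.M.zero_closed S.smult_closed S.M.a_closed
    by (intro S.submoduleI') (auto simp: Z_def)
  hence Z: "module K (?S\<lparr>carrier := Z\<rparr>)" using submodule_module S.module_axioms by blast
  \<comment> \<open>Extending the identity of \<open>Z\<close> along its inclusion into
    \<open>S\<close> gives a retraction onto the kernel.\<close>
  have "\<exists>\<rho> \<in> module_hom K ?S (?S\<lparr>carrier := Z\<rparr>). \<forall>p \<in> carrier (?S\<lparr>carrier := Z\<rparr>). \<rho> (id p) = id p"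
  proof (rule baer_factor)
    show "baer K (?S\<lparr>carrier := Z\<rparr>)" by (rule baer_field) fact+
  qed (use Z S.module_axioms in \<open>auto intro!: module_homI simp: Z_def\<close>)
  then obtain \<rho> where \<rho>: "\<rho> \<in> module_hom K ?S (?S\<lparr>carrier := Z\<rparr>)" "\<And>p. p \<in> Z \<Longrightarrow> \<rho> p = p" by auto
  note \<rho>D = module_homD[OF \<rho>(1), simplified] and fD = module_homD[OF f, simplified]
  have \<rho>Z: "\<rho> s \<in> S" "f (\<rho> s) = \<zero>\<^bsub>W\<^esub>" if "s \<in> S" for s using \<rho>D(1)[OF that] by (auto simp: Z_def)
  \<comment> \<open>The map 1 - \<rho> vanishes on the kernel of \<open>f\<close>, so it factors
    through \<open>f\<close>; the factor is the wanted inverse on \<open>S'\<close>.\<close>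
  let ?h = "\<lambda>s. s \<ominus>\<^bsub>?S\<^esub> \<rho> s"
  have "\<exists>g \<in> module_hom K ?S' ?S. \<forall>p \<in> carrier ?S. g (f p) = ?h p"
  proof (rule baer_factor)
    show "baer K ?S" by (rule baer_field) (fact, rule S.module_axioms)
    show "?h \<in> module_hom K ?S ?S"
    proof (rule module_homI)
      fix x y assume "x \<in> carrier ?S" "y \<in> carrier ?S"
      thus "?h (x \<oplus>\<^bsub>?S\<^esub> y) = ?h x \<oplus>\<^bsub>?S\<^esub> ?h y"
        using \<rho>D(2)[of x y] \<rho>Z[of x] \<rho>Z[of y] S.M.add_diff_add[of x y "\<rho> x" "\<rho> y"] by simp
    next
      fix r x assume "r \<in> carrier K" "x \<in> carrier ?S"
      thus "?h (r \<odot>\<^bsub>?S\<^esub> x) = r \<odot>\<^bsub>?S\<^esub> ?h x"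
        using \<rho>D(3)[of r x] \<rho>Z[of x] S.smult_r_distr[of r x "\<ominus>\<^bsub>?S\<^esub> \<rho> x"] S.smult_r_minus[of r "\<rho> x"]
          S.M.a_inv_closed[of "\<rho> x"]
        by (simp add: a_minus_def)
    next
      fix x assume "x \<in> carrier ?S"
      thus "?h x \<in> carrier ?S" using \<rho>Z[of x] S.M.minus_closed by simp
    qed
    show "\<And>p. \<lbrakk>p \<in> carrier ?S; f p = \<zero>\<^bsub>?S'\<^esub>\<rbrakk> \<Longrightarrow> ?h p = \<zero>\<^bsub>?S\<^esub>"
      using \<rho>(2) S.diff_zero_iff \<rho>Z by (simp add: Z_def)
  qed (use S.module_axioms S'.module_axioms f in auto)
  then obtain g0 where g0: "g0 \<in> module_hom K ?S' ?S" "\<And>p. p \<in> S \<Longrightarrow> g0 (f p) = ?h p" by auto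
  \<comment> \<open>The inverse is extended to the ambient space, because it will act on whole
    modules while its identities hold on the subspaces.\<close>
  have "\<exists>g \<in> module_hom K W V. \<forall>p \<in> carrier ?S'. g (id p) = g0 p"
  proof (rule baer_factor)
    show "baer K V" by (rule baer_field) fact+
    show "id \<in> module_hom K ?S' W" using SV by (auto intro!: module_homI)
    show "g0 \<in> module_hom K ?S' V" using SV module_homD[OF g0(1)] by (auto intro!: module_homI)
    show "\<And>p. \<lbrakk>p \<in> carrier ?S'; id p = \<zero>\<^bsub>W\<^esub>\<rbrakk> \<Longrightarrow> g0 p = \<zero>\<^bsub>V\<^esub>"
      using module_hom_zero[OF S'.module_axioms S.module_axioms g0(1)] by simp
  qed (use W.module_axioms S'.module_axioms in auto)
  then obtain g where g: "g \<in> module_hom K W V" "\<And>p. p \<in> S' \<Longrightarrow> g p = g0 p" by auto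
  show ?thesis
  proof (rule that[OF g(1)])
    show "\<And>w. w \<in> S' \<Longrightarrow> g w \<in> S" using g(2) module_homD(1)[OF g0(1)] by auto
    fix v assume v: "v \<in> S"
    have "g (f v) = ?h v" using g(2) fD(1)[OF v] g0(2)[OF v] by simp
    moreover have "f (?h v) = f v \<ominus>\<^bsub>?S'\<^esub> f (\<rho> v)"
      using module_hom_diff[OF S.module_axioms S'.module_axioms f] v \<rho>Z by simp
    ultimately show "f (g (f v)) = f v" using \<rho>Z(2)[OF v] fD(1)[OF v] S'.diff_zero_right[of "f v"]
      by simp
  qed
qed

section \<open>Torsion and acyclicity\<close>

text \<open>Only the carrier changes, so iterated torsion keeps the type and the operations of
  \<open>M\<close>, and elements can be compared across the steps.\<close>

definition tor :: "('a, 'x) ring_scheme \<Rightarrow> 'a \<Rightarrow> ('a, 'm, 'y) module_scheme \<Rightarrow> ('a, 'm, 'y) module_scheme"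
  where "tor R x M = M\<lparr>carrier := {m \<in> carrier M. \<exists>n::nat. (x [^]\<^bsub>R\<^esub> n) \<odot>\<^bsub>M\<^esub> m = \<zero>\<^bsub>M\<^esub>}\<rparr>"

primrec tors :: "('a, 'x) ring_scheme \<Rightarrow> 'a list \<Rightarrow> ('a, 'm, 'y) module_scheme \<Rightarrow> ('a, 'm, 'y) module_scheme"
  where "tors R [] M = M"
  | "tors R (x # xs) M = tors R xs (tor R x M)"

text \<open>For a Noetherian ring these modules are acyclic for the functor of \<open>xs\<close>-torsion:
  \<open>M = x M + \<Gamma>\<^sub>x M\<close> says that \<open>M\<close> maps onto its localization at \<open>x\<close>, that is, \<open>H\<^sup>1\<^sub>x(M) = 0\<close>.\<close>

definition divisible_mod_tor :: "('a, 'x) ring_scheme \<Rightarrow> 'a \<Rightarrow> ('a, 'm, 'y) module_scheme \<Rightarrow> bool"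
  where "divisible_mod_tor R x M \<longleftrightarrow>
    (\<forall>m\<in>carrier M. \<exists>m'\<in>carrier M. \<exists>t\<in>carrier (tor R x M). m = (x \<odot>\<^bsub>M\<^esub> m') \<oplus>\<^bsub>M\<^esub> t)"

primrec tor_acyclic :: "('a, 'x) ring_scheme \<Rightarrow> 'a list \<Rightarrow> ('a, 'm, 'y) module_scheme \<Rightarrow> bool"
  where "tor_acyclic R [] M \<longleftrightarrow> True"
  | "tor_acyclic R (x # xs) M \<longleftrightarrow> divisible_mod_tor R x M \<and> tor_acyclic R xs (tor R x M)"

lemma tor_simps [simp]:
  "add (tor R x M) = add M" "smult (tor R x M) = smult M" "ring.zero (tor R x M) = ring.zero M"
  by (simp_all add: tor_def)

lemma tors_simps [simp]:
  "add (tors R xs M) = add M" "smult (tors R xs M) = smult M" "ring.zero (tors R xs M) = ring.zero M"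
  by (induct xs arbitrary: M) simp_all

lemma carrier_tor: "m \<in> carrier (tor R x M) \<longleftrightarrow>
  m \<in> carrier M \<and> (\<exists>n::nat. (x [^]\<^bsub>R\<^esub> n) \<odot>\<^bsub>M\<^esub> m = \<zero>\<^bsub>M\<^esub>)"
  by (simp add: tor_def)

text \<open>Shrinking the carrier does not alter the condition imposed by a later element, so
  iterated torsion is simultaneous torsion.\<close>

lemma carrier_tors: "m \<in> carrier (tors R xs M) \<longleftrightarrow>
  m \<in> carrier M \<and> (\<forall>x\<in>set xs. \<exists>n::nat. (x [^]\<^bsub>R\<^esub> n) \<odot>\<^bsub>M\<^esub> m = \<zero>\<^bsub>M\<^esub>)"
  by (induct xs arbitrary: M) (auto simp: carrier_tor)

lemma (in module) pow_smult_add: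
  assumes "x \<in> carrier R" "m \<in> carrier M"
  shows "(x [^] (n + k :: nat)) \<odot>\<^bsub>M\<^esub> m = (x [^] n) \<odot>\<^bsub>M\<^esub> ((x [^] k) \<odot>\<^bsub>M\<^esub> m)"
  using assms by (simp add: R.nat_pow_mult[symmetric] smult_assoc1)

lemma (in module) pow_smult_zero_mono:
  assumes "x \<in> carrier R" "m \<in> carrier M" "(x [^] n) \<odot>\<^bsub>M\<^esub> m = \<zero>\<^bsub>M\<^esub>" "n \<le> k"
  shows "(x [^] (k::nat)) \<odot>\<^bsub>M\<^esub> m = \<zero>\<^bsub>M\<^esub>"
  using pow_smult_add[of x m "k - n" n] assms by simp

lemma (in module) pow_smult_Suc:
  assumes "x \<in> carrier R" "m \<in> carrier M"
  shows "(x [^] Suc n) \<odot>\<^bsub>M\<^esub> m = (x [^] n) \<odot>\<^bsub>M\<^esub> (x \<odot>\<^bsub>M\<^esub> m)"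
  using pow_smult_add[of x m n 1] assms by simp

lemma (in module) submodule_tor:
  assumes "x \<in> carrier R"
  shows "submodule (carrier (tor R x M)) R M"
proof (rule submoduleI')
  show "carrier (tor R x M) \<subseteq> carrier M" by (auto simp: carrier_tor)
  show "\<zero>\<^bsub>M\<^esub> \<in> carrier (tor R x M)" using assms by (auto simp: carrier_tor)
  fix a b assume ab: "a \<in> carrier (tor R x M)" "b \<in> carrier (tor R x M)"
  then obtain n k :: nat where nk: "(x [^] n) \<odot>\<^bsub>M\<^esub> a = \<zero>\<^bsub>M\<^esub>" "(x [^] k) \<odot>\<^bsub>M\<^esub> b = \<zero>\<^bsub>M\<^esub>"
    by (auto simp: carrier_tor)
  have c: "a \<in> carrier M" "b \<in> carrier M" using ab by (auto simp: carrier_tor)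
  have "(x [^] max n k) \<odot>\<^bsub>M\<^esub> a = \<zero>\<^bsub>M\<^esub>" "(x [^] max n k) \<odot>\<^bsub>M\<^esub> b = \<zero>\<^bsub>M\<^esub>"
    using pow_smult_zero_mono[of x] assms nk c by (metis max.cobounded1 max.cobounded2)+
  hence "(x [^] max n k) \<odot>\<^bsub>M\<^esub> (a \<oplus>\<^bsub>M\<^esub> b) = \<zero>\<^bsub>M\<^esub>" using assms c by (simp add: smult_r_distr)
  thus "a \<oplus>\<^bsub>M\<^esub> b \<in> carrier (tor R x M)" using c by (auto simp: carrier_tor)
next
  fix r a assume r: "r \<in> carrier R" and a: "a \<in> carrier (tor R x M)"
  then obtain n :: nat where n: "(x [^] n) \<odot>\<^bsub>M\<^esub> a = \<zero>\<^bsub>M\<^esub>" by (auto simp: carrier_tor)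
  have c: "a \<in> carrier M" using a by (auto simp: carrier_tor)
  have "(x [^] n) \<odot>\<^bsub>M\<^esub> (r \<odot>\<^bsub>M\<^esub> a) = r \<odot>\<^bsub>M\<^esub> ((x [^] n) \<odot>\<^bsub>M\<^esub> a)"
    using assms r c by (metis R.m_comm R.nat_pow_closed smult_assoc1)
  thus "r \<odot>\<^bsub>M\<^esub> a \<in> carrier (tor R x M)" using c n r by (auto simp: carrier_tor)
qed

lemma module_tor: "\<lbrakk>module R M; x \<in> carrier R\<rbrakk> \<Longrightarrow> module R (tor R x M)"
  using submodule_module[OF module.submodule_tor] by (fastforce simp: tor_def)

lemma module_tors: "\<lbrakk>module R M; set xs \<subseteq> carrier R\<rbrakk> \<Longrightarrow> module R (tors R xs M)"
  by (induct xs arbitrary: M) (auto simp: module_tor)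

lemma module_hom_pow:
  assumes "module R M" "f \<in> module_hom R M N" "x \<in> carrier R" "m \<in> carrier M"
  shows "f ((x [^]\<^bsub>R\<^esub> (n::nat)) \<odot>\<^bsub>M\<^esub> m) = (x [^]\<^bsub>R\<^esub> n) \<odot>\<^bsub>N\<^esub> f m"
proof -
  interpret module R M by fact
  show ?thesis using assms by (intro module_homD(3)[OF assms(2)]) auto
qed

lemma module_hom_tor:
  assumes "module R M" "module R N" "f \<in> module_hom R M N" "x \<in> carrier R"
  shows "f \<in> module_hom R (tor R x M) (tor R x N)"
proof (rule module_homI)
  fix m assume m: "m \<in> carrier (tor R x M)"
  then obtain n :: nat where n: "(x [^]\<^bsub>R\<^esub> n) \<odot>\<^bsub>M\<^esub> m = \<zero>\<^bsub>M\<^esub>" "m \<in> carrier M" by (auto simp: carrier_tor)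
  hence "(x [^]\<^bsub>R\<^esub> n) \<odot>\<^bsub>N\<^esub> f m = \<zero>\<^bsub>N\<^esub>"
    using module_hom_pow[OF assms(1,3,4), of m n] module_hom_zero[OF assms(1-3)] by simp
  thus "f m \<in> carrier (tor R x N)" using n module_homD(1)[OF assms(3)] by (auto simp: carrier_tor)
qed (use module_homD[OF assms(3)] in \<open>auto simp: carrier_tor\<close>)

lemma module_hom_tors:
  assumes "module R M" "module R N" "f \<in> module_hom R M N" "set xs \<subseteq> carrier R"
  shows "f \<in> module_hom R (tors R xs M) (tors R xs N)"
  using assms by (induct xs arbitrary: M N) (auto simp: module_hom_tor module_tor)

text \<open>The exponent that kills a given torsion element is not known in advance, so divisibility
  is wanted for every power. In the induction step m' is divided once more, and x^n times its
  torsion part is still torsion.\<close>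

lemma divisible_mod_tor_pow:
  assumes "module R M" "x \<in> carrier R" "divisible_mod_tor R x M" "m \<in> carrier M"
  shows "\<exists>m'\<in>carrier M. \<exists>t\<in>carrier (tor R x M). m = ((x [^]\<^bsub>R\<^esub> (n::nat)) \<odot>\<^bsub>M\<^esub> m') \<oplus>\<^bsub>M\<^esub> t"
proof (induct n)
  interpret module R M by fact
  case 0
  show ?case using assms(2,4)
    by (intro bexI[of _ m] bexI[of _ "\<zero>\<^bsub>M\<^esub>"]) (auto simp: carrier_tor)
next
  interpret module R M by fact
  interpret T: module R "tor R x M" by (rule module_tor) fact+
  case (Suc n)
  then obtain m' t where m': "m' \<in> carrier M" "t \<in> carrier (tor R x M)" "m = ((x [^]\<^bsub>R\<^esub> n) \<odot>\<^bsub>M\<^esub> m') \<oplus>\<^bsub>M\<^esub> t"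
    by auto
  obtain m'' t' where m'': "m'' \<in> carrier M" "t' \<in> carrier (tor R x M)" "m' = (x \<odot>\<^bsub>M\<^esub> m'') \<oplus>\<^bsub>M\<^esub> t'"
    using assms(3) m'(1) unfolding divisible_mod_tor_def by blast
  have c: "t \<in> carrier M" "t' \<in> carrier M" using m' m'' by (auto simp: carrier_tor)
  have "m = ((x [^]\<^bsub>R\<^esub> Suc n) \<odot>\<^bsub>M\<^esub> m'') \<oplus>\<^bsub>M\<^esub> (((x [^]\<^bsub>R\<^esub> n) \<odot>\<^bsub>M\<^esub> t') \<oplus>\<^bsub>M\<^esub> t)"
    using m' m'' c assms(2) by (simp add: smult_r_distr smult_assoc1 a_assoc)
  moreover have "((x [^]\<^bsub>R\<^esub> n) \<odot>\<^bsub>M\<^esub> t') \<oplus>\<^bsub>M\<^esub> t \<in> carrier (tor R x M)"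
    using T.smult_closed[of "x [^]\<^bsub>R\<^esub> n" t'] T.M.a_closed m' m'' assms(2) by simp
  ultimately show ?case using m'' by blast
qed

section \<open>Torsion of exact complexes\<close>

definition exact_complex ::
  "('a, 'x) ring_scheme \<Rightarrow> (nat \<Rightarrow> ('a, 'm, 'y) module_scheme) \<Rightarrow> (nat \<Rightarrow> 'm \<Rightarrow> 'm) \<Rightarrow> bool"
  where "exact_complex R C d \<longleftrightarrow>
    (\<forall>n. module R (C n)) \<and> (\<forall>n. d n \<in> module_hom R (C n) (C (Suc n))) \<and>
    (\<forall>n. \<forall>c\<in>carrier (C n). d (Suc n) (d n c) = \<zero>\<^bsub>C (Suc (Suc n))\<^esub>) \<and>
    (\<forall>c\<in>carrier (C 0). d 0 c = \<zero>\<^bsub>C 1\<^esub> \<longrightarrow> c = \<zero>\<^bsub>C 0\<^esub>) \<and>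
    (\<forall>n. \<forall>c\<in>carrier (C (Suc n)). d (Suc n) c = \<zero>\<^bsub>C (Suc (Suc n))\<^esub> \<longrightarrow> (\<exists>b\<in>carrier (C n). d n b = c))"

text \<open>Let c = d b with x^k c = 0. Then x^k b is a cocycle, so x^k b = d a, and a = x^k a' + t
  with t torsion. Hence x^k (b - d a') = d t is torsion, and b - d a' is a torsion preimage of c. In
  degree 0 the cocycle x^k b is already zero.\<close>

lemma exact_complex_tor:
  assumes ex: "exact_complex R C d" and x: "x \<in> carrier R" and div: "\<And>n. divisible_mod_tor R x (C n)"
  shows "exact_complex R (\<lambda>n. tor R x (C n)) d"
proof -
  have C: "module R (C n)" and d: "d n \<in> module_hom R (C n) (C (Suc n))" for n
    using ex by (auto simp: exact_complex_def)
  have dd: "c \<in> carrier (C n) \<Longrightarrow> d (Suc n) (d n c) = \<zero>\<^bsub>C (Suc (Suc n))\<^esub>" for n c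
    using ex by (auto simp: exact_complex_def)
  have inj: "c \<in> carrier (C 0) \<Longrightarrow> d 0 c = \<zero>\<^bsub>C 1\<^esub> \<Longrightarrow> c = \<zero>\<^bsub>C 0\<^esub>" for c
    using ex by (auto simp: exact_complex_def)
  have surj: "c \<in> carrier (C (Suc n)) \<Longrightarrow> d (Suc n) c = \<zero>\<^bsub>C (Suc (Suc n))\<^esub> \<Longrightarrow> \<exists>b\<in>carrier (C n). d n b = c" for n c
    using ex by (auto simp: exact_complex_def)
  have dC: "d n c \<in> carrier (C (Suc n))" if "c \<in> carrier (C n)" for n c
    using module_homD(1)[OF d that] .
  have key: "\<exists>b\<in>carrier (tor R x (C n)). d n b = c"
    if c: "c \<in> carrier (tor R x (C (Suc n)))" "d (Suc n) c = \<zero>\<^bsub>C (Suc (Suc n))\<^esub>" for n c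
  proof -
    interpret Cn: module R "C n" by (rule C)
    interpret Cs: module R "C (Suc n)" by (rule C)
    obtain k :: nat where k: "c \<in> carrier (C (Suc n))" "(x [^]\<^bsub>R\<^esub> k) \<odot>\<^bsub>C (Suc n)\<^esub> c = \<zero>\<^bsub>C (Suc n)\<^esub>"
      using c(1) by (auto simp: carrier_tor)
    obtain b where b: "b \<in> carrier (C n)" "d n b = c" using surj[OF k(1) c(2)] by blast
    let ?xb = "(x [^]\<^bsub>R\<^esub> k) \<odot>\<^bsub>C n\<^esub> b"
    have xb: "?xb \<in> carrier (C n)" "d n ?xb = \<zero>\<^bsub>C (Suc n)\<^esub>"
      using b x k module_hom_pow[OF C d x b(1)] by auto
    \<comment> \<open>Here b' is d a' in positive degree and 0 in degree 0.\<close>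
    have "\<exists>b'\<in>carrier (C n). d n b' = \<zero>\<^bsub>C (Suc n)\<^esub> \<and>
       (\<exists>t\<in>carrier (tor R x (C n)). ?xb = ((x [^]\<^bsub>R\<^esub> k) \<odot>\<^bsub>C n\<^esub> b') \<oplus>\<^bsub>C n\<^esub> t)"
    proof (cases n)
      case 0
      hence "?xb = \<zero>\<^bsub>C n\<^esub>" using inj xb by simp
      thus ?thesis using x module_hom_zero[OF C C d, of n]
        by (intro bexI[of _ "\<zero>\<^bsub>C n\<^esub>"] conjI bexI[of _ "\<zero>\<^bsub>C n\<^esub>"]) (auto simp: carrier_tor)
    next
      case (Suc j)
      interpret Cj: module R "C j" by (rule C)
      obtain a where a: "a \<in> carrier (C j)" "d j a = ?xb"
        using surj[of ?xb j] xb Suc by auto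
      obtain a' t where a': "a' \<in> carrier (C j)" "t \<in> carrier (tor R x (C j))"
          "a = ((x [^]\<^bsub>R\<^esub> k) \<odot>\<^bsub>C j\<^esub> a') \<oplus>\<^bsub>C j\<^esub> t"
        using divisible_mod_tor_pow[OF C x div a(1), of k] by blast
      have dj: "d j \<in> module_hom R (C j) (C n)" using d[of j] Suc by simp
      have "t \<in> carrier (C j)" using a'(2) by (simp add: carrier_tor)
      hence "?xb = ((x [^]\<^bsub>R\<^esub> k) \<odot>\<^bsub>C n\<^esub> d j a') \<oplus>\<^bsub>C n\<^esub> d j t"
        using a a' x module_homD(2)[OF dj] module_hom_pow[OF C dj x a'(1)] by auto
      moreover have "d j t \<in> carrier (tor R x (C n))"
        using module_homD(1)[OF module_hom_tor[OF C C dj x] a'(2)] .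
      moreover have "d j a' \<in> carrier (C n)" "d n (d j a') = \<zero>\<^bsub>C (Suc n)\<^esub>"
        using dC[OF a'(1)] dd[OF a'(1)] Suc by simp_all
      ultimately show ?thesis by blast
    qed
    then obtain b' t where b': "b' \<in> carrier (C n)" "d n b' = \<zero>\<^bsub>C (Suc n)\<^esub>"
        "t \<in> carrier (tor R x (C n))" "?xb = ((x [^]\<^bsub>R\<^esub> k) \<odot>\<^bsub>C n\<^esub> b') \<oplus>\<^bsub>C n\<^esub> t" by blast
    obtain l :: nat where t: "t \<in> carrier (C n)" "(x [^]\<^bsub>R\<^esub> l) \<odot>\<^bsub>C n\<^esub> t = \<zero>\<^bsub>C n\<^esub>"
      using b'(3) by (auto simp: carrier_tor)
    let ?y = "b \<ominus>\<^bsub>C n\<^esub> b'"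
    have y: "?y \<in> carrier (C n)" using b b' by simp
    have "(x [^]\<^bsub>R\<^esub> k) \<odot>\<^bsub>C n\<^esub> ?y = ?xb \<ominus>\<^bsub>C n\<^esub> ((x [^]\<^bsub>R\<^esub> k) \<odot>\<^bsub>C n\<^esub> b')"
      using b b' x by (simp add: a_minus_def Cn.smult_r_distr Cn.smult_r_minus)
    also have "\<dots> = t" using b' t x
      by (simp add: a_minus_def Cn.M.a_ac Cn.M.r_neg Cn.M.r_neg2)
    finally have "(x [^]\<^bsub>R\<^esub> (l + k)) \<odot>\<^bsub>C n\<^esub> ?y = \<zero>\<^bsub>C n\<^esub>"
      using Cn.pow_smult_add[OF x y] t by simp
    hence "?y \<in> carrier (tor R x (C n))" using y by (auto simp: carrier_tor)
    moreover have "d n ?y = c"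
      using module_hom_diff[OF C C d b(1) b'(1)] b b' k Cs.diff_zero_right by simp
    ultimately show ?thesis by blast
  qed
  show ?thesis
    unfolding exact_complex_def
  proof (intro conjI allI ballI impI)
    show "\<And>n. module R (tor R x (C n))" using module_tor[OF C x] .
    show "\<And>n. d n \<in> module_hom R (tor R x (C n)) (tor R x (C (Suc n)))"
      by (rule module_hom_tor) (use C d x in auto)
  qed (use dd inj key in \<open>auto simp: carrier_tor\<close>)
qed

lemma exact_complex_tors:
  assumes "exact_complex R C d" "set xs \<subseteq> carrier R" "\<And>n. tor_acyclic R xs (C n)"
  shows "exact_complex R (\<lambda>n. tors R xs (C n)) d"
  using assms by (induct xs arbitrary: C) (auto intro: exact_complex_tor)

subsection \<open>Injective modules are acyclic\<close>

lemma noetherian_stable: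
  assumes "noetherian_ring R" "\<And>n. ideal (I n) R" "\<And>n. I n \<subseteq> I (Suc n)"
  shows "\<exists>n. \<forall>k\<ge>n. I k = I n"
proof -
  interpret noetherian_ring R by fact
  have mono: "I n \<subseteq> I k" if "n \<le> k" for n k
    using that assms(3) by (rule lift_Suc_mono_le[rotated])
  have "subset.chain {J. ideal J R} (range I)"
    using assms(2) mono by (auto simp: subset_chain_def) (meson nle_le subset_iff)
  hence "\<Union>(range I) \<in> range I" using ideal_chain_is_trivial[of "range I"] by blast
  then obtain n where "\<Union>(range I) = I n" by blast
  hence "I k = I n" if "n \<le> k" for k using mono[OF that] by blast
  thus ?thesis by blast
qed

text \<open>This is the colon ideal (b : x). The chains (b : x^n) and (0 : x^n) are the ones to
  which \<open>noetherian_stable\<close> will be applied.\<close>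

lemma ideal_quotient:
  assumes "cring R" "ideal b R" "x \<in> carrier R"
  shows "ideal {r \<in> carrier R. x \<otimes>\<^bsub>R\<^esub> r \<in> b} R"
proof -
  interpret cring R by fact
  interpret b: ideal b R by fact
  show ?thesis
  proof (rule idealI)
    show "ring R" by (rule ring_axioms)
    show "subgroup {r \<in> carrier R. x \<otimes>\<^bsub>R\<^esub> r \<in> b} (add_monoid R)"
    proof
      fix r assume r: "r \<in> {r \<in> carrier R. x \<otimes>\<^bsub>R\<^esub> r \<in> b}"
      hence "\<ominus>\<^bsub>R\<^esub> (x \<otimes>\<^bsub>R\<^esub> r) \<in> b" by simp
      thus "inv\<^bsub>add_monoid R\<^esub> r \<in> {r \<in> carrier R. x \<otimes>\<^bsub>R\<^esub> r \<in> b}"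
        using r assms(3) by (simp add: r_minus a_inv_def[symmetric])
    qed (use assms(3) in \<open>auto simp: r_distr\<close>)
    show "\<And>a r. \<lbrakk>a \<in> {r \<in> carrier R. x \<otimes>\<^bsub>R\<^esub> r \<in> b}; r \<in> carrier R\<rbrakk> \<Longrightarrow> r \<otimes>\<^bsub>R\<^esub> a \<in> {r \<in> carrier R. x \<otimes>\<^bsub>R\<^esub> r \<in> b}"
      using assms(3) b.I_l_closed by (auto simp: m_lcomm)
    show "\<And>a r. \<lbrakk>a \<in> {r \<in> carrier R. x \<otimes>\<^bsub>R\<^esub> r \<in> b}; r \<in> carrier R\<rbrakk> \<Longrightarrow> a \<otimes>\<^bsub>R\<^esub> r \<in> {r \<in> carrier R. x \<otimes>\<^bsub>R\<^esub> r \<in> b}"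
      using assms(3) b.I_r_closed by (auto simp: m_assoc[symmetric])
  qed
qed

definition regular_module :: "('a, 'x) ring_scheme \<Rightarrow> ('a, 'a) module"
  where "regular_module R = \<lparr>carrier = carrier R, monoid.mult = undefined, one = undefined,
     ring.zero = \<zero>\<^bsub>R\<^esub>, add = add R, smult = monoid.mult R\<rparr>"

lemma regular_module_simps [simp]:
  "carrier (regular_module R) = carrier R" "ring.zero (regular_module R) = \<zero>\<^bsub>R\<^esub>"
  "add (regular_module R) = add R" "smult (regular_module R) = monoid.mult R"
  by (simp_all add: regular_module_def)

lemma module_regular:
  assumes "cring R"
  shows "module R (regular_module R)"
proof -
  interpret cring R by fact
  show ?thesis
    by (rule moduleI) (auto intro!: abelian_groupI is_cring a_assoc a_comm m_assoc l_distr r_distr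
        intro: bexI[of _ "\<ominus>\<^bsub>R\<^esub> _"] l_neg)
qed

text \<open>If \<open>f : b \<rightarrow> E\<close> is killed by \<open>x\<^sup>k\<close>, then it extends by \<open>0\<close> to \<open>b + x\<^sup>n R\<close> for large \<open>n\<close>
  (the Artin--Rees lemma for a principal ideal), so it is given by an element killed by \<open>x\<^sup>n\<close>.\<close>

lemma baer_torsion_extension:
  assumes R: "noetherian_ring R" and E: "baer R E" and x: "x \<in> carrier R"
    and b: "ideal b R" and f: "f \<in> b \<rightarrow> carrier E"
    and fa: "\<And>r s. \<lbrakk>r \<in> b; s \<in> b\<rbrakk> \<Longrightarrow> f (r \<oplus>\<^bsub>R\<^esub> s) = f r \<oplus>\<^bsub>E\<^esub> f s"
    and fm: "\<And>r s. \<lbrakk>r \<in> carrier R; s \<in> b\<rbrakk> \<Longrightarrow> f (r \<otimes>\<^bsub>R\<^esub> s) = r \<odot>\<^bsub>E\<^esub> f s"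
    and k: "\<And>r. r \<in> b \<Longrightarrow> (x [^]\<^bsub>R\<^esub> (k::nat)) \<odot>\<^bsub>E\<^esub> f r = \<zero>\<^bsub>E\<^esub>"
  obtains e where "e \<in> carrier (tor R x E)" "\<And>r. r \<in> b \<Longrightarrow> f r = r \<odot>\<^bsub>E\<^esub> e"
proof -
  interpret E: module R E using E by (simp add: baer_def)
  interpret b: ideal b R by fact
  let ?I = "\<lambda>n::nat. {r \<in> carrier R. (x [^]\<^bsub>R\<^esub> n) \<otimes>\<^bsub>R\<^esub> r \<in> b}"
  have I1: "ideal (?I n) R" for n using ideal_quotient[OF E.R.is_cring b] x by simp
  have I2: "?I n \<subseteq> ?I (Suc n)" for n
  proof
    fix r assume r: "r \<in> ?I n"
    hence "x \<otimes>\<^bsub>R\<^esub> ((x [^]\<^bsub>R\<^esub> n) \<otimes>\<^bsub>R\<^esub> r) \<in> b" using x by (auto intro: b.I_l_closed)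
    thus "r \<in> ?I (Suc n)" using r x E.R.m_comm[of x "x [^]\<^bsub>R\<^esub> n"] by (simp add: E.R.m_assoc[symmetric])
  qed
  obtain c where c0: "\<forall>j\<ge>c. ?I j = ?I c"
    using noetherian_stable[of R ?I, OF R I1 I2] by (rule exE)
  have c: "?I j = ?I c" if "c \<le> j" for j by (rule c0[rule_format, OF that])
  \<comment> \<open>At c the chain of colon ideals is stable, and x^k kills the image of
    \<open>f\<close>: if x^n r is in \<open>b\<close>, so is x^c r, and f (x^n r) = x^k f (x^c r) =
    0.\<close>
  define n where "n = k + c"
  have fx: "f ((x [^]\<^bsub>R\<^esub> n) \<otimes>\<^bsub>R\<^esub> r) = \<zero>\<^bsub>E\<^esub>" if r: "r \<in> carrier R" "(x [^]\<^bsub>R\<^esub> n) \<otimes>\<^bsub>R\<^esub> r \<in> b" for r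
  proof -
    have "r \<in> ?I n" using r by simp
    hence "r \<in> ?I c" unfolding c[of n, unfolded n_def, OF le_add2] n_def .
    hence rc: "(x [^]\<^bsub>R\<^esub> c) \<otimes>\<^bsub>R\<^esub> r \<in> b" by simp
    have "(x [^]\<^bsub>R\<^esub> n) \<otimes>\<^bsub>R\<^esub> r = (x [^]\<^bsub>R\<^esub> k) \<otimes>\<^bsub>R\<^esub> ((x [^]\<^bsub>R\<^esub> c) \<otimes>\<^bsub>R\<^esub> r)"
      using x r by (simp add: n_def E.R.nat_pow_mult[symmetric] E.R.m_assoc)
    thus ?thesis using fm[of "x [^]\<^bsub>R\<^esub> k", OF _ rc] k[OF rc] x by simp
  qed
  have f0: "f \<zero>\<^bsub>R\<^esub> = \<zero>\<^bsub>E\<^esub>"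
    using fm[of "\<zero>\<^bsub>R\<^esub>" "\<zero>\<^bsub>R\<^esub>"] f b.zero_closed by (auto simp: Pi_iff)
  have fneg: "f (\<ominus>\<^bsub>R\<^esub> r) = \<ominus>\<^bsub>E\<^esub> f r" if "r \<in> b" for r
  proof -
    have "f ((\<ominus>\<^bsub>R\<^esub> \<one>\<^bsub>R\<^esub>) \<otimes>\<^bsub>R\<^esub> r) = (\<ominus>\<^bsub>R\<^esub> \<one>\<^bsub>R\<^esub>) \<odot>\<^bsub>E\<^esub> f r" using fm that by simp
    thus ?thesis using that f b.Icarr by (auto simp: E.R.l_minus E.smult_l_minus Pi_iff)
  qed
  \<comment> \<open>Instead of defining a map on b + x^n R, the map (r, s) to f r on the product of
    b and R is factored through (r, s) to r + x^n s. The condition \<open>ker\<close> is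
    well-definedness on the sum.\<close>
  let ?B = "\<lparr>carrier = b \<times> carrier R, monoid.mult = undefined, one = undefined,
     ring.zero = (\<zero>\<^bsub>R\<^esub>, \<zero>\<^bsub>R\<^esub>), add = (\<lambda>(r, s) (r', s'). (r \<oplus>\<^bsub>R\<^esub> r', s \<oplus>\<^bsub>R\<^esub> s')),
     smult = (\<lambda>a (r, s). (a \<otimes>\<^bsub>R\<^esub> r, a \<otimes>\<^bsub>R\<^esub> s))\<rparr>"
  let ?R = "regular_module R"
  have R': "module R ?R" by (rule module_regular) (rule E.R.is_cring)
  have B: "module R ?B"
  proof (rule moduleI)
    show "abelian_group ?B"
    proof (rule abelian_groupI)
      fix z assume "z \<in> carrier ?B"
      thus "\<exists>y\<in>carrier ?B. y \<oplus>\<^bsub>?B\<^esub> z = \<zero>\<^bsub>?B\<^esub>"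
        by (intro bexI[of _ "(\<ominus>\<^bsub>R\<^esub> fst z, \<ominus>\<^bsub>R\<^esub> snd z)"]) (auto simp: E.R.l_neg b.Icarr)
    qed (auto simp: b.Icarr E.R.a_ac)
  qed (auto simp: b.Icarr E.R.m_assoc E.R.l_distr E.R.r_distr E.R.is_cring b.I_l_closed)
  let ?u = "\<lambda>(r, s). r \<oplus>\<^bsub>R\<^esub> (x [^]\<^bsub>R\<^esub> n) \<otimes>\<^bsub>R\<^esub> s"
  have u: "?u \<in> module_hom R ?B ?R"
    using x by (auto intro!: module_homI simp: b.Icarr E.R.r_distr E.R.a_ac E.R.m_ac)
  have h: "f \<circ> fst \<in> module_hom R ?B E"
    using f by (auto intro!: module_homI simp: fa fm)
  have ker: "(f \<circ> fst) p = \<zero>\<^bsub>E\<^esub>" if p: "p \<in> carrier ?B" "?u p = \<zero>\<^bsub>?R\<^esub>" for p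
  proof -
    obtain r s where rs: "p = (r, s)" "r \<in> b" "s \<in> carrier R" using p(1) by auto
    have "r \<oplus>\<^bsub>R\<^esub> (x [^]\<^bsub>R\<^esub> n) \<otimes>\<^bsub>R\<^esub> s = \<zero>\<^bsub>R\<^esub>" using p(2) rs(1) by simp
    hence eq: "(x [^]\<^bsub>R\<^esub> n) \<otimes>\<^bsub>R\<^esub> s = \<ominus>\<^bsub>R\<^esub> r"
      using rs x b.Icarr by (metis E.R.a_comm E.R.m_closed E.R.minus_equality E.R.nat_pow_closed)
    hence "f (\<ominus>\<^bsub>R\<^esub> r) = \<zero>\<^bsub>E\<^esub>" using fx[of s] rs by (metis b.a_inv_closed)
    hence "\<ominus>\<^bsub>E\<^esub> f r = \<zero>\<^bsub>E\<^esub>" using fneg rs by simp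
    thus ?thesis using rs f by (simp add: Pi_iff)
  qed
  obtain g where g: "g \<in> module_hom R ?R E"
    "\<And>r s. \<lbrakk>r \<in> b; s \<in> carrier R\<rbrakk> \<Longrightarrow> g (r \<oplus>\<^bsub>R\<^esub> (x [^]\<^bsub>R\<^esub> n) \<otimes>\<^bsub>R\<^esub> s) = f r"
    using baer_factor[OF E B R' u h ker] by auto
  define e where "e = g \<one>\<^bsub>R\<^esub>"
  have e: "e \<in> carrier E" using module_homD(1)[OF g(1)] by (simp add: e_def)
  have gr: "g r = r \<odot>\<^bsub>E\<^esub> e" if "r \<in> carrier R" for r
    using module_homD(3)[OF g(1), of r "\<one>\<^bsub>R\<^esub>"] that by (simp add: e_def)
  show ?thesis
  proof (rule that)
    show "f r = r \<odot>\<^bsub>E\<^esub> e" if "r \<in> b" for r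
      using g(2)[OF that, of "\<zero>\<^bsub>R\<^esub>"] gr[of r] that x b.Icarr by simp
    \<comment> \<open>Taking r = 0 and s = 1 gives g (x^n) = f 0.\<close>
    have "(x [^]\<^bsub>R\<^esub> n) \<odot>\<^bsub>E\<^esub> e = \<zero>\<^bsub>E\<^esub>"
      using g(2)[of "\<zero>\<^bsub>R\<^esub>" "\<one>\<^bsub>R\<^esub>"] gr[of "x [^]\<^bsub>R\<^esub> n"] x f0 by simp
    thus "e \<in> carrier (tor R x E)" using e by (auto simp: carrier_tor)
  qed
qed

text \<open>Finite generation of \<open>b\<close> provides a single power of \<open>x\<close> killing the image.\<close>

lemma baer_tor:
  assumes R: "noetherian_ring R" and E: "baer R E" and x: "x \<in> carrier R"
  shows "baer R (tor R x E)"
proof -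
  interpret E: module R E using E by (simp add: baer_def)
  interpret N: noetherian_ring R by fact
  have T: "module R (tor R x E)" by (rule module_tor[OF E.module_axioms x])
  show ?thesis
    unfolding baer_def
  proof (intro conjI allI impI T)
    fix b f assume *: "ideal b R \<and> f \<in> b \<rightarrow> carrier (tor R x E) \<and>
       (\<forall>r\<in>b. \<forall>s\<in>b. f (r \<oplus>\<^bsub>R\<^esub> s) = f r \<oplus>\<^bsub>tor R x E\<^esub> f s) \<and>
       (\<forall>r\<in>carrier R. \<forall>s\<in>b. f (r \<otimes>\<^bsub>R\<^esub> s) = r \<odot>\<^bsub>tor R x E\<^esub> f s)"
    interpret b: ideal b R using * by blast
    have fE: "f \<in> b \<rightarrow> carrier E" using * by (auto simp: carrier_tor Pi_iff)
    have fa: "f (r \<oplus>\<^bsub>R\<^esub> s) = f r \<oplus>\<^bsub>E\<^esub> f s" if "r \<in> b" "s \<in> b" for r s using * that by simp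
    have fm: "f (r \<otimes>\<^bsub>R\<^esub> s) = r \<odot>\<^bsub>E\<^esub> f s" if "r \<in> carrier R" "s \<in> b" for r s using * that by simp
    obtain S where S: "S \<subseteq> carrier R" "finite S" "b = Idl\<^bsub>R\<^esub> S" using N.finetely_gen[of b] * by blast
    have Sb: "S \<subseteq> b" using S E.R.genideal_self by blast
    have "\<forall>s\<in>S. \<exists>n::nat. (x [^]\<^bsub>R\<^esub> n) \<odot>\<^bsub>E\<^esub> f s = \<zero>\<^bsub>E\<^esub>"
      using * Sb by (auto simp: carrier_tor Pi_iff)
    then obtain n where n: "\<And>s. s \<in> S \<Longrightarrow> (x [^]\<^bsub>R\<^esub> (n s :: nat)) \<odot>\<^bsub>E\<^esub> f s = \<zero>\<^bsub>E\<^esub>" by metis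
    \<comment> \<open>The sum serves as a common bound for the finitely many exponents.\<close>
    define k where "k = (\<Sum>s\<in>S. n s)"
    have kS: "(x [^]\<^bsub>R\<^esub> k) \<odot>\<^bsub>E\<^esub> f s = \<zero>\<^bsub>E\<^esub>" if "s \<in> S" for s
    proof (rule E.pow_smult_zero_mono[OF x _ n[OF that]])
      show "f s \<in> carrier E" using fE Sb that by blast
      show "n s \<le> k" unfolding k_def using that S(2) by (simp add: member_le_sum)
    qed
    have kx: "x [^]\<^bsub>R\<^esub> k \<in> carrier R" using x by simp
    \<comment> \<open>The elements of \<open>b\<close> whose image is killed by x^k form an ideal,
      so it is enough that the generators belong to it.\<close>
    let ?Z = "{r \<in> b. (x [^]\<^bsub>R\<^esub> k) \<odot>\<^bsub>E\<^esub> f r = \<zero>\<^bsub>E\<^esub>}"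
    have fc: "f r \<in> carrier E" if "r \<in> b" for r using fE that by blast
    have comm: "(x [^]\<^bsub>R\<^esub> k) \<odot>\<^bsub>E\<^esub> (a \<odot>\<^bsub>E\<^esub> y) = a \<odot>\<^bsub>E\<^esub> ((x [^]\<^bsub>R\<^esub> k) \<odot>\<^bsub>E\<^esub> y)"
      if "a \<in> carrier R" "y \<in> carrier E" for a y
      using that kx by (metis E.R.m_comm E.smult_assoc1)
    have Zm: "a \<otimes>\<^bsub>R\<^esub> r \<in> ?Z" if "r \<in> ?Z" "a \<in> carrier R" for a r
      using that fc[of r] kx comm[of a "f r"] b.I_l_closed[of r a] by (simp add: fm)
    have "ideal ?Z R"
    proof (rule idealI)
      show "ring R" by (rule E.R.ring_axioms)
      show "subgroup ?Z (add_monoid R)"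
      proof
        show "?Z \<subseteq> carrier (add_monoid R)" by (auto simp: b.Icarr)
        show "\<And>r s. \<lbrakk>r \<in> ?Z; s \<in> ?Z\<rbrakk> \<Longrightarrow> r \<otimes>\<^bsub>add_monoid R\<^esub> s \<in> ?Z"
          using kx fc by (auto simp: fa E.smult_r_distr)
        have "\<zero>\<^bsub>R\<^esub> \<in> b" by simp
        hence "f (\<zero>\<^bsub>R\<^esub> \<otimes>\<^bsub>R\<^esub> \<zero>\<^bsub>R\<^esub>) = \<zero>\<^bsub>E\<^esub>" using fm[of "\<zero>\<^bsub>R\<^esub>" "\<zero>\<^bsub>R\<^esub>"] fc by simp
        thus "\<one>\<^bsub>add_monoid R\<^esub> \<in> ?Z" using kx by simp
        fix r assume r: "r \<in> ?Z"
        have "(\<ominus>\<^bsub>R\<^esub> \<one>\<^bsub>R\<^esub>) \<otimes>\<^bsub>R\<^esub> r \<in> ?Z" using Zm[OF r, of "\<ominus>\<^bsub>R\<^esub> \<one>\<^bsub>R\<^esub>"] by blast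
        thus "inv\<^bsub>add_monoid R\<^esub> r \<in> ?Z" using r b.Icarr by (auto simp: E.R.l_minus a_inv_def[symmetric])
      qed
      show "\<And>a r. \<lbrakk>r \<in> ?Z; a \<in> carrier R\<rbrakk> \<Longrightarrow> a \<otimes>\<^bsub>R\<^esub> r \<in> ?Z" by (rule Zm)
      show "\<And>a r. \<lbrakk>r \<in> ?Z; a \<in> carrier R\<rbrakk> \<Longrightarrow> r \<otimes>\<^bsub>R\<^esub> a \<in> ?Z"
        using Zm b.Icarr by (metis (no_types, lifting) E.R.m_comm mem_Collect_eq)
    qed
    moreover have "S \<subseteq> ?Z" using Sb kS by blast
    ultimately have "b \<subseteq> ?Z" using E.R.genideal_minimal S(3) by blast
    hence kb: "\<And>r. r \<in> b \<Longrightarrow> (x [^]\<^bsub>R\<^esub> k) \<odot>\<^bsub>E\<^esub> f r = \<zero>\<^bsub>E\<^esub>" by blast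
    obtain e where "e \<in> carrier (tor R x E)" "\<And>r. r \<in> b \<Longrightarrow> f r = r \<odot>\<^bsub>E\<^esub> e"
      using baer_torsion_extension[OF R E x _ fE fa fm kb] * by blast
    thus "\<exists>e\<in>carrier (tor R x E). \<forall>r\<in>b. f r = r \<odot>\<^bsub>tor R x E\<^esub> e" by auto
  qed
qed

text \<open>The annihilators of \<open>x\<^sup>n\<close> stabilize at some \<open>k\<close>, so \<open>x\<^sup>k\<^sup>+\<^sup>1 r \<mapsto> x\<^sup>k r m\<close> is well defined.\<close>

lemma baer_divisible_mod_tor:
  assumes R: "noetherian_ring R" and E: "baer R E" and x: "x \<in> carrier R"
  shows "divisible_mod_tor R x E"
  unfolding divisible_mod_tor_def
proof
  interpret E: module R E using E by (simp add: baer_def)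
  fix m assume m: "m \<in> carrier E"
  let ?I = "\<lambda>n::nat. {r \<in> carrier R. (x [^]\<^bsub>R\<^esub> n) \<otimes>\<^bsub>R\<^esub> r \<in> {\<zero>\<^bsub>R\<^esub>}}"
  have I1: "ideal (?I n) R" for n
    using ideal_quotient[OF E.R.is_cring E.R.zeroideal] x by simp
  have I2: "?I n \<subseteq> ?I (Suc n)" for n
  proof
    fix r assume r: "r \<in> ?I n"
    have rc: "r \<in> carrier R" using r by simp
    have "(x [^]\<^bsub>R\<^esub> Suc n) \<otimes>\<^bsub>R\<^esub> r = x \<otimes>\<^bsub>R\<^esub> ((x [^]\<^bsub>R\<^esub> n) \<otimes>\<^bsub>R\<^esub> r)"
      using rc x by (simp add: E.R.m_assoc E.R.m_lcomm)
    thus "r \<in> ?I (Suc n)" using r x by simp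
  qed
  obtain c where c0: "\<forall>j\<ge>c. ?I j = ?I c"
    using noetherian_stable[of R ?I, OF R I1 I2] by (rule exE)
  have c: "?I j = ?I c" if "c \<le> j" for j by (rule c0[rule_format, OF that])
  let ?R = "regular_module R"
  have R': "module R ?R" by (rule module_regular) (rule E.R.is_cring)
  let ?u = "\<lambda>p. (x [^]\<^bsub>R\<^esub> Suc c) \<otimes>\<^bsub>R\<^esub> p" and ?h = "\<lambda>p. p \<odot>\<^bsub>E\<^esub> ((x [^]\<^bsub>R\<^esub> c) \<odot>\<^bsub>E\<^esub> m)"
  have xS: "x [^]\<^bsub>R\<^esub> Suc c \<in> carrier R" using x by (rule E.R.nat_pow_closed)
  hence u: "?u \<in> module_hom R ?R ?R"
    by (auto intro!: module_homI simp: E.R.r_distr E.R.m_lcomm simp del: E.R.nat_pow_Suc)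
  have h: "?h \<in> module_hom R ?R E"
    using x m by (auto intro!: module_homI simp: E.smult_l_distr E.smult_assoc1)
  have ker: "?h p = \<zero>\<^bsub>E\<^esub>" if "p \<in> carrier ?R" "?u p = \<zero>\<^bsub>?R\<^esub>" for p
  proof -
    have "p \<in> ?I (Suc c)" using that by simp
    hence "p \<in> ?I c" unfolding c[of "Suc c", OF le_SucI[OF order_refl]] .
    hence p: "p \<in> carrier R" "(x [^]\<^bsub>R\<^esub> c) \<otimes>\<^bsub>R\<^esub> p = \<zero>\<^bsub>R\<^esub>" by auto
    have "p \<odot>\<^bsub>E\<^esub> ((x [^]\<^bsub>R\<^esub> c) \<odot>\<^bsub>E\<^esub> m) = ((x [^]\<^bsub>R\<^esub> c) \<otimes>\<^bsub>R\<^esub> p) \<odot>\<^bsub>E\<^esub> m"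
      using p(1) x m E.R.m_comm[of p "x [^]\<^bsub>R\<^esub> c"] by (simp add: E.smult_assoc1[symmetric])
    thus ?thesis using p(2) m by simp
  qed
  obtain g where g: "g \<in> module_hom R ?R E"
    "\<And>p. p \<in> carrier R \<Longrightarrow> g ((x [^]\<^bsub>R\<^esub> Suc c) \<otimes>\<^bsub>R\<^esub> p) = p \<odot>\<^bsub>E\<^esub> ((x [^]\<^bsub>R\<^esub> c) \<odot>\<^bsub>E\<^esub> m)"
    using baer_factor[OF E R' R' u h ker] by auto
  define e where "e = g \<one>\<^bsub>R\<^esub>"
  have e: "e \<in> carrier E" using module_homD(1)[OF g(1)] by (simp add: e_def)
  have "(x [^]\<^bsub>R\<^esub> Suc c) \<odot>\<^bsub>E\<^esub> e = (x [^]\<^bsub>R\<^esub> c) \<odot>\<^bsub>E\<^esub> m"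
    using module_homD(3)[OF g(1), of "x [^]\<^bsub>R\<^esub> Suc c" "\<one>\<^bsub>R\<^esub>"] g(2)[of "\<one>\<^bsub>R\<^esub>"] xS x m
    by (simp add: e_def del: E.R.nat_pow_Suc)
  hence eq: "(x [^]\<^bsub>R\<^esub> c) \<odot>\<^bsub>E\<^esub> (x \<odot>\<^bsub>E\<^esub> e) = (x [^]\<^bsub>R\<^esub> c) \<odot>\<^bsub>E\<^esub> m" using E.pow_smult_Suc[OF x e] by simp
  let ?t = "m \<ominus>\<^bsub>E\<^esub> (x \<odot>\<^bsub>E\<^esub> e)"
  have t: "?t \<in> carrier E" using x m e by simp
  have "(x [^]\<^bsub>R\<^esub> c) \<odot>\<^bsub>E\<^esub> ?t = \<zero>\<^bsub>E\<^esub>"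
    using eq x m e by (simp add: a_minus_def E.smult_r_distr E.smult_r_minus E.M.r_neg)
  hence "?t \<in> carrier (tor R x E)" using t by (auto simp: carrier_tor)
  moreover have "m = (x \<odot>\<^bsub>E\<^esub> e) \<oplus>\<^bsub>E\<^esub> ?t"
    using E.diff_add_cancel[of m "x \<odot>\<^bsub>E\<^esub> e"] t x e m by (simp add: E.M.a_comm)
  ultimately show "\<exists>m'\<in>carrier E. \<exists>t\<in>carrier (tor R x E). m = (x \<odot>\<^bsub>E\<^esub> m') \<oplus>\<^bsub>E\<^esub> t"
    using e by blast
qed

text \<open>The induction combines both results for one element: divisibility modulo torsion, and
  injectivity of the torsion part, which prepares the next element.\<close>

lemma baer_tor_acyclic:
  assumes "noetherian_ring R" "baer R E" "set xs \<subseteq> carrier R"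
  shows "tor_acyclic R xs E"
  using assms(2,3)
  by (induct xs arbitrary: E) (auto simp: baer_divisible_mod_tor[OF assms(1)] baer_tor[OF assms(1)])

section \<open>Comparison of resolutions\<close>

text \<open>Injectivity is left out so that the total complex qualifies too. Exactness is stated by
  elements, with both inclusions in one equivalence.\<close>

definition resolution ::
  "('a, 'x) ring_scheme \<Rightarrow> ('a, 'm, 'y) module_scheme
     \<Rightarrow> (nat \<Rightarrow> ('a, 'e) module) \<Rightarrow> ('m \<Rightarrow> 'e) \<Rightarrow> (nat \<Rightarrow> 'e \<Rightarrow> 'e) \<Rightarrow> bool"
  where "resolution R M E e d \<longleftrightarrow>
    module R M \<and> (\<forall>n. module R (E n)) \<and>
    e \<in> module_hom R M (E 0) \<and> inj_on e (carrier M) \<and>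
    (\<forall>n. d n \<in> module_hom R (E n) (E (Suc n))) \<and>
    (\<forall>x\<in>carrier (E 0). d 0 x = \<zero>\<^bsub>E 1\<^esub> \<longleftrightarrow> x \<in> e ` carrier M) \<and>
    (\<forall>n. \<forall>x\<in>carrier (E (Suc n)). d (Suc n) x = \<zero>\<^bsub>E (Suc (Suc n))\<^esub> \<longleftrightarrow> x \<in> d n ` carrier (E n))"

lemma resolutionD:
  assumes "resolution R M E e d"
  shows "module R M" "module R (E n)" "e \<in> module_hom R M (E 0)" "inj_on e (carrier M)"
    "d n \<in> module_hom R (E n) (E (Suc n))"
    "x \<in> carrier (E 0) \<Longrightarrow> d 0 x = \<zero>\<^bsub>E 1\<^esub> \<Longrightarrow> \<exists>m\<in>carrier M. e m = x"
    "m \<in> carrier M \<Longrightarrow> d 0 (e m) = \<zero>\<^bsub>E 1\<^esub>"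
    "x \<in> carrier (E (Suc n)) \<Longrightarrow> d (Suc n) x = \<zero>\<^bsub>E (Suc (Suc n))\<^esub> \<Longrightarrow> \<exists>y\<in>carrier (E n). d n y = x"
    "y \<in> carrier (E n) \<Longrightarrow> d (Suc n) (d n y) = \<zero>\<^bsub>E (Suc (Suc n))\<^esub>"
  using assms unfolding resolution_def by (auto simp: module_hom_def Pi_iff)

text \<open>Vanishing of the n-th cohomology of the torsion subcomplex, without forming a quotient.
  In degree 0 the only coboundary is 0.\<close>

definition tors_exact_at ::
  "('a, 'x) ring_scheme \<Rightarrow> 'a list \<Rightarrow> (nat \<Rightarrow> ('a, 'e, 'y) module_scheme) \<Rightarrow> (nat \<Rightarrow> 'e \<Rightarrow> 'e) \<Rightarrow> nat \<Rightarrow> bool"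
  where "tors_exact_at R xs E d n \<longleftrightarrow>
    (\<forall>c\<in>carrier (tors R xs (E n)). d n c = \<zero>\<^bsub>E (Suc n)\<^esub> \<longrightarrow>
       (case n of 0 \<Rightarrow> c = \<zero>\<^bsub>E 0\<^esub> | Suc j \<Rightarrow> \<exists>b\<in>carrier (tors R xs (E j)). d j b = c))"

text \<open>Each map is obtained from the preceding one by extension along the differential, which
  needs injectivity of the target only. Exactness of the source makes d' f vanish on the kernel of
  d.\<close>

lemma comparison_map:
  assumes X: "resolution R M E e d" and G: "resolution R M G e' d'" and baer: "\<And>n. baer R (G n)"
  obtains f where "\<And>n. f n \<in> module_hom R (E n) (G n)" "\<And>m. m \<in> carrier M \<Longrightarrow> f 0 (e m) = e' m"
    "\<And>n x. x \<in> carrier (E n) \<Longrightarrow> f (Suc n) (d n x) = d' n (f n x)"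
proof -
  note X = resolutionD[OF X] and G = resolutionD[OF G]
  \<comment> \<open>The last clause is what the next extension requires: d' h kills the kernel of
    \<open>d n\<close>, so it factors through \<open>d n\<close>.\<close>
  define P where "P n h \<longleftrightarrow> h \<in> module_hom R (E n) (G n) \<and> (n = 0 \<longrightarrow> (\<forall>m\<in>carrier M. h (e m) = e' m)) \<and>
     (\<forall>x\<in>carrier (E n). d n x = \<zero>\<^bsub>E (Suc n)\<^esub> \<longrightarrow> d' n (h x) = \<zero>\<^bsub>G (Suc n)\<^esub>)" for n h
  define Q where "Q n h h' \<longleftrightarrow> (\<forall>x\<in>carrier (E n). h' (d n x) = d' n (h x))" for n h h'
  have "\<exists>f. \<forall>n. P n (f n) \<and> Q n (f n) (f (Suc n))"
  proof (rule dependent_nat_choice)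
    interpret M: module R M by (rule X)
    have "\<exists>g \<in> module_hom R (E 0) (G 0). \<forall>p \<in> carrier M. g (e p) = e' p"
    proof (rule baer_factor[OF baer X(1) X(2) X(3) G(3)])
      fix p assume p: "p \<in> carrier M" "e p = \<zero>\<^bsub>E 0\<^esub>"
      hence "e p = e \<zero>\<^bsub>M\<^esub>" using module_hom_zero[OF X(1) X(2) X(3)] by simp
      hence "p = \<zero>\<^bsub>M\<^esub>" using inj_onD[OF X(4)] p by simp
      thus "e' p = \<zero>\<^bsub>G 0\<^esub>" using module_hom_zero[OF G(1) G(2) G(3)] by simp
    qed
    then obtain h where h: "h \<in> module_hom R (E 0) (G 0)" "\<And>p. p \<in> carrier M \<Longrightarrow> h (e p) = e' p" by blast
    have "d' 0 (h x) = \<zero>\<^bsub>G (Suc 0)\<^esub>" if x: "x \<in> carrier (E 0)" "d 0 x = \<zero>\<^bsub>E (Suc 0)\<^esub>" for x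
    proof -
      obtain m where "m \<in> carrier M" "e m = x" using X(6) x by auto
      thus ?thesis using h(2) G(7) by auto
    qed
    thus "\<exists>h. P 0 h" using h by (auto simp: P_def)
  next
    fix h n assume h: "P n h"
    have hh: "h \<in> module_hom R (E n) (G n)" using h by (simp add: P_def)
    have "\<exists>g \<in> module_hom R (E (Suc n)) (G (Suc n)). \<forall>p \<in> carrier (E n). g (d n p) = d' n (h p)"
      by (rule baer_factor[OF baer X(2) X(2) X(5) module_hom_comp[OF hh G(5)]]) (use h in \<open>auto simp: P_def\<close>)
    then obtain g where g: "g \<in> module_hom R (E (Suc n)) (G (Suc n))"
      "\<And>p. p \<in> carrier (E n) \<Longrightarrow> g (d n p) = d' n (h p)" by blast
    have "d' (Suc n) (g x) = \<zero>\<^bsub>G (Suc (Suc n))\<^esub>"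
      if x: "x \<in> carrier (E (Suc n))" "d (Suc n) x = \<zero>\<^bsub>E (Suc (Suc n))\<^esub>" for x
    proof -
      obtain y where y: "y \<in> carrier (E n)" "d n y = x" using X(8) x by auto
      thus ?thesis using g(2)[OF y(1)] G(9)[OF module_homD(1)[OF hh y(1)]] by simp
    qed
    thus "\<exists>y. P (Suc n) y \<and> Q n h y" using g by (auto simp: P_def Q_def)
  qed
  then obtain f where f: "\<And>n. P n (f n)" "\<And>n. Q n (f n) (f (Suc n))" by blast
  show ?thesis
  proof (rule that)
    show "\<And>n. f n \<in> module_hom R (E n) (G n)" using f(1) by (simp add: P_def)
    show "\<And>m. m \<in> carrier M \<Longrightarrow> f 0 (e m) = e' m" using f(1)[of 0] by (simp add: P_def)
    show "\<And>n x. x \<in> carrier (E n) \<Longrightarrow> f (Suc n) (d n x) = d' n (f n x)" using f(2) by (simp add: Q_def)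
  qed
qed

section \<open>Products and zero modules\<close>

definition prod_module :: "('a, 'm, 'y) module_scheme \<Rightarrow> ('a, 'n, 'z) module_scheme \<Rightarrow> ('a, 'm \<times> 'n) module"
  where "prod_module M N =
    \<lparr>carrier = carrier M \<times> carrier N, monoid.mult = undefined, one = undefined,
     ring.zero = (\<zero>\<^bsub>M\<^esub>, \<zero>\<^bsub>N\<^esub>), add = (\<lambda>u v. (fst u \<oplus>\<^bsub>M\<^esub> fst v, snd u \<oplus>\<^bsub>N\<^esub> snd v)),
     smult = (\<lambda>r u. (r \<odot>\<^bsub>M\<^esub> fst u, r \<odot>\<^bsub>N\<^esub> snd u))\<rparr>"

lemma prod_module_simps [simp]:
  "carrier (prod_module M N) = carrier M \<times> carrier N"
  "\<zero>\<^bsub>prod_module M N\<^esub> = (\<zero>\<^bsub>M\<^esub>, \<zero>\<^bsub>N\<^esub>)"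
  "u \<oplus>\<^bsub>prod_module M N\<^esub> v = (fst u \<oplus>\<^bsub>M\<^esub> fst v, snd u \<oplus>\<^bsub>N\<^esub> snd v)"
  "r \<odot>\<^bsub>prod_module M N\<^esub> u = (r \<odot>\<^bsub>M\<^esub> fst u, r \<odot>\<^bsub>N\<^esub> snd u)"
  by (simp_all add: prod_module_def)

lemma prod_module:
  assumes "module R M" "module R N"
  shows "module R (prod_module M N)"
proof -
  interpret M: module R M by fact
  interpret N: module R N by fact
  show ?thesis
  proof (rule moduleI)
    show "abelian_group (prod_module M N)"
    proof (rule abelian_groupI)
      fix u assume "u \<in> carrier (prod_module M N)"
      thus "\<exists>v\<in>carrier (prod_module M N). v \<oplus>\<^bsub>prod_module M N\<^esub> u = \<zero>\<^bsub>prod_module M N\<^esub>"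
        by (intro bexI[of _ "(\<ominus>\<^bsub>M\<^esub> fst u, \<ominus>\<^bsub>N\<^esub> snd u)"]) (auto simp: M.M.l_neg N.M.l_neg)
    qed (auto simp: M.M.a_ac N.M.a_ac)
  qed (auto simp: M.R.is_cring M.smult_l_distr M.smult_r_distr M.smult_assoc1
      N.smult_l_distr N.smult_r_distr N.smult_assoc1)
qed

lemma tor_prod_module:
  assumes "module R M" "module R N" "x \<in> carrier R"
  shows "tor R x (prod_module M N) = prod_module (tor R x M) (tor R x N)"
proof -
  interpret M: module R M by fact
  interpret N: module R N by fact
  have "carrier (tor R x (prod_module M N)) = carrier (tor R x M) \<times> carrier (tor R x N)"
  proof safe
    fix a b assume "a \<in> carrier (tor R x M)" "b \<in> carrier (tor R x N)"
    then obtain n k :: nat where *: "a \<in> carrier M" "b \<in> carrier N"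
        "(x [^]\<^bsub>R\<^esub> n) \<odot>\<^bsub>M\<^esub> a = \<zero>\<^bsub>M\<^esub>" "(x [^]\<^bsub>R\<^esub> k) \<odot>\<^bsub>N\<^esub> b = \<zero>\<^bsub>N\<^esub>"
      by (auto simp: carrier_tor)
    hence "(x [^]\<^bsub>R\<^esub> max n k) \<odot>\<^bsub>M\<^esub> a = \<zero>\<^bsub>M\<^esub>" "(x [^]\<^bsub>R\<^esub> max n k) \<odot>\<^bsub>N\<^esub> b = \<zero>\<^bsub>N\<^esub>"
      using M.pow_smult_zero_mono[OF assms(3) *(1,3)] N.pow_smult_zero_mono[OF assms(3) *(2,4)] by simp_all
    thus "(a, b) \<in> carrier (tor R x (prod_module M N))" using * by (auto simp: carrier_tor)
  qed (auto simp: carrier_tor)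
  thus ?thesis by (auto simp: tor_def prod_module_def)
qed

lemma carrier_tors_prod_module:
  assumes "module R M" "module R N" "set xs \<subseteq> carrier R"
  shows "carrier (tors R xs (prod_module M N)) = carrier (tors R xs M) \<times> carrier (tors R xs N)"
  using assms by (induct xs arbitrary: M N) (auto simp: tor_prod_module module_tor)

lemma tor_acyclic_prod_module:
  assumes "module R M" "module R N" "set xs \<subseteq> carrier R" "tor_acyclic R xs M" "tor_acyclic R xs N"
  shows "tor_acyclic R xs (prod_module M N)"
  using assms
proof (induct xs arbitrary: M N)
  case (Cons x xs)
  have "divisible_mod_tor R x (prod_module M N)"
    unfolding divisible_mod_tor_def
  proof
    fix u assume "u \<in> carrier (prod_module M N)"
    then obtain m n where u: "u = (m, n)" "m \<in> carrier M" "n \<in> carrier N" by auto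
    obtain m' s where m: "m' \<in> carrier M" "s \<in> carrier (tor R x M)" "m = (x \<odot>\<^bsub>M\<^esub> m') \<oplus>\<^bsub>M\<^esub> s"
      using Cons(5) u by (auto simp: divisible_mod_tor_def)
    obtain n' t where n: "n' \<in> carrier N" "t \<in> carrier (tor R x N)" "n = (x \<odot>\<^bsub>N\<^esub> n') \<oplus>\<^bsub>N\<^esub> t"
      using Cons(6) u by (auto simp: divisible_mod_tor_def)
    show "\<exists>m'\<in>carrier (prod_module M N). \<exists>t\<in>carrier (tor R x (prod_module M N)).
       u = (x \<odot>\<^bsub>prod_module M N\<^esub> m') \<oplus>\<^bsub>prod_module M N\<^esub> t"
      using u m n Cons(2-4) by (intro bexI[of _ "(m', n')"] bexI[of _ "(s, t)"]) (auto simp: tor_prod_module)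
  qed
  thus ?case using Cons by (simp add: tor_prod_module module_tor)
qed simp

text \<open>Fills degree -1 of the target of a comparison map, so that its cone is indexed by the
  natural numbers.\<close>

lemma zero_module:
  assumes "module R M"
  shows "module R (M\<lparr>carrier := {\<zero>\<^bsub>M\<^esub>}\<rparr>)"
proof -
  interpret module R M by fact
  show ?thesis by (intro submodule_module submoduleI') (auto simp: assms)
qed

lemma tor_acyclic_zero_module:
  assumes "module R M" "set xs \<subseteq> carrier R"
  shows "tor_acyclic R xs (M\<lparr>carrier := {\<zero>\<^bsub>M\<^esub>}\<rparr>)"
proof -
  interpret module R M by fact
  show ?thesis using assms(2)
  proof (induct xs)
    case (Cons x xs)
    hence x: "x \<in> carrier R" by simp
    have "{m. m = \<zero>\<^bsub>M\<^esub> \<and> (\<exists>n::nat. (x [^]\<^bsub>R\<^esub> n) \<odot>\<^bsub>M\<^esub> m = \<zero>\<^bsub>M\<^esub>)} = {\<zero>\<^bsub>M\<^esub>}" using x by auto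
    hence "tor R x (M\<lparr>carrier := {\<zero>\<^bsub>M\<^esub>}\<rparr>) = M\<lparr>carrier := {\<zero>\<^bsub>M\<^esub>}\<rparr>" by (simp add: tor_def)
    moreover from this have "divisible_mod_tor R x (M\<lparr>carrier := {\<zero>\<^bsub>M\<^esub>}\<rparr>)"
      using x by (simp add: divisible_mod_tor_def)
    ultimately show ?case using Cons by simp
  qed simp
qed

text \<open>The mapping cone of a comparison map is an exact complex of acyclic modules, so it stays exact
  after taking torsion.\<close>

lemma tors_exact_at_comparison:
  assumes X: "resolution R M E e d" and G: "resolution R M G e' d'" and baer: "\<And>n. baer R (G n)"
    and xs: "set xs \<subseteq> carrier R"
    and acX: "\<And>n. tor_acyclic R xs (E n)" and acG: "\<And>n. tor_acyclic R xs (G n)"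
  shows "tors_exact_at R xs E d n \<longleftrightarrow> tors_exact_at R xs G d' n"
proof -
  obtain f where f: "\<And>n. f n \<in> module_hom R (E n) (G n)" "\<And>m. m \<in> carrier M \<Longrightarrow> f 0 (e m) = e' m"
    "\<And>n x. x \<in> carrier (E n) \<Longrightarrow> f (Suc n) (d n x) = d' n (f n x)"
    using comparison_map[OF X G baer] by blast
  note X = resolutionD[OF X] and G = resolutionD[OF G]
  interpret M: module R M by (rule X)
  \<comment> \<open>The cone has E n and G (n - 1) in degree n, with differential (x, g) to (d x, f
    x - d' g). In degree 0 the second summand is the zero module, with its inclusion as
    \<open>\<delta> 0\<close>.\<close>
  define H where "H n = (case n of 0 \<Rightarrow> (G 0)\<lparr>carrier := {\<zero>\<^bsub>G 0\<^esub>}\<rparr> | Suc j \<Rightarrow> G j)" for n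
  define \<delta> where "\<delta> n = (case n of 0 \<Rightarrow> (\<lambda>g. g) | Suc j \<Rightarrow> d' j)" for n
  define C where "C n = prod_module (E n) (H n)" for n
  define D where "D n u = (d n (fst u), f n (fst u) \<ominus>\<^bsub>G n\<^esub> \<delta> n (snd u))" for n u
  have HS [simp]: "H (Suc n) = G n" "\<delta> (Suc n) = d' n" for n by (simp_all add: H_def \<delta>_def)
  have H: "module R (H n)" for n using G(2) by (cases n) (simp_all add: H_def zero_module)
  have \<delta>: "\<delta> n \<in> module_hom R (H n) (G n)" for n
  proof (cases n)
    case 0
    interpret G0: module R "G 0" by (rule G)
    show ?thesis using 0 by (auto intro!: module_homI simp: H_def \<delta>_def)
  qed (use G(5) in simp)
  have \<delta>\<delta>: "d' n (\<delta> n g) = \<zero>\<^bsub>G (Suc n)\<^esub>" if "g \<in> carrier (H n)" for n g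
  proof (cases n)
    case 0
    thus ?thesis using that module_hom_zero[OF G(2) G(2) G(5)[of 0]] by (simp add: H_def \<delta>_def)
  qed (use that G(9) in simp)
  have Cm: "module R (C n)" for n unfolding C_def by (rule prod_module[OF X(2) H])
  have fG: "f n x \<in> carrier (G n)" if "x \<in> carrier (E n)" for n x using module_homD(1)[OF f(1) that] .
  have dE: "d n x \<in> carrier (E (Suc n))" if "x \<in> carrier (E n)" for n x using module_homD(1)[OF X(5) that] .
  have dG: "d' n x \<in> carrier (G (Suc n))" if "x \<in> carrier (G n)" for n x using module_homD(1)[OF G(5) that] .
  have \<delta>G: "\<delta> n g \<in> carrier (G n)" if "g \<in> carrier (H n)" for n g using module_homD(1)[OF \<delta> that] .
  have Dhom: "D n \<in> module_hom R (C n) (C (Suc n))" for n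
  proof -
    interpret Gn: module R "G n" by (rule G)
    show ?thesis
    proof (rule module_homI)
      fix u assume "u \<in> carrier (C n)"
      thus "D n u \<in> carrier (C (Suc n))" by (auto simp: C_def D_def fG dE \<delta>G)
    next
      fix u v assume uv: "u \<in> carrier (C n)" "v \<in> carrier (C n)"
      thus "D n (u \<oplus>\<^bsub>C n\<^esub> v) = D n u \<oplus>\<^bsub>C (Suc n)\<^esub> D n v"
        using module_homD(2)[OF X(5)[of n]] module_homD(2)[OF f(1)[of n]] module_homD(2)[OF \<delta>[of n]]
        by (auto simp: C_def D_def fG \<delta>G Gn.M.add_diff_add)
    next
      fix r u assume ru: "r \<in> carrier R" "u \<in> carrier (C n)"
      thus "D n (r \<odot>\<^bsub>C n\<^esub> u) = r \<odot>\<^bsub>C (Suc n)\<^esub> D n u"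
        using module_homD(3)[OF X(5)[of n]] module_homD(3)[OF f(1)[of n]] module_homD(3)[OF \<delta>[of n]]
        by (auto simp: C_def D_def fG \<delta>G a_minus_def Gn.smult_r_distr Gn.smult_r_minus)
    qed
  qed
  have ex: "exact_complex R C D"
    unfolding exact_complex_def
  proof (intro conjI allI ballI impI)
    show "\<And>n. module R (C n)" by (rule Cm)
    show "\<And>n. D n \<in> module_hom R (C n) (C (Suc n))" by (rule Dhom)
  next
    fix n c assume "c \<in> carrier (C n)"
    then obtain x g where c: "c = (x, g)" "x \<in> carrier (E n)" "g \<in> carrier (H n)" by (auto simp: C_def)
    interpret Gn: module R "G n" by (rule G)
    interpret Gs: module R "G (Suc n)" by (rule G)
    have "d' n (f n x \<ominus>\<^bsub>G n\<^esub> \<delta> n g) = d' n (f n x)"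
      using module_hom_diff[OF G(2) G(2) G(5) fG[OF c(2)] \<delta>G[OF c(3)]] \<delta>\<delta>[OF c(3)]
        Gs.diff_zero_right dG[OF fG[OF c(2)]] by simp
    thus "D (Suc n) (D n c) = \<zero>\<^bsub>C (Suc (Suc n))\<^esub>"
      using c X(9)[OF c(2)] f(3)[OF c(2)] Gs.diff_zero_iff dG[OF fG[OF c(2)]] by (simp add: D_def C_def)
  next
    \<comment> \<open>A cone cocycle in degree 0 comes from some m with e' m = f (e m) = 0, so
      injectivity of e' gives m = 0.\<close>
    fix c assume c: "c \<in> carrier (C 0)" "D 0 c = \<zero>\<^bsub>C 1\<^esub>"
    then obtain x where x: "c = (x, \<zero>\<^bsub>G 0\<^esub>)" "x \<in> carrier (E 0)" by (auto simp: C_def H_def)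
    interpret G0: module R "G 0" by (rule G)
    have "d 0 x = \<zero>\<^bsub>E 1\<^esub>" "f 0 x = \<zero>\<^bsub>G 0\<^esub>"
      using c(2) x fG[OF x(2)] G0.diff_zero_right by (auto simp: D_def C_def \<delta>_def)
    moreover obtain m where m: "m \<in> carrier M" "e m = x" using X(6) x calculation by blast
    ultimately have "e' m = \<zero>\<^bsub>G 0\<^esub>" using f(2) by auto
    hence "e' m = e' \<zero>\<^bsub>M\<^esub>" using module_hom_zero[OF G(1,2,3)] by simp
    hence "m = \<zero>\<^bsub>M\<^esub>" using inj_onD[OF G(4)] m by simp
    thus "c = \<zero>\<^bsub>C 0\<^esub>" using x m module_hom_zero[OF X(1,2,3)] by (simp add: C_def H_def)
  next
    fix n c assume c: "c \<in> carrier (C (Suc n))" "D (Suc n) c = \<zero>\<^bsub>C (Suc (Suc n))\<^esub>"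
    interpret En: module R "E n" by (rule X)
    interpret Es: module R "E (Suc n)" by (rule X)
    interpret Gn: module R "G n" by (rule G)
    interpret Gs: module R "G (Suc n)" by (rule G)
    obtain x g where xg: "c = (x, g)" "x \<in> carrier (E (Suc n))" "g \<in> carrier (G n)"
      using c(1) by (auto simp: C_def)
    have dx: "d (Suc n) x = \<zero>\<^bsub>E (Suc (Suc n))\<^esub>" and fx: "f (Suc n) x = d' n g"
      using c(2) xg fG[OF xg(2)] dG[OF xg(3)] Gs.diff_zero_iff by (auto simp: D_def C_def)
    obtain y where y: "y \<in> carrier (E n)" "d n y = x" using X(8)[OF xg(2) dx] by blast
    let ?z = "f n y \<ominus>\<^bsub>G n\<^esub> g"
    have z: "?z \<in> carrier (G n)" using fG y xg by simp
    have dz: "d' n ?z = \<zero>\<^bsub>G (Suc n)\<^esub>"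
      using module_hom_diff[OF G(2) G(2) G(5) fG[OF y(1)] xg(3)] f(3)[OF y(1)] y fx dG[OF xg(3)] Gs.diff_zero_iff
      by simp
    \<comment> \<open>The defect f y - g is a cocycle of \<open>G\<close>. In positive degree it is
      a coboundary and enters as d' g'. In degree 0 it equals e' m, and y is changed by e m instead,
      which does not affect d y.\<close>
    have "\<exists>y'\<in>carrier (E n). d n y' = x \<and> (\<exists>g'\<in>carrier (H n). f n y' \<ominus>\<^bsub>G n\<^esub> \<delta> n g' = g)"
    proof (cases n)
      case 0
      obtain m where m: "m \<in> carrier M" "e' m = ?z" using G(6) z dz 0 by auto
      have em: "e m \<in> carrier (E n)" using module_homD(1)[OF X(3) m(1)] 0 by simp
      have dem: "d n (e m) = \<zero>\<^bsub>E (Suc n)\<^esub>" using X(7)[OF m(1)] 0 by simp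
      have "d n (y \<ominus>\<^bsub>E n\<^esub> e m) = x"
        using module_hom_diff[OF X(2) X(2) X(5) y(1) em] dem y Es.diff_zero_right xg by simp
      moreover have "f n (y \<ominus>\<^bsub>E n\<^esub> e m) = f n y \<ominus>\<^bsub>G n\<^esub> ?z"
        using module_hom_diff[OF X(2) G(2) f(1) y(1) em] f(2)[OF m(1)] m 0 by simp
      hence "f n (y \<ominus>\<^bsub>E n\<^esub> e m) = g"
        using fG[OF y(1)] xg(3) by (simp add: a_minus_def Gn.M.minus_add Gn.M.r_neg1 Gn.M.r_neg2)
      moreover have "y \<ominus>\<^bsub>E n\<^esub> e m \<in> carrier (E n)" using y em by simp
      ultimately show ?thesis using 0 y em xg Gn.diff_zero_right
        by (intro bexI[of _ "y \<ominus>\<^bsub>E n\<^esub> e m"] conjI bexI[of _ "\<zero>\<^bsub>G 0\<^esub>"]) (auto simp: H_def \<delta>_def)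
    next
      case (Suc j)
      obtain g' where g': "g' \<in> carrier (G j)" "d' j g' = ?z" using G(8) z dz Suc by metis
      have "f n y \<ominus>\<^bsub>G n\<^esub> ?z = g"
        using fG[OF y(1)] xg(3) by (simp add: a_minus_def Gn.M.minus_add Gn.M.r_neg1 Gn.M.r_neg2)
      thus ?thesis using y g' Suc by (intro bexI[of _ y] conjI bexI[of _ g']) simp_all
    qed
    then obtain y' g' where "y' \<in> carrier (E n)" "d n y' = x" "g' \<in> carrier (H n)"
      "f n y' \<ominus>\<^bsub>G n\<^esub> \<delta> n g' = g" by blast
    thus "\<exists>b\<in>carrier (C n). D n b = c" using xg
      by (intro bexI[of _ "(y', g')"]) (auto simp: C_def D_def)
  qed
  have acH: "tor_acyclic R xs (H n)" for n
    using acG G(2) xs by (cases n) (simp_all add: H_def tor_acyclic_zero_module)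
  have acC: "tor_acyclic R xs (C n)" for n
    unfolding C_def by (rule tor_acyclic_prod_module[OF X(2) H xs acX acH])
  have carC: "carrier (tors R xs (C n)) = carrier (tors R xs (E n)) \<times> carrier (tors R xs (H n))" for n
    unfolding C_def by (rule carrier_tors_prod_module[OF X(2) H xs])
  note exT = exact_complex_tors[OF ex xs acC]
  have tE: "module R (tors R xs (E n))" and tG: "module R (tors R xs (G n))" and tH: "module R (tors R xs (H n))" for n
    using module_tors X(2) G(2) H xs by blast+
  have ftor: "f n x \<in> carrier (tors R xs (G n))" if "x \<in> carrier (tors R xs (E n))" for n x
    by (rule module_homD(1)[OF module_hom_tors[OF X(2) G(2) f(1) xs] that])
  have surjT: "\<exists>b\<in>carrier (tors R xs (C n)). D n b = c"
    if "c \<in> carrier (tors R xs (C (Suc n)))" "D (Suc n) c = \<zero>\<^bsub>C (Suc (Suc n))\<^esub>" for n c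
    using exT that unfolding exact_complex_def by auto
  have injT: "c = \<zero>\<^bsub>C 0\<^esub>" if "c \<in> carrier (tors R xs (C 0))" "D 0 c = \<zero>\<^bsub>C 1\<^esub>" for c
    using exT that unfolding exact_complex_def by auto
  show ?thesis
  proof
    assume L: "tors_exact_at R xs G d' n"
    show "tors_exact_at R xs E d n"
      unfolding tors_exact_at_def
    proof (intro ballI impI)
      fix x assume x: "x \<in> carrier (tors R xs (E n))" "d n x = \<zero>\<^bsub>E (Suc n)\<^esub>"
      interpret Gn: module R "G n" by (rule G)
      have xE: "x \<in> carrier (E n)" using x(1) by (simp add: carrier_tors)
      have fx: "f n x \<in> carrier (tors R xs (G n))" by (rule ftor[OF x(1)])
      have "d' n (f n x) = \<zero>\<^bsub>G (Suc n)\<^esub>"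
        using f(3)[OF xE] x(2) module_hom_zero[OF X(2) G(2) f(1)] by simp
      hence *: "case n of 0 \<Rightarrow> f n x = \<zero>\<^bsub>G 0\<^esub> | Suc j \<Rightarrow> \<exists>b\<in>carrier (tors R xs (G j)). d' j b = f n x"
        using L fx unfolding tors_exact_at_def by blast
      show "case n of 0 \<Rightarrow> x = \<zero>\<^bsub>E 0\<^esub> | Suc j \<Rightarrow> \<exists>b\<in>carrier (tors R xs (E j)). d j b = x"
      proof (cases n)
        case 0
        interpret H0: module R "tors R xs (H 0)" by (rule tH)
        interpret G0: module R "G 0" by (rule G)
        have z0: "\<zero>\<^bsub>H 0\<^esub> \<in> carrier (tors R xs (H 0))" using H0.M.zero_closed by simp
        have "(x, \<zero>\<^bsub>H 0\<^esub>) = \<zero>\<^bsub>C 0\<^esub>"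
        proof (rule injT)
          show "(x, \<zero>\<^bsub>H 0\<^esub>) \<in> carrier (tors R xs (C 0))" using x 0 z0 by (simp add: carC)
          show "D 0 (x, \<zero>\<^bsub>H 0\<^esub>) = \<zero>\<^bsub>C 1\<^esub>" using x 0 * G0.diff_zero_right
            by (simp add: D_def C_def \<delta>_def H_def)
        qed
        thus ?thesis using 0 by (simp add: C_def)
      next
        case (Suc j)
        \<comment> \<open>With f x = d' b the pair (x, b) is a torsion cocycle of the cone, so x is
          the coboundary of a torsion element.\<close>
        obtain b where b: "b \<in> carrier (tors R xs (G j))" "d' j b = f n x" using * Suc by auto
        have "\<exists>c\<in>carrier (tors R xs (C j)). D j c = (x, b)"
        proof (rule surjT)
          show "(x, b) \<in> carrier (tors R xs (C (Suc j)))" using x b Suc by (simp add: carC)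
          show "D (Suc j) (x, b) = \<zero>\<^bsub>C (Suc (Suc j))\<^esub>"
            using x b Suc Gn.diff_zero_iff fG[OF xE] by (simp add: D_def C_def)
        qed
        thus ?thesis using Suc by (auto simp: carC D_def)
      qed
    qed
  next
    assume L: "tors_exact_at R xs E d n"
    show "tors_exact_at R xs G d' n"
      unfolding tors_exact_at_def
    proof (intro ballI impI)
      fix g assume g: "g \<in> carrier (tors R xs (G n))" "d' n g = \<zero>\<^bsub>G (Suc n)\<^esub>"
      interpret Gn: module R "G n" by (rule G)
      interpret Gs: module R "G (Suc n)" by (rule G)
      interpret tEs: module R "tors R xs (E (Suc n))" by (rule tE)
      \<comment> \<open>The pair (0, g) is a cocycle of the cone one degree higher. Writing it as D
        (x, h) gives d x = 0 and g = f x - d' h. In positive degree exactness of \<open>E\<close>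
        turns x into d b, so g = d' (f b - h); in degree 0 both x and h vanish.\<close>
      have "\<exists>c\<in>carrier (tors R xs (C n)). D n c = (\<zero>\<^bsub>E (Suc n)\<^esub>, g)"
      proof (rule surjT)
        show "(\<zero>\<^bsub>E (Suc n)\<^esub>, g) \<in> carrier (tors R xs (C (Suc n)))"
          using g tEs.M.zero_closed by (simp add: carC)
        show "D (Suc n) (\<zero>\<^bsub>E (Suc n)\<^esub>, g) = \<zero>\<^bsub>C (Suc (Suc n))\<^esub>"
          using g module_hom_zero[OF X(2) X(2) X(5)] module_hom_zero[OF X(2) G(2) f(1)] Gs.diff_zero_iff
          by (simp add: D_def C_def)
      qed
      then obtain x h where xh: "x \<in> carrier (tors R xs (E n))" "h \<in> carrier (tors R xs (H n))"
        "d n x = \<zero>\<^bsub>E (Suc n)\<^esub>" "f n x \<ominus>\<^bsub>G n\<^esub> \<delta> n h = g" by (auto simp: carC D_def)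
      hence *: "case n of 0 \<Rightarrow> x = \<zero>\<^bsub>E 0\<^esub> | Suc j \<Rightarrow> \<exists>b\<in>carrier (tors R xs (E j)). d j b = x"
        using L unfolding tors_exact_at_def by blast
      show "case n of 0 \<Rightarrow> g = \<zero>\<^bsub>G 0\<^esub> | Suc j \<Rightarrow> \<exists>b\<in>carrier (tors R xs (G j)). d' j b = g"
      proof (cases n)
        case 0
        have "h = \<zero>\<^bsub>G 0\<^esub>" using xh(2) 0 by (simp add: carrier_tors H_def)
        thus ?thesis using 0 * xh module_hom_zero[OF X(2) G(2) f(1), of 0] Gn.diff_zero_right Gn.M.zero_closed
          by (simp add: \<delta>_def)
      next
        case (Suc j)
        interpret tGj: module R "tors R xs (G j)" by (rule tG)
        obtain b where b: "b \<in> carrier (tors R xs (E j))" "d j b = x" using * Suc by auto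
        have h: "h \<in> carrier (tors R xs (G j))" using xh(2) Suc by simp
        have c: "f j b \<in> carrier (G j)" "h \<in> carrier (G j)" "b \<in> carrier (E j)"
          using ftor[OF b(1)] h b(1) by (simp_all add: carrier_tors)
        let ?y = "f j b \<ominus>\<^bsub>tors R xs (G j)\<^esub> h"
        have y: "?y \<in> carrier (tors R xs (G j))" using ftor[OF b(1)] h by simp
        have "d' j \<in> module_hom R (tors R xs (G j)) (G n)"
          using G(5)[of j] Suc by (auto simp: module_hom_def carrier_tors)
        hence "d' j ?y = d' j (f j b) \<ominus>\<^bsub>G n\<^esub> d' j h"
          using module_hom_diff[OF tG G(2)] ftor[OF b(1)] h by blast
        hence "d' j ?y = g" using f(3)[OF c(3)] b(2) xh(4) Suc by simp
        thus ?thesis using y Suc by auto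
      qed
    qed
  qed
qed

section \<open>Injective resolutions\<close>

text \<open>Transport of structure along an injection, used to move ideals, the ring and coinduced
  modules into a prescribed type. The operations go through the inverse on the image, so injectivity
  on the carrier suffices.\<close>

definition copy_module :: "('m \<Rightarrow> 'e) \<Rightarrow> ('a, 'm, 'y) module_scheme \<Rightarrow> ('a, 'e) module"
  where "copy_module \<iota> M = (let j = inv_into (carrier M) \<iota> in
    \<lparr>carrier = \<iota> ` carrier M, monoid.mult = undefined, one = undefined, ring.zero = \<iota> \<zero>\<^bsub>M\<^esub>,
     add = (\<lambda>u v. \<iota> (j u \<oplus>\<^bsub>M\<^esub> j v)), smult = (\<lambda>r u. \<iota> (r \<odot>\<^bsub>M\<^esub> j u))\<rparr>)"

lemma copy_module_simps [simp]:
  "carrier (copy_module \<iota> M) = \<iota> ` carrier M"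
  "\<zero>\<^bsub>copy_module \<iota> M\<^esub> = \<iota> \<zero>\<^bsub>M\<^esub>"
  by (simp_all add: copy_module_def Let_def)

lemma copy_module_ops:
  assumes "inj_on \<iota> (carrier M)"
  shows "\<lbrakk>x \<in> carrier M; y \<in> carrier M\<rbrakk> \<Longrightarrow> \<iota> x \<oplus>\<^bsub>copy_module \<iota> M\<^esub> \<iota> y = \<iota> (x \<oplus>\<^bsub>M\<^esub> y)"
    and "x \<in> carrier M \<Longrightarrow> r \<odot>\<^bsub>copy_module \<iota> M\<^esub> \<iota> x = \<iota> (r \<odot>\<^bsub>M\<^esub> x)"
  using assms by (simp_all add: copy_module_def Let_def)

lemma module_copy:
  assumes "module R M" "inj_on \<iota> (carrier M)"
  shows "module R (copy_module \<iota> M)"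
proof -
  interpret module R M by fact
  note ops [simp] = copy_module_ops[OF assms(2)]
  show ?thesis
  proof (rule moduleI)
    show "abelian_group (copy_module \<iota> M)"
    proof (rule abelian_groupI)
      fix u assume "u \<in> carrier (copy_module \<iota> M)"
      then obtain m where "m \<in> carrier M" "u = \<iota> m" by auto
      thus "\<exists>v\<in>carrier (copy_module \<iota> M). v \<oplus>\<^bsub>copy_module \<iota> M\<^esub> u = \<zero>\<^bsub>copy_module \<iota> M\<^esub>"
        by (intro bexI[of _ "\<iota> (\<ominus>\<^bsub>M\<^esub> m)"]) (auto simp: l_neg)
    qed (auto simp: a_ac)
  qed (auto simp: R.is_cring smult_l_distr smult_r_distr smult_assoc1)
qed

lemma copy_module_hom:
  assumes "inj_on \<iota> (carrier M)"
  shows "\<iota> \<in> module_hom R M (copy_module \<iota> M)"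
  using copy_module_ops[OF assms] by (intro module_homI) auto

lemma copy_module_inv_hom:
  assumes "module R M" "inj_on \<iota> (carrier M)"
  shows "inv_into (carrier M) \<iota> \<in> module_hom R (copy_module \<iota> M) M"
proof -
  interpret module R M by fact
  show ?thesis using copy_module_ops[OF assms(2)] assms(2) by (intro module_homI) auto
qed

lemma baer_copy:
  assumes "baer R M" "inj_on \<iota> (carrier M)"
  shows "baer R (copy_module \<iota> M)"
proof -
  interpret module R M using assms(1) by (simp add: baer_def)
  let ?j = "inv_into (carrier M) \<iota>" and ?C = "copy_module \<iota> M"
  have hom: "?j \<in> module_hom R ?C M" by (rule copy_module_inv_hom[OF module_axioms assms(2)])
  show ?thesis
    unfolding baer_def
  proof (intro conjI allI impI)
    show "module R ?C" by (rule module_copy[OF module_axioms assms(2)])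
    fix b f assume *: "ideal b R \<and> f \<in> b \<rightarrow> carrier ?C \<and>
       (\<forall>r\<in>b. \<forall>s\<in>b. f (r \<oplus>\<^bsub>R\<^esub> s) = f r \<oplus>\<^bsub>?C\<^esub> f s) \<and>
       (\<forall>r\<in>carrier R. \<forall>s\<in>b. f (r \<otimes>\<^bsub>R\<^esub> s) = r \<odot>\<^bsub>?C\<^esub> f s)"
    have fc: "f r \<in> carrier ?C" if "r \<in> b" for r using * that by blast
    have "\<exists>e\<in>carrier M. \<forall>r\<in>b. ?j (f r) = r \<odot>\<^bsub>M\<^esub> e"
    proof -
      have "(\<lambda>r. ?j (f r)) \<in> b \<rightarrow> carrier M" using fc module_homD(1)[OF hom] by blast
      moreover have "?j (f (r \<oplus>\<^bsub>R\<^esub> s)) = ?j (f r) \<oplus>\<^bsub>M\<^esub> ?j (f s)" if "r \<in> b" "s \<in> b" for r s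
        using * that module_homD(2)[OF hom] fc by simp
      moreover have "?j (f (r \<otimes>\<^bsub>R\<^esub> s)) = r \<odot>\<^bsub>M\<^esub> ?j (f s)" if "r \<in> carrier R" "s \<in> b" for r s
        using * that module_homD(3)[OF hom] fc by simp
      ultimately show ?thesis
        using assms(1) * unfolding baer_def by (elim conjE allE[of _ b] allE[of _ "\<lambda>r. ?j (f r)"]) simp
    qed
    then obtain e where e: "e \<in> carrier M" "\<And>r. r \<in> b \<Longrightarrow> ?j (f r) = r \<odot>\<^bsub>M\<^esub> e" by blast
    have "f r = r \<odot>\<^bsub>?C\<^esub> \<iota> e" if "r \<in> b" for r
      using fc[OF that] e(2)[OF that] copy_module_ops(2)[OF assms(2) e(1), of r]
        f_inv_into_f[of "f r" \<iota> "carrier M"] by simp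
    thus "\<exists>e\<in>carrier ?C. \<forall>r\<in>b. f r = r \<odot>\<^bsub>?C\<^esub> e" using e by auto
  qed
qed

lemma baer_imp_injective_module:
  fixes E :: "('a, 'e) module"
  assumes E: "baer R E"
  shows "injective_module R E"
  unfolding injective_module_def
proof (intro conjI allI impI)
  fix P Q :: "('a, 'e) module" and i f
  assume *: "module R P \<and> module R Q \<and> i \<in> module_hom R P Q \<and> inj_on i (carrier P) \<and> f \<in> module_hom R P E"
  interpret P: module R P using * by blast
  interpret E: module R E using E by (simp add: baer_def)
  have "f p = \<zero>\<^bsub>E\<^esub>" if "p \<in> carrier P" "i p = \<zero>\<^bsub>Q\<^esub>" for p
  proof -
    have "i p = i \<zero>\<^bsub>P\<^esub>" using that module_hom_zero[of R P Q i] * by simp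
    hence "p = \<zero>\<^bsub>P\<^esub>" using * that inj_onD[of i "carrier P"] by simp
    thus ?thesis using module_hom_zero[of R P E f] * E.module_axioms by simp
  qed
  thus "\<exists>g\<in>module_hom R Q E. \<forall>x\<in>carrier P. g (i x) = f x"
    using baer_factor[OF E, of P Q i f] * by blast
qed (use E in \<open>simp add: baer_def\<close>)

text \<open>The injection \<open>\<kappa>\<close> provides copies of \<open>b\<close> and of the
  ring inside the type of \<open>E\<close>, where \<open>injective_module\<close> applies to the
  inclusion. The value at the copy of 1 is the wanted element.\<close>

lemma injective_module_imp_baer:
  fixes R :: "('a, 'x) ring_scheme" and E :: "('a, 'e) module" and \<kappa> :: "'a \<Rightarrow> 'e"
  assumes E: "injective_module R E" and \<kappa>: "inj \<kappa>"
  shows "baer R E"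
  unfolding baer_def
proof (intro conjI allI impI)
  show mod: "module R E" using E by (simp add: injective_module_def)
  interpret E: module R E by fact
  fix b f assume *: "ideal b R \<and> f \<in> b \<rightarrow> carrier E \<and>
       (\<forall>r\<in>b. \<forall>s\<in>b. f (r \<oplus>\<^bsub>R\<^esub> s) = f r \<oplus>\<^bsub>E\<^esub> f s) \<and>
       (\<forall>r\<in>carrier R. \<forall>s\<in>b. f (r \<otimes>\<^bsub>R\<^esub> s) = r \<odot>\<^bsub>E\<^esub> f s)"
  interpret b: ideal b R using * by blast
  let ?b = "(regular_module R)\<lparr>carrier := b\<rparr>"
  have Rm: "module R (regular_module R)" by (rule module_regular[OF E.R.is_cring])
  interpret Rm: module R "regular_module R" by (rule Rm)
  have bm: "module R ?b"
    by (rule submodule_module[OF Rm.submoduleI' Rm]) (auto simp: b.Icarr b.I_l_closed)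
  have ib: "inj_on \<kappa> (carrier ?b)" and iR: "inj_on \<kappa> (carrier (regular_module R))"
    using \<kappa> by (auto intro: inj_on_subset)
  note cb = copy_module_ops[OF ib, simplified] and cR = copy_module_ops[OF iR, simplified]
  let ?P = "copy_module \<kappa> ?b" and ?Q = "copy_module \<kappa> (regular_module R)"
  have "(\<lambda>u. u) \<in> module_hom R ?P ?Q"
    by (rule module_homI) (auto simp: cb cR b.Icarr)
  moreover have "(\<lambda>u. f (inv_into b \<kappa> u)) \<in> module_hom R ?P E"
  proof (rule module_hom_comp[where N = ?b])
    show "inv_into b \<kappa> \<in> module_hom R ?P ?b" using copy_module_inv_hom[OF bm ib] by simp
    show "f \<in> module_hom R ?b E" using * by (intro module_homI) auto
  qed
  ultimately obtain g where g: "g \<in> module_hom R ?Q E" "\<And>u. u \<in> carrier ?P \<Longrightarrow> g u = f (inv_into b \<kappa> u)"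
    using E module_copy[OF bm ib] module_copy[OF Rm iR] unfolding injective_module_def
    by (elim conjE allE[of _ ?P] allE[of _ ?Q] allE[of _ "\<lambda>u. u"] allE[of _ "\<lambda>u. f (inv_into b \<kappa> u)"]) auto
  have "f r = r \<odot>\<^bsub>E\<^esub> g (\<kappa> \<one>\<^bsub>R\<^esub>)" if r: "r \<in> b" for r
  proof -
    have "f r = g (\<kappa> r)" using g(2)[of "\<kappa> r"] r inv_into_f_f[of \<kappa> b r] ib by simp
    also have "\<kappa> r = r \<odot>\<^bsub>?Q\<^esub> \<kappa> \<one>\<^bsub>R\<^esub>" using cR(2)[of "\<one>\<^bsub>R\<^esub>" r] b.Icarr[OF r] by simp
    also have "g \<dots> = r \<odot>\<^bsub>E\<^esub> g (\<kappa> \<one>\<^bsub>R\<^esub>)" using module_homD(3)[OF g(1)] b.Icarr[OF r] by simp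
    finally show ?thesis .
  qed
  moreover have "g (\<kappa> \<one>\<^bsub>R\<^esub>) \<in> carrier E" using module_homD(1)[OF g(1)] by simp
  ultimately show "\<exists>e\<in>carrier E. \<forall>r\<in>b. f r = r \<odot>\<^bsub>E\<^esub> e" by blast
qed

subsection \<open>Coinduced modules\<close>

lemma restrict_scalars_simps [simp]:
  "carrier (restrict_scalars A M) = carrier M" "ring.zero (restrict_scalars A M) = \<zero>\<^bsub>M\<^esub>"
  "add (restrict_scalars A M) = add M"
  "c \<odot>\<^bsub>restrict_scalars A M\<^esub> m = (c \<odot>\<^bsub>A\<^esub> \<one>\<^bsub>A\<^esub>) \<odot>\<^bsub>M\<^esub> m"
  by (simp_all add: restrict_scalars_def)

lemma algebra_D:
  assumes "algebra K A"
  shows "cring K" "cring A" "module K A"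
    "\<lbrakk>c \<in> carrier K; a \<in> carrier A; b \<in> carrier A\<rbrakk> \<Longrightarrow> (c \<odot>\<^bsub>A\<^esub> a) \<otimes>\<^bsub>A\<^esub> b = c \<odot>\<^bsub>A\<^esub> (a \<otimes>\<^bsub>A\<^esub> b)"
    "\<lbrakk>c \<in> carrier K; a \<in> carrier A; b \<in> carrier A\<rbrakk> \<Longrightarrow> a \<otimes>\<^bsub>A\<^esub> (c \<odot>\<^bsub>A\<^esub> b) = c \<odot>\<^bsub>A\<^esub> (a \<otimes>\<^bsub>A\<^esub> b)"
    "\<lbrakk>c \<in> carrier K; a \<in> carrier A\<rbrakk> \<Longrightarrow> (c \<odot>\<^bsub>A\<^esub> \<one>\<^bsub>A\<^esub>) \<otimes>\<^bsub>A\<^esub> a = c \<odot>\<^bsub>A\<^esub> a"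
proof -
  interpret algebra K A by fact
  show "cring K" "cring A" "module K A" by (rule R_cring M_cring module)+
  show assoc: "(c \<odot>\<^bsub>A\<^esub> a) \<otimes>\<^bsub>A\<^esub> b = c \<odot>\<^bsub>A\<^esub> (a \<otimes>\<^bsub>A\<^esub> b)"
    if "c \<in> carrier K" "a \<in> carrier A" "b \<in> carrier A" for a b c
    using smult_assoc2 that by blast
  show "a \<otimes>\<^bsub>A\<^esub> (c \<odot>\<^bsub>A\<^esub> b) = c \<odot>\<^bsub>A\<^esub> (a \<otimes>\<^bsub>A\<^esub> b)"
    if "c \<in> carrier K" "a \<in> carrier A" "b \<in> carrier A"
    using assoc[OF that(1,3,2)] that by (metis cring.cring_simprules(14) M_cring smult_closed)
  show "(c \<odot>\<^bsub>A\<^esub> \<one>\<^bsub>A\<^esub>) \<otimes>\<^bsub>A\<^esub> a = c \<odot>\<^bsub>A\<^esub> a" if "c \<in> carrier K" "a \<in> carrier A"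
    using assoc[of c "\<one>\<^bsub>A\<^esub>" a] that cring.cring_simprules(6,12)[OF M_cring] by simp
qed

lemma module_restrict_scalars:
  assumes "algebra K A" "module A M"
  shows "module K (restrict_scalars A M)"
proof -
  note A = algebra_D[OF assms(1)]
  interpret KA: module K A by (rule A)
  interpret M: module A M by fact
  have "abelian_group (restrict_scalars A M)"
    by (rule abelian_groupI) (auto simp: M.M.a_ac intro: bexI[of _ "\<ominus>\<^bsub>M\<^esub> _"] M.M.l_neg)
  thus ?thesis
  proof (rule moduleI[OF A(1)])
    fix c c' m assume *: "c \<in> carrier K" "c' \<in> carrier K" "m \<in> carrier (restrict_scalars A M)"
    have "(c \<otimes>\<^bsub>K\<^esub> c') \<odot>\<^bsub>A\<^esub> \<one>\<^bsub>A\<^esub> = (c \<odot>\<^bsub>A\<^esub> \<one>\<^bsub>A\<^esub>) \<otimes>\<^bsub>A\<^esub> (c' \<odot>\<^bsub>A\<^esub> \<one>\<^bsub>A\<^esub>)"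
      using * A(6)[of c "c' \<odot>\<^bsub>A\<^esub> \<one>\<^bsub>A\<^esub>"] by (simp add: KA.smult_assoc1)
    thus "(c \<otimes>\<^bsub>K\<^esub> c') \<odot>\<^bsub>restrict_scalars A M\<^esub> m
       = c \<odot>\<^bsub>restrict_scalars A M\<^esub> (c' \<odot>\<^bsub>restrict_scalars A M\<^esub> m)"
      using * by (simp add: M.smult_assoc1)
  qed (auto simp: KA.smult_l_distr M.smult_l_distr M.smult_r_distr)
qed

lemma module_hom_restrict_scalars:
  assumes "algebra K A" "f \<in> module_hom A M N"
  shows "f \<in> module_hom K (restrict_scalars A M) (restrict_scalars A N)"
proof -
  interpret module K A by (rule algebra_D[OF assms(1)])
  interpret A: cring A by (rule algebra_D[OF assms(1)])
  show ?thesis using module_homD[OF assms(2)] by (intro module_homI) auto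
qed

lemma submodule_restrict_scalars:
  assumes "algebra K A" "module A M" "submodule S A M"
  shows "submodule S K (restrict_scalars A M)"
proof -
  interpret KA: module K A by (rule algebra_D[OF assms(1)])
  interpret A: cring A by (rule algebra_D[OF assms(1)])
  interpret M: module A M by fact
  interpret KM: module K "restrict_scalars A M" by (rule module_restrict_scalars) fact+
  interpret S: submodule S A M by fact
  show ?thesis using S.subset S.one_closed S.m_closed by (intro KM.submoduleI') auto
qed

text \<open>Hom_K(A, M) with A acting on the argument. Membership in \<open>extensional\<close> and
  the restricted operations make functions equal as soon as they agree on the carrier.\<close>

definition coinduced :: "('k, 'x) ring_scheme \<Rightarrow> ('k, 'a, 'z) module_scheme \<Rightarrow> ('a, 'm, 'y) module_scheme \<Rightarrow> ('a,
    'a \<Rightarrow> 'm) module"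
  where "coinduced K A M =
    \<lparr>carrier = {h \<in> module_hom K A (restrict_scalars A M). h \<in> extensional (carrier A)},
     monoid.mult = undefined, one = undefined, ring.zero = (\<lambda>a\<in>carrier A. \<zero>\<^bsub>M\<^esub>),
     add = (\<lambda>h k. \<lambda>a\<in>carrier A. h a \<oplus>\<^bsub>M\<^esub> k a), smult = (\<lambda>r h. \<lambda>a\<in>carrier A. h (r \<otimes>\<^bsub>A\<^esub> a))\<rparr>"

lemma coinduced_simps [simp]:
  "h \<in> carrier (coinduced K A M) \<longleftrightarrow> h \<in> module_hom K A (restrict_scalars A M) \<and> h \<in> extensional (carrier A)"
  "\<zero>\<^bsub>coinduced K A M\<^esub> = (\<lambda>a\<in>carrier A. \<zero>\<^bsub>M\<^esub>)"
  "h \<oplus>\<^bsub>coinduced K A M\<^esub> k = (\<lambda>a\<in>carrier A. h a \<oplus>\<^bsub>M\<^esub> k a)"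
  "r \<odot>\<^bsub>coinduced K A M\<^esub> h = (\<lambda>a\<in>carrier A. h (r \<otimes>\<^bsub>A\<^esub> a))"
  by (simp_all add: coinduced_def)

lemma module_coinduced:
  assumes "algebra K A" "module A M"
  shows "module A (coinduced K A M)"
proof -
  note A = algebra_D[OF assms(1)]
  interpret KA: module K A by (rule A)
  interpret A: cring A by (rule A)
  interpret M: module A M by fact
  interpret KM: module K "restrict_scalars A M" by (rule module_restrict_scalars) fact+
  have hD: "\<And>a. a \<in> carrier A \<Longrightarrow> h a \<in> carrier M"
    "\<And>a b. \<lbrakk>a \<in> carrier A; b \<in> carrier A\<rbrakk> \<Longrightarrow> h (a \<oplus>\<^bsub>A\<^esub> b) = h a \<oplus>\<^bsub>M\<^esub> h b"
    "\<And>c a. \<lbrakk>c \<in> carrier K; a \<in> carrier A\<rbrakk> \<Longrightarrow> h (c \<odot>\<^bsub>A\<^esub> a) = (c \<odot>\<^bsub>A\<^esub> \<one>\<^bsub>A\<^esub>) \<odot>\<^bsub>M\<^esub> h a"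
    if "h \<in> module_hom K A (restrict_scalars A M)" for h
    using module_homD[OF that] by simp_all
  have addc: "(\<lambda>a\<in>carrier A. h a \<oplus>\<^bsub>M\<^esub> k a) \<in> module_hom K A (restrict_scalars A M)"
    if "h \<in> module_hom K A (restrict_scalars A M)" "k \<in> module_hom K A (restrict_scalars A M)" for h k
    using hD[OF that(1)] hD[OF that(2)] by (intro module_homI) (auto simp: M.smult_r_distr M.M.a_ac)
  have smc: "(\<lambda>a\<in>carrier A. h (r \<otimes>\<^bsub>A\<^esub> a)) \<in> module_hom K A (restrict_scalars A M)"
    if "h \<in> module_hom K A (restrict_scalars A M)" "r \<in> carrier A" for h r
    using hD[OF that(1)] that(2) by (intro module_homI) (auto simp: A.r_distr A(5))
  show ?thesis
  proof (rule moduleI[OF A(2)])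
    show "abelian_group (coinduced K A M)"
    proof (rule abelian_groupI)
      show "\<zero>\<^bsub>coinduced K A M\<^esub> \<in> carrier (coinduced K A M)"
        by (auto intro!: module_homI)
      fix h assume h: "h \<in> carrier (coinduced K A M)"
      let ?k = "\<lambda>a\<in>carrier A. \<ominus>\<^bsub>M\<^esub> h a"
      have "?k \<in> module_hom K A (restrict_scalars A M)"
        using hD[of h] h by (intro module_homI) (auto simp: M.smult_r_minus M.M.minus_add)
      thus "\<exists>k\<in>carrier (coinduced K A M). k \<oplus>\<^bsub>coinduced K A M\<^esub> h = \<zero>\<^bsub>coinduced K A M\<^esub>"
        using h hD[of h] by (intro bexI[of _ ?k]) (auto simp: M.M.l_neg)
      show "\<zero>\<^bsub>coinduced K A M\<^esub> \<oplus>\<^bsub>coinduced K A M\<^esub> h = h"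
        using h hD(1)[of h] by (auto intro!: extensionalityI[of _ "carrier A"])
    qed (use hD(1) addc in \<open>auto simp: M.M.a_ac intro!: restrict_ext\<close>)
  qed (use hD(1,2) smc in \<open>auto simp: A.l_distr A.m_assoc A.m_lcomm A.r_distr
         intro!: restrict_ext extensionalityI[of _ "carrier A"]\<close>)
qed

text \<open>\<open>Hom\<^sub>A(b, Hom\<^sub>K(A, M)) = Hom\<^sub>K(b, M)\<close>, and \<open>K\<close>-linear maps extend.\<close>

lemma baer_coinduced:
  assumes "field K" "algebra K A" "module A M"
  shows "baer A (coinduced K A M)"
  unfolding baer_def
proof (intro conjI allI impI)
  note A = algebra_D[OF assms(2)]
  interpret KA: module K A by (rule A)
  interpret A: cring A by (rule A)
  interpret M: module A M by fact
  interpret C: module A "coinduced K A M" by (rule module_coinduced) fact+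
  have KM: "module K (restrict_scalars A M)" by (rule module_restrict_scalars) fact+
  show "module A (coinduced K A M)" by (rule C.module_axioms)
  fix b f assume *: "ideal b A \<and> f \<in> b \<rightarrow> carrier (coinduced K A M) \<and>
       (\<forall>r\<in>b. \<forall>s\<in>b. f (r \<oplus>\<^bsub>A\<^esub> s) = f r \<oplus>\<^bsub>coinduced K A M\<^esub> f s) \<and>
       (\<forall>r\<in>carrier A. \<forall>s\<in>b. f (r \<otimes>\<^bsub>A\<^esub> s) = r \<odot>\<^bsub>coinduced K A M\<^esub> f s)"
  interpret b: ideal b A using * by blast
  have fc: "f r \<in> module_hom K A (restrict_scalars A M)" "f r \<in> extensional (carrier A)" if "r \<in> b" for r
    using * that by auto
  have bK: "c \<odot>\<^bsub>A\<^esub> a \<in> b" if "c \<in> carrier K" "a \<in> b" for c a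
    using b.I_l_closed[OF that(2), of "c \<odot>\<^bsub>A\<^esub> \<one>\<^bsub>A\<^esub>"] A(6)[of c a] that b.Icarr by simp
  have bm: "module K (A\<lparr>carrier := b\<rparr>)"
    by (rule submodule_module[OF KA.submoduleI' A(3)]) (auto simp: b.Icarr bK)
  \<comment> \<open>Linearity of \<open>f\<close> for the action on arguments lets evaluation at 1
    recover all values; this is the adjunction.\<close>
  have f1: "f (a \<otimes>\<^bsub>A\<^esub> r) \<one>\<^bsub>A\<^esub> = f r a" if "a \<in> carrier A" "r \<in> b" for a r
    using * that by simp
  define \<phi> where "\<phi> r = f r \<one>\<^bsub>A\<^esub>" for r
  have "\<phi> \<in> module_hom K (A\<lparr>carrier := b\<rparr>) (restrict_scalars A M)"
  proof (rule module_homI)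
    fix c r assume cr: "c \<in> carrier K" "r \<in> carrier (A\<lparr>carrier := b\<rparr>)"
    have "f (c \<odot>\<^bsub>A\<^esub> r) \<one>\<^bsub>A\<^esub> = f r (c \<odot>\<^bsub>A\<^esub> \<one>\<^bsub>A\<^esub>)"
      using f1[of "c \<odot>\<^bsub>A\<^esub> \<one>\<^bsub>A\<^esub>" r] A(6)[of c r] cr b.Icarr by simp
    thus "\<phi> (c \<odot>\<^bsub>A\<lparr>carrier := b\<rparr>\<^esub> r) = c \<odot>\<^bsub>restrict_scalars A M\<^esub> \<phi> r"
      using module_homD(3)[OF fc(1), of r c "\<one>\<^bsub>A\<^esub>"] cr by (simp add: \<phi>_def)
  qed (use * module_homD(1)[OF fc(1)] in \<open>auto simp: \<phi>_def\<close>)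
  moreover have "(\<lambda>a. a) \<in> module_hom K (A\<lparr>carrier := b\<rparr>) A"
    by (rule module_homI) (auto simp: b.Icarr)
  moreover have "\<phi> \<zero>\<^bsub>A\<^esub> = \<zero>\<^bsub>M\<^esub>"
    using module_hom_zero[OF bm KM calculation(1)] by simp
  ultimately obtain \<psi> where \<psi>: "\<psi> \<in> module_hom K A (restrict_scalars A M)" "\<And>r. r \<in> b \<Longrightarrow> \<psi> r = \<phi> r"
    using baer_factor[OF baer_field[OF assms(1) KM] bm A(3), of "\<lambda>a. a" \<phi>] by auto
  let ?e = "restrict \<psi> (carrier A)"
  have "?e \<in> module_hom K A (restrict_scalars A M)"
    using module_homD[OF \<psi>(1)] by (intro module_homI) auto
  hence "?e \<in> carrier (coinduced K A M)" by simp
  moreover have "f r = r \<odot>\<^bsub>coinduced K A M\<^esub> ?e" if r: "r \<in> b" for r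
  proof (rule extensionalityI)
    show "f r \<in> extensional (carrier A)" by (rule fc(2)[OF r])
    show "r \<odot>\<^bsub>coinduced K A M\<^esub> ?e \<in> extensional (carrier A)" by simp
    fix a assume a: "a \<in> carrier A"
    have "f r a = \<phi> (a \<otimes>\<^bsub>A\<^esub> r)" using f1[OF a r] by (simp add: \<phi>_def)
    also have "\<dots> = \<psi> (a \<otimes>\<^bsub>A\<^esub> r)" using \<psi>(2) b.I_l_closed[OF r a] by simp
    finally show "f r a = (r \<odot>\<^bsub>coinduced K A M\<^esub> ?e) a" using a r b.Icarr A.m_comm by simp
  qed
  ultimately show "\<exists>e\<in>carrier (coinduced K A M). \<forall>r\<in>b. f r = r \<odot>\<^bsub>coinduced K A M\<^esub> e" by blast
qed

text \<open>Evaluation at 1 recovers m. Together with \<open>baer_coinduced\<close> this embeds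
  every module into an injective one.\<close>

lemma coinduced_embedding:
  assumes "algebra K A" "module A M"
  defines "\<eta> \<equiv> \<lambda>m. \<lambda>a\<in>carrier A. a \<odot>\<^bsub>M\<^esub> m"
  shows "\<eta> \<in> module_hom A M (coinduced K A M)" "inj_on \<eta> (carrier M)"
proof -
  note A = algebra_D[OF assms(1)]
  interpret KA: module K A by (rule A)
  interpret A: cring A by (rule A)
  interpret M: module A M by fact
  show "\<eta> \<in> module_hom A M (coinduced K A M)"
  proof (rule module_homI)
    fix m assume m: "m \<in> carrier M"
    have "\<eta> m \<in> module_hom K A (restrict_scalars A M)"
    proof (rule module_homI)
      fix c a assume "c \<in> carrier K" "a \<in> carrier A"
      thus "\<eta> m (c \<odot>\<^bsub>A\<^esub> a) = c \<odot>\<^bsub>restrict_scalars A M\<^esub> \<eta> m a"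
        using m A(6)[of c a] M.smult_assoc1[of "c \<odot>\<^bsub>A\<^esub> \<one>\<^bsub>A\<^esub>" a m] by (simp add: \<eta>_def)
    qed (use m in \<open>auto simp: \<eta>_def M.smult_l_distr\<close>)
    thus "\<eta> m \<in> carrier (coinduced K A M)" by (simp add: \<eta>_def)
  next
    fix r m assume "r \<in> carrier A" "m \<in> carrier M"
    thus "\<eta> (r \<odot>\<^bsub>M\<^esub> m) = r \<odot>\<^bsub>coinduced K A M\<^esub> \<eta> m"
      by (auto simp: \<eta>_def M.smult_assoc1[symmetric] A.m_comm intro!: restrict_ext)
  qed (auto simp: \<eta>_def M.smult_r_distr intro!: restrict_ext)
  show "inj_on \<eta> (carrier M)"
  proof (rule inj_onI)
    fix x y assume *: "x \<in> carrier M" "y \<in> carrier M" "\<eta> x = \<eta> y"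
    hence "\<eta> x \<one>\<^bsub>A\<^esub> = \<eta> y \<one>\<^bsub>A\<^esub>" by simp
    thus "x = y" using * by (simp add: \<eta>_def)
  qed
qed

subsection \<open>Existence of injective resolutions\<close>

text \<open>A quotient is carried by a set of representatives, so it lives in the same type.\<close>

lemma quotient_exists:
  fixes M :: "('a, 'm) module"
  assumes "module R M" "submodule S R M"
  shows "\<exists>(Q :: ('a, 'm) module) q. module R Q \<and> q \<in> module_hom R M Q \<and>
    (\<forall>x\<in>carrier M. q x = \<zero>\<^bsub>Q\<^esub> \<longleftrightarrow> x \<in> S)"
proof -
  interpret M: module R M by fact
  interpret S: submodule S R M by fact
  have S0: "\<zero>\<^bsub>M\<^esub> \<in> S" using S.one_closed by simp
  have Sa: "s \<oplus>\<^bsub>M\<^esub> t \<in> S" if "s \<in> S" "t \<in> S" for s t using S.m_closed that by simp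
  have Sn: "\<ominus>\<^bsub>M\<^esub> s \<in> S" if "s \<in> S" for s using M.submoduleE(3)[OF assms(2) that] .
  \<comment> \<open>A chosen representative of the coset of x. By \<open>eq\<close> it depends on
    the coset only, since the predicate under the choice does.\<close>
  define q where "q x = (SOME y. y \<in> carrier M \<and> x \<ominus>\<^bsub>M\<^esub> y \<in> S)" for x
  have q: "q x \<in> carrier M" "x \<ominus>\<^bsub>M\<^esub> q x \<in> S" if "x \<in> carrier M" for x
  proof -
    have "x \<in> carrier M \<and> x \<ominus>\<^bsub>M\<^esub> x \<in> S" using that S0 by (simp add: a_minus_def M.M.r_neg)
    hence "q x \<in> carrier M \<and> x \<ominus>\<^bsub>M\<^esub> q x \<in> S" unfolding q_def by (rule someI)
    thus "q x \<in> carrier M" "x \<ominus>\<^bsub>M\<^esub> q x \<in> S" by auto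
  qed
  have sym: "y \<ominus>\<^bsub>M\<^esub> x \<in> S" if "x \<ominus>\<^bsub>M\<^esub> y \<in> S" "x \<in> carrier M" "y \<in> carrier M" for x y
    using Sn[OF that(1)] that(2,3) by (simp add: a_minus_def M.M.minus_add M.M.a_comm)
  have trans: "x \<ominus>\<^bsub>M\<^esub> z \<in> S" if "x \<ominus>\<^bsub>M\<^esub> y \<in> S" "y \<ominus>\<^bsub>M\<^esub> z \<in> S" "x \<in> carrier M" "y \<in> carrier M" "z \<in> carrier M" for x y z
    using Sa[OF that(1,2)] that(3-5) by (simp add: a_minus_def M.M.a_assoc M.M.r_neg1)
  have eq: "q x = q y \<longleftrightarrow> x \<ominus>\<^bsub>M\<^esub> y \<in> S" if "x \<in> carrier M" "y \<in> carrier M" for x y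
  proof
    assume e: "q x = q y"
    have "q x \<ominus>\<^bsub>M\<^esub> y \<in> S" unfolding e by (rule sym) (use q that in auto)
    thus "x \<ominus>\<^bsub>M\<^esub> y \<in> S" using trans[OF q(2)[OF that(1)]] that q by blast
  next
    assume "x \<ominus>\<^bsub>M\<^esub> y \<in> S"
    hence "z \<in> carrier M \<and> x \<ominus>\<^bsub>M\<^esub> z \<in> S \<longleftrightarrow> z \<in> carrier M \<and> y \<ominus>\<^bsub>M\<^esub> z \<in> S" for z
      using trans sym that by blast
    thus "q x = q y" by (simp add: q_def)
  qed
  have qq: "q (q x) = q x" if "x \<in> carrier M" for x using eq[of x "q x"] q[OF that] that by simp
  let ?Q = "\<lparr>carrier = q ` carrier M, monoid.mult = undefined, one = undefined, ring.zero = q \<zero>\<^bsub>M\<^esub>,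
     add = (\<lambda>x y. q (x \<oplus>\<^bsub>M\<^esub> y)), smult = (\<lambda>r x. q (r \<odot>\<^bsub>M\<^esub> x))\<rparr>"
  have qa: "q (q x \<oplus>\<^bsub>M\<^esub> q y) = q (x \<oplus>\<^bsub>M\<^esub> y)" if "x \<in> carrier M" "y \<in> carrier M" for x y
  proof -
    have "(x \<oplus>\<^bsub>M\<^esub> y) \<ominus>\<^bsub>M\<^esub> (q x \<oplus>\<^bsub>M\<^esub> q y) \<in> S"
      using that q[OF that(1)] q[OF that(2)] Sa by (simp add: M.M.add_diff_add)
    thus ?thesis using eq that q by (metis M.M.a_closed)
  qed
  have qs: "q (r \<odot>\<^bsub>M\<^esub> q x) = q (r \<odot>\<^bsub>M\<^esub> x)" if "r \<in> carrier R" "x \<in> carrier M" for r x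
  proof -
    have "r \<odot>\<^bsub>M\<^esub> (x \<ominus>\<^bsub>M\<^esub> q x) \<in> S" using q[OF that(2)] that(1) by simp
    hence "(r \<odot>\<^bsub>M\<^esub> x) \<ominus>\<^bsub>M\<^esub> (r \<odot>\<^bsub>M\<^esub> q x) \<in> S"
      using that q[OF that(2)] by (simp add: a_minus_def M.smult_r_distr M.smult_r_minus)
    thus ?thesis using eq that q by (metis M.smult_closed)
  qed
  have qa1: "q (q x \<oplus>\<^bsub>M\<^esub> y) = q (x \<oplus>\<^bsub>M\<^esub> y)" "q (y \<oplus>\<^bsub>M\<^esub> q x) = q (y \<oplus>\<^bsub>M\<^esub> x)" if "x \<in> carrier M" "y \<in> carrier M" for x y
    using qa[of "q x" y] qa[of x y] qa[of y "q x"] qa[of y x] qq q that by simp_all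
  have "module R ?Q"
  proof (rule moduleI)
    show "abelian_group ?Q"
    proof (rule abelian_groupI)
      fix u assume "u \<in> carrier ?Q"
      then obtain m where "m \<in> carrier M" "u = q m" by auto
      thus "\<exists>v\<in>carrier ?Q. v \<oplus>\<^bsub>?Q\<^esub> u = \<zero>\<^bsub>?Q\<^esub>"
        by (intro bexI[of _ "q (\<ominus>\<^bsub>M\<^esub> m)"]) (auto simp: qa M.M.l_neg)
    next
      show "\<And>u v w. \<lbrakk>u \<in> carrier ?Q; v \<in> carrier ?Q; w \<in> carrier ?Q\<rbrakk> \<Longrightarrow>
          u \<oplus>\<^bsub>?Q\<^esub> v \<oplus>\<^bsub>?Q\<^esub> w = u \<oplus>\<^bsub>?Q\<^esub> (v \<oplus>\<^bsub>?Q\<^esub> w)"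
        by (auto simp: qa qa1 qq M.M.a_assoc q)
    qed (auto simp: qa qa1 qq M.M.a_comm q)
  next
    fix a b u assume ab: "a \<in> carrier R" "b \<in> carrier R" and "u \<in> carrier ?Q"
    then obtain m where m: "m \<in> carrier M" "u = q m" by auto
    have "q ((a \<oplus>\<^bsub>R\<^esub> b) \<odot>\<^bsub>M\<^esub> q m) = q ((a \<oplus>\<^bsub>R\<^esub> b) \<odot>\<^bsub>M\<^esub> m)" using ab m by (intro qs) auto
    also have "\<dots> = q (q (a \<odot>\<^bsub>M\<^esub> q m) \<oplus>\<^bsub>M\<^esub> q (b \<odot>\<^bsub>M\<^esub> q m))"
      using ab m by (simp add: qs qa M.smult_l_distr)
    finally show "(a \<oplus>\<^bsub>R\<^esub> b) \<odot>\<^bsub>?Q\<^esub> u = a \<odot>\<^bsub>?Q\<^esub> u \<oplus>\<^bsub>?Q\<^esub> b \<odot>\<^bsub>?Q\<^esub> u" using m by simp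
    have "q ((a \<otimes>\<^bsub>R\<^esub> b) \<odot>\<^bsub>M\<^esub> q m) = q ((a \<otimes>\<^bsub>R\<^esub> b) \<odot>\<^bsub>M\<^esub> m)" using ab m by (intro qs) auto
    also have "\<dots> = q (a \<odot>\<^bsub>M\<^esub> q (b \<odot>\<^bsub>M\<^esub> q m))"
      using ab m by (simp add: qs M.smult_assoc1)
    finally show "(a \<otimes>\<^bsub>R\<^esub> b) \<odot>\<^bsub>?Q\<^esub> u = a \<odot>\<^bsub>?Q\<^esub> (b \<odot>\<^bsub>?Q\<^esub> u)" using m by simp
  qed (auto simp: qa qa1 qs qq q M.R.is_cring M.smult_r_distr)
  moreover have "q \<in> module_hom R M ?Q" by (rule module_homI) (auto simp: qa qs)
  moreover have "q x = \<zero>\<^bsub>?Q\<^esub> \<longleftrightarrow> x \<in> S" if "x \<in> carrier M" for x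
    using eq[of x "\<zero>\<^bsub>M\<^esub>"] that M.diff_zero_right by simp
  ultimately show ?thesis by blast
qed

text \<open>The coinduced module consists of functions; \<open>c\<close> encodes them in the target
  type.\<close>

lemma baer_embedding:
  fixes M :: "('a, 'm) module" and c :: "('a \<Rightarrow> 'm) \<Rightarrow> 'u"
  assumes "field K" "algebra K A" "module A M" "inj c"
  shows "\<exists>(E :: ('a, 'u) module) e. baer A E \<and> e \<in> module_hom A M E \<and> inj_on e (carrier M)"
proof -
  let ?\<eta> = "\<lambda>m. \<lambda>a\<in>carrier A. a \<odot>\<^bsub>M\<^esub> m"
  have ic: "inj_on c Y" for Y using assms(4) by (rule inj_on_subset) simp
  note emb = coinduced_embedding[OF assms(2,3)]
  have "baer A (copy_module c (coinduced K A M))"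
    by (rule baer_copy[OF baer_coinduced ic]) fact+
  moreover have "(\<lambda>m. c (?\<eta> m)) \<in> module_hom A M (copy_module c (coinduced K A M))"
    by (rule module_hom_comp[OF emb(1) copy_module_hom[OF ic]])
  moreover have "inj_on (\<lambda>m. c (?\<eta> m)) (carrier M)"
    using emb(2) assms(4) by (auto simp: inj_on_def)
  ultimately show ?thesis by blast
qed

lemma submodule_image:
  assumes "module A N" "module A N'" "f \<in> module_hom A N N'"
  shows "submodule (f ` carrier N) A N'"
proof -
  interpret N: module A N by fact
  interpret N': module A N' by fact
  note fD = module_homD[OF assms(3)]
  show ?thesis
  proof (rule N'.submoduleI')
    show "f ` carrier N \<subseteq> carrier N'" using fD(1) by blast
    show "\<zero>\<^bsub>N'\<^esub> \<in> f ` carrier N" using module_hom_zero[OF assms] N.M.zero_closed by (metis imageI)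
    show "\<And>a b. \<lbrakk>a \<in> f ` carrier N; b \<in> f ` carrier N\<rbrakk> \<Longrightarrow> a \<oplus>\<^bsub>N'\<^esub> b \<in> f ` carrier N"
      using fD(2)[symmetric] by auto
    show "\<And>r a. \<lbrakk>r \<in> carrier A; a \<in> f ` carrier N\<rbrakk> \<Longrightarrow> r \<odot>\<^bsub>N'\<^esub> a \<in> f ` carrier N"
      using fD(3)[symmetric] by auto
  qed
qed

text \<open>The encoding \<open>c\<close> returns a module of functions into \<open>'u\<close> to
  the type \<open>'u\<close> itself, so the embedding can be iterated; \<open>c'\<close> serves to
  bring \<open>M\<close> into that type at the start.\<close>

lemma baer_resolution_exists:
  fixes A :: "('k, 'a) module" and M :: "('a, 'm) module" and c :: "('a \<Rightarrow> 'u) \<Rightarrow> 'u" and c' :: "'m \<Rightarrow> 'u"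
  assumes "field K" "algebra K A" "module A M" "inj c" "inj c'"
  shows "\<exists>(E :: nat \<Rightarrow> ('a, 'u) module) e d. (\<forall>n. baer A (E n)) \<and> resolution A M E e d"
proof -
  have step: "\<exists>(E' :: ('a, 'u) module) d. baer A E' \<and> d \<in> module_hom A E E' \<and>
      (\<forall>x\<in>carrier E. d x = \<zero>\<^bsub>E'\<^esub> \<longleftrightarrow> x \<in> S)"
    if E: "module A E" "submodule S A E" for E :: "('a, 'u) module" and S
  proof -
    obtain Q :: "('a, 'u) module" and q where q: "module A Q" "q \<in> module_hom A E Q"
      "\<And>x. x \<in> carrier E \<Longrightarrow> q x = \<zero>\<^bsub>Q\<^esub> \<longleftrightarrow> x \<in> S" using quotient_exists[OF E] by blast
    obtain E' :: "('a, 'u) module" and e where e: "baer A E'" "e \<in> module_hom A Q E'" "inj_on e (carrier Q)"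
      using baer_embedding[OF assms(1,2) q(1) assms(4)] by blast
    have E': "module A E'" using e(1) by (simp add: baer_def)
    interpret Q: module A Q by fact
    have "e (q x) = \<zero>\<^bsub>E'\<^esub> \<longleftrightarrow> q x = \<zero>\<^bsub>Q\<^esub>" if "x \<in> carrier E" for x
      using module_hom_zero[OF q(1) E' e(2)] inj_onD[OF e(3), of "q x" "\<zero>\<^bsub>Q\<^esub>"] module_homD(1)[OF q(2) that]
      by auto
    thus ?thesis using e(1) module_hom_comp[OF q(2) e(2)] q(3) by blast
  qed
  interpret M: module A M by fact
  have ic: "inj_on c' Y" for Y using assms(5) by (rule inj_on_subset) simp
  \<comment> \<open>A triple consists of an injective module, the submodule to be divided out next,
    and the map entering the module. At 0 the submodule is the image of \<open>M\<close>, later it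
    is the image of the entering map.\<close>
  define P where "P n T \<longleftrightarrow> (case T of (E, S, d) \<Rightarrow> baer A E \<and> submodule S A E \<and>
      (n = 0 \<longrightarrow> (\<exists>e. e \<in> module_hom A M E \<and> inj_on e (carrier M) \<and> S = e ` carrier M)))"
    for n :: nat and T :: "('a, 'u) module \<times> 'u set \<times> ('u \<Rightarrow> 'u)"
  define Q where "Q n T T' \<longleftrightarrow> (case (T, T') of ((E, S, d), (E', S', d')) \<Rightarrow>
      d' \<in> module_hom A E E' \<and> (\<forall>x\<in>carrier E. d' x = \<zero>\<^bsub>E'\<^esub> \<longleftrightarrow> x \<in> S) \<and> S' = d' ` carrier E)"
    for n :: nat and T T' :: "('a, 'u) module \<times> 'u set \<times> ('u \<Rightarrow> 'u)"
  have "\<exists>T. \<forall>n. P n (T n) \<and> Q n (T n) (T (Suc n))"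
  proof (rule dependent_nat_choice)
    let ?M = "copy_module c' M"
    obtain E :: "('a, 'u) module" and e where e: "baer A E" "e \<in> module_hom A ?M E" "inj_on e (carrier ?M)"
      using baer_embedding[OF assms(1,2) module_copy[OF assms(3) ic] assms(4)] by blast
    have hom: "(\<lambda>m. e (c' m)) \<in> module_hom A M E" by (rule module_hom_comp[OF copy_module_hom[OF ic] e(2)])
    moreover have "inj_on (\<lambda>m. e (c' m)) (carrier M)" using e(3) assms(5) by (auto simp: inj_on_def)
    moreover have "submodule ((\<lambda>m. e (c' m)) ` carrier M) A E"
      by (rule submodule_image[OF assms(3) _ hom]) (use e in \<open>simp add: baer_def\<close>)
    ultimately have "P 0 (E, (\<lambda>m. e (c' m)) ` carrier M, id)" using e(1) by (auto simp: P_def)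
    thus "\<exists>T. P 0 T" by blast
  next
    fix T n assume "P n T"
    then obtain E S d where T: "T = (E, S, d)" "baer A E" "submodule S A E" by (auto simp: P_def)
    have E: "module A E" using T(2) by (simp add: baer_def)
    obtain E' :: "('a, 'u) module" and d' where d': "baer A E'" "d' \<in> module_hom A E E'"
      "\<forall>x\<in>carrier E. d' x = \<zero>\<^bsub>E'\<^esub> \<longleftrightarrow> x \<in> S" using step[OF E T(3)] by blast
    have "submodule (d' ` carrier E) A E'" by (rule submodule_image[OF E _ d'(2)]) (use d' in \<open>simp add: baer_def\<close>)
    hence "P (Suc n) (E', d' ` carrier E, d') \<and> Q n T (E', d' ` carrier E, d')"
      using d' T by (simp add: P_def Q_def)
    thus "\<exists>T'. P (Suc n) T' \<and> Q n T T'" by blast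
  qed
  then obtain T where T: "\<And>n. P n (T n)" "\<And>n. Q n (T n) (T (Suc n))" by blast
  define E where "E n = fst (T n)" for n
  define S where "S n = fst (snd (T n))" for n
  \<comment> \<open>The map leaving \<open>E n\<close> is stored in the next triple, as the map
    entering \<open>E (Suc n)\<close>.\<close>
  define d where "d n = snd (snd (T (Suc n)))" for n
  have baer: "baer A (E n)" for n using T(1)[of n] by (auto simp: P_def E_def split: prod.splits)
  obtain e where e: "e \<in> module_hom A M (E 0)" "inj_on e (carrier M)" "S 0 = e ` carrier M"
    using T(1)[of 0] by (auto simp: P_def E_def S_def split: prod.splits)
  have d: "d n \<in> module_hom A (E n) (E (Suc n))" "\<forall>x\<in>carrier (E n). d n x = \<zero>\<^bsub>E (Suc n)\<^esub> \<longleftrightarrow> x \<in> S n"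
    "S (Suc n) = d n ` carrier (E n)" for n
    using T(2)[of n] by (auto simp: Q_def E_def S_def d_def split: prod.splits)
  have "resolution A M E e d"
    unfolding resolution_def using e d baer assms(3) by (auto simp: baer_def)
  thus ?thesis using baer by blast
qed

lemma injective_resolution_iff:
  assumes "module R M"
  shows "injective_resolution R M E e d \<longleftrightarrow> resolution R M E e d \<and> (\<forall>n. injective_module R (E n))"
proof (cases "\<forall>n. injective_module R (E n) \<and> d n \<in> module_hom R (E n) (E (Suc n))")
  case True
  hence E: "module R (E n)" and d: "d n \<in> module_hom R (E n) (E (Suc n))" for n
    by (auto simp: injective_module_def)
  have ker: "a_kernel (E n) (E (Suc n)) (d n) = {x \<in> carrier (E n). d n x = \<zero>\<^bsub>E (Suc n)\<^esub>}" for n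
    by (simp add: a_kernel_def kernel_def)
  have eq0: "e ` carrier M = {x \<in> carrier (E 0). d 0 x = \<zero>\<^bsub>E (Suc 0)\<^esub>} \<longleftrightarrow>
     (\<forall>x\<in>carrier (E 0). d 0 x = \<zero>\<^bsub>E (Suc 0)\<^esub> \<longleftrightarrow> x \<in> e ` carrier M)" if "e \<in> module_hom R M (E 0)"
    using module_homD(1)[OF that] by blast
  have eqS: "d n ` carrier (E n) = {x \<in> carrier (E (Suc n)). d (Suc n) x = \<zero>\<^bsub>E (Suc (Suc n))\<^esub>} \<longleftrightarrow>
     (\<forall>x\<in>carrier (E (Suc n)). d (Suc n) x = \<zero>\<^bsub>E (Suc (Suc n))\<^esub> \<longleftrightarrow> x \<in> d n ` carrier (E n))" for n
    using module_homD(1)[OF d] by blast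
  show ?thesis
  proof (cases "e \<in> module_hom R M (E 0)")
    case e: True
    show ?thesis
      unfolding injective_resolution_def resolution_def One_nat_def ker eqS eq0[OF e]
      using True E d assms e by (simp only: simp_thms)
  qed (simp add: injective_resolution_def resolution_def)
qed (auto simp: injective_resolution_def resolution_def)

text \<open>The type of the injective resolution has to contain a copy of the module coinduced from it.\<close>

lemma inj_encode_function:
  "inj (\<lambda>h :: 'a \<Rightarrow> ('a \<times> 'm) list set. {(a, undefined) # l | a l. l \<in> h a})"
proof (rule injI)
  fix h k :: "'a \<Rightarrow> ('a \<times> 'm) list set"
  assume eq: "{(a, undefined) # l | a l. l \<in> h a} = {(a, undefined) # l | a l. l \<in> k a}"
  \<comment> \<open>The head of a list records the argument, so each value of h can be read off from
    the code.\<close>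
  have "l \<in> h a \<longleftrightarrow> l \<in> k a" for a l
  proof -
    have "l \<in> h a \<longleftrightarrow> (a, undefined) # l \<in> {(a, undefined) # l | a l. l \<in> h a}" by simp
    also have "\<dots> \<longleftrightarrow> l \<in> k a" unfolding eq by simp
    finally show ?thesis .
  qed
  thus "h = k" by blast
qed

text \<open>Ensures that the choice in \<open>local_cohomology\<close> selects an actual injective
  resolution.\<close>

theorem injective_resolution_exists:
  fixes A :: "('k, 'a) module" and M :: "('a, 'm) module"
  assumes "field K" "algebra K A" "module A M"
  shows "\<exists>(E :: nat \<Rightarrow> ('a, ('a \<times> 'm) list set) module) e d. injective_resolution A M E e d"
proof -
  have "inj (\<lambda>m :: 'm. {[(undefined :: 'a, m)]})" by (auto intro: injI)
  from baer_resolution_exists[OF assms inj_encode_function this] show ?thesis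
    using injective_resolution_iff[OF assms(3)] baer_imp_injective_module by blast
qed

subsection \<open>The degrees of nonvanishing local cohomology\<close>

lemma ideals_set_pow:
  "\<aa> [^]\<^bsub>ideals_set R\<^esub> (0::nat) = carrier R"
  "\<aa> [^]\<^bsub>ideals_set R\<^esub> Suc n = ideal_prod R (\<aa> [^]\<^bsub>ideals_set R\<^esub> n) \<aa>"
  by (simp_all add: nat_pow_def ideals_set_def)

lemma ideals_set_simps:
  "\<one>\<^bsub>ideals_set R\<^esub> = carrier R" "monoid.mult (ideals_set R) = ideal_prod R"
  by (simp_all add: ideals_set_def)

lemma ideal_pow:
  assumes "cring R" "ideal \<aa> R"
  shows "ideal (\<aa> [^]\<^bsub>ideals_set R\<^esub> (n::nat)) R"
proof -
  interpret cring R by fact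
  show ?thesis using oneideal assms(2) by (induct n) (auto simp: ideals_set_simps ideal_prod_is_ideal)
qed

text \<open>If \<open>x\<^sup>\<nu>\<^sup>(\<^sup>x\<^sup>) m = 0\<close> for the generators \<open>x\<close>, then \<open>x m\<close> satisfies the same condition with \<open>\<nu> x\<close>
  lowered by one; this gives an induction on \<open>\<Sum>\<nu>\<close>.\<close>

lemma ideal_pow_kills:
  assumes M: "module R M" and S: "finite S" "S \<subseteq> carrier R" and m: "m \<in> carrier M"
    and \<nu>: "\<And>x. x \<in> S \<Longrightarrow> (x [^]\<^bsub>R\<^esub> (\<nu> x :: nat)) \<odot>\<^bsub>M\<^esub> m = \<zero>\<^bsub>M\<^esub>" and N: "(\<Sum>x\<in>S. \<nu> x) \<le> N"
    and r: "r \<in> (Idl\<^bsub>R\<^esub> S) [^]\<^bsub>ideals_set R\<^esub> Suc N"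
  shows "r \<odot>\<^bsub>M\<^esub> m = \<zero>\<^bsub>M\<^esub>"
  using m \<nu> N r
proof (induct N arbitrary: m \<nu> r)
  interpret module R M by fact
  let ?I = "Idl\<^bsub>R\<^esub> S"
  have I: "ideal ?I R" by (rule R.genideal_ideal[OF S(2)])
  have key: "r \<odot>\<^bsub>M\<^esub> m = \<zero>\<^bsub>M\<^esub>" if m: "m \<in> carrier M"
    and k: "\<And>x s. \<lbrakk>x \<in> S; s \<in> ?I [^]\<^bsub>ideals_set R\<^esub> N\<rbrakk> \<Longrightarrow> s \<odot>\<^bsub>M\<^esub> (x \<odot>\<^bsub>M\<^esub> m) = \<zero>\<^bsub>M\<^esub>"
    and r: "r \<in> ?I [^]\<^bsub>ideals_set R\<^esub> Suc N" for m r and N :: nat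
  proof -
    interpret IN: ideal "?I [^]\<^bsub>ideals_set R\<^esub> N" R by (rule ideal_pow[OF R.is_cring I])
    interpret I: ideal ?I R by (rule I)
    \<comment> \<open>The t with I^N t m = 0 form an ideal that contains the generators, hence all
      of I; products of elements of I^N and I then kill m.\<close>
    let ?T = "{t \<in> carrier R. \<forall>s\<in>?I [^]\<^bsub>ideals_set R\<^esub> N. s \<odot>\<^bsub>M\<^esub> (t \<odot>\<^bsub>M\<^esub> m) = \<zero>\<^bsub>M\<^esub>}"
    have mult: "a \<otimes>\<^bsub>R\<^esub> t \<in> ?T" if "t \<in> ?T" "a \<in> carrier R" for a t
    proof -
      have "s \<odot>\<^bsub>M\<^esub> ((a \<otimes>\<^bsub>R\<^esub> t) \<odot>\<^bsub>M\<^esub> m) = a \<odot>\<^bsub>M\<^esub> (s \<odot>\<^bsub>M\<^esub> (t \<odot>\<^bsub>M\<^esub> m))" if "s \<in> ?I [^]\<^bsub>ideals_set R\<^esub> N" for s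
        using that \<open>t \<in> ?T\<close> \<open>a \<in> carrier R\<close> m IN.Icarr[OF that]
        by (simp add: smult_assoc1[symmetric] R.m_ac del: IN.I_l_closed)
      thus ?thesis using that by simp
    qed
    have "ideal ?T R"
    proof (rule idealI)
      show "ring R" by (rule R.ring_axioms)
      show "subgroup ?T (add_monoid R)"
      proof
        show "\<And>a b. \<lbrakk>a \<in> ?T; b \<in> ?T\<rbrakk> \<Longrightarrow> a \<otimes>\<^bsub>add_monoid R\<^esub> b \<in> ?T"
          using m IN.Icarr by (auto simp: smult_l_distr smult_r_distr)
        show "\<one>\<^bsub>add_monoid R\<^esub> \<in> ?T" using m IN.Icarr by auto
        fix t assume t: "t \<in> ?T"
        have "(\<ominus>\<^bsub>R\<^esub> \<one>\<^bsub>R\<^esub>) \<otimes>\<^bsub>R\<^esub> t \<in> ?T" by (rule mult[OF t]) simp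
        thus "inv\<^bsub>add_monoid R\<^esub> t \<in> ?T" using t by (simp add: R.l_minus a_inv_def[symmetric])
      qed auto
      show "\<And>a t. \<lbrakk>t \<in> ?T; a \<in> carrier R\<rbrakk> \<Longrightarrow> a \<otimes>\<^bsub>R\<^esub> t \<in> ?T" by (rule mult)
      show "\<And>a t. \<lbrakk>t \<in> ?T; a \<in> carrier R\<rbrakk> \<Longrightarrow> t \<otimes>\<^bsub>R\<^esub> a \<in> ?T"
        using mult by (metis (no_types, lifting) R.m_comm mem_Collect_eq)
    qed
    moreover have "S \<subseteq> ?T" using k S(2) by blast
    ultimately have IT: "?I \<subseteq> ?T" by (rule R.genideal_minimal)
    have "r \<in> ideal_prod R (?I [^]\<^bsub>ideals_set R\<^esub> N) ?I" using r by (simp only: ideals_set_pow)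
    hence "r \<in> carrier R \<and> r \<odot>\<^bsub>M\<^esub> m = \<zero>\<^bsub>M\<^esub>"
    proof (induct rule: ideal_prod.induct)
      case (prod i j)
      thus ?case using IT IN.Icarr m by (auto simp: smult_assoc1)
    qed (use m in \<open>auto simp: smult_l_distr\<close>)
    thus ?thesis by simp
  qed
  {
    case 0
    show ?case
    \<comment> \<open>With all exponents 0 either there is no generator or m = 0. The exponent
      \<open>Suc N\<close> covers the empty set as well: there I^0 is still the whole ring, while
      I^1 is zero.\<close>
    proof (rule key[OF 0(1) _ 0(4)])
      fix x s assume x: "x \<in> S"
      hence "\<nu> x = 0" using 0(3) S(1) by simp
      hence "m = \<zero>\<^bsub>M\<^esub>" using 0(2)[OF x] 0(1) by simp
      moreover assume "s \<in> ?I [^]\<^bsub>ideals_set R\<^esub> (0::nat)"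
      ultimately show "s \<odot>\<^bsub>M\<^esub> (x \<odot>\<^bsub>M\<^esub> m) = \<zero>\<^bsub>M\<^esub>" using x S(2) by (auto simp: ideals_set_simps)
    qed
  next
    case (Suc N)
    show ?case
    proof (rule key[OF Suc(2) _ Suc(5)])
      fix x s assume x: "x \<in> S" and s: "s \<in> ?I [^]\<^bsub>ideals_set R\<^esub> Suc N"
      have xR: "x \<in> carrier R" using x S(2) by auto
      have sR: "s \<in> carrier R" using ideal.Icarr[OF ideal_pow[OF R.is_cring I] s] .
      show "s \<odot>\<^bsub>M\<^esub> (x \<odot>\<^bsub>M\<^esub> m) = \<zero>\<^bsub>M\<^esub>"
      proof (cases "\<nu> x")
        case 0
        hence "m = \<zero>\<^bsub>M\<^esub>" using Suc(3)[OF x] Suc(2) by simp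
        thus ?thesis using xR sR by simp
      next
        case (Suc k)
        let ?\<nu> = "\<nu>(x := k)"
        show ?thesis
        proof (rule Suc.hyps[of "x \<odot>\<^bsub>M\<^esub> m" ?\<nu>])
          show "x \<odot>\<^bsub>M\<^esub> m \<in> carrier M" using xR Suc.prems by simp
          show "s \<in> ?I [^]\<^bsub>ideals_set R\<^esub> Suc N" by (rule s)
          have "(\<Sum>x\<in>S. ?\<nu> x) < (\<Sum>x\<in>S. \<nu> x)"
            by (rule sum_strict_mono_ex1) (use S(1) x Suc in auto)
          thus "(\<Sum>x\<in>S. ?\<nu> x) \<le> N" using Suc.prems(3) by simp
          fix y assume y: "y \<in> S"
          have yR: "y \<in> carrier R" using y S(2) by auto
          show "(y [^]\<^bsub>R\<^esub> ?\<nu> y) \<odot>\<^bsub>M\<^esub> (x \<odot>\<^bsub>M\<^esub> m) = \<zero>\<^bsub>M\<^esub>"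
          proof (cases "y = x")
            case True
            thus ?thesis using Suc.prems(2)[OF x] Suc pow_smult_Suc[OF xR Suc.prems(1), of k] by simp
          next
            case False
            have "(y [^]\<^bsub>R\<^esub> \<nu> y) \<odot>\<^bsub>M\<^esub> (x \<odot>\<^bsub>M\<^esub> m) = x \<odot>\<^bsub>M\<^esub> ((y [^]\<^bsub>R\<^esub> \<nu> y) \<odot>\<^bsub>M\<^esub> m)"
              using xR yR Suc.prems(1) R.m_comm[of x "y [^]\<^bsub>R\<^esub> \<nu> y"] by (simp add: smult_assoc1[symmetric])
            thus ?thesis using False Suc.prems(2)[OF y] xR by simp
          qed
        qed
      qed
    qed
  }
qed

text \<open>Local cohomology is defined by powers of the ideal, acyclicity by single generators. One
  direction uses that x^n is in I^n; the other takes an exponent for each generator and applies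
  \<open>ideal_pow_kills\<close> with their sum.\<close>

lemma torsion_part_eq:
  assumes "module R M" "set xs \<subseteq> carrier R"
  shows "torsion_part R (Idl\<^bsub>R\<^esub> (set xs)) M = carrier (tors R xs M)"
proof -
  interpret module R M by fact
  let ?I = "Idl\<^bsub>R\<^esub> (set xs)"
  have pow: "x [^]\<^bsub>R\<^esub> n \<in> ?I [^]\<^bsub>ideals_set R\<^esub> n" if "x \<in> set xs" for x and n :: nat
  proof (induct n)
    case 0
    show ?case by (simp add: ideals_set_simps)
  next
    case (Suc n)
    have "x \<in> ?I" using R.genideal_self[OF assms(2)] that by auto
    thus ?case using Suc by (simp add: ideals_set_simps ideal_prod.prod)
  qed
  show ?thesis
  proof (intro Set.set_eqI iffI)
    fix m assume "m \<in> torsion_part R ?I M"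
    thus "m \<in> carrier (tors R xs M)" using pow by (auto simp: torsion_part_def carrier_tors)
  next
    fix m assume m: "m \<in> carrier (tors R xs M)"
    hence mM: "m \<in> carrier M" and "\<forall>x\<in>set xs. \<exists>n::nat. (x [^]\<^bsub>R\<^esub> n) \<odot>\<^bsub>M\<^esub> m = \<zero>\<^bsub>M\<^esub>"
      by (simp_all add: carrier_tors)
    then obtain \<nu> where \<nu>: "\<And>x. x \<in> set xs \<Longrightarrow> (x [^]\<^bsub>R\<^esub> (\<nu> x :: nat)) \<odot>\<^bsub>M\<^esub> m = \<zero>\<^bsub>M\<^esub>" by metis
    have "r \<odot>\<^bsub>M\<^esub> m = \<zero>\<^bsub>M\<^esub>" if "r \<in> ?I [^]\<^bsub>ideals_set R\<^esub> Suc (\<Sum>x\<in>set xs. \<nu> x)" for r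
      by (rule ideal_pow_kills[OF assms(1) finite_set assms(2) mM \<nu> order_refl that])
    thus "m \<in> torsion_part R ?I M" using mM unfolding torsion_part_def by blast
  qed
qed

text \<open>The resolution is handed out by \<open>obtains\<close> because it is the one picked by
  the choice operator, of which nothing is known except that it is an injective resolution.\<close>

lemma nonvanishing_degrees_eq:
  fixes A :: "('k, 'a) module" and M :: "('a, 'm) module"
  assumes "field K" "algebra K A" "module A M" "set xs \<subseteq> carrier A"
  obtains E :: "nat \<Rightarrow> ('a, ('a \<times> 'm) list set) module" and e d where
    "resolution A M E e d" "\<And>n. baer A (E n)"
    "nonvanishing_degrees A (Idl\<^bsub>A\<^esub> (set xs)) M = {n. \<not> tors_exact_at A xs E d n}"
proof -
  \<comment> \<open>Repeats the choice in \<open>local_cohomology\<close> literally, so that it can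
    be folded there.\<close>
  define T :: "(nat \<Rightarrow> ('a, ('a \<times> 'm) list set) module) \<times> ('m \<Rightarrow> ('a \<times> 'm) list set) \<times>
      (nat \<Rightarrow> ('a \<times> 'm) list set \<Rightarrow> ('a \<times> 'm) list set)"
    where "T = (SOME (E, e, d). injective_resolution A M E e d)"
  obtain E e d where T: "T = (E, e, d)" by (cases T) auto
  have "case T of (E, e, d) \<Rightarrow> injective_resolution A M E e d"
    unfolding T_def by (rule someI_ex) (use injective_resolution_exists[OF assms(1-3)] in auto)
  hence "injective_resolution A M E e d" by (simp add: T)
  hence res: "resolution A M E e d" and inj: "\<And>n. injective_module A (E n)"
    using injective_resolution_iff[OF assms(3)] by blast+
  have baer: "baer A (E n)" for n
    by (rule injective_module_imp_baer[OF inj, of "\<lambda>a. {[(a, undefined)]}"]) (auto intro: injI)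
  note X = resolutionD[OF res]
  have lc: "local_cohomology A \<aa> M n = quotient_module ((E n)\<lparr>carrier := torsion_cocycles A \<aa> E d n\<rparr>)
          (torsion_coboundaries A \<aa> E d n)" for \<aa> n
    unfolding local_cohomology_def T_def[symmetric] T by simp
  let ?\<aa> = "Idl\<^bsub>A\<^esub> (set xs)"
  have tp: "torsion_part A ?\<aa> (E n) = carrier (tors A xs (E n))" for n
    by (rule torsion_part_eq[OF X(2) assms(4)])
  have "n \<in> nonvanishing_degrees A ?\<aa> M \<longleftrightarrow> \<not> tors_exact_at A xs E d n" for n
  proof -
    interpret En: module A "E n" by (rule X)
    interpret Es: module A "E (Suc n)" by (rule X)
    interpret Tn: module A "tors A xs (E n)" by (rule module_tors[OF X(2) assms(4)])
    let ?Z = "torsion_cocycles A ?\<aa> E d n" and ?B = "torsion_coboundaries A ?\<aa> E d n"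
    have Z: "x \<in> ?Z \<longleftrightarrow> x \<in> carrier (tors A xs (E n)) \<and> d n x = \<zero>\<^bsub>E (Suc n)\<^esub>" for x
      by (simp add: torsion_cocycles_def tp)
    have dhom: "d n \<in> module_hom A (E n) (E (Suc n))" by (rule X)
    have dtor: "d j x \<in> carrier (tors A xs (E (Suc j)))" if "x \<in> carrier (tors A xs (E j))" for j x
      by (rule module_homD(1)[OF module_hom_tors[OF X(2,2,5) assms(4)] that])
    have BZ: "?B \<subseteq> ?Z"
    proof (cases n)
      case 0
      hence "?B = {\<zero>\<^bsub>E n\<^esub>}" by (simp add: torsion_coboundaries_def)
      thus ?thesis using Tn.M.zero_closed module_hom_zero[OF X(2,2) dhom] by (simp add: Z)
    next
      case (Suc j)
      show ?thesis
      proof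
        fix y assume "y \<in> ?B"
        then obtain x where x: "x \<in> carrier (tors A xs (E j))" "y = d j x"
          using Suc by (auto simp: torsion_coboundaries_def tp)
        show "y \<in> ?Z" unfolding Z using dtor[OF x(1)] X(9)[of x j] x Suc by (simp add: carrier_tors)
      qed
    qed
    \<comment> \<open>The coboundaries form a subgroup, so the coset of z is trivial exactly if z is
      a coboundary. This identifies vanishing of the quotient with exactness.\<close>
    have B0: "\<zero>\<^bsub>E n\<^esub> \<in> ?B" and Ba: "\<And>a b. \<lbrakk>a \<in> ?B; b \<in> ?B\<rbrakk> \<Longrightarrow> a \<oplus>\<^bsub>E n\<^esub> b \<in> ?B"
      and Bm: "\<And>a r. \<lbrakk>r \<in> carrier A; a \<in> ?B\<rbrakk> \<Longrightarrow> r \<odot>\<^bsub>E n\<^esub> a \<in> ?B"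
    proof -
      have "\<zero>\<^bsub>E n\<^esub> \<in> ?B \<and> (\<forall>a\<in>?B. \<forall>b\<in>?B. a \<oplus>\<^bsub>E n\<^esub> b \<in> ?B) \<and> (\<forall>r\<in>carrier A. \<forall>a\<in>?B. r \<odot>\<^bsub>E n\<^esub> a \<in> ?B)"
      proof (cases n)
        case 0
        interpret E0: module A "E 0" by (rule X)
        show ?thesis using 0 by (simp add: torsion_coboundaries_def)
      next
        case (Suc j)
        interpret Tj: module A "tors A xs (E j)" by (rule module_tors[OF X(2) assms(4)])
        have dj: "d j \<in> module_hom A (tors A xs (E j)) (E n)"
          using X(5)[of j] Suc by (auto simp: module_hom_def carrier_tors)
        have B: "?B = d j ` carrier (tors A xs (E j))" using Suc by (simp add: torsion_coboundaries_def tp)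
        have "\<zero>\<^bsub>E n\<^esub> \<in> ?B"
          unfolding B using module_hom_zero[OF Tj.module_axioms X(2) dj] Tj.M.zero_closed by (metis imageI)
        moreover have "a \<oplus>\<^bsub>E n\<^esub> b \<in> ?B" if "a \<in> ?B" "b \<in> ?B" for a b
          using that module_homD(2)[OF dj, symmetric] Tj.M.a_closed unfolding B by auto
        moreover have "r \<odot>\<^bsub>E n\<^esub> a \<in> ?B" if "r \<in> carrier A" "a \<in> ?B" for r a
          using that module_homD(3)[OF dj, symmetric] Tj.smult_closed unfolding B by auto
        ultimately show ?thesis by blast
      qed
      thus "\<zero>\<^bsub>E n\<^esub> \<in> ?B" "\<And>a b. \<lbrakk>a \<in> ?B; b \<in> ?B\<rbrakk> \<Longrightarrow> a \<oplus>\<^bsub>E n\<^esub> b \<in> ?B"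
        "\<And>a r. \<lbrakk>r \<in> carrier A; a \<in> ?B\<rbrakk> \<Longrightarrow> r \<odot>\<^bsub>E n\<^esub> a \<in> ?B" by auto
    qed
    have BE: "?B \<subseteq> carrier (E n)" using BZ Z by (auto simp: carrier_tors)
    have coset: "?B +>\<^bsub>(E n)\<lparr>carrier := ?Z\<rparr>\<^esub> z = (\<lambda>b. b \<oplus>\<^bsub>E n\<^esub> z) ` ?B" for z
      unfolding a_r_coset_def' by auto
    have "carrier (local_cohomology A ?\<aa> M n) = (\<lambda>z. (\<lambda>b. b \<oplus>\<^bsub>E n\<^esub> z) ` ?B) ` ?Z"
      unfolding lc quotient_module_def
      unfolding A_RCOSETS_def' coset[symmetric] by auto
    moreover have "\<zero>\<^bsub>local_cohomology A ?\<aa> M n\<^esub> = ?B" unfolding lc quotient_module_def by simp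
    moreover have "(\<lambda>z. (\<lambda>b. b \<oplus>\<^bsub>E n\<^esub> z) ` ?B) ` ?Z = {?B} \<longleftrightarrow> ?Z \<subseteq> ?B"
    proof
      assume eq: "(\<lambda>z. (\<lambda>b. b \<oplus>\<^bsub>E n\<^esub> z) ` ?B) ` ?Z = {?B}"
      show "?Z \<subseteq> ?B"
      proof
        fix z assume z: "z \<in> ?Z"
        have "(\<lambda>b. b \<oplus>\<^bsub>E n\<^esub> z) ` ?B \<in> {?B}" unfolding eq[symmetric] using z by (rule imageI)
        hence "(\<lambda>b. b \<oplus>\<^bsub>E n\<^esub> z) ` ?B = ?B" by (rule singletonD)
        moreover have "\<zero>\<^bsub>E n\<^esub> \<oplus>\<^bsub>E n\<^esub> z = z" using z Z by (simp add: carrier_tors)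
        ultimately show "z \<in> ?B" using B0 by (metis imageI)
      qed
    next
      assume sub: "?Z \<subseteq> ?B"
      have "(\<lambda>b. b \<oplus>\<^bsub>E n\<^esub> z) ` ?B = ?B" if "z \<in> ?B" for z
      proof
        show "(\<lambda>b. b \<oplus>\<^bsub>E n\<^esub> z) ` ?B \<subseteq> ?B" using Ba that by auto
        show "?B \<subseteq> (\<lambda>b. b \<oplus>\<^bsub>E n\<^esub> z) ` ?B"
        proof
          fix b assume b: "b \<in> ?B"
          have "\<ominus>\<^bsub>E n\<^esub> z \<in> ?B" using Bm[of "\<ominus>\<^bsub>A\<^esub> \<one>\<^bsub>A\<^esub>" z] En.neg_eq_smult[of z] that BE by auto
          hence "b \<ominus>\<^bsub>E n\<^esub> z \<in> ?B" using Ba[OF b] by (simp add: a_minus_def)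
          moreover have "b = (b \<ominus>\<^bsub>E n\<^esub> z) \<oplus>\<^bsub>E n\<^esub> z" using b that BE En.diff_add_cancel[of b z] by auto
          ultimately show "b \<in> (\<lambda>b. b \<oplus>\<^bsub>E n\<^esub> z) ` ?B" by (metis imageI)
        qed
      qed
      moreover have "?Z = ?B" using sub BZ by blast
      ultimately show "(\<lambda>z. (\<lambda>b. b \<oplus>\<^bsub>E n\<^esub> z) ` ?B) ` ?Z = {?B}" using B0 by auto
    qed
    moreover have "?Z \<subseteq> ?B \<longleftrightarrow> tors_exact_at A xs E d n"
    proof -
      have B: "x \<in> ?B \<longleftrightarrow> (case n of 0 \<Rightarrow> x = \<zero>\<^bsub>E 0\<^esub> | Suc j \<Rightarrow> \<exists>b\<in>carrier (tors A xs (E j)). d j b = x)" for x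
        by (cases n) (auto simp: torsion_coboundaries_def tp)
      show ?thesis unfolding tors_exact_at_def subset_iff Z B by blast
    qed
    ultimately show ?thesis by (simp add: nonvanishing_degrees_def)
  qed
  hence "nonvanishing_degrees A ?\<aa> M = {n. \<not> tors_exact_at A xs E d n}" by blast
  thus ?thesis using that res baer by blast
qed

section \<open>Tensor products\<close>

lemmas frag_induct = free_Abelian_group_induct [consumes 1, case_names zero diff one]

section \<open>The tensor product as an abelian group and its universal property\<close>

lemma keys_add_le: "\<lbrakk>Poly_Mapping.keys u \<subseteq> S; Poly_Mapping.keys v \<subseteq> S\<rbrakk> \<Longrightarrow> Poly_Mapping.keys (u + v) \<subseteq> S"
  using keys_add[of u v] by blast

lemma keys_diff_le:
  fixes u v :: "'a \<Rightarrow>\<^sub>0 int"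
  shows "\<lbrakk>Poly_Mapping.keys u \<subseteq> S; Poly_Mapping.keys v \<subseteq> S\<rbrakk> \<Longrightarrow> Poly_Mapping.keys (u - v) \<subseteq> S"
  using keys_diff[of u v] by blast

definition pure_tensor ::
  "('k, 'x) ring_scheme \<Rightarrow> ('k, 'm, 'y) module_scheme \<Rightarrow> ('k, 'n, 'z) module_scheme
     \<Rightarrow> 'm \<Rightarrow> 'n \<Rightarrow> ('m \<times> 'n \<Rightarrow>\<^sub>0 int) set"
  where "pure_tensor K V W v w = tensor_class K V W (frag_of (v, w))"

lemma subgroup_tensor_relations:
  assumes "module K V" "module K W"
  shows "subgroup (tensor_relations K V W) (free_Abelian_group (carrier V \<times> carrier W))"
proof -
  interpret V: module K V by fact
  interpret W: module K W by fact
  interpret F: comm_group "free_Abelian_group (carrier V \<times> carrier W)" by (rule abelian_free_Abelian_group)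
  show ?thesis
    unfolding tensor_relations_def
    by (rule F.generate_is_subgroup, rule subsetI, elim UnE CollectE exE conjE)
      (simp_all add: keys_diff_le keys_frag_of)
qed

context
  fixes K :: "('k, 'x) ring_scheme" and V :: "('k, 'm, 'y) module_scheme" and W :: "('k, 'n, 'z) module_scheme"
  assumes V: "module K V" and W: "module K W"
begin

interpretation V: module K V by (rule V)
interpretation W: module K W by (rule W)
interpretation F: comm_group "free_Abelian_group (carrier V \<times> carrier W)" by (rule abelian_free_Abelian_group)

private abbreviation "F \<equiv> free_Abelian_group (carrier V \<times> carrier W)"
private abbreviation "Rel \<equiv> tensor_relations K V W"
private abbreviation "TG \<equiv> tensor_group K V W"
private abbreviation "cls \<equiv> tensor_class K V W"
private abbreviation "ptVW \<equiv> pure_tensor K V W"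

lemma tensor_rel_keys: "r \<in> Rel \<Longrightarrow> Poly_Mapping.keys r \<subseteq> carrier V \<times> carrier W"
  using subgroup.mem_carrier[OF subgroup_tensor_relations[OF V W], of r] by simp

lemma tensor_rel_closed: "\<lbrakk>r \<in> Rel; s \<in> Rel\<rbrakk> \<Longrightarrow> r + s \<in> Rel"
  using subgroup.m_closed[OF subgroup_tensor_relations[OF V W]] by simp

lemma normal_tensor_rel: "Rel \<lhd> F"
  by (rule F.subgroup_imp_normal[OF subgroup_tensor_relations[OF V W]])

lemma comm_group_tensor_group: "comm_group TG"
  unfolding tensor_group_def by (rule F.abelian_FactGroup[OF subgroup_tensor_relations[OF V W]])

lemma tensor_carrier_cases:
  assumes "U \<in> carrier TG"
  obtains u where "Poly_Mapping.keys u \<subseteq> carrier V \<times> carrier W" "U = cls u"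
  using assms unfolding tensor_group_def carrier_FactGroup tensor_class_def by auto

lemma tensor_class_closed: "Poly_Mapping.keys u \<subseteq> carrier V \<times> carrier W \<Longrightarrow> cls u \<in> carrier TG"
  unfolding tensor_group_def carrier_FactGroup tensor_class_def by auto

lemma tensor_class_add:
  assumes "Poly_Mapping.keys u \<subseteq> carrier V \<times> carrier W" "Poly_Mapping.keys v \<subseteq> carrier V \<times> carrier W"
  shows "cls u \<otimes>\<^bsub>TG\<^esub> cls v = cls (u + v)"
  using normal.rcos_sum[OF normal_tensor_rel, of u v] assms by (simp add: tensor_group_def tensor_class_def)

lemma tensor_class_self: "Poly_Mapping.keys u \<subseteq> carrier V \<times> carrier W \<Longrightarrow> u \<in> cls u"
  using F.rcos_self[OF _ subgroup_tensor_relations[OF V W], of u] by (simp add: tensor_class_def)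

lemma tensor_class_mem:
  assumes "Poly_Mapping.keys u \<subseteq> carrier V \<times> carrier W" "v \<in> cls u"
  shows "Poly_Mapping.keys v \<subseteq> carrier V \<times> carrier W" "v - u \<in> Rel"
proof -
  obtain r where r: "r \<in> Rel" "v = r + u" using assms(2) by (auto simp: tensor_class_def r_coset_def)
  show "v - u \<in> Rel" using r by simp
  show "Poly_Mapping.keys v \<subseteq> carrier V \<times> carrier W"
    using r(2) tensor_rel_keys[OF r(1)] assms(1) by (simp add: keys_add_le)
qed

lemma tensor_class_eqI:
  assumes "Poly_Mapping.keys u \<subseteq> carrier V \<times> carrier W" "v - u \<in> Rel"
  shows "cls v = cls u"
proof -
  have "v \<in> cls u" using assms(2) by (auto simp: tensor_class_def r_coset_def intro: bexI[of _ "v - u"])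
  thus ?thesis
    using F.repr_independence[OF _ _ subgroup_tensor_relations[OF V W], of v u] assms(1)
    by (simp add: tensor_class_def)
qed

lemma tensor_one: "\<one>\<^bsub>TG\<^esub> = cls 0"
  using F.coset_mult_one[OF subgroup.subset[OF subgroup_tensor_relations[OF V W]]]
  by (simp add: tensor_group_def tensor_class_def)

lemma pure_tensor_closed [simp, intro]: "\<lbrakk>v \<in> carrier V; w \<in> carrier W\<rbrakk> \<Longrightarrow> ptVW v w \<in> carrier TG"
  unfolding pure_tensor_def by (rule tensor_class_closed) (simp add: keys_frag_of)

lemma tensor_rel_incl:
  "\<lbrakk>x \<in> carrier V; x' \<in> carrier V; y \<in> carrier W\<rbrakk> \<Longrightarrow> frag_of (x \<oplus>\<^bsub>V\<^esub> x', y) - frag_of (x, y) - frag_of (x', y) \<in> Rel"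
  "\<lbrakk>x \<in> carrier V; y \<in> carrier W; y' \<in> carrier W\<rbrakk> \<Longrightarrow> frag_of (x, y \<oplus>\<^bsub>W\<^esub> y') - frag_of (x, y) - frag_of (x, y') \<in> Rel"
  "\<lbrakk>c \<in> carrier K; x \<in> carrier V; y \<in> carrier W\<rbrakk> \<Longrightarrow> frag_of (c \<odot>\<^bsub>V\<^esub> x, y) - frag_of (x, c \<odot>\<^bsub>W\<^esub> y) \<in> Rel"
  unfolding tensor_relations_def by (rule generate.incl; blast)+

lemma pure_tensor_add_left:
  assumes "x \<in> carrier V" "x' \<in> carrier V" "y \<in> carrier W"
  shows "ptVW (x \<oplus>\<^bsub>V\<^esub> x') y = ptVW x y \<otimes>\<^bsub>TG\<^esub> ptVW x' y"
  using assms tensor_rel_incl(1)[OF assms]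
  by (simp add: pure_tensor_def tensor_class_add keys_frag_of keys_add_le tensor_class_eqI diff_diff_eq)

lemma pure_tensor_add_right:
  assumes "x \<in> carrier V" "y \<in> carrier W" "y' \<in> carrier W"
  shows "ptVW x (y \<oplus>\<^bsub>W\<^esub> y') = ptVW x y \<otimes>\<^bsub>TG\<^esub> ptVW x y'"
  using assms tensor_rel_incl(2)[OF assms]
  by (simp add: pure_tensor_def tensor_class_add keys_frag_of keys_add_le tensor_class_eqI diff_diff_eq)

lemma pure_tensor_balanced:
  assumes "c \<in> carrier K" "x \<in> carrier V" "y \<in> carrier W"
  shows "ptVW (c \<odot>\<^bsub>V\<^esub> x) y = ptVW x (c \<odot>\<^bsub>W\<^esub> y)"
  using assms tensor_rel_incl(3)[OF assms] by (simp add: pure_tensor_def keys_frag_of tensor_class_eqI)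

lemma pure_tensor_zero:
  "y \<in> carrier W \<Longrightarrow> ptVW \<zero>\<^bsub>V\<^esub> y = \<one>\<^bsub>TG\<^esub>" "x \<in> carrier V \<Longrightarrow> ptVW x \<zero>\<^bsub>W\<^esub> = \<one>\<^bsub>TG\<^esub>"
proof -
  interpret T: comm_group TG by (rule comm_group_tensor_group)
  show "ptVW \<zero>\<^bsub>V\<^esub> y = \<one>\<^bsub>TG\<^esub>" if "y \<in> carrier W"
    using pure_tensor_add_left[of "\<zero>\<^bsub>V\<^esub>" "\<zero>\<^bsub>V\<^esub>" y] that by (simp add: T.r_cancel_one')
  show "ptVW x \<zero>\<^bsub>W\<^esub> = \<one>\<^bsub>TG\<^esub>" if "x \<in> carrier V"
    using pure_tensor_add_right[of x "\<zero>\<^bsub>W\<^esub>" "\<zero>\<^bsub>W\<^esub>"] that by (simp add: T.r_cancel_one')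
qed

lemma pure_tensor_neg:
  assumes "x \<in> carrier V" "y \<in> carrier W"
  shows "ptVW (\<ominus>\<^bsub>V\<^esub> x) y = inv\<^bsub>TG\<^esub> ptVW x y"
proof -
  interpret T: comm_group TG by (rule comm_group_tensor_group)
  have "ptVW (\<ominus>\<^bsub>V\<^esub> x) y \<otimes>\<^bsub>TG\<^esub> ptVW x y = \<one>\<^bsub>TG\<^esub>"
    using pure_tensor_add_left[of "\<ominus>\<^bsub>V\<^esub> x" x y] assms by (simp add: V.M.l_neg pure_tensor_zero)
  thus ?thesis using assms by (metis T.inv_equality V.M.a_inv_closed pure_tensor_closed)
qed

text \<open>There is no case for negatives because -(x \<otimes> y) = (-x) \<otimes> y.\<close>

lemma tensor_induct [consumes 1, case_names pure add]:
  assumes U: "U \<in> carrier TG"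
    and pure: "\<And>x y. \<lbrakk>x \<in> carrier V; y \<in> carrier W\<rbrakk> \<Longrightarrow> P (ptVW x y)"
    and add: "\<And>U U'. \<lbrakk>U \<in> carrier TG; U' \<in> carrier TG; P U; P U'\<rbrakk> \<Longrightarrow> P (U \<otimes>\<^bsub>TG\<^esub> U')"
  shows "P U"
proof -
  interpret T: comm_group TG by (rule comm_group_tensor_group)
  \<comment> \<open>\<open>frag_induct\<close> proceeds by differences, so the claim is carried for
    u and -u at once.\<close>
  have "P (cls u) \<and> P (cls (- u))" if "Poly_Mapping.keys u \<subseteq> carrier V \<times> carrier W" for u
    using that
  proof (induct u rule: frag_induct)
    case zero
    have "P (ptVW \<zero>\<^bsub>V\<^esub> \<zero>\<^bsub>W\<^esub>)" by (rule pure) auto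
    thus ?case by (simp add: pure_tensor_zero tensor_one)
  next
    case (diff u v)
    have "cls u \<otimes>\<^bsub>TG\<^esub> cls (- v) = cls (u - v)" "cls (- u) \<otimes>\<^bsub>TG\<^esub> cls v = cls (- (u - v))"
      using diff by (simp_all add: tensor_class_add)
    thus ?case using diff add[of "cls u" "cls (- v)"] add[of "cls (- u)" "cls v"]
      by (simp add: tensor_class_closed)
  next
    case (one a)
    then obtain x y where xy: "a = (x, y)" "x \<in> carrier V" "y \<in> carrier W" using one by auto
    have "cls (frag_of a) \<otimes>\<^bsub>TG\<^esub> cls (- frag_of a) = \<one>\<^bsub>TG\<^esub>"
      using xy by (simp add: tensor_class_add keys_frag_of tensor_one)
    hence "cls (- frag_of a) = inv\<^bsub>TG\<^esub> ptVW x y"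
      using xy T.inv_equality[of "cls (- frag_of a)" "ptVW x y"] T.m_comm tensor_class_closed[of "- frag_of a"]
      by (simp add: pure_tensor_def keys_frag_of tensor_class_closed)
    also have "\<dots> = ptVW (\<ominus>\<^bsub>V\<^esub> x) y" using xy by (simp add: pure_tensor_neg)
    finally have "P (cls (- frag_of a))" using pure[of "\<ominus>\<^bsub>V\<^esub> x" y] xy by simp
    thus ?case using pure[of x y] xy by (simp add: pure_tensor_def)
  qed
  thus ?thesis using tensor_carrier_cases[OF U] by metis
qed

text \<open>This is the universal property: the extension of \<open>\<beta>\<close> to the free
  abelian group has the generating relations in its kernel.\<close>

lemma tensor_hom_lift:
  assumes H: "comm_group H" and closed: "\<And>x y. \<lbrakk>x \<in> carrier V; y \<in> carrier W\<rbrakk> \<Longrightarrow> \<beta> x y \<in> carrier H"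
    and left: "\<And>x x' y. \<lbrakk>x \<in> carrier V; x' \<in> carrier V; y \<in> carrier W\<rbrakk> \<Longrightarrow> \<beta> (x \<oplus>\<^bsub>V\<^esub> x') y = \<beta> x y \<otimes>\<^bsub>H\<^esub> \<beta> x' y"
    and right: "\<And>x y y'. \<lbrakk>x \<in> carrier V; y \<in> carrier W; y' \<in> carrier W\<rbrakk> \<Longrightarrow> \<beta> x (y \<oplus>\<^bsub>W\<^esub> y') = \<beta> x y \<otimes>\<^bsub>H\<^esub> \<beta> x y'"
    and bal: "\<And>c x y. \<lbrakk>c \<in> carrier K; x \<in> carrier V; y \<in> carrier W\<rbrakk> \<Longrightarrow> \<beta> (c \<odot>\<^bsub>V\<^esub> x) y = \<beta> x (c \<odot>\<^bsub>W\<^esub> y)"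
  obtains h where "h \<in> hom TG H" "\<And>x y. \<lbrakk>x \<in> carrier V; y \<in> carrier W\<rbrakk> \<Longrightarrow> h (ptVW x y) = \<beta> x y"
proof -
  interpret H: comm_group H by fact
  have img: "(\<lambda>(x, y). \<beta> x y) ` (carrier V \<times> carrier W) \<subseteq> carrier H" using closed by auto
  obtain h0 where h0: "h0 \<in> hom F H" "\<And>p. p \<in> carrier V \<times> carrier W \<Longrightarrow> h0 (frag_of p) = (\<lambda>(x, y). \<beta> x y) p"
    using H.free_Abelian_group_universal[OF img] by blast
  interpret h0: group_hom F H h0 by (rule group_hom.intro) (use h0 in \<open>auto simp: group_hom_axioms_def\<close>)
  have diff: "h0 (u - v) = h0 u \<otimes>\<^bsub>H\<^esub> inv\<^bsub>H\<^esub> h0 v"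
    if "Poly_Mapping.keys u \<subseteq> carrier V \<times> carrier W" "Poly_Mapping.keys v \<subseteq> carrier V \<times> carrier W" for u v
    using h0.hom_mult[of u "- v"] h0.hom_inv[of v] that by simp
  have sub: "Rel \<subseteq> kernel F H h0"
    unfolding tensor_relations_def
  proof (rule F.generate_subgroup_incl)
    show "subgroup (kernel F H h0) F" by (rule h0.subgroup_kernel)
    have h0of: "h0 (frag_of (x, y)) = \<beta> x y" if "x \<in> carrier V" "y \<in> carrier W" for x y
      using h0(2)[of "(x, y)"] that by simp
    have "h0 (frag_of (x \<oplus>\<^bsub>V\<^esub> x', y) - frag_of (x, y) - frag_of (x', y)) = \<one>\<^bsub>H\<^esub>"
      if "x \<in> carrier V" "x' \<in> carrier V" "y \<in> carrier W" for x x' y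
      using that by (simp add: diff keys_frag_of keys_diff_le h0of left closed H.m_assoc H.inv_mult_group H.m_lcomm)
    moreover have "h0 (frag_of (x, y \<oplus>\<^bsub>W\<^esub> y') - frag_of (x, y) - frag_of (x, y')) = \<one>\<^bsub>H\<^esub>"
      if "x \<in> carrier V" "y \<in> carrier W" "y' \<in> carrier W" for x y y'
      using that by (simp add: diff keys_frag_of keys_diff_le h0of right closed H.m_assoc H.inv_mult_group H.m_lcomm)
    moreover have "h0 (frag_of (c \<odot>\<^bsub>V\<^esub> x, y) - frag_of (x, c \<odot>\<^bsub>W\<^esub> y)) = \<one>\<^bsub>H\<^esub>"
      if "c \<in> carrier K" "x \<in> carrier V" "y \<in> carrier W" for c x y
      using that by (simp add: diff keys_frag_of h0of bal closed)
    ultimately show "{frag_of (x \<oplus>\<^bsub>V\<^esub> x', y) - frag_of (x, y) - frag_of (x', y) | x x' y.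
          x \<in> carrier V \<and> x' \<in> carrier V \<and> y \<in> carrier W} \<union>
       {frag_of (x, y \<oplus>\<^bsub>W\<^esub> y') - frag_of (x, y) - frag_of (x, y') | x y y'.
          x \<in> carrier V \<and> y \<in> carrier W \<and> y' \<in> carrier W} \<union>
       {frag_of (c \<odot>\<^bsub>V\<^esub> x, y) - frag_of (x, c \<odot>\<^bsub>W\<^esub> y) | c x y.
          c \<in> carrier K \<and> x \<in> carrier V \<and> y \<in> carrier W} \<subseteq> kernel F H h0"
      by (intro subsetI, elim UnE CollectE exE conjE) (simp_all add: kernel_def keys_diff_le keys_frag_of)
  qed
  obtain h where h: "h \<in> hom (F Mod Rel) H" "\<And>u. u \<in> carrier F \<Longrightarrow> h (Rel #>\<^bsub>F\<^esub> u) = h0 u"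
    using h0.FactGroup_universal_kernel[OF normal_tensor_rel sub] by blast
  show ?thesis
  proof (rule that)
    show "h \<in> hom TG H" using h(1) by (simp add: tensor_group_def)
    fix x y assume "x \<in> carrier V" "y \<in> carrier W"
    thus "h (ptVW x y) = \<beta> x y" using h(2)[of "frag_of (x, y)"] h0(2)[of "(x, y)"]
      by (simp add: pure_tensor_def tensor_class_def keys_frag_of)
  qed
qed

end

lemmas tensor_induct' = tensor_induct [consumes 3, case_names pure add]

text \<open>Connects operations written on representatives with homomorphisms obtained from the
  universal property. Additivity of \<open>e\<close> already determines it at 0 and on
  differences.\<close>

lemma tensor_hom_class_ext:
  assumes "module K V" "module K W" "group H" "h \<in> hom (tensor_group K V W) H"
    and u: "Poly_Mapping.keys u \<subseteq> carrier V \<times> carrier W"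
    and e: "\<And>u v. \<lbrakk>Poly_Mapping.keys u \<subseteq> carrier V \<times> carrier W; Poly_Mapping.keys v \<subseteq> carrier V \<times> carrier W\<rbrakk>
       \<Longrightarrow> e (u + v) = e u \<otimes>\<^bsub>H\<^esub> e v"
    and ec: "\<And>u. Poly_Mapping.keys u \<subseteq> carrier V \<times> carrier W \<Longrightarrow> e u \<in> carrier H"
    and eq: "\<And>x y. \<lbrakk>x \<in> carrier V; y \<in> carrier W\<rbrakk> \<Longrightarrow> e (frag_of (x, y)) = h (pure_tensor K V W x y)"
  shows "e u = h (tensor_class K V W u)"
proof -
  interpret H: group H by fact
  interpret T: comm_group "tensor_group K V W" by (rule comm_group_tensor_group) fact+
  interpret h: group_hom "tensor_group K V W" H h
    by (rule group_hom.intro) (use assms in \<open>auto simp: group_hom_axioms_def\<close>)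
  note [simp] = tensor_class_closed[OF assms(1,2)]
  have e0: "e 0 = \<one>\<^bsub>H\<^esub>" using e[of 0 0] ec[of 0] by (simp add: H.r_cancel_one')
  show ?thesis using u
  proof (induct u rule: frag_induct)
    case zero
    thus ?case using e0 h.hom_one tensor_one[OF assms(1,2)] by simp
  next
    case (diff u v)
    have "e (u - v) \<otimes>\<^bsub>H\<^esub> e v = e u" using e[of "u - v" v] diff by (simp add: keys_diff_le)
    moreover have "h (tensor_class K V W (u - v)) \<otimes>\<^bsub>H\<^esub> h (tensor_class K V W v) = h (tensor_class K V W u)"
      using h.hom_mult[of "tensor_class K V W (u - v)" "tensor_class K V W v"] diff
        tensor_class_add[OF assms(1,2), of "u - v" v] by (simp add: keys_diff_le)
    ultimately show ?case using diff
      by (metis H.r_cancel ec h.hom_closed keys_diff_le tensor_class_closed[OF assms(1,2)])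
  next
    case (one a)
    thus ?case using eq by (auto simp: pure_tensor_def)
  qed
qed

lemma tensor_map_exists:
  assumes V: "module K V" and W: "module K W" and V': "module K V'" and W': "module K W'"
    and f: "f \<in> module_hom K V V'" and g: "g \<in> module_hom K W W'"
  obtains h where "h \<in> hom (tensor_group K V W) (tensor_group K V' W')"
    "\<And>x y. \<lbrakk>x \<in> carrier V; y \<in> carrier W\<rbrakk> \<Longrightarrow> h (pure_tensor K V W x y) = pure_tensor K V' W' (f x) (g y)"
proof (rule tensor_hom_lift[OF V W comm_group_tensor_group[OF V' W'], of "\<lambda>x y. pure_tensor K V' W' (f x) (g y)"])
  note fD = module_homD[OF f] and gD = module_homD[OF g]
  show "\<And>x y. \<lbrakk>x \<in> carrier V; y \<in> carrier W\<rbrakk> \<Longrightarrow> pure_tensor K V' W' (f x) (g y) \<in> carrier (tensor_group K V' W')"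
    by (rule pure_tensor_closed[OF V' W']) (use fD gD in auto)
qed (use module_homD[OF f] module_homD[OF g] that in
    \<open>auto simp: pure_tensor_add_left[OF V' W'] pure_tensor_add_right[OF V' W'] pure_tensor_balanced[OF V' W']\<close>)

text \<open>\<open>tensor_map\<close> is a choice function for \<open>f \<otimes> g\<close>; only its values on the carrier matter.\<close>

definition tensor_map ::
  "('k, 'x) ring_scheme \<Rightarrow> ('k, 'm, 'y) module_scheme \<Rightarrow> ('k, 'n, 'z) module_scheme
     \<Rightarrow> ('k, 'm2, 'y2) module_scheme \<Rightarrow> ('k, 'n2, 'z2) module_scheme \<Rightarrow> ('m \<Rightarrow> 'm2) \<Rightarrow> ('n \<Rightarrow> 'n2)
     \<Rightarrow> ('m \<times> 'n \<Rightarrow>\<^sub>0 int) set \<Rightarrow> ('m2 \<times> 'n2 \<Rightarrow>\<^sub>0 int) set"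
  where "tensor_map K V W V' W' f g =
    (SOME h. h \<in> hom (tensor_group K V W) (tensor_group K V' W') \<and>
       (\<forall>x\<in>carrier V. \<forall>y\<in>carrier W. h (pure_tensor K V W x y) = pure_tensor K V' W' (f x) (g y)))"

lemma tensor_map:
  assumes "module K V" "module K W" "module K V'" "module K W'"
    and "f \<in> module_hom K V V'" "g \<in> module_hom K W W'"
  shows "tensor_map K V W V' W' f g \<in> hom (tensor_group K V W) (tensor_group K V' W')"
    and "\<lbrakk>x \<in> carrier V; y \<in> carrier W\<rbrakk> \<Longrightarrow>
      tensor_map K V W V' W' f g (pure_tensor K V W x y) = pure_tensor K V' W' (f x) (g y)"
proof -
  have "\<exists>h. h \<in> hom (tensor_group K V W) (tensor_group K V' W') \<and>
       (\<forall>x\<in>carrier V. \<forall>y\<in>carrier W. h (pure_tensor K V W x y) = pure_tensor K V' W' (f x) (g y))"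
    using tensor_map_exists[OF assms] by metis
  from someI_ex[OF this]
  show "tensor_map K V W V' W' f g \<in> hom (tensor_group K V W) (tensor_group K V' W')"
    and "\<lbrakk>x \<in> carrier V; y \<in> carrier W\<rbrakk> \<Longrightarrow>
      tensor_map K V W V' W' f g (pure_tensor K V W x y) = pure_tensor K V' W' (f x) (g y)"
    unfolding tensor_map_def by blast+
qed

subsection \<open>The multiplication of formal sums\<close>

lemma frag_extend_fun_add: "frag_extend (\<lambda>i. p i + q i) x = frag_extend p x + frag_extend q x"
  by (simp add: frag_extend_def frag_cmul_distrib2 sum.distrib)

lemma frag_extend_fun_minus: "frag_extend (\<lambda>i. - p i) x = - frag_extend p x"
proof -
  have "frag_extend (\<lambda>i. - p i) x + frag_extend p x = frag_extend (\<lambda>i. - p i + p i) x"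
    by (rule frag_extend_fun_add[symmetric])
  also have "\<dots> = 0" by (simp add: frag_extend_def)
  finally show ?thesis by (simp add: eq_neg_iff_add_eq_0)
qed

lemma frag_mult_simps:
  "frag_mult f g (u + u') v = frag_mult f g u v + frag_mult f g u' v"
  "frag_mult f g u (v + v') = frag_mult f g u v + frag_mult f g u v'"
  "frag_mult f g (- u) v = - frag_mult f g u v"
  "frag_mult f g u (- v) = - frag_mult f g u v"
  "frag_mult f g (u - u') v = frag_mult f g u v - frag_mult f g u' v"
  "frag_mult f g u (v - v') = frag_mult f g u v - frag_mult f g u v'"
  "frag_mult f g 0 v = 0" "frag_mult f g u 0 = 0"
  "frag_mult f g (frag_of (a, b)) (frag_of (x, y)) = frag_of (f a x, g b y)"
proof -
  show add: "frag_mult f g u (v + v') = frag_mult f g u v + frag_mult f g u v'" for v v'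
    by (simp add: frag_mult_def frag_extend_add case_prod_unfold frag_extend_fun_add)
  show minus: "frag_mult f g u (- v) = - frag_mult f g u v" for v
    by (simp add: frag_mult_def frag_extend_minus case_prod_unfold frag_extend_fun_minus)
  show "frag_mult f g u (v - v') = frag_mult f g u v - frag_mult f g u v'"
    using add[of v "- v'"] minus by simp
  show "frag_mult f g u 0 = 0" using add[of 0 0] by simp
qed (simp_all add: frag_mult_def frag_extend_add frag_extend_minus frag_extend_diff)

text \<open>Covers both the multiplication of an algebra and its action on a module, so that the
  product of the tensor algebra and its action on a tensor module are handled by the same
  lemmas.\<close>

definition bilinear_action ::
  "('k, 'x) ring_scheme \<Rightarrow> ('k, 'a, 'u) module_scheme \<Rightarrow> ('k, 'm, 'y) module_scheme \<Rightarrow> ('a \<Rightarrow> 'm \<Rightarrow> 'm) \<Rightarrow> bool"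
  where "bilinear_action K A V f \<longleftrightarrow>
    (\<forall>a\<in>carrier A. \<forall>v\<in>carrier V. f a v \<in> carrier V) \<and>
    (\<forall>a\<in>carrier A. \<forall>a'\<in>carrier A. \<forall>v\<in>carrier V. f (a \<oplus>\<^bsub>A\<^esub> a') v = f a v \<oplus>\<^bsub>V\<^esub> f a' v) \<and>
    (\<forall>a\<in>carrier A. \<forall>v\<in>carrier V. \<forall>v'\<in>carrier V. f a (v \<oplus>\<^bsub>V\<^esub> v') = f a v \<oplus>\<^bsub>V\<^esub> f a v') \<and>
    (\<forall>c\<in>carrier K. \<forall>a\<in>carrier A. \<forall>v\<in>carrier V.
       f (c \<odot>\<^bsub>A\<^esub> a) v = c \<odot>\<^bsub>V\<^esub> f a v \<and> f a (c \<odot>\<^bsub>V\<^esub> v) = c \<odot>\<^bsub>V\<^esub> f a v)"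

lemma bilinear_actionD:
  assumes "bilinear_action K A V f"
  shows "\<lbrakk>a \<in> carrier A; v \<in> carrier V\<rbrakk> \<Longrightarrow> f a v \<in> carrier V"
    and "\<lbrakk>a \<in> carrier A; a' \<in> carrier A; v \<in> carrier V\<rbrakk> \<Longrightarrow> f (a \<oplus>\<^bsub>A\<^esub> a') v = f a v \<oplus>\<^bsub>V\<^esub> f a' v"
    and "\<lbrakk>a \<in> carrier A; v \<in> carrier V; v' \<in> carrier V\<rbrakk> \<Longrightarrow> f a (v \<oplus>\<^bsub>V\<^esub> v') = f a v \<oplus>\<^bsub>V\<^esub> f a v'"
    and "\<lbrakk>c \<in> carrier K; a \<in> carrier A; v \<in> carrier V\<rbrakk> \<Longrightarrow> f (c \<odot>\<^bsub>A\<^esub> a) v = c \<odot>\<^bsub>V\<^esub> f a v"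
    and "\<lbrakk>c \<in> carrier K; a \<in> carrier A; v \<in> carrier V\<rbrakk> \<Longrightarrow> f a (c \<odot>\<^bsub>V\<^esub> v) = c \<odot>\<^bsub>V\<^esub> f a v"
  using assms unfolding bilinear_action_def by blast+

definition tensor_act ::
  "('k, 'x) ring_scheme \<Rightarrow> ('k, 'm, 'y) module_scheme \<Rightarrow> ('k, 'n, 'z) module_scheme
    \<Rightarrow> ('a \<Rightarrow> 'm \<Rightarrow> 'm) \<Rightarrow> ('b \<Rightarrow> 'n \<Rightarrow> 'n) \<Rightarrow> ('a \<times> 'b \<Rightarrow>\<^sub>0 int) set \<Rightarrow> ('m \<times> 'n \<Rightarrow>\<^sub>0 int) set
    \<Rightarrow> ('m \<times> 'n \<Rightarrow>\<^sub>0 int) set"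
  where "tensor_act K V W f g = (\<lambda>U Z. \<Union>u\<in>U. \<Union>v\<in>Z. tensor_class K V W (frag_mult f g u v))"

context
  fixes K :: "('k, 'x) ring_scheme" and A :: "('k, 'a, 'x1) module_scheme" and B :: "('k, 'b, 'x2) module_scheme"
    and V :: "('k, 'm, 'y) module_scheme" and W :: "('k, 'n, 'z) module_scheme" and f g
  assumes A: "module K A" and B: "module K B" and V: "module K V" and W: "module K W"
    and f: "bilinear_action K A V f" and g: "bilinear_action K B W g"
begin

private abbreviation "keysAB u \<equiv> Poly_Mapping.keys u \<subseteq> carrier A \<times> carrier B"
private abbreviation "keysVW u \<equiv> Poly_Mapping.keys u \<subseteq> carrier V \<times> carrier W"

lemma frag_mult_keys:
  assumes "keysAB u" "keysVW v"
  shows "keysVW (frag_mult f g u v)"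
  using assms(1)
proof (induct u rule: frag_induct)
  case (one p)
  obtain a b where p: "p = (a, b)" "a \<in> carrier A" "b \<in> carrier B" using one by auto
  show ?case using assms(2)
  proof (induct v rule: frag_induct)
    case (one q)
    thus ?case using p bilinear_actionD(1)[OF f] bilinear_actionD(1)[OF g]
      by (auto simp: frag_mult_simps keys_frag_of)
  qed (simp_all add: frag_mult_simps keys_diff_le)
qed (simp_all add: frag_mult_simps keys_diff_le)

text \<open>The r for which r v is a relation for every v form a subgroup. For the generating r it
  suffices, by additivity, to let v run through the basis.\<close>

lemma frag_mult_rel_left:
  assumes "r \<in> tensor_relations K A B" "keysVW v"
  shows "frag_mult f g r v \<in> tensor_relations K V W"
proof -
  interpret AB: comm_group "free_Abelian_group (carrier A \<times> carrier B)" by (rule abelian_free_Abelian_group)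
  interpret A: module K A by (rule A)
  interpret B: module K B by (rule B)
  interpret S: subgroup "tensor_relations K V W" "free_Abelian_group (carrier V \<times> carrier W)"
    by (rule subgroup_tensor_relations[OF V W])
  note fD = bilinear_actionD[OF f] and gD = bilinear_actionD[OF g]
  have Rdiff: "r - s \<in> tensor_relations K V W" if "r \<in> tensor_relations K V W" "s \<in> tensor_relations K V W" for r s
    using S.m_closed[OF that(1) S.m_inv_closed[OF that(2)]] tensor_rel_keys[OF V W that(2)] by simp
  have R0: "0 \<in> tensor_relations K V W" using S.one_closed by simp
  let ?Z = "{r. keysAB r \<and> (\<forall>v. keysVW v \<longrightarrow> frag_mult f g r v \<in> tensor_relations K V W)}"
  have "tensor_relations K A B \<subseteq> ?Z"
    unfolding tensor_relations_def[of K A B]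
  proof (rule AB.generate_subgroup_incl)
    show "subgroup ?Z (free_Abelian_group (carrier A \<times> carrier B))"
    proof
      show "\<And>x. x \<in> ?Z \<Longrightarrow> inv\<^bsub>free_Abelian_group (carrier A \<times> carrier B)\<^esub> x \<in> ?Z"
        using Rdiff[OF R0] by (simp add: frag_mult_simps)
      show "\<And>x y. \<lbrakk>x \<in> ?Z; y \<in> ?Z\<rbrakk> \<Longrightarrow> x \<otimes>\<^bsub>free_Abelian_group (carrier A \<times> carrier B)\<^esub> y \<in> ?Z"
        using tensor_rel_closed[OF V W] by (simp add: frag_mult_simps keys_add_le)
    qed (use R0 in \<open>auto simp: frag_mult_simps\<close>)
    have 1: "frag_mult f g (frag_of (a \<oplus>\<^bsub>A\<^esub> a', b) - frag_of (a, b) - frag_of (a', b)) v \<in> tensor_relations K V W"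
      if "a \<in> carrier A" "a' \<in> carrier A" "b \<in> carrier B" "keysVW v" for a a' b v
      using that(4)
    proof (induct v rule: frag_induct)
      case (one q)
      thus ?case using that tensor_rel_incl(1)[OF V W, of "f a (fst q)" "f a' (fst q)" "g b (snd q)"] fD gD
        by (cases q) (simp add: frag_mult_simps)
    qed (simp_all only: frag_mult_simps(6,8) Rdiff R0)
    have 2: "frag_mult f g (frag_of (a, b \<oplus>\<^bsub>B\<^esub> b') - frag_of (a, b) - frag_of (a, b')) v \<in> tensor_relations K V W"
      if "a \<in> carrier A" "b \<in> carrier B" "b' \<in> carrier B" "keysVW v" for a b b' v
      using that(4)
    proof (induct v rule: frag_induct)
      case (one q)
      thus ?case using that tensor_rel_incl(2)[OF V W, of "f a (fst q)" "g b (snd q)" "g b' (snd q)"] fD gD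
        by (cases q) (simp add: frag_mult_simps)
    qed (simp_all only: frag_mult_simps(6,8) Rdiff R0)
    have 3: "frag_mult f g (frag_of (c \<odot>\<^bsub>A\<^esub> a, b) - frag_of (a, c \<odot>\<^bsub>B\<^esub> b)) v \<in> tensor_relations K V W"
      if "c \<in> carrier K" "a \<in> carrier A" "b \<in> carrier B" "keysVW v" for a b c v
      using that(4)
    proof (induct v rule: frag_induct)
      case (one q)
      thus ?case using that tensor_rel_incl(3)[OF V W, of c "f a (fst q)" "g b (snd q)"] fD gD
        by (cases q) (simp add: frag_mult_simps)
    qed (simp_all only: frag_mult_simps(6,8) Rdiff R0)
    show "{frag_of (x \<oplus>\<^bsub>A\<^esub> x', y) - frag_of (x, y) - frag_of (x', y) | x x' y.
          x \<in> carrier A \<and> x' \<in> carrier A \<and> y \<in> carrier B} \<union>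
       {frag_of (x, y \<oplus>\<^bsub>B\<^esub> y') - frag_of (x, y) - frag_of (x, y') | x y y'.
          x \<in> carrier A \<and> y \<in> carrier B \<and> y' \<in> carrier B} \<union>
       {frag_of (c \<odot>\<^bsub>A\<^esub> x, y) - frag_of (x, c \<odot>\<^bsub>B\<^esub> y) | c x y.
          c \<in> carrier K \<and> x \<in> carrier A \<and> y \<in> carrier B} \<subseteq> ?Z"
      using 1 2 3 by (intro subsetI, elim UnE CollectE exE conjE) (simp_all add: keys_diff_le keys_frag_of)
  qed
  thus ?thesis using assms by blast
qed

lemma frag_mult_rel_right:
  assumes "keysAB u" "r \<in> tensor_relations K V W"
  shows "frag_mult f g u r \<in> tensor_relations K V W"
proof -
  interpret VW: comm_group "free_Abelian_group (carrier V \<times> carrier W)" by (rule abelian_free_Abelian_group)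
  interpret V: module K V by (rule V)
  interpret W: module K W by (rule W)
  interpret S: subgroup "tensor_relations K V W" "free_Abelian_group (carrier V \<times> carrier W)"
    by (rule subgroup_tensor_relations[OF V W])
  note fD = bilinear_actionD[OF f] and gD = bilinear_actionD[OF g]
  have Rdiff: "r - s \<in> tensor_relations K V W" if "r \<in> tensor_relations K V W" "s \<in> tensor_relations K V W" for r s
    using S.m_closed[OF that(1) S.m_inv_closed[OF that(2)]] tensor_rel_keys[OF V W that(2)] by simp
  have R0: "0 \<in> tensor_relations K V W" using S.one_closed by simp
  let ?Z = "{r. keysVW r \<and> (\<forall>u. keysAB u \<longrightarrow> frag_mult f g u r \<in> tensor_relations K V W)}"
  have "tensor_relations K V W \<subseteq> ?Z"
    \<comment> \<open>Rewrites only the left side of the inclusion, since \<open>?Z\<close> itself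
      mentions the relations and has to stay folded.\<close>
    unfolding tensor_relations_def[of K V W, THEN arg_cong[of _ _ "\<lambda>R. R \<subseteq> ?Z"]]
  proof (rule VW.generate_subgroup_incl)
    show "subgroup ?Z (free_Abelian_group (carrier V \<times> carrier W))"
    proof
      show "\<And>x. x \<in> ?Z \<Longrightarrow> inv\<^bsub>free_Abelian_group (carrier V \<times> carrier W)\<^esub> x \<in> ?Z"
        using Rdiff[OF R0] by (simp add: frag_mult_simps)
      show "\<And>x y. \<lbrakk>x \<in> ?Z; y \<in> ?Z\<rbrakk> \<Longrightarrow> x \<otimes>\<^bsub>free_Abelian_group (carrier V \<times> carrier W)\<^esub> y \<in> ?Z"
        using tensor_rel_closed[OF V W] by (simp add: frag_mult_simps keys_add_le)
    qed (use R0 in \<open>auto simp: frag_mult_simps\<close>)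
    have 1: "frag_mult f g u (frag_of (x \<oplus>\<^bsub>V\<^esub> x', y) - frag_of (x, y) - frag_of (x', y)) \<in> tensor_relations K V W"
      if "x \<in> carrier V" "x' \<in> carrier V" "y \<in> carrier W" "keysAB u" for x x' y u
      using that(4)
    proof (induct u rule: frag_induct)
      case (one q)
      thus ?case using that tensor_rel_incl(1)[OF V W, of "f (fst q) x" "f (fst q) x'" "g (snd q) y"] fD gD
        by (cases q) (simp add: frag_mult_simps)
    qed (simp_all only: frag_mult_simps(5,7) Rdiff R0)
    have 2: "frag_mult f g u (frag_of (x, y \<oplus>\<^bsub>W\<^esub> y') - frag_of (x, y) - frag_of (x, y')) \<in> tensor_relations K V W"
      if "x \<in> carrier V" "y \<in> carrier W" "y' \<in> carrier W" "keysAB u" for x y y' u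
      using that(4)
    proof (induct u rule: frag_induct)
      case (one q)
      thus ?case using that tensor_rel_incl(2)[OF V W, of "f (fst q) x" "g (snd q) y" "g (snd q) y'"] fD gD
        by (cases q) (simp add: frag_mult_simps)
    qed (simp_all only: frag_mult_simps(5,7) Rdiff R0)
    have 3: "frag_mult f g u (frag_of (c \<odot>\<^bsub>V\<^esub> x, y) - frag_of (x, c \<odot>\<^bsub>W\<^esub> y)) \<in> tensor_relations K V W"
      if "c \<in> carrier K" "x \<in> carrier V" "y \<in> carrier W" "keysAB u" for x y c u
      using that(4)
    proof (induct u rule: frag_induct)
      case (one q)
      thus ?case using that tensor_rel_incl(3)[OF V W, of c "f (fst q) x" "g (snd q) y"] fD gD
        by (cases q) (simp add: frag_mult_simps)
    qed (simp_all only: frag_mult_simps(5,7) Rdiff R0)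
    show "{frag_of (x \<oplus>\<^bsub>V\<^esub> x', y) - frag_of (x, y) - frag_of (x', y) | x x' y.
          x \<in> carrier V \<and> x' \<in> carrier V \<and> y \<in> carrier W} \<union>
       {frag_of (x, y \<oplus>\<^bsub>W\<^esub> y') - frag_of (x, y) - frag_of (x, y') | x y y'.
          x \<in> carrier V \<and> y \<in> carrier W \<and> y' \<in> carrier W} \<union>
       {frag_of (c \<odot>\<^bsub>V\<^esub> x, y) - frag_of (x, c \<odot>\<^bsub>W\<^esub> y) | c x y.
          c \<in> carrier K \<and> x \<in> carrier V \<and> y \<in> carrier W} \<subseteq> ?Z"
      using 1 2 3 by (intro subsetI, elim UnE CollectE exE conjE) (simp_all add: keys_diff_le keys_frag_of)
  qed
  thus ?thesis using assms by blast
qed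

text \<open>Other representatives give the same class, since u' v' - u v = (u' - u) v' + u (v' - v)
  is a relation; hence the union in \<open>tensor_act\<close> is over equal sets.\<close>

lemma tensor_act_class:
  assumes "keysAB u" "keysVW v"
  shows "tensor_act K V W f g (tensor_class K A B u) (tensor_class K V W v) = tensor_class K V W (frag_mult f g u v)"
proof -
  have "tensor_class K V W (frag_mult f g u' v') = tensor_class K V W (frag_mult f g u v)"
    if "u' \<in> tensor_class K A B u" "v' \<in> tensor_class K V W v" for u' v'
  proof (rule tensor_class_eqI[OF V W frag_mult_keys[OF assms]])
    note u' = tensor_class_mem[OF A B assms(1) that(1)] and v' = tensor_class_mem[OF V W assms(2) that(2)]
    have "frag_mult f g (u' - u) v' + frag_mult f g u (v' - v) \<in> tensor_relations K V W"
      by (intro tensor_rel_closed[OF V W] frag_mult_rel_left frag_mult_rel_right u' v' assms)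
    thus "frag_mult f g u' v' - frag_mult f g u v \<in> tensor_relations K V W"
      by (simp add: frag_mult_simps)
  qed
  thus ?thesis
    unfolding tensor_act_def using tensor_class_self[OF A B assms(1)] tensor_class_self[OF V W assms(2)] by blast
qed

lemma tensor_act_closed:
  assumes "U \<in> carrier (tensor_group K A B)" "Z \<in> carrier (tensor_group K V W)"
  shows "tensor_act K V W f g U Z \<in> carrier (tensor_group K V W)"
proof -
  obtain u where u: "keysAB u" "U = tensor_class K A B u" using tensor_carrier_cases[OF A B assms(1)] .
  obtain z where z: "keysVW z" "Z = tensor_class K V W z" using tensor_carrier_cases[OF V W assms(2)] .
  show ?thesis using u z by (simp add: tensor_act_class tensor_class_closed[OF V W] frag_mult_keys)
qed

lemma tensor_act_add_left:
  assumes "U \<in> carrier (tensor_group K A B)" "U' \<in> carrier (tensor_group K A B)" "Z \<in> carrier (tensor_group K V W)"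
  shows "tensor_act K V W f g (U \<otimes>\<^bsub>tensor_group K A B\<^esub> U') Z =
    tensor_act K V W f g U Z \<otimes>\<^bsub>tensor_group K V W\<^esub> tensor_act K V W f g U' Z"
proof -
  obtain u where u: "keysAB u" "U = tensor_class K A B u" using tensor_carrier_cases[OF A B assms(1)] .
  obtain u' where u': "keysAB u'" "U' = tensor_class K A B u'" using tensor_carrier_cases[OF A B assms(2)] .
  obtain z where z: "keysVW z" "Z = tensor_class K V W z" using tensor_carrier_cases[OF V W assms(3)] .
  show ?thesis using u u' z
    by (simp add: tensor_class_add[OF A B] tensor_class_add[OF V W] tensor_act_class keys_add_le
        frag_mult_simps frag_mult_keys)
qed

lemma tensor_act_add_right:
  assumes "U \<in> carrier (tensor_group K A B)" "Z \<in> carrier (tensor_group K V W)" "Z' \<in> carrier (tensor_group K V W)"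
  shows "tensor_act K V W f g U (Z \<otimes>\<^bsub>tensor_group K V W\<^esub> Z') =
    tensor_act K V W f g U Z \<otimes>\<^bsub>tensor_group K V W\<^esub> tensor_act K V W f g U Z'"
proof -
  obtain u where u: "keysAB u" "U = tensor_class K A B u" using tensor_carrier_cases[OF A B assms(1)] .
  obtain z where z: "keysVW z" "Z = tensor_class K V W z" using tensor_carrier_cases[OF V W assms(2)] .
  obtain z' where z': "keysVW z'" "Z' = tensor_class K V W z'" using tensor_carrier_cases[OF V W assms(3)] .
  show ?thesis using u z z'
    by (simp add: tensor_class_add[OF V W] tensor_act_class keys_add_le frag_mult_simps frag_mult_keys)
qed

lemma tensor_act_pure:
  assumes "a \<in> carrier A" "b \<in> carrier B" "x \<in> carrier V" "y \<in> carrier W"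
  shows "tensor_act K V W f g (pure_tensor K A B a b) (pure_tensor K V W x y) = pure_tensor K V W (f a x) (g b y)"
  using assms by (simp add: pure_tensor_def tensor_act_class keys_frag_of frag_mult_simps)

end

subsection \<open>The tensor product of algebras and of modules\<close>

text \<open>With \<open>f\<close>, \<open>g\<close> equal to \<open>\<mu>\<close>,
  \<open>\<nu>\<close> this is associativity of the tensor algebra; otherwise it is the mixed
  associativity of its action on a tensor module.\<close>

lemma tensor_act_assoc:
  assumes A: "module K A" and B: "module K B" and V: "module K V" and W: "module K W"
    and \<mu>: "bilinear_action K A A \<mu>" and \<nu>: "bilinear_action K B B \<nu>"
    and f: "bilinear_action K A V f" and g: "bilinear_action K B W g"
    and f\<mu>: "\<And>a a' v. \<lbrakk>a \<in> carrier A; a' \<in> carrier A; v \<in> carrier V\<rbrakk> \<Longrightarrow> f (\<mu> a a') v = f a (f a' v)"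
    and g\<nu>: "\<And>b b' w. \<lbrakk>b \<in> carrier B; b' \<in> carrier B; w \<in> carrier W\<rbrakk> \<Longrightarrow> g (\<nu> b b') w = g b (g b' w)"
    and U: "U \<in> carrier (tensor_group K A B)" and U': "U' \<in> carrier (tensor_group K A B)"
    and Z: "Z \<in> carrier (tensor_group K V W)"
  shows "tensor_act K V W f g (tensor_act K A B \<mu> \<nu> U U') Z = tensor_act K V W f g U (tensor_act K V W f g U' Z)"
proof -
  note clR = tensor_act_closed[OF A B A B \<mu> \<nu>] and clM = tensor_act_closed[OF A B V W f g]
  note alR = tensor_act_add_left[OF A B A B \<mu> \<nu>] and arR = tensor_act_add_right[OF A B A B \<mu> \<nu>]
  note alM = tensor_act_add_left[OF A B V W f g] and arM = tensor_act_add_right[OF A B V W f g]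
  note pR = tensor_act_pure[OF A B A B \<mu> \<nu>] and pM = tensor_act_pure[OF A B V W f g]
  note ptR [simp] = pure_tensor_closed[OF A B] and ptM [simp] = pure_tensor_closed[OF V W]
  note \<mu>c = bilinear_actionD(1)[OF \<mu>] and \<nu>c = bilinear_actionD(1)[OF \<nu>]
  note fc = bilinear_actionD(1)[OF f] and gc = bilinear_actionD(1)[OF g]
  interpret R: comm_group "tensor_group K A B" by (rule comm_group_tensor_group[OF A B])
  interpret M: comm_group "tensor_group K V W" by (rule comm_group_tensor_group[OF V W])
  show ?thesis using A B U
  proof (induct U rule: tensor_induct')
    case (pure a b)
    note ab = pure
    show ?case using A B U'
    proof (induct U' rule: tensor_induct')
      case (pure a' b')
      note ab' = pure
      show ?case using V W Z
      proof (induct Z rule: tensor_induct')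
        case (pure x y)
        thus ?case using ab ab' by (simp add: pR pM \<mu>c \<nu>c fc gc f\<mu> g\<nu>)
      next
        case (add Z Z')
        thus ?case using ab ab' by (simp add: arM clM clR)
      qed
    next
      case (add U U')
      thus ?case using ab Z by (simp add: arR arM alM clM clR)
    qed
  next
    case (add U1 U2)
    thus ?case using U' Z by (simp add: alR alM clM clR)
  qed
qed

lemma tensor_act_one:
  assumes A: "module K A" and B: "module K B" and V: "module K V" and W: "module K W"
    and f: "bilinear_action K A V f" and g: "bilinear_action K B W g"
    and one: "e \<in> carrier A" "e' \<in> carrier B" "\<And>v. v \<in> carrier V \<Longrightarrow> f e v = v" "\<And>w. w \<in> carrier W \<Longrightarrow> g e' w = w"
    and Z: "Z \<in> carrier (tensor_group K V W)"
  shows "tensor_act K V W f g (pure_tensor K A B e e') Z = Z"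
  using V W Z
proof (induct Z rule: tensor_induct')
  case (pure x y)
  thus ?case using one by (simp add: tensor_act_pure[OF A B V W f g])
next
  case (add Z Z')
  thus ?case using one by (simp add: tensor_act_add_right[OF A B V W f g] pure_tensor_closed[OF A B])
qed

lemma abelian_group_of_comm_group:
  assumes "comm_group G" "carrier M = carrier G" "add M = monoid.mult G" "ring.zero M = one G"
  shows "abelian_group M"
proof -
  interpret comm_group G by fact
  show ?thesis
    by (rule abelian_groupI) (auto simp: assms(2-4) m_ac intro: bexI[of _ "inv\<^bsub>G\<^esub> _"] l_inv)
qed

lemma tensor_algebra_simps [simp]:
  "carrier (tensor_algebra K A B) = carrier (tensor_group K A B)"
  "monoid.mult (tensor_algebra K A B) = tensor_act K A B (monoid.mult A) (monoid.mult B)"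
  "one (tensor_algebra K A B) = pure_tensor K A B \<one>\<^bsub>A\<^esub> \<one>\<^bsub>B\<^esub>"
  "ring.zero (tensor_algebra K A B) = one (tensor_group K A B)"
  "add (tensor_algebra K A B) = monoid.mult (tensor_group K A B)"
  by (simp_all add: tensor_algebra_def tensor_act_def pure_tensor_def)

lemma tensor_module_simps [simp]:
  "carrier (tensor_module K A B L N) = carrier (tensor_group K (restrict_scalars A L) (restrict_scalars B N))"
  "ring.zero (tensor_module K A B L N) = one (tensor_group K (restrict_scalars A L) (restrict_scalars B N))"
  "add (tensor_module K A B L N) = monoid.mult (tensor_group K (restrict_scalars A L) (restrict_scalars B N))"
  "smult (tensor_module K A B L N) = tensor_act K (restrict_scalars A L) (restrict_scalars B N) (smult L) (smult N)"
  by (simp_all add: tensor_module_def tensor_act_def Let_def)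

lemma bilinear_action_mult:
  assumes "algebra K A"
  shows "bilinear_action K A A (monoid.mult A)"
proof -
  interpret A: cring A by (rule algebra_D[OF assms])
  interpret KA: module K A by (rule algebra_D[OF assms])
  show ?thesis
    unfolding bilinear_action_def using algebra_D(4,5)[OF assms] by (auto simp: A.l_distr A.r_distr)
qed

lemma bilinear_action_smult:
  assumes "algebra K A" "module A L"
  shows "bilinear_action K A (restrict_scalars A L) (smult L)"
proof -
  interpret L: module A L by fact
  interpret KA: module K A by (rule algebra_D[OF assms(1)])
  have 1: "(c \<odot>\<^bsub>A\<^esub> a) \<odot>\<^bsub>L\<^esub> x = (c \<odot>\<^bsub>A\<^esub> \<one>\<^bsub>A\<^esub>) \<odot>\<^bsub>L\<^esub> (a \<odot>\<^bsub>L\<^esub> x)"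
    if "c \<in> carrier K" "a \<in> carrier A" "x \<in> carrier L" for a c x
    using algebra_D(6)[OF assms(1) that(1,2)] that by (simp add: L.smult_assoc1[symmetric])
  have 2: "a \<odot>\<^bsub>L\<^esub> ((c \<odot>\<^bsub>A\<^esub> \<one>\<^bsub>A\<^esub>) \<odot>\<^bsub>L\<^esub> x) = (c \<odot>\<^bsub>A\<^esub> \<one>\<^bsub>A\<^esub>) \<odot>\<^bsub>L\<^esub> (a \<odot>\<^bsub>L\<^esub> x)"
    if "c \<in> carrier K" "a \<in> carrier A" "x \<in> carrier L" for a c x
    using that L.R.m_comm[of a "c \<odot>\<^bsub>A\<^esub> \<one>\<^bsub>A\<^esub>"] by (simp add: L.smult_assoc1[symmetric])
  show ?thesis
    unfolding bilinear_action_def restrict_scalars_simps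
    by (intro conjI ballI; (rule 1 2 L.smult_l_distr L.smult_r_distr L.smult_closed; assumption))
qed

context
  fixes K :: "('k, 'x) ring_scheme" and A :: "('k, 'a, 'x1) module_scheme" and B :: "('k, 'b, 'x2) module_scheme"
  assumes A: "algebra K A" and B: "algebra K B"
begin

interpretation A: cring A by (rule algebra_D[OF A])
interpretation B: cring B by (rule algebra_D[OF B])
interpretation KA: module K A by (rule algebra_D[OF A])
interpretation KB: module K B by (rule algebra_D[OF B])

private abbreviation "R \<equiv> tensor_algebra K A B"
private abbreviation "ptAB \<equiv> pure_tensor K A B"

private lemmas KAm = KA.module_axioms
private lemmas KBm = KB.module_axioms
private lemmas mA = bilinear_action_mult[OF A]
private lemmas mB = bilinear_action_mult[OF B]

lemma tensor_algebra_induct [consumes 1, case_names pure add]: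
  assumes "U \<in> carrier R" "\<And>a b. \<lbrakk>a \<in> carrier A; b \<in> carrier B\<rbrakk> \<Longrightarrow> P (ptAB a b)"
    and "\<And>U U'. \<lbrakk>U \<in> carrier R; U' \<in> carrier R; P U; P U'\<rbrakk> \<Longrightarrow> P (U \<oplus>\<^bsub>R\<^esub> U')"
  shows "P U"
  using tensor_induct[OF KAm KBm, of U P] assms by simp

lemma cring_tensor_algebra: "cring R"
proof (rule cringI)
  show "abelian_group R"
    by (rule abelian_group_of_comm_group[OF comm_group_tensor_group[OF KAm KBm]]) simp_all
  have one: "\<one>\<^bsub>R\<^esub> \<otimes>\<^bsub>R\<^esub> Z = Z" if "Z \<in> carrier R" for Z
    using tensor_act_one[OF KAm KBm KAm KBm mA mB, of "\<one>\<^bsub>A\<^esub>" "\<one>\<^bsub>B\<^esub>" Z] that by simp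
  have cl: "U \<otimes>\<^bsub>R\<^esub> Z \<in> carrier R" if "U \<in> carrier R" "Z \<in> carrier R" for U Z
    using tensor_act_closed[OF KAm KBm KAm KBm mA mB] that by simp
  have dl: "(U \<oplus>\<^bsub>R\<^esub> U') \<otimes>\<^bsub>R\<^esub> Z = U \<otimes>\<^bsub>R\<^esub> Z \<oplus>\<^bsub>R\<^esub> U' \<otimes>\<^bsub>R\<^esub> Z"
    if "U \<in> carrier R" "U' \<in> carrier R" "Z \<in> carrier R" for U U' Z
    using tensor_act_add_left[OF KAm KBm KAm KBm mA mB] that by simp
  have dr: "Z \<otimes>\<^bsub>R\<^esub> (U \<oplus>\<^bsub>R\<^esub> U') = Z \<otimes>\<^bsub>R\<^esub> U \<oplus>\<^bsub>R\<^esub> Z \<otimes>\<^bsub>R\<^esub> U'"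
    if "U \<in> carrier R" "U' \<in> carrier R" "Z \<in> carrier R" for U U' Z
    using tensor_act_add_right[OF KAm KBm KAm KBm mA mB] that by simp
  have comm: "U \<otimes>\<^bsub>R\<^esub> Z = Z \<otimes>\<^bsub>R\<^esub> U" if U: "U \<in> carrier R" and Z: "Z \<in> carrier R" for U Z
    using U
  proof (induct U rule: tensor_algebra_induct)
    case (pure a b)
    note ab = pure
    show ?case using Z
    proof (induct Z rule: tensor_algebra_induct)
      case (pure x y)
      thus ?case using ab tensor_act_pure[OF KAm KBm KAm KBm mA mB] by (simp add: A.m_comm B.m_comm)
    next
      case (add Z Z')
      have "ptAB a b \<in> carrier R" using ab pure_tensor_closed[OF KAm KBm] by simp
      thus ?case using add by (simp only: dr dl)
    qed
  next
    case (add U U')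
    thus ?case using Z by (simp only: dr dl)
  qed
  show "Group.comm_monoid R"
  proof (rule comm_monoidI)
    show "\<one>\<^bsub>R\<^esub> \<in> carrier R" using pure_tensor_closed[OF KAm KBm] by simp
    fix x y z assume "x \<in> carrier R" "y \<in> carrier R" "z \<in> carrier R"
    hence xyz: "x \<in> carrier (tensor_group K A B)" "y \<in> carrier (tensor_group K A B)"
      "z \<in> carrier (tensor_group K A B)" by simp_all
    show "x \<otimes>\<^bsub>R\<^esub> y \<otimes>\<^bsub>R\<^esub> z = x \<otimes>\<^bsub>R\<^esub> (y \<otimes>\<^bsub>R\<^esub> z)"
      unfolding tensor_algebra_simps
      by (rule tensor_act_assoc[OF KAm KBm KAm KBm mA mB mA mB _ _ xyz]) (rule A.m_assoc B.m_assoc; assumption)+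
  qed (rule one cl comm; assumption)+
  show "\<And>x y z. \<lbrakk>x \<in> carrier R; y \<in> carrier R; z \<in> carrier R\<rbrakk> \<Longrightarrow>
     (x \<oplus>\<^bsub>R\<^esub> y) \<otimes>\<^bsub>R\<^esub> z = x \<otimes>\<^bsub>R\<^esub> z \<oplus>\<^bsub>R\<^esub> y \<otimes>\<^bsub>R\<^esub> z" by (rule dl)
qed

lemma tensor_algebra_mult_pure:
  assumes "a \<in> carrier A" "b \<in> carrier B" "a' \<in> carrier A" "b' \<in> carrier B"
  shows "ptAB a b \<otimes>\<^bsub>R\<^esub> ptAB a' b' = ptAB (a \<otimes>\<^bsub>A\<^esub> a') (b \<otimes>\<^bsub>B\<^esub> b')"
  using tensor_act_pure[OF KAm KBm KAm KBm mA mB] assms by simp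

lemma smult_module_hom:
  assumes "module K V" "c \<in> carrier K"
  shows "(\<lambda>x. c \<odot>\<^bsub>V\<^esub> x) \<in> module_hom K V V"
proof -
  interpret V: module K V by fact
  show ?thesis
    using assms KA.R.m_comm by (intro module_homI) (auto simp: V.smult_r_distr V.smult_assoc1[symmetric])
qed

text \<open>The scalar action has a formula of its own on representatives. Its identification with a
  tensor product of linear maps gives closure and additivity.\<close>

lemma tensor_algebra_smult:
  assumes c: "c \<in> carrier K" and U: "U \<in> carrier R"
  shows "c \<odot>\<^bsub>R\<^esub> U = tensor_map K A B A B (\<lambda>a. c \<odot>\<^bsub>A\<^esub> a) (\<lambda>b. b) U"
proof -
  let ?h = "tensor_map K A B A B (\<lambda>a. c \<odot>\<^bsub>A\<^esub> a) (\<lambda>b. b)"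
  let ?e = "\<lambda>u. frag_extend (\<lambda>(a, b). frag_of (c \<odot>\<^bsub>A\<^esub> a, b)) u"
  have id: "(\<lambda>b. b) \<in> module_hom K B B" by (rule module_homI) auto
  note h = tensor_map[OF KAm KBm KAm KBm smult_module_hom[OF KAm c] id]
  obtain u where u: "Poly_Mapping.keys u \<subseteq> carrier A \<times> carrier B" "U = tensor_class K A B u"
    using tensor_carrier_cases[OF KAm KBm] U by auto
  have keys: "Poly_Mapping.keys (?e u) \<subseteq> carrier A \<times> carrier B"
    if "Poly_Mapping.keys u \<subseteq> carrier A \<times> carrier B" for u
    using that
  proof (induct u rule: frag_induct)
    case (one p)
    thus ?case using c by (cases p) (simp add: keys_frag_of)
  qed (simp_all add: frag_extend_diff keys_diff_le)
  have ext: "tensor_class K A B (?e u) = ?h (tensor_class K A B u)"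
    if "Poly_Mapping.keys u \<subseteq> carrier A \<times> carrier B" for u
  proof (rule tensor_hom_class_ext[OF KAm KBm _ h(1) that])
    show "group (tensor_group K A B)" using comm_group_tensor_group[OF KAm KBm] by (simp add: comm_group_def)
  qed (simp_all add: frag_extend_add tensor_class_add[OF KAm KBm] keys tensor_class_closed[OF KAm KBm]
        h(2) pure_tensor_def[symmetric])
  have "tensor_class K A B (?e v) = ?h U" if "v \<in> U" for v
    using that u ext tensor_class_mem[OF KAm KBm, of u v] tensor_class_eqI[OF KAm KBm, of u v] by simp
  moreover have "U \<noteq> {}" using tensor_class_self[OF KAm KBm] u by blast
  ultimately show ?thesis by (simp add: tensor_algebra_def)
qed

lemma tensor_algebra_smult_pure:
  assumes "c \<in> carrier K" "a \<in> carrier A" "b \<in> carrier B"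
  shows "c \<odot>\<^bsub>R\<^esub> ptAB a b = ptAB (c \<odot>\<^bsub>A\<^esub> a) b"
proof -
  have id: "(\<lambda>b. b) \<in> module_hom K B B" by (rule module_homI) auto
  show ?thesis
    using assms tensor_algebra_smult[of c "ptAB a b"] pure_tensor_closed[OF KAm KBm]
      tensor_map(2)[OF KAm KBm KAm KBm smult_module_hom[OF KAm assms(1)] id] by simp
qed

text \<open>The algebra structure is required because injective resolutions over the tensor algebra
  are built from modules coinduced from \<open>K\<close>.\<close>

lemma algebra_tensor_algebra: "algebra K R"
proof (rule algebraI[OF KA.R.is_cring cring_tensor_algebra])
  interpret R: cring R by (rule cring_tensor_algebra)
  have id: "(\<lambda>b. b) \<in> module_hom K B B" by (rule module_homI) auto
  have cl: "c \<odot>\<^bsub>R\<^esub> U \<in> carrier R" if "c \<in> carrier K" "U \<in> carrier R" for c U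
    using tensor_algebra_smult[OF that] hom_in_carrier[OF tensor_map(1)[OF KAm KBm KAm KBm smult_module_hom[OF KAm
      that(1)] id]] that
    by simp
  have add: "c \<odot>\<^bsub>R\<^esub> (U \<oplus>\<^bsub>R\<^esub> U') = c \<odot>\<^bsub>R\<^esub> U \<oplus>\<^bsub>R\<^esub> c \<odot>\<^bsub>R\<^esub> U'"
    if "c \<in> carrier K" "U \<in> carrier R" "U' \<in> carrier R" for c U U'
    using tensor_algebra_smult[OF that(1,2)] tensor_algebra_smult[OF that(1,3)]
      tensor_algebra_smult[OF that(1) R.a_closed[OF that(2,3)]] that
      hom_mult[OF tensor_map(1)[OF KAm KBm KAm KBm smult_module_hom[OF KAm that(1)] id], of U U'] by simp
  have ptc: "ptAB a b \<in> carrier R" if "a \<in> carrier A" "b \<in> carrier B" for a b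
    using that pure_tensor_closed[OF KAm KBm] by simp
  show "\<And>c U. \<lbrakk>c \<in> carrier K; U \<in> carrier R\<rbrakk> \<Longrightarrow> c \<odot>\<^bsub>R\<^esub> U \<in> carrier R" by (rule cl)
  show "\<And>c U U'. \<lbrakk>c \<in> carrier K; U \<in> carrier R; U' \<in> carrier R\<rbrakk> \<Longrightarrow>
     c \<odot>\<^bsub>R\<^esub> (U \<oplus>\<^bsub>R\<^esub> U') = c \<odot>\<^bsub>R\<^esub> U \<oplus>\<^bsub>R\<^esub> c \<odot>\<^bsub>R\<^esub> U'" by (rule add)
  show "(c \<oplus>\<^bsub>K\<^esub> c') \<odot>\<^bsub>R\<^esub> U = c \<odot>\<^bsub>R\<^esub> U \<oplus>\<^bsub>R\<^esub> c' \<odot>\<^bsub>R\<^esub> U" if "c \<in> carrier K" "c' \<in> carrier K" "U \<in> carrier R" for c c' U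
    using that(3)
  proof (induct U rule: tensor_algebra_induct)
    case (pure a b)
    thus ?case using that(1,2) pure_tensor_add_left[OF KAm KBm, of "c \<odot>\<^bsub>A\<^esub> a" "c' \<odot>\<^bsub>A\<^esub> a" b]
      by (simp add: tensor_algebra_smult_pure KA.smult_l_distr)
  next
    case (add U U')
    have "(c \<oplus>\<^bsub>K\<^esub> c') \<odot>\<^bsub>R\<^esub> (U \<oplus>\<^bsub>R\<^esub> U') = (c \<odot>\<^bsub>R\<^esub> U \<oplus>\<^bsub>R\<^esub> c' \<odot>\<^bsub>R\<^esub> U) \<oplus>\<^bsub>R\<^esub> (c \<odot>\<^bsub>R\<^esub> U' \<oplus>\<^bsub>R\<^esub> c' \<odot>\<^bsub>R\<^esub> U')"
      using add that(1,2) \<open>\<And>c U U'. \<lbrakk>c \<in> carrier K; U \<in> carrier R; U' \<in> carrier R\<rbrakk> \<Longrightarrow>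
     c \<odot>\<^bsub>R\<^esub> (U \<oplus>\<^bsub>R\<^esub> U') = c \<odot>\<^bsub>R\<^esub> U \<oplus>\<^bsub>R\<^esub> c \<odot>\<^bsub>R\<^esub> U'\<close> by (metis KA.R.a_closed)
    also have "\<dots> = (c \<odot>\<^bsub>R\<^esub> U \<oplus>\<^bsub>R\<^esub> c \<odot>\<^bsub>R\<^esub> U') \<oplus>\<^bsub>R\<^esub> (c' \<odot>\<^bsub>R\<^esub> U \<oplus>\<^bsub>R\<^esub> c' \<odot>\<^bsub>R\<^esub> U')"
      using cl add(1,2) that(1,2) by (simp only: R.a_ac R.a_closed)
    finally show ?case
      using \<open>\<And>c U U'. \<lbrakk>c \<in> carrier K; U \<in> carrier R; U' \<in> carrier R\<rbrakk> \<Longrightarrow>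
     c \<odot>\<^bsub>R\<^esub> (U \<oplus>\<^bsub>R\<^esub> U') = c \<odot>\<^bsub>R\<^esub> U \<oplus>\<^bsub>R\<^esub> c \<odot>\<^bsub>R\<^esub> U'\<close> add(1,2) that(1,2) by metis
  qed
  note dr = add
  show "(c \<otimes>\<^bsub>K\<^esub> c') \<odot>\<^bsub>R\<^esub> U = c \<odot>\<^bsub>R\<^esub> (c' \<odot>\<^bsub>R\<^esub> U)" if "c \<in> carrier K" "c' \<in> carrier K" "U \<in> carrier R" for c c' U
    using that(3)
  proof (induct U rule: tensor_algebra_induct)
    case (pure a b)
    thus ?case using that(1,2) by (simp add: tensor_algebra_smult_pure KA.smult_assoc1)
  next
    case (add U U')
    have cc: "c \<otimes>\<^bsub>K\<^esub> c' \<in> carrier K" using that by simp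
    show ?case
      unfolding dr[OF cc add(1,2)] dr[OF that(2) add(1,2)] dr[OF that(1) cl[OF that(2) add(1)] cl[OF that(2) add(2)]]
        add(3,4) ..
  qed
  show "\<one>\<^bsub>K\<^esub> \<odot>\<^bsub>R\<^esub> U = U" if "U \<in> carrier R" for U
    using that
  proof (induct U rule: tensor_algebra_induct)
    case (pure a b)
    thus ?case by (simp add: tensor_algebra_smult_pure)
  next
    case (add U U')
    show ?case unfolding dr[OF KA.R.one_closed add(1,2)] add(3,4) ..
  qed
  show "(c \<odot>\<^bsub>R\<^esub> U) \<otimes>\<^bsub>R\<^esub> Z = c \<odot>\<^bsub>R\<^esub> (U \<otimes>\<^bsub>R\<^esub> Z)" if c: "c \<in> carrier K" and U: "U \<in> carrier R" and Z: "Z \<in> carrier R" for c U Z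
    using U
  proof (induct U rule: tensor_algebra_induct)
    case (pure a b)
    note ab = pure
    have ab': "ptAB a b \<in> carrier R" "c \<odot>\<^bsub>R\<^esub> ptAB a b \<in> carrier R" using ptc[OF ab] cl[OF c] by auto
    show ?case using Z
    proof (induct Z rule: tensor_algebra_induct)
      case (pure x y)
      have "c \<odot>\<^bsub>A\<^esub> a \<in> carrier A" "a \<otimes>\<^bsub>A\<^esub> x \<in> carrier A" "b \<otimes>\<^bsub>B\<^esub> y \<in> carrier B" using ab pure c by auto
      thus ?case using ab pure c algebra_D(4)[OF A]
        by (simp only: tensor_algebra_mult_pure tensor_algebra_smult_pure)
    next
      case (add Z Z')
      show ?case
        unfolding R.r_distr[OF add(1,2) ab'(2)] R.r_distr[OF add(1,2) ab'(1)] add(3,4)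
          dr[OF c R.m_closed[OF ab'(1) add(1)] R.m_closed[OF ab'(1) add(2)]] ..
    qed
  next
    case (add U U')
    show ?case
      unfolding dr[OF c add(1,2)] R.l_distr[OF add(1,2) Z] R.l_distr[OF cl[OF c add(1)] cl[OF c add(2)] Z] add(3,4)
        dr[OF c R.m_closed[OF add(1) Z] R.m_closed[OF add(2) Z]] ..
  qed
qed

end

lemmas tensor_algebra_induct' = tensor_algebra_induct [consumes 3, case_names pure add]

context
  fixes K :: "('k, 'x) ring_scheme" and A :: "('k, 'a, 'x1) module_scheme" and B :: "('k, 'b, 'x2) module_scheme"
    and L :: "('a, 'l, 'y1) module_scheme" and N :: "('b, 'n, 'y2) module_scheme"
  assumes A: "algebra K A" and B: "algebra K B" and L: "module A L" and N: "module B N"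
begin

interpretation A: cring A by (rule algebra_D[OF A])
interpretation B: cring B by (rule algebra_D[OF B])
interpretation KA: module K A by (rule algebra_D[OF A])
interpretation KB: module K B by (rule algebra_D[OF B])
interpretation L: module A L by (rule L)
interpretation N: module B N by (rule N)

private abbreviation "RT \<equiv> tensor_algebra K A B"
private abbreviation "VL \<equiv> restrict_scalars A L"
private abbreviation "WN \<equiv> restrict_scalars B N"
private abbreviation "TM \<equiv> tensor_module K A B L N"
private lemmas KAm2 = KA.module_axioms
private lemmas KBm2 = KB.module_axioms
private lemmas modV = module_restrict_scalars[OF A L]
private lemmas modW = module_restrict_scalars[OF B N]
private lemmas mA2 = bilinear_action_mult[OF A]
private lemmas mB2 = bilinear_action_mult[OF B]
private lemmas fL = bilinear_action_smult[OF A L]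
private lemmas gN = bilinear_action_smult[OF B N]

lemma module_tensor_module: "module RT TM"
proof (rule moduleI[OF cring_tensor_algebra[OF A B]])
  show "abelian_group TM"
    by (rule abelian_group_of_comm_group[OF comm_group_tensor_group[OF modV modW]]) simp_all
  show "\<And>r x. \<lbrakk>r \<in> carrier RT; x \<in> carrier TM\<rbrakk> \<Longrightarrow> r \<odot>\<^bsub>TM\<^esub> x \<in> carrier TM"
    using tensor_act_closed[OF KAm2 KBm2 modV modW fL gN] by simp
  show "\<And>r s x. \<lbrakk>r \<in> carrier RT; s \<in> carrier RT; x \<in> carrier TM\<rbrakk> \<Longrightarrow> (r \<oplus>\<^bsub>RT\<^esub> s) \<odot>\<^bsub>TM\<^esub> x = r \<odot>\<^bsub>TM\<^esub> x \<oplus>\<^bsub>TM\<^esub> s \<odot>\<^bsub>TM\<^esub> x"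
    using tensor_act_add_left[OF KAm2 KBm2 modV modW fL gN] by simp
  show "\<And>r x y. \<lbrakk>r \<in> carrier RT; x \<in> carrier TM; y \<in> carrier TM\<rbrakk> \<Longrightarrow> r \<odot>\<^bsub>TM\<^esub> (x \<oplus>\<^bsub>TM\<^esub> y) = r \<odot>\<^bsub>TM\<^esub> x \<oplus>\<^bsub>TM\<^esub> r \<odot>\<^bsub>TM\<^esub> y"
    using tensor_act_add_right[OF KAm2 KBm2 modV modW fL gN] by simp
  show "\<And>r s x. \<lbrakk>r \<in> carrier RT; s \<in> carrier RT; x \<in> carrier TM\<rbrakk> \<Longrightarrow> (r \<otimes>\<^bsub>RT\<^esub> s) \<odot>\<^bsub>TM\<^esub> x = r \<odot>\<^bsub>TM\<^esub> (s \<odot>\<^bsub>TM\<^esub> x)"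
    using tensor_act_assoc[OF KAm2 KBm2 modV modW mA2 mB2 fL gN] by (simp add: L.smult_assoc1 N.smult_assoc1)
  show "\<And>x. x \<in> carrier TM \<Longrightarrow> \<one>\<^bsub>RT\<^esub> \<odot>\<^bsub>TM\<^esub> x = x"
    using tensor_act_one[OF KAm2 KBm2 modV modW fL gN, of "\<one>\<^bsub>A\<^esub>" "\<one>\<^bsub>B\<^esub>"] by simp
qed

lemma tensor_module_induct [consumes 1, case_names pure add]:
  assumes "U \<in> carrier TM" "\<And>x y. \<lbrakk>x \<in> carrier L; y \<in> carrier N\<rbrakk> \<Longrightarrow> P (pure_tensor K VL WN x y)"
    and "\<And>U U'. \<lbrakk>U \<in> carrier TM; U' \<in> carrier TM; P U; P U'\<rbrakk> \<Longrightarrow> P (U \<oplus>\<^bsub>TM\<^esub> U')"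
  shows "P U"
  using tensor_induct[OF modV modW, of U P] assms by simp

lemma tensor_module_pure:
  assumes "x \<in> carrier L" "y \<in> carrier N"
  shows "pure_tensor K VL WN x y \<in> carrier TM"
    and "x' \<in> carrier L \<Longrightarrow> pure_tensor K VL WN (x \<oplus>\<^bsub>L\<^esub> x') y = pure_tensor K VL WN x y \<oplus>\<^bsub>TM\<^esub> pure_tensor K VL WN x' y"
    and "y' \<in> carrier N \<Longrightarrow> pure_tensor K VL WN x (y \<oplus>\<^bsub>N\<^esub> y') = pure_tensor K VL WN x y \<oplus>\<^bsub>TM\<^esub> pure_tensor K VL WN x y'"
    and "pure_tensor K VL WN \<zero>\<^bsub>L\<^esub> y = \<zero>\<^bsub>TM\<^esub>" "pure_tensor K VL WN x \<zero>\<^bsub>N\<^esub> = \<zero>\<^bsub>TM\<^esub>"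
    and "\<lbrakk>a \<in> carrier A; b \<in> carrier B\<rbrakk> \<Longrightarrow>
       pure_tensor K A B a b \<odot>\<^bsub>TM\<^esub> pure_tensor K VL WN x y = pure_tensor K VL WN (a \<odot>\<^bsub>L\<^esub> x) (b \<odot>\<^bsub>N\<^esub> y)"
  using assms pure_tensor_closed[OF modV modW, of x y] pure_tensor_add_left[OF modV modW, of x x' y]
    pure_tensor_add_right[OF modV modW, of x y y'] pure_tensor_zero(1)[OF modV modW, of y]
        pure_tensor_zero(2)[OF modV modW, of x]
    tensor_act_pure[OF KAm2 KBm2 modV modW fL gN, of a b x y]
  by simp_all

end

lemmas tensor_module_induct' = tensor_module_induct [consumes 5, case_names pure add]

definition tensor_module_map where
  "tensor_module_map K A B L N L' N' =
     tensor_map K (restrict_scalars A L) (restrict_scalars B N) (restrict_scalars A L') (restrict_scalars B N')"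

context
  fixes K :: "('k, 'x) ring_scheme" and A :: "('k, 'a, 'x1) module_scheme" and B :: "('k, 'b, 'x2) module_scheme"
    and L :: "('a, 'l, 'y1) module_scheme" and N :: "('b, 'n, 'y2) module_scheme"
    and L' :: "('a, 'l2, 'y3) module_scheme" and N' :: "('b, 'n2, 'y4) module_scheme" and f g
  assumes A: "algebra K A" and B: "algebra K B" and L: "module A L" and N: "module B N"
    and L': "module A L'" and N': "module B N'"
    and f: "f \<in> module_hom K (restrict_scalars A L) (restrict_scalars A L')"
    and g: "g \<in> module_hom K (restrict_scalars B N) (restrict_scalars B N')"
begin

private lemmas m = module_restrict_scalars[OF A L] module_restrict_scalars[OF B N]
  module_restrict_scalars[OF A L'] module_restrict_scalars[OF B N']

text \<open>The maps are only assumed to be linear over \<open>K\<close>, because the generalized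
  inverses in homotopies and projections need not be linear over \<open>A\<close> or
  \<open>B\<close>.\<close>

lemma tensor_module_map:
  shows "U \<in> carrier (tensor_module K A B L N) \<Longrightarrow>
      tensor_module_map K A B L N L' N' f g U \<in> carrier (tensor_module K A B L' N')"
    and "\<lbrakk>U \<in> carrier (tensor_module K A B L N); U' \<in> carrier (tensor_module K A B L N)\<rbrakk> \<Longrightarrow>
      tensor_module_map K A B L N L' N' f g (U \<oplus>\<^bsub>tensor_module K A B L N\<^esub> U') =
      tensor_module_map K A B L N L' N' f g U \<oplus>\<^bsub>tensor_module K A B L' N'\<^esub> tensor_module_map K A B L N L' N' f g U'"
    and "\<lbrakk>x \<in> carrier L; y \<in> carrier N\<rbrakk> \<Longrightarrow>
      tensor_module_map K A B L N L' N' f g (pure_tensor K (restrict_scalars A L) (restrict_scalars B N) x y) =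
      pure_tensor K (restrict_scalars A L') (restrict_scalars B N') (f x) (g y)"
  using hom_in_carrier[OF tensor_map(1)[OF m f g]] hom_mult[OF tensor_map(1)[OF m f g]] tensor_map(2)[OF m f g]
  by (simp_all add: tensor_module_map_def)

lemma tensor_module_map_hom:
  assumes fA: "f \<in> module_hom A L L'" and gB: "g \<in> module_hom B N N'"
  shows "tensor_module_map K A B L N L' N' f g \<in>
    module_hom (tensor_algebra K A B) (tensor_module K A B L N) (tensor_module K A B L' N')"
proof (rule module_homI)
  let ?h = "tensor_module_map K A B L N L' N' f g" and ?T = "tensor_module K A B L N"
    and ?T' = "tensor_module K A B L' N'" and ?R = "tensor_algebra K A B"
  interpret T: module ?R ?T by (rule module_tensor_module[OF A B L N])
  interpret T': module ?R ?T' by (rule module_tensor_module[OF A B L' N'])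
  interpret L: module A L by (rule L)
  interpret N: module B N by (rule N)
  fix r U assume r: "r \<in> carrier ?R" and U: "U \<in> carrier ?T"
  show "?h (r \<odot>\<^bsub>?T\<^esub> U) = r \<odot>\<^bsub>?T'\<^esub> ?h U"
    using A B r
  proof (induct r rule: tensor_algebra_induct')
    case (pure a b)
    note ab = pure
    have p: "pure_tensor K A B a b \<in> carrier ?R"
      using ab pure_tensor_closed[OF algebra_D(3)[OF A] algebra_D(3)[OF B]] by simp
    show ?case using A B L N U
    proof (induct U rule: tensor_module_induct')
      case (pure x y)
      show ?case
        using ab pure module_homD[OF fA] module_homD[OF gB]
        by (simp only: tensor_module_map(3) tensor_module_pure(6)[OF A B L N] tensor_module_pure(6)[OF A B L' N']
            L.smult_closed N.smult_closed)
    next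
      case (add U U')
      show ?case
        using add p by (simp only: tensor_module_map(1,2) T.smult_r_distr T'.smult_r_distr T.smult_closed)
    qed
  next
    case (add r s)
    show ?case
      using add U by (simp only: tensor_module_map(1,2) T.smult_l_distr T'.smult_l_distr T.smult_closed)
  qed
qed (rule tensor_module_map(1,2); assumption)+

end

subsection \<open>The ideal \<open>I \<otimes> B + A \<otimes> J\<close>\<close>

text \<open>Turns torsion for I \<otimes> B + A \<otimes> J into iterated torsion for the elements x
  \<otimes> 1 and 1 \<otimes> y, each of which acts on one factor only.\<close>

lemma tensor_ideal_eq:
  assumes A: "algebra K A" and B: "algebra K B" and S: "S \<subseteq> carrier A" and S': "S' \<subseteq> carrier B"
  shows "tensor_ideal K A B (Idl\<^bsub>A\<^esub> S) (Idl\<^bsub>B\<^esub> S') =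
    Idl\<^bsub>tensor_algebra K A B\<^esub> ((\<lambda>x. pure_tensor K A B x \<one>\<^bsub>B\<^esub>) ` S \<union> (\<lambda>y. pure_tensor K A B \<one>\<^bsub>A\<^esub> y) ` S')"
proof -
  let ?R = "tensor_algebra K A B" and ?pt = "pure_tensor K A B"
  let ?Z = "(\<lambda>x. ?pt x \<one>\<^bsub>B\<^esub>) ` S \<union> (\<lambda>y. ?pt \<one>\<^bsub>A\<^esub> y) ` S'"
  interpret A: cring A by (rule algebra_D[OF A])
  interpret B: cring B by (rule algebra_D[OF B])
  interpret KA: module K A by (rule algebra_D[OF A])
  interpret KB: module K B by (rule algebra_D[OF B])
  interpret R: cring ?R by (rule cring_tensor_algebra[OF A B])
  have I: "ideal (Idl\<^bsub>A\<^esub> S) A" by (rule A.genideal_ideal[OF S])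
  have J: "ideal (Idl\<^bsub>B\<^esub> S') B" by (rule B.genideal_ideal[OF S'])
  have pt: "?pt a b \<in> carrier ?R" if "a \<in> carrier A" "b \<in> carrier B" for a b
    using pure_tensor_closed[OF KA.module_axioms KB.module_axioms] that by simp
  have pta: "?pt (a \<oplus>\<^bsub>A\<^esub> a') b = ?pt a b \<oplus>\<^bsub>?R\<^esub> ?pt a' b" if "a \<in> carrier A" "a' \<in> carrier A" "b \<in> carrier B" for a a' b
    using pure_tensor_add_left[OF KA.module_axioms KB.module_axioms] that by simp
  have ptb: "?pt a (b \<oplus>\<^bsub>B\<^esub> b') = ?pt a b \<oplus>\<^bsub>?R\<^esub> ?pt a b'" if "a \<in> carrier A" "b \<in> carrier B" "b' \<in> carrier B" for a b b'
    using pure_tensor_add_right[OF KA.module_axioms KB.module_axioms] that by simp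
  note ptm = tensor_algebra_mult_pure[OF A B]
  have image_ideal: "ideal (tensor_image K A B C D) ?R" if C: "ideal C A" and D: "ideal D B" for C D
  proof -
    interpret C: ideal C A by (rule C)
    interpret D: ideal D B by (rule D)
    let ?gens = "{tensor_class K A B (frag_of (s, t)) | s t. s \<in> C \<and> t \<in> D}"
    let ?G = "tensor_image K A B C D"
    have gens: "?gens \<subseteq> carrier ?R" using pt C.Icarr D.Icarr by (auto simp: pure_tensor_def)
    have G: "subgroup ?G (add_monoid ?R)"
      unfolding tensor_image_def using R.add.generate_is_subgroup[of ?gens] gens by simp
    have Gpt: "?pt s t \<in> ?G" if "s \<in> C" "t \<in> D" for s t
      unfolding tensor_image_def pure_tensor_def by (rule generate.incl) (use that in blast)
    have Gc: "?G \<subseteq> carrier ?R" using subgroup.subset[OF G] by simp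
    have Ga: "u \<oplus>\<^bsub>?R\<^esub> v \<in> ?G" if "u \<in> ?G" "v \<in> ?G" for u v using subgroup.m_closed[OF G that] by simp
    have G0: "\<zero>\<^bsub>?R\<^esub> \<in> ?G" using subgroup.one_closed[OF G] by simp
    have Gn: "\<ominus>\<^bsub>?R\<^esub> u \<in> ?G" if "u \<in> ?G" for u using subgroup.m_inv_closed[OF G that] by (simp add: a_inv_def)
    \<comment> \<open>To see that the generated group is an ideal, consider the u whose multiples
      all lie in it; they form a subgroup that contains the generators.\<close>
    let ?H = "{u \<in> carrier ?R. \<forall>r\<in>carrier ?R. r \<otimes>\<^bsub>?R\<^esub> u \<in> ?G}"
    have "?G \<subseteq> ?H"
      unfolding tensor_image_def[of K A B C D, THEN arg_cong[of _ _ "\<lambda>G. G \<subseteq> ?H"]]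
    proof (rule R.add.generate_subgroup_incl)
      show "subgroup ?H (add_monoid ?R)"
      proof
        show "?H \<subseteq> carrier (add_monoid ?R)" by auto
        fix u v assume "u \<in> ?H" "v \<in> ?H"
        thus "u \<otimes>\<^bsub>add_monoid ?R\<^esub> v \<in> ?H"
          using Ga R.a_closed R.r_distr[of u v] by (simp del: tensor_algebra_simps)
      next
        show "\<one>\<^bsub>add_monoid ?R\<^esub> \<in> ?H" using G0 by (simp del: tensor_algebra_simps)
      next
        fix u assume "u \<in> ?H"
        thus "inv\<^bsub>add_monoid ?R\<^esub> u \<in> ?H"
          using Gn by (simp add: a_inv_def[symmetric] R.r_minus del: tensor_algebra_simps)
      qed
      have mG: "r \<otimes>\<^bsub>?R\<^esub> ?pt s t \<in> ?G" if "s \<in> C" "t \<in> D" "r \<in> carrier ?R" for s t r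
        using A B that(3)
      proof (induct r rule: tensor_algebra_induct')
        case (pure a b)
        thus ?case using that ptm[OF pure] C.Icarr D.Icarr Gpt C.I_l_closed D.I_l_closed
          by (simp del: tensor_algebra_simps)
      next
        case (add u v)
        have "?pt s t \<in> carrier ?R" using that pt C.Icarr D.Icarr by blast
        thus ?case using add Ga by (simp only: R.l_distr)
      qed
      show "?gens \<subseteq> ?H"
      proof
        fix u assume u: "u \<in> ?gens"
        then obtain s t where st: "s \<in> C" "t \<in> D" "u = ?pt s t" by (auto simp: pure_tensor_def)
        have "u \<in> carrier ?R" using u gens by (rule rev_subsetD)
        thus "u \<in> ?H" using mG[OF st(1,2)] st(3) by blast
      qed
    qed
    hence m: "r \<otimes>\<^bsub>?R\<^esub> u \<in> ?G" if "u \<in> ?G" "r \<in> carrier ?R" for u r using that by blast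
    show ?thesis
    proof (rule idealI[OF R.ring_axioms G])
      show "\<And>a x. \<lbrakk>a \<in> ?G; x \<in> carrier ?R\<rbrakk> \<Longrightarrow> x \<otimes>\<^bsub>?R\<^esub> a \<in> ?G" by (rule m)
      fix a x assume a: "a \<in> ?G" and x: "x \<in> carrier ?R"
      have "a \<in> carrier ?R" using Gc a by (rule subsetD)
      thus "a \<otimes>\<^bsub>?R\<^esub> x \<in> ?G" using m[OF a x] by (simp only: R.m_comm[OF x])
    qed
  qed
  have G0: "\<zero>\<^bsub>?R\<^esub> \<in> tensor_image K A B C D" if "ideal C A" "ideal D B" for C D
    using additive_subgroup.zero_closed[OF ideal.axioms(1)[OF image_ideal[OF that]]] .
  have ptG: "?pt s t \<in> tensor_image K A B C D" if "s \<in> C" "t \<in> D" for s t C D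
    unfolding tensor_image_def pure_tensor_def by (rule generate.incl) (use that in blast)
  have gens_sub: "{tensor_class K A B (frag_of (s, t)) | s t. s \<in> C \<and> t \<in> D} \<subseteq> H"
    if "\<And>s t. \<lbrakk>s \<in> C; t \<in> D\<rbrakk> \<Longrightarrow> ?pt s t \<in> H" for C D H
    using that by (auto simp: pure_tensor_def)
  have Zc: "?Z \<subseteq> carrier ?R" using S S' pt A.one_closed B.one_closed by blast
  let ?I = "Idl\<^bsub>?R\<^esub> ?Z"
  interpret I': ideal ?I ?R by (rule R.genideal_ideal[OF Zc])
  have ti: "tensor_ideal K A B (Idl\<^bsub>A\<^esub> S) (Idl\<^bsub>B\<^esub> S') =
      {u \<oplus>\<^bsub>?R\<^esub> v | u v. u \<in> tensor_image K A B (Idl\<^bsub>A\<^esub> S) (carrier B) \<and> v \<in> tensor_image K A B (carrier A) (Idl\<^bsub>B\<^esub> S')}"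
    unfolding tensor_ideal_def set_add_def' by auto
  show ?thesis
  proof
    \<comment> \<open>Both factors map to the tensor algebra by ring homomorphisms, and preimages of
      ideals are ideals; this reduces the inclusion to the generators.\<close>
    have h1: "(\<lambda>s. ?pt s \<one>\<^bsub>B\<^esub>) \<in> ring_hom A ?R"
      by (rule ring_hom_memI) (simp_all add: pt pta ptm del: tensor_algebra_simps, simp)
    have h2: "(\<lambda>t. ?pt \<one>\<^bsub>A\<^esub> t) \<in> ring_hom B ?R"
      by (rule ring_hom_memI) (simp_all add: pt ptb ptm del: tensor_algebra_simps, simp)
    have 1: "Idl\<^bsub>A\<^esub> S \<subseteq> {s \<in> carrier A. ?pt s \<one>\<^bsub>B\<^esub> \<in> ?I}"
      by (rule A.genideal_minimal[OF ring_hom_ring.ideal_vimage[OF ring_hom_ringI2[OF A.ring_axioms R.ring_axioms h1]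
        I'.ideal_axioms]])
        (use S R.genideal_self[OF Zc] in blast)
    have 2: "Idl\<^bsub>B\<^esub> S' \<subseteq> {t \<in> carrier B. ?pt \<one>\<^bsub>A\<^esub> t \<in> ?I}"
      by (rule B.genideal_minimal[OF ring_hom_ring.ideal_vimage[OF ring_hom_ringI2[OF B.ring_axioms R.ring_axioms h2]
        I'.ideal_axioms]])
        (use S' R.genideal_self[OF Zc] in blast)
    have pm: "?pt s t = ?pt s \<one>\<^bsub>B\<^esub> \<otimes>\<^bsub>?R\<^esub> ?pt \<one>\<^bsub>A\<^esub> t" if "s \<in> carrier A" "t \<in> carrier B" for s t
      using ptm[of s "\<one>\<^bsub>B\<^esub>" "\<one>\<^bsub>A\<^esub>" t] that by (simp del: tensor_algebra_simps)
    have sub: "subgroup ?I (add_monoid ?R)" by (rule I'.a_subgroup)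
    have "tensor_image K A B (Idl\<^bsub>A\<^esub> S) (carrier B) \<subseteq> ?I"
      unfolding tensor_image_def
    proof (rule R.add.generate_subgroup_incl[OF _ sub])
      show "{tensor_class K A B (frag_of (s, t)) | s t. s \<in> Idl\<^bsub>A\<^esub> S \<and> t \<in> carrier B} \<subseteq> ?I"
      proof (rule gens_sub)
        fix s t assume s: "s \<in> Idl\<^bsub>A\<^esub> S" and t: "t \<in> carrier B"
        have s1: "s \<in> carrier A" "?pt s \<one>\<^bsub>B\<^esub> \<in> ?I" using subsetD[OF 1 s] by blast+
        show "?pt s t \<in> ?I" unfolding pm[OF s1(1) t] by (rule I'.I_r_closed[OF s1(2) pt[OF A.one_closed t]])
      qed
    qed
    moreover have "tensor_image K A B (carrier A) (Idl\<^bsub>B\<^esub> S') \<subseteq> ?I"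
      unfolding tensor_image_def
    proof (rule R.add.generate_subgroup_incl[OF _ sub])
      show "{tensor_class K A B (frag_of (s, t)) | s t. s \<in> carrier A \<and> t \<in> Idl\<^bsub>B\<^esub> S'} \<subseteq> ?I"
      proof (rule gens_sub)
        fix s t assume s: "s \<in> carrier A" and t: "t \<in> Idl\<^bsub>B\<^esub> S'"
        have t1: "t \<in> carrier B" "?pt \<one>\<^bsub>A\<^esub> t \<in> ?I" using subsetD[OF 2 t] by blast+
        show "?pt s t \<in> ?I" unfolding pm[OF s t1(1)] by (rule I'.I_l_closed[OF t1(2) pt[OF s B.one_closed]])
      qed
    qed
    ultimately show "tensor_ideal K A B (Idl\<^bsub>A\<^esub> S) (Idl\<^bsub>B\<^esub> S') \<subseteq> ?I"
      unfolding ti using I'.a_closed by blast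
    show "?I \<subseteq> tensor_ideal K A B (Idl\<^bsub>A\<^esub> S) (Idl\<^bsub>B\<^esub> S')"
    proof (rule R.genideal_minimal)
      show "ideal (tensor_ideal K A B (Idl\<^bsub>A\<^esub> S) (Idl\<^bsub>B\<^esub> S')) ?R"
        unfolding tensor_ideal_def by (intro R.add_ideals image_ideal I J A.oneideal B.oneideal)
      show "?Z \<subseteq> tensor_ideal K A B (Idl\<^bsub>A\<^esub> S) (Idl\<^bsub>B\<^esub> S')"
      proof
        fix z assume "z \<in> ?Z"
        then consider x where "x \<in> S" "z = ?pt x \<one>\<^bsub>B\<^esub>" | y where "y \<in> S'" "z = ?pt \<one>\<^bsub>A\<^esub> y" by blast
        thus "z \<in> tensor_ideal K A B (Idl\<^bsub>A\<^esub> S) (Idl\<^bsub>B\<^esub> S')"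
        proof cases
          case 1
          have "x \<in> Idl\<^bsub>A\<^esub> S" using A.genideal_self[OF S] 1 by blast
          hence "z \<in> tensor_image K A B (Idl\<^bsub>A\<^esub> S) (carrier B)" using 1 ptG B.one_closed by blast
          moreover have "z = z \<oplus>\<^bsub>?R\<^esub> \<zero>\<^bsub>?R\<^esub>" using 1 S pt[of x "\<one>\<^bsub>B\<^esub>"] R.r_zero[of z]
              by (simp add: subset_iff del: tensor_algebra_simps)
          ultimately show ?thesis unfolding ti using G0[OF A.oneideal J] by blast
        next
          case 2
          have "y \<in> Idl\<^bsub>B\<^esub> S'" using B.genideal_self[OF S'] 2 by blast
          hence "z \<in> tensor_image K A B (carrier A) (Idl\<^bsub>B\<^esub> S')" using 2 ptG A.one_closed by blast
          moreover have "z = \<zero>\<^bsub>?R\<^esub> \<oplus>\<^bsub>?R\<^esub> z" using 2 S' pt[of "\<one>\<^bsub>A\<^esub>" y] R.l_zero[of z]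
              by (simp add: subset_iff del: tensor_algebra_simps)
          ultimately show ?thesis unfolding ti using G0[OF I B.oneideal] by blast
        qed
      qed
    qed
  qed
qed

section \<open>The total complex of a tensor product\<close>

lemma module_hom_sum:
  assumes "module R N" "f \<in> module_hom R M N" "g \<in> module_hom R M N"
  shows "(\<lambda>x. f x \<oplus>\<^bsub>N\<^esub> g x) \<in> module_hom R M N"
proof -
  interpret N: module R N by fact
  show ?thesis
    using module_homD[OF assms(2)] module_homD[OF assms(3)]
    by (intro module_homI) (simp_all add: N.smult_r_distr N.M.a_ac)
qed

lemma module_hom_uminus:
  assumes "module R N" "f \<in> module_hom R M N"
  shows "(\<lambda>x. \<ominus>\<^bsub>N\<^esub> f x) \<in> module_hom R M N"
proof -
  interpret N: module R N by fact
  show ?thesis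
    using module_homD[OF assms(2)]
    by (intro module_homI) (simp_all add: N.smult_r_minus N.M.minus_add)
qed

lemma module_hom_id: "(\<lambda>x. x) \<in> module_hom R M M"
  by (rule module_homI) auto

text \<open>Modulo \<open>S\<close> the vector v stays nonzero, so c v to c is a functional on its
  line, and \<open>baer_factor\<close> extends it to the quotient.\<close>

lemma functional_exists:
  fixes V :: "('k, 'm) module"
  assumes "field K" "module K V" "submodule S K V" "v \<in> carrier V" "v \<notin> S"
  obtains \<phi> where "\<phi> \<in> module_hom K V (regular_module K)" "\<And>s. s \<in> S \<Longrightarrow> \<phi> s = \<zero>\<^bsub>K\<^esub>" "\<phi> v = \<one>\<^bsub>K\<^esub>"
proof -
  interpret K: field K by fact
  obtain Q :: "('k, 'm) module" and q where q: "module K Q" "q \<in> module_hom K V Q"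
    "\<And>x. x \<in> carrier V \<Longrightarrow> q x = \<zero>\<^bsub>Q\<^esub> \<longleftrightarrow> x \<in> S"
    using quotient_exists[OF assms(2,3)] by blast
  interpret Q: module K Q by fact
  interpret S: submodule S K V by fact
  have qv: "q v \<in> carrier Q" "q v \<noteq> \<zero>\<^bsub>Q\<^esub>" using module_homD(1)[OF q(2) assms(4)] q(3)[OF assms(4)] assms(5) by auto
  have Rm: "module K (regular_module K)" by (rule module_regular[OF K.is_cring])
  have u: "(\<lambda>c. c \<odot>\<^bsub>Q\<^esub> q v) \<in> module_hom K (regular_module K) Q"
    using qv by (intro module_homI) (simp_all add: Q.smult_l_distr Q.smult_assoc1)
  have ker: "c = \<zero>\<^bsub>regular_module K\<^esub>" if "c \<in> carrier (regular_module K)" "c \<odot>\<^bsub>Q\<^esub> q v = \<zero>\<^bsub>Q\<^esub>" for c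
  proof (rule ccontr)
    assume c: "c \<noteq> \<zero>\<^bsub>regular_module K\<^esub>"
    hence cU: "c \<in> Units K" using that(1) K.field_Units by simp
    have "q v = (inv\<^bsub>K\<^esub> c \<otimes>\<^bsub>K\<^esub> c) \<odot>\<^bsub>Q\<^esub> q v" using cU qv by simp
    also have "\<dots> = inv\<^bsub>K\<^esub> c \<odot>\<^bsub>Q\<^esub> (c \<odot>\<^bsub>Q\<^esub> q v)" using cU qv that(1) by (intro Q.smult_assoc1) auto
    also have "\<dots> = \<zero>\<^bsub>Q\<^esub>" using that(2) cU by simp
    finally show False using qv(2) by simp
  qed
  obtain g where g: "g \<in> module_hom K Q (regular_module K)" "\<And>c. c \<in> carrier K \<Longrightarrow> g (c \<odot>\<^bsub>Q\<^esub> q v) = c"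
    using baer_factor[OF baer_field[OF assms(1) Rm] Rm q(1) u module_hom_id ker] by auto
  show ?thesis
  proof (rule that)
    show "(\<lambda>x. g (q x)) \<in> module_hom K V (regular_module K)" by (rule module_hom_comp[OF q(2) g(1)])
    show "g (q v) = \<one>\<^bsub>K\<^esub>" using g(2)[OF K.one_closed] qv by simp
    fix s assume "s \<in> S"
    hence "q s = \<zero>\<^bsub>Q\<^esub>" using q(3) S.subset by auto
    thus "g (q s) = \<zero>\<^bsub>K\<^esub>" using module_hom_zero[OF q(1) Rm g(1)] by simp
  qed
qed

text \<open>Collects all terms of a complex in one module, so that every P i \<otimes> Q j has its
  image in a single tensor product. The full product is convenient as it carries no support
  condition; the degrees are generated by \<open>hsingle\<close>.\<close>

definition prod_family :: "(nat \<Rightarrow> ('a, 'e) module) \<Rightarrow> ('a, nat \<Rightarrow> 'e) module"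
  where "prod_family P = \<lparr>carrier = {f. \<forall>n. f n \<in> carrier (P n)}, monoid.mult = undefined, one = undefined,
    ring.zero = (\<lambda>n. \<zero>\<^bsub>P n\<^esub>), add = (\<lambda>f g n. f n \<oplus>\<^bsub>P n\<^esub> g n), smult = (\<lambda>r f n. r \<odot>\<^bsub>P n\<^esub> f n)\<rparr>"

lemma prod_family_simps [simp]:
  "f \<in> carrier (prod_family P) \<longleftrightarrow> (\<forall>n. f n \<in> carrier (P n))"
  "\<zero>\<^bsub>prod_family P\<^esub> = (\<lambda>n. \<zero>\<^bsub>P n\<^esub>)"
  "f \<oplus>\<^bsub>prod_family P\<^esub> g = (\<lambda>n. f n \<oplus>\<^bsub>P n\<^esub> g n)"
  "r \<odot>\<^bsub>prod_family P\<^esub> f = (\<lambda>n. r \<odot>\<^bsub>P n\<^esub> f n)"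
  by (simp_all add: prod_family_def)

lemma module_prod_family:
  assumes "\<And>n. module R (P n)"
  shows "module R (prod_family P)"
proof (rule moduleI)
  interpret P0: module R "P 0" by (rule assms)
  show "cring R" by (rule P0.R.is_cring)
  show "abelian_group (prod_family P)"
  proof (rule abelian_groupI)
    fix f assume f: "f \<in> carrier (prod_family P)"
    have "(\<ominus>\<^bsub>P n\<^esub> f n) \<in> carrier (P n) \<and> (\<ominus>\<^bsub>P n\<^esub> f n) \<oplus>\<^bsub>P n\<^esub> f n = \<zero>\<^bsub>P n\<^esub>" for n
    proof -
      interpret Pn: module R "P n" by (rule assms)
      show ?thesis using f by (simp add: Pn.M.l_neg)
    qed
    thus "\<exists>g\<in>carrier (prod_family P). g \<oplus>\<^bsub>prod_family P\<^esub> f = \<zero>\<^bsub>prod_family P\<^esub>"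
      by (intro bexI[of _ "\<lambda>n. \<ominus>\<^bsub>P n\<^esub> f n"]) auto
  next
    note ab = module.axioms(2)[OF assms]
    show "\<zero>\<^bsub>prod_family P\<^esub> \<in> carrier (prod_family P)"
      using abelian_monoid.zero_closed[OF abelian_group.axioms(1)[OF ab]] by simp
    fix f g h assume f: "f \<in> carrier (prod_family P)"
    show "\<zero>\<^bsub>prod_family P\<^esub> \<oplus>\<^bsub>prod_family P\<^esub> f = f"
      using f abelian_monoid.l_zero[OF abelian_group.axioms(1)[OF ab]] by simp
    assume g: "g \<in> carrier (prod_family P)"
    show "f \<oplus>\<^bsub>prod_family P\<^esub> g \<in> carrier (prod_family P)"
      using f g abelian_monoid.a_closed[OF abelian_group.axioms(1)[OF ab]] by simp
    show "f \<oplus>\<^bsub>prod_family P\<^esub> g = g \<oplus>\<^bsub>prod_family P\<^esub> f"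
    proof -
      have "f n \<oplus>\<^bsub>P n\<^esub> g n = g n \<oplus>\<^bsub>P n\<^esub> f n" for n
        using f g by (intro abelian_monoid.a_comm[OF abelian_group.axioms(1)[OF ab]]) simp_all
      thus ?thesis by simp
    qed
    assume h: "h \<in> carrier (prod_family P)"
    show "f \<oplus>\<^bsub>prod_family P\<^esub> g \<oplus>\<^bsub>prod_family P\<^esub> h = f \<oplus>\<^bsub>prod_family P\<^esub> (g \<oplus>\<^bsub>prod_family P\<^esub> h)"
      using f g h abelian_monoid.a_assoc[OF abelian_group.axioms(1)[OF ab]] by simp
  qed
qed (simp_all add: module.smult_closed[OF assms] module.smult_l_distr[OF assms] module.smult_r_distr[OF assms]
      module.smult_assoc1[OF assms] module.smult_one[OF assms])

section \<open>Operators on a graded module\<close>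

definition hsingle :: "(nat \<Rightarrow> ('a, 'e) module) \<Rightarrow> nat \<Rightarrow> 'e \<Rightarrow> nat \<Rightarrow> 'e"
  where "hsingle P i v = (\<lambda>j. if j = i then v else \<zero>\<^bsub>P j\<^esub>)"

definition shift_up :: "(nat \<Rightarrow> ('a, 'e) module) \<Rightarrow> (nat \<Rightarrow> 'e \<Rightarrow> 'e) \<Rightarrow> (nat \<Rightarrow> 'e) \<Rightarrow> nat \<Rightarrow> 'e"
  where "shift_up P d f = (\<lambda>i. case i of 0 \<Rightarrow> \<zero>\<^bsub>P 0\<^esub> | Suc j \<Rightarrow> d j (f j))"

definition shift_down :: "(nat \<Rightarrow> 'e \<Rightarrow> 'e) \<Rightarrow> (nat \<Rightarrow> 'e) \<Rightarrow> nat \<Rightarrow> 'e"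
  where "shift_down s f = (\<lambda>i. s i (f (Suc i)))"

text \<open>The sign (-1)^i of the grading. It anticommutes with operators of odd degree and so
  supplies the Koszul signs.\<close>

definition alternate :: "(nat \<Rightarrow> ('a, 'e) module) \<Rightarrow> (nat \<Rightarrow> 'e) \<Rightarrow> nat \<Rightarrow> 'e"
  where "alternate P f = (\<lambda>i. if even i then f i else \<ominus>\<^bsub>P i\<^esub> f i)"

lemma hsingle_hom:
  assumes "\<And>n. module R (P n)"
  shows "hsingle P i \<in> module_hom R (P i) (prod_family P)"
proof (rule module_homI)
  have z: "\<zero>\<^bsub>P j\<^esub> \<in> carrier (P j)" "\<zero>\<^bsub>P j\<^esub> \<oplus>\<^bsub>P j\<^esub> \<zero>\<^bsub>P j\<^esub> = \<zero>\<^bsub>P j\<^esub>"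
    "r \<in> carrier R \<Longrightarrow> r \<odot>\<^bsub>P j\<^esub> \<zero>\<^bsub>P j\<^esub> = \<zero>\<^bsub>P j\<^esub>" for j r
  proof -
    interpret module R "P j" by (rule assms)
    show "\<zero>\<^bsub>P j\<^esub> \<in> carrier (P j)" "\<zero>\<^bsub>P j\<^esub> \<oplus>\<^bsub>P j\<^esub> \<zero>\<^bsub>P j\<^esub> = \<zero>\<^bsub>P j\<^esub>"
      "r \<in> carrier R \<Longrightarrow> r \<odot>\<^bsub>P j\<^esub> \<zero>\<^bsub>P j\<^esub> = \<zero>\<^bsub>P j\<^esub>" by simp_all
  qed
  fix v w r assume v: "v \<in> carrier (P i)"
  show "hsingle P i v \<in> carrier (prod_family P)" using v z by (simp add: hsingle_def)
  show "hsingle P i (v \<oplus>\<^bsub>P i\<^esub> w) = hsingle P i v \<oplus>\<^bsub>prod_family P\<^esub> hsingle P i w"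
    using z by (auto simp: hsingle_def)
  assume "r \<in> carrier R"
  thus "hsingle P i (r \<odot>\<^bsub>P i\<^esub> v) = r \<odot>\<^bsub>prod_family P\<^esub> hsingle P i v"
    using z by (auto simp: hsingle_def)
qed

lemma hsingle_zero: "hsingle P i \<zero>\<^bsub>P i\<^esub> = \<zero>\<^bsub>prod_family P\<^esub>"
  by (auto simp: hsingle_def)

lemma shift_up_hom:
  assumes "\<And>n. module R (P n)" "\<And>n. d n \<in> module_hom R (P n) (P (Suc n))"
  shows "shift_up P d \<in> module_hom R (prod_family P) (prod_family P)"
proof -
  interpret P0: module R "P 0" by (rule assms)
  note dD = module_homD[OF assms(2)]
  show ?thesis
    by (rule module_homI) (auto simp: shift_up_def dD fun_eq_iff split: nat.split)
qed

text \<open>Linearity over a second ring that acts through \<open>restrict_scalars\<close> is needed for maps that are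
  not linear over the ring of the family.\<close>

lemma shift_down_hom:
  assumes "\<And>n. s n \<in> module_hom K (restrict_scalars A (P (Suc n))) (restrict_scalars A (P n))"
  shows "shift_down s \<in> module_hom K (restrict_scalars A (prod_family P)) (restrict_scalars A (prod_family P))"
  using module_homD[OF assms] by (intro module_homI) (auto simp: shift_down_def)

lemma componentwise_hom:
  assumes "\<And>n. s n \<in> module_hom K (restrict_scalars A (P n)) (restrict_scalars A (P n))"
  shows "(\<lambda>f n. s n (f n)) \<in> module_hom K (restrict_scalars A (prod_family P)) (restrict_scalars A (prod_family P))"
  using module_homD[OF assms] by (intro module_homI) auto

lemma alternate_hom:
  assumes "\<And>n. module R (P n)"
  shows "alternate P \<in> module_hom R (prod_family P) (prod_family P)"
proof (rule module_homI)
  fix f g r assume f: "f \<in> carrier (prod_family P)"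
  have n: "\<ominus>\<^bsub>P n\<^esub> f n \<in> carrier (P n)"
    "g \<in> carrier (prod_family P) \<Longrightarrow> \<ominus>\<^bsub>P n\<^esub> (f n \<oplus>\<^bsub>P n\<^esub> g n) = \<ominus>\<^bsub>P n\<^esub> f n \<oplus>\<^bsub>P n\<^esub> \<ominus>\<^bsub>P n\<^esub> g n"
    "r \<in> carrier R \<Longrightarrow> \<ominus>\<^bsub>P n\<^esub> (r \<odot>\<^bsub>P n\<^esub> f n) = r \<odot>\<^bsub>P n\<^esub> (\<ominus>\<^bsub>P n\<^esub> f n)" for n
  proof -
    interpret module R "P n" by (rule assms)
    show "\<ominus>\<^bsub>P n\<^esub> f n \<in> carrier (P n)"
      "g \<in> carrier (prod_family P) \<Longrightarrow> \<ominus>\<^bsub>P n\<^esub> (f n \<oplus>\<^bsub>P n\<^esub> g n) = \<ominus>\<^bsub>P n\<^esub> f n \<oplus>\<^bsub>P n\<^esub> \<ominus>\<^bsub>P n\<^esub> g n"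
      "r \<in> carrier R \<Longrightarrow> \<ominus>\<^bsub>P n\<^esub> (r \<odot>\<^bsub>P n\<^esub> f n) = r \<odot>\<^bsub>P n\<^esub> (\<ominus>\<^bsub>P n\<^esub> f n)"
      using f by (simp_all add: minus_add smult_r_minus)
  qed
  show "alternate P f \<in> carrier (prod_family P)" using f n by (simp add: alternate_def)
  show "r \<in> carrier R \<Longrightarrow> alternate P (r \<odot>\<^bsub>prod_family P\<^esub> f) = r \<odot>\<^bsub>prod_family P\<^esub> alternate P f"
    using n by (auto simp: alternate_def)
  show "g \<in> carrier (prod_family P) \<Longrightarrow> alternate P (f \<oplus>\<^bsub>prod_family P\<^esub> g) = alternate P f \<oplus>\<^bsub>prod_family P\<^esub> alternate P g"
    using n by (auto simp: alternate_def)
qed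

definition sign :: "(nat \<Rightarrow> ('a, 'e) module) \<Rightarrow> nat \<Rightarrow> 'e \<Rightarrow> 'e"
  where "sign P i v = (if even i then v else \<ominus>\<^bsub>P i\<^esub> v)"

lemma hsingle_shift_up:
  assumes "\<And>n. module R (P n)" "\<And>n. d n \<in> module_hom R (P n) (P (Suc n))"
  shows "shift_up P d (hsingle P i v) = hsingle P (Suc i) (d i v)"
  using module_hom_zero[OF assms(1) assms(1) assms(2)]
  by (auto simp: shift_up_def hsingle_def fun_eq_iff split: nat.split)

lemma hsingle_shift_down:
  assumes "\<And>n. s n \<zero>\<^bsub>P (Suc n)\<^esub> = \<zero>\<^bsub>P n\<^esub>"
  shows "shift_down s (hsingle P 0 v) = \<zero>\<^bsub>prod_family P\<^esub>"
    and "shift_down s (hsingle P (Suc i) v) = hsingle P i (s i v)"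
  using assms by (auto simp: shift_down_def hsingle_def fun_eq_iff)

lemma hsingle_alternate:
  assumes "\<And>n. module R (P n)"
  shows "alternate P (hsingle P i v) = hsingle P i (sign P i v)"
proof -
  have "\<ominus>\<^bsub>P n\<^esub> \<zero>\<^bsub>P n\<^esub> = \<zero>\<^bsub>P n\<^esub>" for n
  proof -
    interpret module R "P n" by (rule assms)
    show ?thesis using module_hom_neg[OF module_axioms module_axioms module_hom_id, of "\<zero>\<^bsub>P n\<^esub>"]
      by (metis M.l_zero M.minus_equality M.zero_closed)
  qed
  thus ?thesis by (auto simp: alternate_def hsingle_def sign_def fun_eq_iff)
qed

subsection \<open>The homotopy on pure tensors\<close>

text \<open>If \<open>s\<close> is a generalized inverse of \<open>d\<close>, then \<open>\<pi> = 1 - d s - s d\<close> is a chain map onto the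
  cocycles, homotopic to the identity; likewise \<open>t\<close> and \<open>\<rho>\<close>.  On the tensor product
  \<open>s \<otimes> 1 + \<sigma> \<pi> \<otimes> t\<close>, with the sign operator \<open>\<sigma>\<close>, is a homotopy from \<open>1\<close> to \<open>\<pi> \<otimes> \<rho>\<close>.\<close>

lemma homotopy_pure:
  fixes V :: "('k, 'm, 'y) module_scheme" and W :: "('k, 'n, 'z) module_scheme"
  assumes V: "module K V" and W: "module K W"
    and d: "d \<in> module_hom K V V" and s: "s \<in> module_hom K V V" and \<sigma>: "\<sigma> \<in> module_hom K V V"
    and d': "d' \<in> module_hom K W W" and t: "t \<in> module_hom K W W"
    and D: "\<And>U U'. \<lbrakk>U \<in> carrier (tensor_group K V W); U' \<in> carrier (tensor_group K V W)\<rbrakk> \<Longrightarrow>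
       D (U \<otimes>\<^bsub>tensor_group K V W\<^esub> U') = D U \<otimes>\<^bsub>tensor_group K V W\<^esub> D U'"
    and Dp: "\<And>x y. \<lbrakk>x \<in> carrier V; y \<in> carrier W\<rbrakk> \<Longrightarrow> D (pure_tensor K V W x y) =
       pure_tensor K V W (d x) y \<otimes>\<^bsub>tensor_group K V W\<^esub> pure_tensor K V W (\<sigma> x) (d' y)"
    and h: "\<And>U U'. \<lbrakk>U \<in> carrier (tensor_group K V W); U' \<in> carrier (tensor_group K V W)\<rbrakk> \<Longrightarrow>
       h (U \<otimes>\<^bsub>tensor_group K V W\<^esub> U') = h U \<otimes>\<^bsub>tensor_group K V W\<^esub> h U'"
    and hp: "\<And>x y. \<lbrakk>x \<in> carrier V; y \<in> carrier W\<rbrakk> \<Longrightarrow> h (pure_tensor K V W x y) =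
       pure_tensor K V W (s x) y \<otimes>\<^bsub>tensor_group K V W\<^esub> pure_tensor K V W (\<sigma> (\<pi> x)) (t y)"
    and H: "H \<subseteq> carrier V" and Hd: "\<And>x. x \<in> H \<Longrightarrow> d x \<in> H" and Hs: "\<And>x. x \<in> H \<Longrightarrow> s x \<in> H"
    and H\<sigma>: "\<And>x. x \<in> H \<Longrightarrow> \<sigma> x \<in> H" and H\<pi>: "\<And>x. x \<in> H \<Longrightarrow> \<pi> x \<in> H"
    and \<pi>: "\<And>x. \<pi> x = x \<ominus>\<^bsub>V\<^esub> (d (s x) \<oplus>\<^bsub>V\<^esub> s (d x))"
    and dd: "\<And>x. x \<in> H \<Longrightarrow> d (d x) = \<zero>\<^bsub>V\<^esub>" and dsd: "\<And>x. x \<in> H \<Longrightarrow> d (s (d x)) = d x"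
    and \<sigma>\<sigma>: "\<And>x. x \<in> H \<Longrightarrow> \<sigma> (\<sigma> x) = x" and d\<sigma>: "\<And>x. x \<in> H \<Longrightarrow> d (\<sigma> x) = \<ominus>\<^bsub>V\<^esub> \<sigma> (d x)"
    and s\<sigma>: "\<And>x. x \<in> H \<Longrightarrow> s (\<sigma> x) = \<ominus>\<^bsub>V\<^esub> \<sigma> (s x)"
    and x: "x \<in> H" and y: "y \<in> carrier W"
  shows "pure_tensor K V W x y = (D (h (pure_tensor K V W x y)) \<otimes>\<^bsub>tensor_group K V W\<^esub> h (D (pure_tensor K V W x y)))
     \<otimes>\<^bsub>tensor_group K V W\<^esub> pure_tensor K V W (\<pi> x) (y \<ominus>\<^bsub>W\<^esub> (d' (t y) \<oplus>\<^bsub>W\<^esub> t (d' y)))" (is "_ = _ \<otimes>\<^bsub>?T\<^esub> _")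
    and "d (\<pi> x) = \<zero>\<^bsub>V\<^esub>"
proof -
  interpret V: module K V by (rule V)
  interpret W: module K W by (rule W)
  interpret T: comm_group ?T by (rule comm_group_tensor_group[OF V W])
  let ?pt = "pure_tensor K V W"
  note dc = module_homD(1)[OF d] and sc = module_homD(1)[OF s] and \<sigma>c = module_homD(1)[OF \<sigma>]
    and d'c = module_homD(1)[OF d'] and tc = module_homD(1)[OF t]
  note ptc = pure_tensor_closed[OF V W] and pl = pure_tensor_add_left[OF V W] and pr = pure_tensor_add_right[OF V W]
  have Hc: "x \<in> carrier V" if "x \<in> H" for x using H that by blast
  have d0: "d \<zero>\<^bsub>V\<^esub> = \<zero>\<^bsub>V\<^esub>" "s \<zero>\<^bsub>V\<^esub> = \<zero>\<^bsub>V\<^esub>" "\<sigma> \<zero>\<^bsub>V\<^esub> = \<zero>\<^bsub>V\<^esub>"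
    by (rule module_hom_zero[OF V V]; fact)+
  have d\<pi>: "d (\<pi> x) = \<zero>\<^bsub>V\<^esub>" if x: "x \<in> H" for x
  proof -
    have "d (\<pi> x) = d x \<ominus>\<^bsub>V\<^esub> (d (d (s x)) \<oplus>\<^bsub>V\<^esub> d (s (d x)))"
      unfolding \<pi> using module_hom_diff[OF V V d] module_homD(2)[OF d] Hc[OF x] dc sc by simp
    also have "\<dots> = d x \<ominus>\<^bsub>V\<^esub> d x" using dd[OF Hs[OF x]] dsd[OF x] dc Hc[OF x] by simp
    finally show ?thesis using V.diff_zero_iff dc Hc[OF x] by simp
  qed
  show "d (\<pi> x) = \<zero>\<^bsub>V\<^esub>" by (rule d\<pi>[OF x])
  have \<pi>d: "\<pi> (d x) = \<zero>\<^bsub>V\<^esub>"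
  proof -
    have "\<pi> (d x) = d x \<ominus>\<^bsub>V\<^esub> (d x \<oplus>\<^bsub>V\<^esub> \<zero>\<^bsub>V\<^esub>)" unfolding \<pi> using dsd[OF x] dd[OF x] d0 by simp
    thus ?thesis using V.diff_zero_iff dc Hc[OF x] by simp
  qed
  have \<pi>\<sigma>: "\<pi> (\<sigma> x) = \<sigma> (\<pi> x)"
  proof -
    have "d (s (\<sigma> x)) = \<sigma> (d (s x))"
      using s\<sigma>[OF x] module_hom_neg[OF V V d] d\<sigma>[OF Hs[OF x]] sc \<sigma>c dc Hc[OF x] by simp
    moreover have "s (d (\<sigma> x)) = \<sigma> (s (d x))"
      using d\<sigma>[OF x] module_hom_neg[OF V V s] s\<sigma>[OF Hd[OF x]] sc \<sigma>c dc Hc[OF x] by simp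
    ultimately show ?thesis
      unfolding \<pi> using module_hom_diff[OF V V \<sigma>] module_homD(2)[OF \<sigma>] Hc[OF x] dc sc by simp
  qed
  have \<sigma>\<sigma>\<pi>: "\<sigma> (\<sigma> (\<pi> x)) = \<pi> x" by (rule \<sigma>\<sigma>[OF H\<pi>[OF x]])
  have d\<sigma>\<pi>: "d (\<sigma> (\<pi> x)) = \<zero>\<^bsub>V\<^esub>"
    using d\<sigma>[OF H\<pi>[OF x]] d\<pi>[OF x] d0 V.neg_eq_smult[of "\<zero>\<^bsub>V\<^esub>"] by simp
  let ?\<rho> = "y \<ominus>\<^bsub>W\<^esub> (d' (t y) \<oplus>\<^bsub>W\<^esub> t (d' y))"
  have c: "x \<in> carrier V" "s x \<in> carrier V" "d x \<in> carrier V" "d (s x) \<in> carrier V" "s (d x) \<in> carrier V"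
    "\<pi> x \<in> carrier V" "\<sigma> x \<in> carrier V" "\<sigma> (s x) \<in> carrier V" "\<sigma> (\<pi> x) \<in> carrier V"
    "t y \<in> carrier W" "d' y \<in> carrier W" "d' (t y) \<in> carrier W" "t (d' y) \<in> carrier W" "?\<rho> \<in> carrier W"
    using Hc[OF x] Hc[OF H\<pi>[OF x]] y dc sc \<sigma>c d'c tc by simp_all
  \<comment> \<open>This mixed term occurs in D h and, because s anticommutes with \<sigma>,
    inverted in h D, so the two cancel.\<close>
  let ?b = "?pt (\<sigma> (s x)) (d' y)"
  have Dh: "D (h (?pt x y)) = (?pt (d (s x)) y \<otimes>\<^bsub>?T\<^esub> ?b) \<otimes>\<^bsub>?T\<^esub> ?pt (\<pi> x) (d' (t y))"
    using c y by (simp add: hp Dp D ptc d\<sigma>\<pi> \<sigma>\<sigma>\<pi> pure_tensor_zero[OF V W])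
  have hD: "h (D (?pt x y)) = ?pt (s (d x)) y \<otimes>\<^bsub>?T\<^esub> (inv\<^bsub>?T\<^esub> ?b \<otimes>\<^bsub>?T\<^esub> ?pt (\<pi> x) (t (d' y)))"
    using c y by (simp add: hp Dp h ptc \<pi>d d0 \<pi>\<sigma> \<sigma>\<sigma>\<pi> s\<sigma>[OF x] pure_tensor_zero[OF V W] pure_tensor_neg[OF V W])
  have "x = (d (s x) \<oplus>\<^bsub>V\<^esub> s (d x)) \<oplus>\<^bsub>V\<^esub> \<pi> x"
    unfolding \<pi> using V.diff_add_cancel[of x "d (s x) \<oplus>\<^bsub>V\<^esub> s (d x)"] c by (simp add: V.M.a_comm)
  hence "?pt x y = ?pt ((d (s x) \<oplus>\<^bsub>V\<^esub> s (d x)) \<oplus>\<^bsub>V\<^esub> \<pi> x) y" by simp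
  also have "\<dots> = (?pt (d (s x)) y \<otimes>\<^bsub>?T\<^esub> ?pt (s (d x)) y) \<otimes>\<^bsub>?T\<^esub> ?pt (\<pi> x) y"
    using c y by (simp add: pl)
  also have "?pt (\<pi> x) y = (?pt (\<pi> x) (d' (t y)) \<otimes>\<^bsub>?T\<^esub> ?pt (\<pi> x) (t (d' y))) \<otimes>\<^bsub>?T\<^esub> ?pt (\<pi> x) ?\<rho>"
  proof -
    have "y = (d' (t y) \<oplus>\<^bsub>W\<^esub> t (d' y)) \<oplus>\<^bsub>W\<^esub> ?\<rho>"
      using W.diff_add_cancel[of y "d' (t y) \<oplus>\<^bsub>W\<^esub> t (d' y)"] c y by (simp add: W.M.a_comm)
    hence "?pt (\<pi> x) y = ?pt (\<pi> x) ((d' (t y) \<oplus>\<^bsub>W\<^esub> t (d' y)) \<oplus>\<^bsub>W\<^esub> ?\<rho>)" by simp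
    also have "\<dots> = (?pt (\<pi> x) (d' (t y)) \<otimes>\<^bsub>?T\<^esub> ?pt (\<pi> x) (t (d' y))) \<otimes>\<^bsub>?T\<^esub> ?pt (\<pi> x) ?\<rho>"
      using c y by (simp add: pr)
    finally show ?thesis .
  qed
  finally have "?pt x y = (?pt (d (s x)) y \<otimes>\<^bsub>?T\<^esub> ?pt (s (d x)) y) \<otimes>\<^bsub>?T\<^esub>
     ((?pt (\<pi> x) (d' (t y)) \<otimes>\<^bsub>?T\<^esub> ?pt (\<pi> x) (t (d' y))) \<otimes>\<^bsub>?T\<^esub> ?pt (\<pi> x) ?\<rho>)" .
  \<comment> \<open>The rearrangement is first proved with a free b', where only commutativity is
    involved; b' is then specialized to the inverse of b.\<close>
  moreover have "(((a \<otimes>\<^bsub>?T\<^esub> b) \<otimes>\<^bsub>?T\<^esub> c) \<otimes>\<^bsub>?T\<^esub> (e \<otimes>\<^bsub>?T\<^esub> (inv\<^bsub>?T\<^esub> b \<otimes>\<^bsub>?T\<^esub> f))) \<otimes>\<^bsub>?T\<^esub> g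
      = (a \<otimes>\<^bsub>?T\<^esub> e) \<otimes>\<^bsub>?T\<^esub> ((c \<otimes>\<^bsub>?T\<^esub> f) \<otimes>\<^bsub>?T\<^esub> g)"
    if "a \<in> carrier ?T" "b \<in> carrier ?T" "c \<in> carrier ?T" "e \<in> carrier ?T" "f \<in> carrier ?T" "g \<in> carrier ?T"
    for a b c e f g
  proof -
    have "(((a \<otimes>\<^bsub>?T\<^esub> b) \<otimes>\<^bsub>?T\<^esub> c) \<otimes>\<^bsub>?T\<^esub> (e \<otimes>\<^bsub>?T\<^esub> (b' \<otimes>\<^bsub>?T\<^esub> f))) \<otimes>\<^bsub>?T\<^esub> g
        = (b \<otimes>\<^bsub>?T\<^esub> b') \<otimes>\<^bsub>?T\<^esub> ((a \<otimes>\<^bsub>?T\<^esub> e) \<otimes>\<^bsub>?T\<^esub> ((c \<otimes>\<^bsub>?T\<^esub> f) \<otimes>\<^bsub>?T\<^esub> g))" if "b' \<in> carrier ?T" for b'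
      using \<open>a \<in> carrier ?T\<close> \<open>b \<in> carrier ?T\<close> \<open>c \<in> carrier ?T\<close> \<open>e \<in> carrier ?T\<close> \<open>f \<in> carrier ?T\<close>
        \<open>g \<in> carrier ?T\<close> that by (simp add: T.m_ac)
    from this[OF T.inv_closed[OF that(2)]] show ?thesis using that by simp
  qed
  ultimately show "?pt x y = (D (h (?pt x y)) \<otimes>\<^bsub>?T\<^esub> h (D (?pt x y))) \<otimes>\<^bsub>?T\<^esub> ?pt (\<pi> x) ?\<rho>"
    unfolding Dh hD using ptc c y by simp
qed

text \<open>Submodules of fixed terms rather than new modules: one construction then serves for the
  full complexes, which give the resolution, and for their torsion parts, which give the
  cohomology.\<close>

definition subcomplex ::
  "('a, 'x) ring_scheme \<Rightarrow> (nat \<Rightarrow> ('a, 'e) module) \<Rightarrow> (nat \<Rightarrow> 'e \<Rightarrow> 'e) \<Rightarrow> (nat \<Rightarrow> 'e set) \<Rightarrow> bool"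
  where "subcomplex A P d S \<longleftrightarrow>
    (\<forall>i. submodule (S i) A (P i)) \<and> (\<forall>i. \<forall>v\<in>S i. d i v \<in> S (Suc i)) \<and>
    (\<forall>i. \<forall>v\<in>S i. d (Suc i) (d i v) = \<zero>\<^bsub>P (Suc (Suc i))\<^esub>)"

definition exact_at :: "(nat \<Rightarrow> ('a, 'e) module) \<Rightarrow> (nat \<Rightarrow> 'e \<Rightarrow> 'e) \<Rightarrow> (nat \<Rightarrow> 'e set) \<Rightarrow> nat \<Rightarrow> bool"
  where "exact_at P d S i \<longleftrightarrow> (\<forall>v\<in>S i. d i v = \<zero>\<^bsub>P (Suc i)\<^esub> \<longrightarrow>
     (case i of 0 \<Rightarrow> v = \<zero>\<^bsub>P 0\<^esub> | Suc k \<Rightarrow> \<exists>u\<in>S k. d k u = v))"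

lemma subcomplexD:
  assumes "subcomplex A P d S"
  shows "submodule (S i) A (P i)" "v \<in> S i \<Longrightarrow> d i v \<in> S (Suc i)"
    "v \<in> S i \<Longrightarrow> d (Suc i) (d i v) = \<zero>\<^bsub>P (Suc (Suc i))\<^esub>"
  using assms by (auto simp: subcomplex_def)

lemma submodule_facts:
  assumes "module R M" "submodule S R M"
  shows "v \<in> S \<Longrightarrow> v \<in> carrier M" "\<zero>\<^bsub>M\<^esub> \<in> S" "\<lbrakk>v \<in> S; w \<in> S\<rbrakk> \<Longrightarrow> v \<oplus>\<^bsub>M\<^esub> w \<in> S"
    "v \<in> S \<Longrightarrow> \<ominus>\<^bsub>M\<^esub> v \<in> S" "\<lbrakk>v \<in> S; w \<in> S\<rbrakk> \<Longrightarrow> v \<ominus>\<^bsub>M\<^esub> w \<in> S"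
    "\<lbrakk>r \<in> carrier R; v \<in> S\<rbrakk> \<Longrightarrow> r \<odot>\<^bsub>M\<^esub> v \<in> S"
proof -
  interpret M: module R M by fact
  interpret S: submodule S R M by fact
  show "v \<in> S \<Longrightarrow> v \<in> carrier M" "\<zero>\<^bsub>M\<^esub> \<in> S" "\<lbrakk>v \<in> S; w \<in> S\<rbrakk> \<Longrightarrow> v \<oplus>\<^bsub>M\<^esub> w \<in> S"
    "\<lbrakk>r \<in> carrier R; v \<in> S\<rbrakk> \<Longrightarrow> r \<odot>\<^bsub>M\<^esub> v \<in> S"
    using S.subset S.one_closed S.m_closed by auto
  have n: "v \<in> S \<Longrightarrow> \<ominus>\<^bsub>M\<^esub> v \<in> S" for v using M.submoduleE(3)[OF assms(2)] .
  show "v \<in> S \<Longrightarrow> \<ominus>\<^bsub>M\<^esub> v \<in> S" by (rule n)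
  show "\<lbrakk>v \<in> S; w \<in> S\<rbrakk> \<Longrightarrow> v \<ominus>\<^bsub>M\<^esub> w \<in> S" using n[of w] S.m_closed[of v "\<ominus>\<^bsub>M\<^esub> w"] by (simp add: a_minus_def)
qed

lemma restrict_scalars_minus:
  assumes "algebra K A" "module A M" "x \<in> carrier M" "y \<in> carrier M"
  shows "\<ominus>\<^bsub>restrict_scalars A M\<^esub> x = \<ominus>\<^bsub>M\<^esub> x" "x \<ominus>\<^bsub>restrict_scalars A M\<^esub> y = x \<ominus>\<^bsub>M\<^esub> y"
proof -
  interpret M: module A M by fact
  interpret KM: module K "restrict_scalars A M" by (rule module_restrict_scalars) fact+
  have n: "\<ominus>\<^bsub>restrict_scalars A M\<^esub> x = \<ominus>\<^bsub>M\<^esub> x" if "x \<in> carrier M" for x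
    using KM.M.minus_equality[of "\<ominus>\<^bsub>M\<^esub> x" x] that by (simp add: M.M.l_neg)
  show "\<ominus>\<^bsub>restrict_scalars A M\<^esub> x = \<ominus>\<^bsub>M\<^esub> x" by (rule n[OF assms(3)])
  show "x \<ominus>\<^bsub>restrict_scalars A M\<^esub> y = x \<ominus>\<^bsub>M\<^esub> y" using n[of y] assms by (simp add: a_minus_def)
qed

text \<open>Applied to differentials, with \<open>P'\<close> the shifted family, and to
  multiplication by a ring element, with \<open>P'\<close> equal to \<open>P\<close>.\<close>

lemma generalized_inverse_family:
  assumes "field K" "algebra K A" "\<And>n. module A (P n)" "\<And>n. module A (P' n)"
    and "\<And>n. submodule (S n) A (P n)" "\<And>n. submodule (S' n) A (P' n)"
    and "\<And>n. f n \<in> module_hom A (P n) (P' n)" "\<And>n v. v \<in> S n \<Longrightarrow> f n v \<in> S' n"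
  obtains s where "\<And>n. s n \<in> module_hom K (restrict_scalars A (P' n)) (restrict_scalars A (P n))"
    "\<forall>n. \<forall>w\<in>S' n. s n w \<in> S n" "\<forall>n. \<forall>v\<in>S n. f n (s n (f n v)) = f n v"
proof -
  have "\<exists>g. g \<in> module_hom K (restrict_scalars A (P' n)) (restrict_scalars A (P n)) \<and>
    (\<forall>w\<in>S' n. g w \<in> S n) \<and> (\<forall>v\<in>S n. f n (g (f n v)) = f n v)" for n
  proof -
    have f: "f n \<in> module_hom K (restrict_scalars A (P n)\<lparr>carrier := S n\<rparr>) (restrict_scalars A (P' n)\<lparr>carrier := S' n\<rparr>)"
      using module_homD[OF module_hom_restrict_scalars[OF assms(2) assms(7)]] assms(8)
        submodule_facts(1)[OF assms(3,5)]
      by (intro module_homI) auto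
    show ?thesis
      using pseudo_inverse[OF assms(1) module_restrict_scalars[OF assms(2,3)] module_restrict_scalars[OF assms(2,4)]
          submodule_restrict_scalars[OF assms(2,3,5)] submodule_restrict_scalars[OF assms(2,4,6)] f] by metis
  qed
  thus ?thesis using that by metis
qed

text \<open>The generalized inverses satisfy their identities on the \<open>S i\<close>, so the
  homotopy formula is verified on elements with a single component taken from there.\<close>

definition homogeneous :: "(nat \<Rightarrow> ('a, 'e) module) \<Rightarrow> (nat \<Rightarrow> 'e set) \<Rightarrow> (nat \<Rightarrow> 'e) set"
  where "homogeneous P S = {hsingle P i v | i v. v \<in> S i}"

text \<open>The operator \<open>\<pi>\<close> of the homotopy, on a graded module.\<close>

definition homotopy_rest ::
  "('k, 'a) module \<Rightarrow> (nat \<Rightarrow> ('a, 'e) module) \<Rightarrow> (nat \<Rightarrow> 'e \<Rightarrow> 'e) \<Rightarrow> (nat \<Rightarrow> 'e \<Rightarrow> 'e) \<Rightarrow> (nat \<Rightarrow> 'e) \<Rightarrow> nat \<Rightarrow> 'e"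
  where "homotopy_rest A P d s x = x \<ominus>\<^bsub>restrict_scalars A (prod_family P)\<^esub>
     (shift_up P d (shift_down s x) \<oplus>\<^bsub>restrict_scalars A (prod_family P)\<^esub> shift_down s (shift_up P d x))"

context
  fixes K :: "'k ring" and A :: "('k, 'a) module" and P :: "nat \<Rightarrow> ('a, 'e) module" and d s S
  assumes A: "algebra K A" and P: "\<And>n. module A (P n)"
    and d: "\<And>n. d n \<in> module_hom A (P n) (P (Suc n))"
    and S: "subcomplex A P d S"
    and s: "\<And>n. s n \<in> module_hom K (restrict_scalars A (P (Suc n))) (restrict_scalars A (P n))"
    and sS_all: "\<forall>n. \<forall>w\<in>S (Suc n). s n w \<in> S n"
    and dsd_all: "\<forall>n. \<forall>v\<in>S n. d n (s n (d n v)) = d n v"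
begin

private lemmas sS = sS_all[rule_format]
private lemmas dsd = dsd_all[rule_format]

private lemmas Sub = submodule_facts[OF P subcomplexD(1)[OF S]]
private lemmas Vm = module_prod_family[of A P, OF P]
private lemmas VK = module_restrict_scalars[OF A Vm]

lemma shift_hom_K:
  "shift_up P d \<in> module_hom K (restrict_scalars A (prod_family P)) (restrict_scalars A (prod_family P))"
  "shift_down s \<in> module_hom K (restrict_scalars A (prod_family P)) (restrict_scalars A (prod_family P))"
  "alternate P \<in> module_hom K (restrict_scalars A (prod_family P)) (restrict_scalars A (prod_family P))"
  by (rule module_hom_restrict_scalars[OF A shift_up_hom[of A P, OF P d]] shift_down_hom[of s K A P, OF s]
      module_hom_restrict_scalars[OF A alternate_hom[of A P, OF P]])+

lemma homotopy_rest_hom: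
  "homotopy_rest A P d s \<in> module_hom K (restrict_scalars A (prod_family P)) (restrict_scalars A (prod_family P))"
  unfolding homotopy_rest_def[abs_def] a_minus_def
  by (intro module_hom_sum[OF VK] module_hom_uminus[OF VK]
    module_hom_id module_hom_comp[OF shift_hom_K(1) shift_hom_K(2)]
      module_hom_comp[OF shift_hom_K(2) shift_hom_K(1)])

private lemma s0: "s n \<zero>\<^bsub>P (Suc n)\<^esub> = \<zero>\<^bsub>P n\<^esub>"
  using module_hom_zero[OF module_restrict_scalars[OF A P] module_restrict_scalars[OF A P] s] by simp

private lemmas up = hsingle_shift_up[of A P d, OF P d]
private lemmas down = hsingle_shift_down[of s P, OF s0]
private lemmas alt = hsingle_alternate[of A P, OF P]

lemma hsingle_S: "v \<in> S i \<Longrightarrow> hsingle P i v \<in> carrier (prod_family P)"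
  using module_homD(1)[OF hsingle_hom[of A P, OF P], of v i] Sub(1) by simp

text \<open>In degree 0 the result is zero, which is also \<open>hsingle P 0\<close> of zero, so the
  truncated \<open>i - 1\<close> causes no exception.\<close>

lemma shift_down_S:
  assumes "v \<in> S i"
  shows "\<exists>u\<in>S (i - 1). shift_down s (hsingle P i v) = hsingle P (i - 1) u" "i = 0 \<Longrightarrow> shift_down s (hsingle P i v) =
      \<zero>\<^bsub>prod_family P\<^esub>"
proof -
  show "i = 0 \<Longrightarrow> shift_down s (hsingle P i v) = \<zero>\<^bsub>prod_family P\<^esub>" by (simp only: down)
  show "\<exists>u\<in>S (i - 1). shift_down s (hsingle P i v) = hsingle P (i - 1) u"
  proof (cases i)
    case 0
    thus ?thesis using Sub(2)[of 0] hsingle_zero[of P 0, symmetric] by (simp only: down diff_0_eq_0) blast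
  next
    case (Suc k)
    thus ?thesis using sS assms by (auto simp: down)
  qed
qed

text \<open>The operator 1 - d s - s d preserves the degree, and d maps the result to d v - d s d v
  = 0. The term c stands for d s v, which is zero in degree 0.\<close>

lemma homotopy_rest_S:
  assumes v: "v \<in> S i"
  shows "\<exists>u\<in>S i. homotopy_rest A P d s (hsingle P i v) = hsingle P i u \<and> d i u = \<zero>\<^bsub>P (Suc i)\<^esub>"
proof -
  interpret Pi: module A "P i" by (rule P)
  interpret Ps: module A "P (Suc i)" by (rule P)
  define c where "c = (case i of 0 \<Rightarrow> \<zero>\<^bsub>P i\<^esub> | Suc k \<Rightarrow> d k (s k v))"
  define u where "u = v \<ominus>\<^bsub>P i\<^esub> (c \<oplus>\<^bsub>P i\<^esub> s i (d i v))"
  have c: "c \<in> S i" "d i c = \<zero>\<^bsub>P (Suc i)\<^esub>" "shift_up P d (shift_down s (hsingle P i v)) = hsingle P i c"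
  proof -
    have "c \<in> S i \<and> d i c = \<zero>\<^bsub>P (Suc i)\<^esub> \<and> shift_up P d (shift_down s (hsingle P i v)) = hsingle P i c"
    proof (cases i)
      case 0
      have "shift_up P d \<zero>\<^bsub>prod_family P\<^esub> = \<zero>\<^bsub>prod_family P\<^esub>"
        by (rule module_hom_zero[OF Vm Vm shift_up_hom[of A P, OF P d]])
      thus ?thesis using 0 Sub(2)[of i] module_hom_zero[OF P P d, of i]
        by (simp only: c_def nat.case down hsingle_zero simp_thms)
    next
      case (Suc k)
      thus ?thesis using v sS[of v k] subcomplexD(2,3)[OF S, of "s k v" k] by (simp add: c_def down up)
    qed
    thus "c \<in> S i" "d i c = \<zero>\<^bsub>P (Suc i)\<^esub>" "shift_up P d (shift_down s (hsingle P i v)) = hsingle P i c" by auto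
  qed
  have e: "s i (d i v) \<in> S i" using sS subcomplexD(2)[OF S v] by blast
  have uS: "u \<in> S i" unfolding u_def by (intro Sub v c e)
  have carr: "v \<in> carrier (P i)" "c \<in> carrier (P i)" "s i (d i v) \<in> carrier (P i)" "d i v \<in> carrier (P (Suc i))"
    using Sub(1) v c(1) e subcomplexD(2)[OF S v] by blast+
  have "d i u = d i v \<ominus>\<^bsub>P (Suc i)\<^esub> (d i c \<oplus>\<^bsub>P (Suc i)\<^esub> d i (s i (d i v)))"
    unfolding u_def using module_hom_diff[OF P P d, of v i] module_homD(2)[OF d[of i]] carr by simp
  also have "\<dots> = \<zero>\<^bsub>P (Suc i)\<^esub>" using c(2) dsd[OF v] carr Ps.diff_zero_iff by simp
  finally have du: "d i u = \<zero>\<^bsub>P (Suc i)\<^esub>" .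
  note hs = hsingle_hom[of A P i, OF P]
  have "hsingle P i u = hsingle P i v \<ominus>\<^bsub>prod_family P\<^esub> (hsingle P i c \<oplus>\<^bsub>prod_family P\<^esub> hsingle P i (s i (d i v)))"
    unfolding u_def using module_hom_diff[OF P Vm hs] module_homD(2)[OF hs] carr by simp
  also have "\<dots> = homotopy_rest A P d s (hsingle P i v)"
  proof -
    interpret V: module A "prod_family P" by (rule Vm)
    have cc: "hsingle P i v \<in> carrier (prod_family P)" "hsingle P i c \<in> carrier (prod_family P)"
      "hsingle P i (s i (d i v)) \<in> carrier (prod_family P)"
      using hsingle_S v c(1) e by blast+
    have "homotopy_rest A P d s (hsingle P i v) = hsingle P i v \<ominus>\<^bsub>restrict_scalars A (prod_family P)\<^esub>
        (hsingle P i c \<oplus>\<^bsub>prod_family P\<^esub> hsingle P i (s i (d i v)))"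
      unfolding homotopy_rest_def c(3) up down(2) restrict_scalars_simps ..
    also have "\<dots> = hsingle P i v \<ominus>\<^bsub>prod_family P\<^esub> (hsingle P i c \<oplus>\<^bsub>prod_family P\<^esub> hsingle P i (s i (d i v)))"
      by (rule restrict_scalars_minus(2)[OF A Vm cc(1) V.M.a_closed[OF cc(2,3)]])
    finally show ?thesis by (rule sym)
  qed
  finally have eq: "hsingle P i u = homotopy_rest A P d s (hsingle P i v)" .
  show ?thesis by (intro bexI[OF _ uS] conjI eq[symmetric] du)
qed

text \<open>Collects the hypotheses of \<open>homotopy_pure\<close>. The minus signs arise because
  the grading sign flips under operators of degree 1 and -1.\<close>

lemma homogeneous_facts:
  assumes "x \<in> homogeneous P S"
  shows "x \<in> carrier (restrict_scalars A (prod_family P))" "shift_up P d x \<in> homogeneous P S"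
      "shift_down s x \<in> homogeneous P S" "alternate P x \<in> homogeneous P S"
    "homotopy_rest A P d s x \<in> homogeneous P S"
    "shift_up P d (shift_up P d x) = \<zero>\<^bsub>restrict_scalars A (prod_family P)\<^esub>"
    "shift_up P d (shift_down s (shift_up P d x)) = shift_up P d x"
    "alternate P (alternate P x) = x"
    "shift_up P d (alternate P x) = \<ominus>\<^bsub>restrict_scalars A (prod_family P)\<^esub> alternate P (shift_up P d x)"
    "shift_down s (alternate P x) = \<ominus>\<^bsub>restrict_scalars A (prod_family P)\<^esub> alternate P (shift_down s x)"
proof -
  obtain i v where x: "x = hsingle P i v" and v: "v \<in> S i" using assms by (auto simp: homogeneous_def)
  interpret V: module A "prod_family P" by (rule Vm)
  have neg: "sign P i v \<in> S i" if "v \<in> S i" for i v using that Sub(4) by (simp add: sign_def)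
  note hs = hsingle_hom[of A P, OF P]
  have hneg: "hsingle P i (\<ominus>\<^bsub>P i\<^esub> v) = \<ominus>\<^bsub>restrict_scalars A (prod_family P)\<^esub> hsingle P i v" if "v \<in> S i" for i v
    using module_hom_neg[OF P Vm hs Sub(1)[OF that]] restrict_scalars_minus(1)[OF A Vm hsingle_S[OF that]
      hsingle_S[OF that]]
    by simp
  have nn: "\<ominus>\<^bsub>P i\<^esub> (\<ominus>\<^bsub>P i\<^esub> v) = v" if "v \<in> S i" for i v
  proof -
    interpret module A "P i" by (rule P)
    show ?thesis using Sub(1)[OF that] by simp
  qed
  show "x \<in> carrier (restrict_scalars A (prod_family P))" using hsingle_S[OF v] x by simp
  show "shift_up P d x \<in> homogeneous P S" using subcomplexD(2)[OF S v] unfolding x up homogeneous_def by blast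
  show "shift_down s x \<in> homogeneous P S" using shift_down_S(1)[OF v] unfolding x homogeneous_def by blast
  show "alternate P x \<in> homogeneous P S" using neg[OF v] unfolding x alt homogeneous_def by blast
  show "homotopy_rest A P d s x \<in> homogeneous P S" using homotopy_rest_S[OF v] unfolding x homogeneous_def by blast
  show "shift_up P d (shift_up P d x) = \<zero>\<^bsub>restrict_scalars A (prod_family P)\<^esub>"
    unfolding x up subcomplexD(3)[OF S v] hsingle_zero by simp
  show "shift_up P d (shift_down s (shift_up P d x)) = shift_up P d x"
    unfolding x up down dsd[OF v] ..
  show "alternate P (alternate P x) = x" unfolding x alt using nn[OF v] by (simp add: sign_def)
  have ds: "d i (sign P i v) = \<ominus>\<^bsub>P (Suc i)\<^esub> sign P (Suc i) (d i v)"
    using module_hom_neg[OF P P d Sub(1)[OF v]] nn[OF subcomplexD(2)[OF S v]] by (simp add: sign_def)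
  show "shift_up P d (alternate P x) = \<ominus>\<^bsub>restrict_scalars A (prod_family P)\<^esub> alternate P (shift_up P d x)"
    unfolding x alt up ds using hneg[OF neg[OF subcomplexD(2)[OF S v]]] .
  show "shift_down s (alternate P x) = \<ominus>\<^bsub>restrict_scalars A (prod_family P)\<^esub> alternate P (shift_down s x)"
  proof (cases i)
    case 0
    have "alternate P \<zero>\<^bsub>prod_family P\<^esub> = \<zero>\<^bsub>prod_family P\<^esub>"
      by (rule module_hom_zero[OF Vm Vm alternate_hom[of A P, OF P]])
    moreover have "\<ominus>\<^bsub>restrict_scalars A (prod_family P)\<^esub> \<zero>\<^bsub>prod_family P\<^esub> = \<zero>\<^bsub>prod_family P\<^esub>"
      using restrict_scalars_minus(1)[OF A Vm V.M.zero_closed V.M.zero_closed] V.neg_eq_smult[OF V.M.zero_closed]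
        V.smult_r_null by (metis V.R.one_closed V.R.a_inv_closed)
    ultimately show ?thesis using 0 unfolding x by (simp only: alt down)
  next
    case (Suc k)
    have "\<ominus>\<^bsub>restrict_scalars A (P (Suc k))\<^esub> v = \<ominus>\<^bsub>P (Suc k)\<^esub> v"
      using restrict_scalars_minus(1)[OF A P] Sub(1) v Suc by blast
    moreover have "\<ominus>\<^bsub>restrict_scalars A (P k)\<^esub> s k v = \<ominus>\<^bsub>P k\<^esub> s k v"
      using restrict_scalars_minus(1)[OF A P] Sub(1) sS v Suc by blast
    ultimately have n: "s k (\<ominus>\<^bsub>P (Suc k)\<^esub> v) = \<ominus>\<^bsub>P k\<^esub> s k v"
      using module_hom_neg[OF module_restrict_scalars[OF A P] module_restrict_scalars[OF A P] s, of v k] Sub(1) v Suc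
        by simp
    have "s k (sign P (Suc k) v) = \<ominus>\<^bsub>P k\<^esub> sign P k (s k v)"
      using n nn[of "s k v" k] sS v Suc by (simp add: sign_def)
    thus ?thesis unfolding x Suc alt down using hneg[OF neg[of "s k v" k]] sS v Suc by simp
  qed
qed

end

subsection \<open>The total complex\<close>

locale tensor_complex =
  fixes K :: "'k ring" and A :: "('k, 'a) module" and B :: "('k, 'b) module"
    and P :: "nat \<Rightarrow> ('a, 'e) module" and Q :: "nat \<Rightarrow> ('b, 'f) module"
    and dP :: "nat \<Rightarrow> 'e \<Rightarrow> 'e" and dQ :: "nat \<Rightarrow> 'f \<Rightarrow> 'f"
  assumes K: "field K" and A: "algebra K A" and B: "algebra K B"
    and P: "\<And>n. module A (P n)" and Q: "\<And>n. module B (Q n)"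
    and dP: "\<And>n. dP n \<in> module_hom A (P n) (P (Suc n))"
    and dQ: "\<And>n. dQ n \<in> module_hom B (Q n) (Q (Suc n))"
begin

abbreviation "V \<equiv> prod_family P"
abbreviation "W \<equiv> prod_family Q"
abbreviation "VK \<equiv> restrict_scalars A V"
abbreviation "WK \<equiv> restrict_scalars B W"
abbreviation "R \<equiv> tensor_algebra K A B"
abbreviation "T \<equiv> tensor_module K A B V W"
abbreviation "pt \<equiv> pure_tensor K VK WK"
abbreviation "tmap \<equiv> tensor_module_map K A B V W V W"
abbreviation "\<tau> i v j w \<equiv> pt (hsingle P i v) (hsingle Q j w)"

lemma Vm: "module A V" by (rule module_prod_family[of A P, OF P])
lemma Wm: "module B W" by (rule module_prod_family[of B Q, OF Q])
lemma VKm: "module K VK" by (rule module_restrict_scalars[OF A Vm])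
lemma WKm: "module K WK" by (rule module_restrict_scalars[OF B Wm])

sublocale TM: module R T by (rule module_tensor_module[OF A B Vm Wm])

lemmas pure = tensor_module_pure[OF A B Vm Wm]

lemma hsP: "v \<in> carrier (P i) \<Longrightarrow> hsingle P i v \<in> carrier V"
  by (rule module_homD(1)[OF hsingle_hom[of A P, OF P]])

lemma hsQ: "w \<in> carrier (Q j) \<Longrightarrow> hsingle Q j w \<in> carrier W"
  by (rule module_homD(1)[OF hsingle_hom[of B Q, OF Q]])

definition D where "D U = tmap (shift_up P dP) (\<lambda>y. y) U \<oplus>\<^bsub>T\<^esub> tmap (alternate P) (shift_up Q dQ) U"

lemmas up_hom = shift_up_hom[of A P dP, OF P dP] shift_up_hom[of B Q dQ, OF Q dQ] alternate_hom[of A P, OF P]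
lemmas up_hom_K = module_hom_restrict_scalars[OF A up_hom(1)] module_hom_restrict_scalars[OF B up_hom(2)]
  module_hom_restrict_scalars[OF A up_hom(3)]

lemma D_hom: "D \<in> module_hom R T T"
  unfolding D_def[abs_def]
  by (rule module_hom_sum[OF TM.module_axioms tensor_module_map_hom[OF A B Vm Wm Vm Wm up_hom_K(1) module_hom_id
    up_hom(1) module_hom_id]
      tensor_module_map_hom[OF A B Vm Wm Vm Wm up_hom_K(3) up_hom_K(2) up_hom(3) up_hom(2)]])

lemma D_pure:
  assumes "x \<in> carrier V" "y \<in> carrier W"
  shows "D (pt x y) = pt (shift_up P dP x) y \<oplus>\<^bsub>T\<^esub> pt (alternate P x) (shift_up Q dQ y)"
  unfolding D_def tensor_module_map(3)[OF A B Vm Wm Vm Wm up_hom_K(1) module_hom_id assms]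
    tensor_module_map(3)[OF A B Vm Wm Vm Wm up_hom_K(3) up_hom_K(2) assms] ..

lemma D_gen:
  assumes "v \<in> carrier (P i)" "w \<in> carrier (Q j)"
  shows "D (\<tau> i v j w) = \<tau> (Suc i) (dP i v) j w \<oplus>\<^bsub>T\<^esub> \<tau> i (sign P i v) (Suc j) (dQ j w)"
  unfolding D_pure[OF hsP[OF assms(1)] hsQ[OF assms(2)]] hsingle_shift_up[of A P dP, OF P dP]
    hsingle_shift_up[of B Q dQ, OF Q dQ] hsingle_alternate[of A P, OF P] ..

lemma sign_P: "v \<in> carrier (P i) \<Longrightarrow> sign P i v \<in> carrier (P i)"
  using module.axioms(2)[OF P] abelian_group.a_inv_closed by (fastforce simp: sign_def)

lemma dP_carrier: "v \<in> carrier (P i) \<Longrightarrow> dP i v \<in> carrier (P (Suc i))"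
  by (rule module_homD(1)[OF dP])

lemma dQ_carrier: "w \<in> carrier (Q j) \<Longrightarrow> dQ j w \<in> carrier (Q (Suc j))"
  by (rule module_homD(1)[OF dQ])

lemma gen_closed: "\<lbrakk>v \<in> carrier (P i); w \<in> carrier (Q j)\<rbrakk> \<Longrightarrow> \<tau> i v j w \<in> carrier T"
  by (rule pure(1)[OF hsP hsQ])

lemma gen_zero:
  "w \<in> carrier (Q j) \<Longrightarrow> \<tau> i \<zero>\<^bsub>P i\<^esub> j w = \<zero>\<^bsub>T\<^esub>" "v \<in> carrier (P i) \<Longrightarrow> \<tau> i v j \<zero>\<^bsub>Q j\<^esub> = \<zero>\<^bsub>T\<^esub>"
proof -
  interpret V: module A V by (rule Vm)
  interpret W: module B W by (rule Wm)
  show "w \<in> carrier (Q j) \<Longrightarrow> \<tau> i \<zero>\<^bsub>P i\<^esub> j w = \<zero>\<^bsub>T\<^esub>"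
    unfolding hsingle_zero by (rule pure(4)[OF V.M.zero_closed hsQ])
  show "v \<in> carrier (P i) \<Longrightarrow> \<tau> i v j \<zero>\<^bsub>Q j\<^esub> = \<zero>\<^bsub>T\<^esub>"
    unfolding hsingle_zero by (rule pure(5)[OF hsP W.M.zero_closed])
qed

text \<open>The part of total degree n, as sums of homogeneous tensors. For submodules zero and
  negatives are already of this form. The parameters \<open>S\<close> and \<open>S'\<close> admit
  full complexes, torsion parts and cocycles alike.\<close>

inductive_set tot :: "(nat \<Rightarrow> 'e set) \<Rightarrow> (nat \<Rightarrow> 'f set) \<Rightarrow> nat \<Rightarrow> ((nat \<Rightarrow> 'e) \<times> (nat \<Rightarrow> 'f) \<Rightarrow>\<^sub>0 int) set set"
  for S S' n
  where gen: "\<lbrakk>v \<in> S i; w \<in> S' j; i + j = n\<rbrakk> \<Longrightarrow> \<tau> i v j w \<in> tot S S' n"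
  | add: "\<lbrakk>z \<in> tot S S' n; z' \<in> tot S S' n\<rbrakk> \<Longrightarrow> z \<oplus>\<^bsub>T\<^esub> z' \<in> tot S S' n"

lemma tot_closed:
  assumes "\<And>i. S i \<subseteq> carrier (P i)" "\<And>j. S' j \<subseteq> carrier (Q j)" "z \<in> tot S S' n"
  shows "z \<in> carrier T"
  using assms(3)
proof (induct rule: tot.induct)
  case (gen v i w j)
  thus ?case using gen_closed assms(1,2) by (meson subsetD)
next
  case (add z z')
  show ?case by (rule TM.M.a_closed[OF add(2,4)])
qed

lemma tot_zero:
  assumes "\<zero>\<^bsub>P n\<^esub> \<in> S n" "\<zero>\<^bsub>Q 0\<^esub> \<in> S' 0"
  shows "\<zero>\<^bsub>T\<^esub> \<in> tot S S' n"
proof -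
  have "\<zero>\<^bsub>Q 0\<^esub> \<in> carrier (Q 0)"
    using abelian_monoid.zero_closed[OF abelian_group.axioms(1)[OF module.axioms(2)[OF Q]]] .
  from gen_zero(1)[OF this, of n] tot.gen[of "\<zero>\<^bsub>P n\<^esub>" S n "\<zero>\<^bsub>Q 0\<^esub>" S' 0 n, OF assms]
  show ?thesis by simp
qed

lemma tot_map_closed:
  assumes z: "z \<in> tot S S' n" and S: "\<And>i. S i \<subseteq> carrier (P i)" "\<And>j. S' j \<subseteq> carrier (Q j)"
    and f: "\<And>U U'. \<lbrakk>U \<in> carrier T; U' \<in> carrier T\<rbrakk> \<Longrightarrow> f (U \<oplus>\<^bsub>T\<^esub> U') = f U \<oplus>\<^bsub>T\<^esub> f U'"
    and g: "\<And>v i w j. \<lbrakk>v \<in> S i; w \<in> S' j; i + j = n\<rbrakk> \<Longrightarrow> f (\<tau> i v j w) \<in> Z"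
    and Z: "\<And>a b. \<lbrakk>a \<in> Z; b \<in> Z\<rbrakk> \<Longrightarrow> a \<oplus>\<^bsub>T\<^esub> b \<in> Z"
  shows "f z \<in> Z"
  using z
proof (induct rule: tot.induct)
  case (gen v i w j)
  thus ?case by (rule g)
next
  case (add z z')
  show ?case
    unfolding f[OF tot_closed[OF S add(1)] tot_closed[OF S add(3)]] by (rule Z[OF add(2,4)])
qed

lemma tot_maps_eq:
  assumes z: "z \<in> tot S S' n" and S: "\<And>i. S i \<subseteq> carrier (P i)" "\<And>j. S' j \<subseteq> carrier (Q j)"
    and f: "\<And>U U'. \<lbrakk>U \<in> carrier T; U' \<in> carrier T\<rbrakk> \<Longrightarrow> f (U \<oplus>\<^bsub>T\<^esub> U') = f U \<oplus>\<^bsub>T\<^esub> f U'"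
    and g: "\<And>U U'. \<lbrakk>U \<in> carrier T; U' \<in> carrier T\<rbrakk> \<Longrightarrow> g (U \<oplus>\<^bsub>T\<^esub> U') = g U \<oplus>\<^bsub>T\<^esub> g U'"
    and eq: "\<And>v i w j. \<lbrakk>v \<in> S i; w \<in> S' j; i + j = n\<rbrakk> \<Longrightarrow> f (\<tau> i v j w) = g (\<tau> i v j w)"
  shows "f z = g z"
  using z
proof (induct rule: tot.induct)
  case (gen v i w j)
  thus ?case by (rule eq)
next
  case (add z z')
  show ?case
    unfolding f[OF tot_closed[OF S add(1)] tot_closed[OF S add(3)]] g[OF tot_closed[OF S add(1)]
      tot_closed[OF S add(3)]]
      add(2,4) ..
qed

lemma tot_submodule:
  assumes S: "\<And>i. submodule (S i) A (P i)" and S': "\<And>j. submodule (S' j) B (Q j)"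
  shows "submodule (tot S S' n) R T"
proof (rule TM.submoduleI')
  note f = submodule_facts[OF P S] and f' = submodule_facts[OF Q S']
  have Sc: "S i \<subseteq> carrier (P i)" "S' j \<subseteq> carrier (Q j)" for i j using f(1) f'(1) by blast+
  note tc = tot_closed[of S S', OF Sc]
  show "tot S S' n \<subseteq> carrier T" by (rule subsetI) (rule tc)
  show z: "\<zero>\<^bsub>T\<^esub> \<in> tot S S' n" by (rule tot_zero[of n S S', OF f(2) f'(2)])
  show "\<And>a b. \<lbrakk>a \<in> tot S S' n; b \<in> tot S S' n\<rbrakk> \<Longrightarrow> a \<oplus>\<^bsub>T\<^esub> b \<in> tot S S' n" by (rule tot.add)
  fix r z assume r: "r \<in> carrier R" and z: "z \<in> tot S S' n"
  show "r \<odot>\<^bsub>T\<^esub> z \<in> tot S S' n"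
    using A B r
  proof (induct r rule: tensor_algebra_induct')
    case (pure a b)
    have p: "pure_tensor K A B a b \<in> carrier R"
      using pure_tensor_closed[OF algebra_D(3)[OF A] algebra_D(3)[OF B] pure] by (simp only: tensor_algebra_simps)
    show ?case
    proof (rule tot_map_closed[OF z Sc, of "\<lambda>z. pure_tensor K A B a b \<odot>\<^bsub>T\<^esub> z"])
      show "\<And>U U'. \<lbrakk>U \<in> carrier T; U' \<in> carrier T\<rbrakk> \<Longrightarrow> pure_tensor K A B a b \<odot>\<^bsub>T\<^esub> (U \<oplus>\<^bsub>T\<^esub> U') =
          pure_tensor K A B a b \<odot>\<^bsub>T\<^esub> U \<oplus>\<^bsub>T\<^esub> pure_tensor K A B a b \<odot>\<^bsub>T\<^esub> U'"
        by (rule TM.smult_r_distr[OF p])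
      show "\<And>u v. \<lbrakk>u \<in> tot S S' n; v \<in> tot S S' n\<rbrakk> \<Longrightarrow> u \<oplus>\<^bsub>T\<^esub> v \<in> tot S S' n" by (rule tot.add)
      fix v i w j assume vw: "v \<in> S i" "w \<in> S' j" "i + j = n"
      have "pure_tensor K A B a b \<odot>\<^bsub>T\<^esub> \<tau> i v j w = \<tau> i (a \<odot>\<^bsub>P i\<^esub> v) j (b \<odot>\<^bsub>Q j\<^esub> w)"
        using tensor_module_pure(6)[OF A B Vm Wm hsP[OF f(1)[OF vw(1)]] hsQ[OF f'(1)[OF vw(2)]] pure]
          module_homD(3)[OF hsingle_hom[of A P, OF P] pure(1) f(1)[OF vw(1)]]
          module_homD(3)[OF hsingle_hom[of B Q, OF Q] pure(2) f'(1)[OF vw(2)]] by (simp only:)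
      thus "pure_tensor K A B a b \<odot>\<^bsub>T\<^esub> \<tau> i v j w \<in> tot S S' n"
        using tot.gen[of _ S i _ S' j n, OF f(6)[OF pure(1) vw(1)] f'(6)[OF pure(2) vw(2)] vw(3)] by (simp only:)
    qed
  next
    case (add r s)
    show ?case
      unfolding TM.smult_l_distr[OF add(1,2) tc[OF z]] by (rule tot.add[OF add(3,4)])
  qed
qed

lemma D_add: "\<lbrakk>U \<in> carrier T; U' \<in> carrier T\<rbrakk> \<Longrightarrow> D (U \<oplus>\<^bsub>T\<^esub> U') = D U \<oplus>\<^bsub>T\<^esub> D U'"
  by (rule module_homD(2)[OF D_hom])

lemma D_closed: "U \<in> carrier T \<Longrightarrow> D U \<in> carrier T"
  by (rule module_homD(1)[OF D_hom])

lemma D_zero: "D \<zero>\<^bsub>T\<^esub> = \<zero>\<^bsub>T\<^esub>"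
  by (rule module_hom_zero[OF TM.module_axioms TM.module_axioms D_hom])

lemma tmap_zero:
  assumes "f \<in> module_hom K VK VK" "g \<in> module_hom K WK WK"
  shows "tmap f g \<zero>\<^bsub>T\<^esub> = \<zero>\<^bsub>T\<^esub>"
  using tensor_module_map(1)[OF A B Vm Wm Vm Wm assms TM.M.zero_closed]
    tensor_module_map(2)[OF A B Vm Wm Vm Wm assms TM.M.zero_closed TM.M.zero_closed]
  by (metis TM.M.add.l_cancel_one' TM.M.l_zero TM.M.zero_closed)

end

locale tensor_subcomplex = tensor_complex K A B P Q dP dQ
  for K :: "'k ring" and A :: "('k, 'a) module" and B :: "('k, 'b) module"
    and P :: "nat \<Rightarrow> ('a, 'e) module" and Q :: "nat \<Rightarrow> ('b, 'f) module"
    and dP :: "nat \<Rightarrow> 'e \<Rightarrow> 'e" and dQ :: "nat \<Rightarrow> 'f \<Rightarrow> 'f" +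
  fixes S :: "nat \<Rightarrow> 'e set" and S' :: "nat \<Rightarrow> 'f set"
  assumes S: "subcomplex A P dP S" and S': "subcomplex B Q dQ S'"
begin

lemmas SD = submodule_facts[OF P subcomplexD(1)[OF S]]
lemmas SD' = submodule_facts[OF Q subcomplexD(1)[OF S']]

lemma Sc: "S i \<subseteq> carrier (P i)" "S' j \<subseteq> carrier (Q j)"
  using SD(1) SD'(1) by blast+

lemmas tc = tot_closed[of S S', OF Sc]

lemma tot0: "\<zero>\<^bsub>T\<^esub> \<in> tot S S' n"
  by (rule tot_zero[of n S S', OF SD(2) SD'(2)])

lemma sign_S: "v \<in> S i \<Longrightarrow> sign P i v \<in> S i"
  by (simp add: sign_def SD(4))

lemma D_tot:
  assumes "z \<in> tot S S' n"
  shows "D z \<in> tot S S' (Suc n)"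
proof (rule tot_map_closed[OF assms Sc, of D])
  fix v i w j assume vw: "v \<in> S i" "w \<in> S' j" "i + j = n"
  show "D (\<tau> i v j w) \<in> tot S S' (Suc n)"
    unfolding D_gen[OF SD(1)[OF vw(1)] SD'(1)[OF vw(2)]]
    by (intro tot.add tot.gen subcomplexD(2)[OF S] subcomplexD(2)[OF S'] sign_S vw) (use vw in auto)
qed (rule D_add tot.add; assumption)+

lemma D_D:
  assumes "z \<in> tot S S' n"
  shows "D (D z) = \<zero>\<^bsub>T\<^esub>"
proof -
  have "D (D z) \<in> {\<zero>\<^bsub>T\<^esub>}"
  proof (rule tot_map_closed[OF assms Sc, of "\<lambda>z. D (D z)"])
    fix v i w j assume vw: "v \<in> S i" "w \<in> S' j" "i + j = n"
    note c = SD(1)[OF vw(1)] SD'(1)[OF vw(2)]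
    interpret Pi: module A "P i" by (rule P)
    interpret Ps: module A "P (Suc i)" by (rule P)
    have dc: "dP i v \<in> carrier (P (Suc i))" "dQ j w \<in> carrier (Q (Suc j))" "sign P i v \<in> carrier (P i)"
      "dP i (sign P i v) \<in> carrier (P (Suc i))" "sign P (Suc i) (dP i v) \<in> carrier (P (Suc i))"
      "sign P i (sign P i v) \<in> carrier (P i)"
      by (intro dP_carrier dQ_carrier sign_P c)+
    have "D (D (\<tau> i v j w)) = D (\<tau> (Suc i) (dP i v) j w) \<oplus>\<^bsub>T\<^esub> D (\<tau> i (sign P i v) (Suc j) (dQ j w))"
      unfolding D_gen[OF c] by (intro D_add gen_closed dc c)
    also have "D (\<tau> (Suc i) (dP i v) j w) = \<tau> (Suc i) (sign P (Suc i) (dP i v)) (Suc j) (dQ j w)"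
      unfolding D_gen[OF dc(1) c(2)] subcomplexD(3)[OF S vw(1)] gen_zero(1)[OF c(2)]
      by (rule TM.M.l_zero[OF gen_closed[OF dc(5,2)]])
    also have "D (\<tau> i (sign P i v) (Suc j) (dQ j w)) = \<tau> (Suc i) (dP i (sign P i v)) (Suc j) (dQ j w)"
      unfolding D_gen[OF dc(3,2)] subcomplexD(3)[OF S' vw(2)] gen_zero(2)[OF dc(6)]
      by (rule TM.M.r_zero[OF gen_closed[OF dc(4,2)]])
    \<comment> \<open>The two mixed terms share their second factor and are merged; their first
      factors are opposite by the grading sign.\<close>
    also have "\<tau> (Suc i) (sign P (Suc i) (dP i v)) (Suc j) (dQ j w) \<oplus>\<^bsub>T\<^esub> \<tau> (Suc i) (dP i (sign P i v)) (Suc j) (dQ j w)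
       = \<tau> (Suc i) (sign P (Suc i) (dP i v) \<oplus>\<^bsub>P (Suc i)\<^esub> dP i (sign P i v)) (Suc j) (dQ j w)"
      using pure(2)[OF hsP[OF dc(5)] hsQ[OF dc(2)] hsP[OF dc(4)]]
        module_homD(2)[OF hsingle_hom[of A P, OF P] dc(5,4)] by (simp only:)
    also have "sign P (Suc i) (dP i v) \<oplus>\<^bsub>P (Suc i)\<^esub> dP i (sign P i v) = \<zero>\<^bsub>P (Suc i)\<^esub>"
      using module_hom_neg[OF P P dP c(1)] dc(1) by (simp add: sign_def Ps.M.l_neg Ps.M.r_neg)
    also have "\<tau> (Suc i) \<zero>\<^bsub>P (Suc i)\<^esub> (Suc j) (dQ j w) = \<zero>\<^bsub>T\<^esub>" by (rule gen_zero(1)[OF dc(2)])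
    finally have "D (D (\<tau> i v j w)) = \<zero>\<^bsub>T\<^esub>" .
    thus "D (D (\<tau> i v j w)) \<in> {\<zero>\<^bsub>T\<^esub>}" by (simp only: singleton_iff)
  next
    show "\<And>a b. \<lbrakk>a \<in> {\<zero>\<^bsub>T\<^esub>}; b \<in> {\<zero>\<^bsub>T\<^esub>}\<rbrakk> \<Longrightarrow> a \<oplus>\<^bsub>T\<^esub> b \<in> {\<zero>\<^bsub>T\<^esub>}"
      using TM.M.l_zero[OF TM.M.zero_closed] by (simp only: singleton_iff)
    fix U U' assume U: "U \<in> carrier T" "U' \<in> carrier T"
    show "D (D (U \<oplus>\<^bsub>T\<^esub> U')) = D (D U) \<oplus>\<^bsub>T\<^esub> D (D U')"
      unfolding D_add[OF U] by (rule D_add[OF D_closed[OF U(1)] D_closed[OF U(2)]])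
  qed
  thus ?thesis by simp
qed

definition Z where "Z i = {v \<in> S i. dP i v = \<zero>\<^bsub>P (Suc i)\<^esub>}"
definition Z' where "Z' j = {w \<in> S' j. dQ j w = \<zero>\<^bsub>Q (Suc j)\<^esub>}"

lemma Zc: "Z i \<subseteq> carrier (P i)" "Z' j \<subseteq> carrier (Q j)"
  using Sc by (auto simp: Z_def Z'_def)

text \<open>The homotopy formula gives z = D (h z) + h (D z) + \<kappa> z, where h lowers the degree
  by one and \<kappa> = \<pi> \<otimes> \<rho> produces tensor products of cocycles. In degree 0 the
  first term vanishes.\<close>

lemma cocycle_decomposition:
  assumes z: "z \<in> tot S S' n" and Dz: "D z = \<zero>\<^bsub>T\<^esub>"
  shows "case n of 0 \<Rightarrow> z \<in> tot Z Z' 0 | Suc m \<Rightarrow> \<exists>b\<in>tot S S' m. \<exists>c\<in>tot Z Z' n. z = D b \<oplus>\<^bsub>T\<^esub> c"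
proof -
  obtain s where s: "\<And>n. s n \<in> module_hom K (restrict_scalars A (P (Suc n))) (restrict_scalars A (P n))"
    "\<forall>n. \<forall>w\<in>S (Suc n). s n w \<in> S n" "\<forall>n. \<forall>v\<in>S n. dP n (s n (dP n v)) = dP n v"
    using generalized_inverse_family[of K A P "\<lambda>n. P (Suc n)" S "\<lambda>n. S (Suc n)" dP, OF K A P P
        subcomplexD(1)[OF S] subcomplexD(1)[OF S] dP subcomplexD(2)[OF S]] by blast
  obtain t where t: "\<And>n. t n \<in> module_hom K (restrict_scalars B (Q (Suc n))) (restrict_scalars B (Q n))"
    "\<forall>n. \<forall>w\<in>S' (Suc n). t n w \<in> S' n" "\<forall>n. \<forall>v\<in>S' n. dQ n (t n (dQ n v)) = dQ n v"
    using generalized_inverse_family[of K B Q "\<lambda>n. Q (Suc n)" S' "\<lambda>n. S' (Suc n)" dQ, OF K B Q Q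
        subcomplexD(1)[OF S'] subcomplexD(1)[OF S'] dQ subcomplexD(2)[OF S']] by blast
  let ?d = "shift_up P dP" and ?s = "shift_down s" and ?\<sigma> = "alternate P" and ?\<pi> = "homotopy_rest A P dP s"
  let ?d' = "shift_up Q dQ" and ?t = "shift_down t" and ?\<rho> = "homotopy_rest B Q dQ t"
  note ctxP = A P dP S s and ctxQ = B Q dQ S' t
  note hP = shift_hom_K[of K A P dP S s, OF ctxP] and hQ = shift_hom_K[of K B Q dQ S' t, OF ctxQ]
  note \<pi>h = homotopy_rest_hom[of K A P dP S s, OF ctxP] and \<rho>h = homotopy_rest_hom[of K B Q dQ S' t, OF ctxQ]
  note \<sigma>\<pi> = module_hom_comp[OF \<pi>h hP(3)]
  define h where "h U = tmap ?s (\<lambda>y. y) U \<oplus>\<^bsub>T\<^esub> tmap (\<lambda>x. ?\<sigma> (?\<pi> x)) ?t U" for U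
  define \<kappa> where "\<kappa> = tmap ?\<pi> ?\<rho>"
  note tm1 = tensor_module_map[OF A B Vm Wm Vm Wm hP(2) module_hom_id]
  note tm2 = tensor_module_map[OF A B Vm Wm Vm Wm \<sigma>\<pi> hQ(2)]
  note tm3 = tensor_module_map[OF A B Vm Wm Vm Wm \<pi>h \<rho>h, folded \<kappa>_def]
  have h_closed: "h U \<in> carrier T" if "U \<in> carrier T" for U
    unfolding h_def by (rule TM.M.a_closed[OF tm1(1)[OF that] tm2(1)[OF that]])
  have h_add: "h (U \<oplus>\<^bsub>T\<^esub> U') = h U \<oplus>\<^bsub>T\<^esub> h U'" if U: "U \<in> carrier T" "U' \<in> carrier T" for U U'
  proof -
    have "(a \<oplus>\<^bsub>T\<^esub> b) \<oplus>\<^bsub>T\<^esub> (c \<oplus>\<^bsub>T\<^esub> e) = (a \<oplus>\<^bsub>T\<^esub> c) \<oplus>\<^bsub>T\<^esub> (b \<oplus>\<^bsub>T\<^esub> e)"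
      if "a \<in> carrier T" "b \<in> carrier T" "c \<in> carrier T" "e \<in> carrier T" for a b c e
      using that by (simp only: TM.M.a_ac TM.M.a_closed)
    thus ?thesis unfolding h_def tm1(2)[OF U] tm2(2)[OF U]
      using tm1(1)[OF U(1)] tm1(1)[OF U(2)] tm2(1)[OF U(1)] tm2(1)[OF U(2)] by blast
  qed
  have h_pure: "h (pt x y) = pt (?s x) y \<oplus>\<^bsub>T\<^esub> pt (?\<sigma> (?\<pi> x)) (?t y)" if "x \<in> carrier V" "y \<in> carrier W" for x y
    unfolding h_def tm1(3)[OF that] tm2(3)[OF that] ..
  have hsS: "hsingle P i v \<in> homogeneous P S" if "v \<in> S i" for i v
    using that by (auto simp: homogeneous_def)
  note hf = homogeneous_facts[of K A P dP S s, OF ctxP]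
  have key: "\<tau> i v j w = (D (h (\<tau> i v j w)) \<oplus>\<^bsub>T\<^esub> h (D (\<tau> i v j w))) \<oplus>\<^bsub>T\<^esub> \<kappa> (\<tau> i v j w)"
    if v: "v \<in> S i" and w: "w \<in> S' j" for i v j w
  proof -
    have y: "hsingle Q j w \<in> carrier WK" using hsQ[OF SD'(1)[OF w]] by (simp only: restrict_scalars_simps)
    have T: "add T = monoid.mult (tensor_group K VK WK)" by (rule tensor_module_simps(3))
    have "\<tau> i v j w = (D (h (\<tau> i v j w)) \<otimes>\<^bsub>tensor_group K VK WK\<^esub> h (D (\<tau> i v j w)))
        \<otimes>\<^bsub>tensor_group K VK WK\<^esub> pt (?\<pi> (hsingle P i v)) (hsingle Q j w \<ominus>\<^bsub>WK\<^esub> (?d' (?t (hsingle Q j w))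
            \<oplus>\<^bsub>WK\<^esub> ?t (?d' (hsingle Q j w))))"
    proof (rule homotopy_pure(1)[where H = "homogeneous P S" and \<pi> = ?\<pi> and \<sigma> = ?\<sigma> and d = ?d and d' = ?d' and s =
        ?s and t = ?t
            and D = D and h = h, OF VKm WKm hP(1,2,3) hQ(1,2)])
      show "\<And>U U'. \<lbrakk>U \<in> carrier (tensor_group K VK WK); U' \<in> carrier (tensor_group K VK WK)\<rbrakk> \<Longrightarrow>
          D (U \<otimes>\<^bsub>tensor_group K VK WK\<^esub> U') = D U \<otimes>\<^bsub>tensor_group K VK WK\<^esub> D U'"
        using D_add by (simp only: tensor_module_simps)
      show "\<And>U U'. \<lbrakk>U \<in> carrier (tensor_group K VK WK); U' \<in> carrier (tensor_group K VK WK)\<rbrakk> \<Longrightarrow>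
          h (U \<otimes>\<^bsub>tensor_group K VK WK\<^esub> U') = h U \<otimes>\<^bsub>tensor_group K VK WK\<^esub> h U'"
        using h_add by (simp only: tensor_module_simps)
      show "\<And>x y. \<lbrakk>x \<in> carrier VK; y \<in> carrier WK\<rbrakk> \<Longrightarrow> D (pt x y) = pt (?d x) y \<otimes>\<^bsub>tensor_group K VK WK\<^esub> pt (?\<sigma> x) (?d' y)"
        using D_pure by (simp only: tensor_module_simps restrict_scalars_simps)
      show "\<And>x y. \<lbrakk>x \<in> carrier VK; y \<in> carrier WK\<rbrakk> \<Longrightarrow> h (pt x y) =
          pt (?s x) y \<otimes>\<^bsub>tensor_group K VK WK\<^esub> pt (?\<sigma> (?\<pi> x)) (?t y)"
        using h_pure by (simp only: tensor_module_simps restrict_scalars_simps)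
      show "homogeneous P S \<subseteq> carrier VK" using hf(1) by blast
      show "hsingle P i v \<in> homogeneous P S" by (rule hsS[OF v])
      show "\<And>x. ?\<pi> x = x \<ominus>\<^bsub>VK\<^esub> (?d (?s x) \<oplus>\<^bsub>VK\<^esub> ?s (?d x))" by (rule homotopy_rest_def)
    qed (rule hf y; assumption?)+
    also have "hsingle Q j w \<ominus>\<^bsub>WK\<^esub> (?d' (?t (hsingle Q j w)) \<oplus>\<^bsub>WK\<^esub> ?t (?d' (hsingle Q j w))) = ?\<rho> (hsingle Q j w)"
      by (simp only: homotopy_rest_def)
    also have "pt (?\<pi> (hsingle P i v)) (?\<rho> (hsingle Q j w)) = \<kappa> (\<tau> i v j w)"
      by (rule tm3(3)[OF hsP[OF SD(1)[OF v]] hsQ[OF SD'(1)[OF w]], symmetric])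
    finally show ?thesis unfolding T .
  qed
  have decomp: "z = (D (h z) \<oplus>\<^bsub>T\<^esub> h (D z)) \<oplus>\<^bsub>T\<^esub> \<kappa> z"
  proof (rule tot_maps_eq[OF z Sc, of "\<lambda>z. z" "\<lambda>z. (D (h z) \<oplus>\<^bsub>T\<^esub> h (D z)) \<oplus>\<^bsub>T\<^esub> \<kappa> z"])
    fix U U' assume U: "U \<in> carrier T" "U' \<in> carrier T"
    have c: "D (h U) \<in> carrier T" "D (h U') \<in> carrier T" "h (D U) \<in> carrier T" "h (D U') \<in> carrier T"
      "\<kappa> U \<in> carrier T" "\<kappa> U' \<in> carrier T"
      by (intro D_closed h_closed tm3(1) U)+
    have "((a \<oplus>\<^bsub>T\<^esub> a') \<oplus>\<^bsub>T\<^esub> (b \<oplus>\<^bsub>T\<^esub> b')) \<oplus>\<^bsub>T\<^esub> (c \<oplus>\<^bsub>T\<^esub> c') = ((a \<oplus>\<^bsub>T\<^esub> b) \<oplus>\<^bsub>T\<^esub> c) \<oplus>\<^bsub>T\<^esub> ((a' \<oplus>\<^bsub>T\<^esub> b') \<oplus>\<^bsub>T\<^esub> c')"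
      if "a \<in> carrier T" "b \<in> carrier T" "c \<in> carrier T" "a' \<in> carrier T" "b' \<in> carrier T" "c' \<in> carrier T"
          for a b c a' b' c'
      using that by (simp only: TM.M.a_ac TM.M.a_closed)
    note ac = this[OF c(1,3,5,2,4,6)]
    show "(D (h (U \<oplus>\<^bsub>T\<^esub> U')) \<oplus>\<^bsub>T\<^esub> h (D (U \<oplus>\<^bsub>T\<^esub> U'))) \<oplus>\<^bsub>T\<^esub> \<kappa> (U \<oplus>\<^bsub>T\<^esub> U') =
        ((D (h U) \<oplus>\<^bsub>T\<^esub> h (D U)) \<oplus>\<^bsub>T\<^esub> \<kappa> U) \<oplus>\<^bsub>T\<^esub> ((D (h U') \<oplus>\<^bsub>T\<^esub> h (D U')) \<oplus>\<^bsub>T\<^esub> \<kappa> U')"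
      unfolding h_add[OF U] D_add[OF U] tm3(2)[OF U] D_add[OF h_closed[OF U(1)] h_closed[OF U(2)]]
        h_add[OF D_closed[OF U(1)] D_closed[OF U(2)]] by (rule ac)
  qed (rule refl key; assumption)+
  have h0: "h \<zero>\<^bsub>T\<^esub> = \<zero>\<^bsub>T\<^esub>"
    unfolding h_def tmap_zero[OF hP(2) module_hom_id] tmap_zero[OF \<sigma>\<pi> hQ(2)] by (rule TM.M.l_zero[OF TM.M.zero_closed])
  have \<kappa>z: "\<kappa> z \<in> tot Z Z' n"
  proof (rule tot_map_closed[OF z Sc, of \<kappa>])
    fix v i w j assume vw: "v \<in> S i" "w \<in> S' j" "i + j = n"
    obtain u where u: "u \<in> S i" "?\<pi> (hsingle P i v) = hsingle P i u" "dP i u = \<zero>\<^bsub>P (Suc i)\<^esub>"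
      using homotopy_rest_S[of K A P dP S s, OF ctxP vw(1)] by blast
    obtain u' where u': "u' \<in> S' j" "?\<rho> (hsingle Q j w) = hsingle Q j u'" "dQ j u' = \<zero>\<^bsub>Q (Suc j)\<^esub>"
      using homotopy_rest_S[of K B Q dQ S' t, OF ctxQ vw(2)] by blast
    have "\<kappa> (\<tau> i v j w) = \<tau> i u j u'"
      unfolding tm3(3)[OF hsP[OF SD(1)[OF vw(1)]] hsQ[OF SD'(1)[OF vw(2)]]] u(2) u'(2) ..
    moreover have "u \<in> Z i" "u' \<in> Z' j" using u u' by (auto simp: Z_def Z'_def)
    ultimately show "\<kappa> (\<tau> i v j w) \<in> tot Z Z' n" using tot.gen[of u Z i u' Z' j n] vw(3) by (simp only:)
  qed (rule tm3(2) tot.add; assumption)+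
  have zc: "z \<in> carrier T" by (rule tc[OF z])
  have decomp': "z = D (h z) \<oplus>\<^bsub>T\<^esub> \<kappa> z"
    using decomp unfolding Dz h0 TM.M.r_zero[OF D_closed[OF h_closed[OF zc]]] .
  \<comment> \<open>There is no degree -1, so for n = 0 the target is the zero group.\<close>
  have hgen: "h (\<tau> i v j w) \<in> (case n of 0 \<Rightarrow> {\<zero>\<^bsub>T\<^esub>} | Suc m \<Rightarrow> tot S S' m)"
    if vw: "v \<in> S i" "w \<in> S' j" "i + j = n" for v i w j
  proof -
    note x = hsP[OF SD(1)[OF vw(1)]] and y = hsQ[OF SD'(1)[OF vw(2)]]
    obtain u where u: "u \<in> S i" "?\<pi> (hsingle P i v) = hsingle P i u"
      using homotopy_rest_S[of K A P dP S s, OF ctxP vw(1)] by blast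
    have \<sigma>u: "?\<sigma> (?\<pi> (hsingle P i v)) = hsingle P i (sign P i u)"
      unfolding u(2) by (rule hsingle_alternate[of A P, OF P])
    note sd = shift_down_S[of K A P dP S s, OF ctxP vw(1)]
    note td = shift_down_S[of K B Q dQ S' t, OF ctxQ vw(2)]
    note uc = SD(1)[OF sign_S[OF u(1)]]
    show ?thesis
    proof (cases n)
      case 0
      hence ij: "i = 0" "j = 0" using vw(3) by auto
      have "h (\<tau> i v j w) = \<zero>\<^bsub>T\<^esub>"
        unfolding h_pure[OF x y] \<sigma>u sd(2)[OF ij(1)] td(2)[OF ij(2)] pure(4)[OF x y] pure(5)[OF hsP[OF uc] y]
        by (rule TM.M.l_zero[OF TM.M.zero_closed])
      thus ?thesis using 0 by (simp only: nat.case singleton_iff)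
    next
      case (Suc m)
      have 1: "pt (?s (hsingle P i v)) (hsingle Q j w) \<in> tot S S' m"
      proof (cases i)
        case 0
        show ?thesis unfolding sd(2)[OF 0] pure(4)[OF x y] by (rule tot0)
      next
        case (Suc k)
        obtain a where a: "a \<in> S (i - 1)" "?s (hsingle P i v) = hsingle P (i - 1) a" using sd(1) by blast
        show ?thesis unfolding a(2) by (rule tot.gen[of a S "i - 1" w S' j m, OF a(1) vw(2)]) (use Suc vw \<open>n =
            Suc m\<close> in simp)
      qed
      have 2: "pt (?\<sigma> (?\<pi> (hsingle P i v))) (?t (hsingle Q j w)) \<in> tot S S' m"
      proof (cases j)
        case 0
        show ?thesis unfolding td(2)[OF 0] \<sigma>u pure(5)[OF hsP[OF uc] y] by (rule tot0)
      next
        case (Suc k)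
        obtain a where a: "a \<in> S' (j - 1)" "?t (hsingle Q j w) = hsingle Q (j - 1) a" using td(1) by blast
        show ?thesis unfolding a(2) \<sigma>u by (rule tot.gen[of "sign P i u" S i a S' "j - 1" m, OF sign_S[OF u(1)]
            a(1)]) (use Suc vw \<open>n = Suc m\<close> in simp)
      qed
      show ?thesis unfolding h_pure[OF x y] Suc nat.case by (rule tot.add[OF 1 2])
    qed
  qed
  have hz: "h z \<in> (case n of 0 \<Rightarrow> {\<zero>\<^bsub>T\<^esub>} | Suc m \<Rightarrow> tot S S' m)"
  proof (rule tot_map_closed[OF z Sc, of h])
    fix a b assume "a \<in> (case n of 0 \<Rightarrow> {\<zero>\<^bsub>T\<^esub>} | Suc m \<Rightarrow> tot S S' m)" "b \<in> (case n of 0 \<Rightarrow> {\<zero>\<^bsub>T\<^esub>} | Suc m \<Rightarrow> tot S S' m)"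
    thus "a \<oplus>\<^bsub>T\<^esub> b \<in> (case n of 0 \<Rightarrow> {\<zero>\<^bsub>T\<^esub>} | Suc m \<Rightarrow> tot S S' m)"
      using TM.M.l_zero[OF TM.M.zero_closed] tot.add[of a S S' _ b]
      by (cases n) (simp_all only: nat.case singleton_iff)
  qed (rule h_add hgen; assumption)+
  show ?thesis
  proof (cases n)
    case 0
    have "h z = \<zero>\<^bsub>T\<^esub>" using hz 0 by (simp only: nat.case singleton_iff)
    hence "z = \<kappa> z" using decomp' D_zero TM.M.l_zero[OF tm3(1)[OF zc]] by (simp only:)
    thus ?thesis using \<kappa>z 0 by (simp only: nat.case)
  next
    case (Suc m)
    have "h z \<in> tot S S' m" using hz Suc by (simp only: nat.case)
    thus ?thesis using decomp' \<kappa>z unfolding Suc nat.case by blast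
  qed
qed

text \<open>A tensor v \<otimes> w of cocycles bounds as soon as one factor does: d u \<otimes> w is
  D (u \<otimes> w), and v \<otimes> d u is D (\<sigma> v \<otimes> u), where \<sigma> v compensates
  the sign in D.\<close>

lemma cocycle_exact:
  assumes z: "z \<in> tot Z Z' n" and ex: "\<And>i. i \<le> n \<Longrightarrow> exact_at P dP S i \<or> exact_at Q dQ S' (n - i)"
  shows "case n of 0 \<Rightarrow> z = \<zero>\<^bsub>T\<^esub> | Suc m \<Rightarrow> \<exists>b\<in>tot S S' m. D b = z"
  using z
proof (induct rule: tot.induct)
  case (gen v i w j)
  have v: "v \<in> S i" "dP i v = \<zero>\<^bsub>P (Suc i)\<^esub>" and w: "w \<in> S' j" "dQ j w = \<zero>\<^bsub>Q (Suc j)\<^esub>"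
    using gen by (auto simp: Z_def Z'_def)
  note vc = SD(1)[OF v(1)] and wc = SD'(1)[OF w(1)]
  have zero: ?case if "\<tau> i v j w = \<zero>\<^bsub>T\<^esub>"
  proof (cases n)
    case (Suc m)
    show ?thesis unfolding that Suc nat.case by (rule bexI[where x = "\<zero>\<^bsub>T\<^esub>"], rule D_zero, rule tot0)
  qed (simp only: that nat.case)
  have "exact_at P dP S i \<or> exact_at Q dQ S' j" using ex[of i] gen(3) by auto
  thus ?case
  proof
    assume e: "exact_at P dP S i"
    show ?case
    proof (cases i)
      case 0
      hence v0: "v = \<zero>\<^bsub>P i\<^esub>" using e v by (simp add: exact_at_def)
      show ?thesis by (rule zero) (simp only: v0 gen_zero(1)[OF wc])
    next
      case (Suc k)
      then obtain u where u: "u \<in> S k" "dP k u = v" using e v unfolding exact_at_def by auto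
      note uc = SD(1)[OF u(1)]
      obtain m where m: "n = Suc m" "k + j = m" using Suc gen(3) by auto
      have "D (\<tau> k u j w) = \<tau> i v j w"
        unfolding D_gen[OF uc wc] u(2) w(2) gen_zero(2)[OF sign_P[OF uc]] Suc[symmetric]
        by (rule TM.M.r_zero[OF gen_closed[OF vc wc]])
      moreover have "\<tau> k u j w \<in> tot S S' m" by (rule tot.gen[of u S k w S' j m, OF u(1) w(1) m(2)])
      ultimately show ?thesis unfolding m(1) nat.case by (rule bexI)
    qed
  next
    assume e: "exact_at Q dQ S' j"
    show ?case
    proof (cases j)
      case 0
      hence w0: "w = \<zero>\<^bsub>Q j\<^esub>" using e w by (simp add: exact_at_def)
      show ?thesis by (rule zero) (simp only: w0 gen_zero(2)[OF vc])
    next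
      case (Suc k)
      then obtain u where u: "u \<in> S' k" "dQ k u = w" using e w unfolding exact_at_def by auto
      note uc = SD'(1)[OF u(1)] and sc = sign_P[OF vc]
      interpret Pi: module A "P i" by (rule P)
      interpret Ps: module A "P (Suc i)" by (rule P)
      obtain m where m: "n = Suc m" "i + k = m" using Suc gen(3) by auto
      have ds: "dP i (sign P i v) = \<zero>\<^bsub>P (Suc i)\<^esub>"
        using module_hom_neg[OF P P dP vc] v(2) Ps.neg_eq_smult[OF Ps.M.zero_closed] by (simp add: sign_def)
      have ss: "sign P i (sign P i v) = v" using vc by (simp add: sign_def)
      have "D (\<tau> i (sign P i v) k u) = \<tau> i v j w"
        unfolding D_gen[OF sc uc] u(2) ds ss gen_zero(1)[OF uc] Suc[symmetric]
        by (rule TM.M.l_zero[OF gen_closed[OF vc wc]])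
      moreover have "\<tau> i (sign P i v) k u \<in> tot S S' m"
          by (rule tot.gen[of "sign P i v" S i u S' k m, OF sign_S[OF v(1)] u(1) m(2)])
      ultimately show ?thesis unfolding m(1) nat.case by (rule bexI)
    qed
  qed
next
  case (add z z')
  show ?case
  proof (cases n)
    case 0
    show ?thesis using add(2,4) TM.M.l_zero[OF TM.M.zero_closed] unfolding 0 by (simp only: nat.case)
  next
    case (Suc m)
    obtain b b' where b: "b \<in> tot S S' m" "D b = z" "b' \<in> tot S S' m" "D b' = z'"
      using add(2,4) unfolding Suc nat.case by blast
    have "D (b \<oplus>\<^bsub>T\<^esub> b') = z \<oplus>\<^bsub>T\<^esub> z'" unfolding D_add[OF tc[OF b(1)] tc[OF b(3)]] b(2,4) ..
    thus ?thesis unfolding Suc nat.case by (rule bexI[OF _ tot.add[OF b(1,3)]])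
  qed
qed

lemma total_exact:
  assumes z: "z \<in> tot S S' n" and Dz: "D z = \<zero>\<^bsub>T\<^esub>"
    and ex: "\<And>i. i \<le> n \<Longrightarrow> exact_at P dP S i \<or> exact_at Q dQ S' (n - i)"
  shows "case n of 0 \<Rightarrow> z = \<zero>\<^bsub>T\<^esub> | Suc m \<Rightarrow> \<exists>b\<in>tot S S' m. D b = z"
proof (cases n)
  case 0
  thus ?thesis using cocycle_decomposition[OF z Dz] cocycle_exact[of z 0] ex by (simp only: nat.case)
next
  case (Suc m)
  obtain b c where bc: "b \<in> tot S S' m" "c \<in> tot Z Z' n" "z = D b \<oplus>\<^bsub>T\<^esub> c"
    using cocycle_decomposition[OF z Dz] unfolding Suc nat.case by blast
  obtain b' where b': "b' \<in> tot S S' m" "D b' = c"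
    using cocycle_exact[OF bc(2) ex] unfolding Suc nat.case by blast
  have "D (b \<oplus>\<^bsub>T\<^esub> b') = z" unfolding D_add[OF tc[OF bc(1)] tc[OF b'(1)]] b'(2) bc(3) ..
  thus ?thesis unfolding Suc nat.case by (rule bexI[OF _ tot.add[OF bc(1) b'(1)]])
qed

text \<open>Conversely, functionals that kill the coboundaries detect the class of a tensor product of
  cocycles.\<close>

lemma total_not_exact:
  assumes i: "\<not> exact_at P dP S i" and j: "\<not> exact_at Q dQ S' j"
  shows "\<exists>z\<in>tot S S' (i + j). D z = \<zero>\<^bsub>T\<^esub> \<and> \<not> (case i + j of 0 \<Rightarrow> z = \<zero>\<^bsub>T\<^esub> | Suc m \<Rightarrow> \<exists>b\<in>tot S S' m. D b = z)"
proof -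
  interpret K: field K by (rule K)
  define bP where "bP = (case i of 0 \<Rightarrow> {\<zero>\<^bsub>P i\<^esub>} | Suc k \<Rightarrow> dP k ` S k)"
  define bQ where "bQ = (case j of 0 \<Rightarrow> {\<zero>\<^bsub>Q j\<^esub>} | Suc k \<Rightarrow> dQ k ` S' k)"
  obtain v where v: "v \<in> S i" "dP i v = \<zero>\<^bsub>P (Suc i)\<^esub>" "v \<notin> bP"
    using i unfolding exact_at_def bP_def by (cases i) auto
  obtain w where w: "w \<in> S' j" "dQ j w = \<zero>\<^bsub>Q (Suc j)\<^esub>" "w \<notin> bQ"
    using j unfolding exact_at_def bQ_def by (cases j) auto
  note vc = SD(1)[OF v(1)] and wc = SD'(1)[OF w(1)]
  \<comment> \<open>Stated for a generic complex because it is applied to both factors.\<close>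
  have sub: "submodule b C (M i)"
    if M: "\<And>n. module C (M n)" and Sb: "subcomplex C M dM U" and dM: "\<And>n. dM n \<in> module_hom C (M n) (M (Suc n))"
      and b: "b = (case i of 0 \<Rightarrow> {\<zero>\<^bsub>M i\<^esub>} | Suc k \<Rightarrow> dM k ` U k)"
    for C :: "('k, 'c) module" and M :: "nat \<Rightarrow> ('c, 'g) module" and dM U b and i :: nat
  proof (cases i)
    case 0
    interpret module C "M i" by (rule M)
    have bz: "b = {\<zero>\<^bsub>M i\<^esub>}" using 0 by (simp add: b)
    show ?thesis unfolding bz by (intro submoduleI') auto
  next
    case (Suc k)
    have "dM k \<in> module_hom C (M k\<lparr>carrier := U k\<rparr>) (M i)"
      using module_homD[OF dM[of k]] submodule_facts(1)[OF M subcomplexD(1)[OF Sb]] Suc by (intro module_homI) auto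
    from submodule_image[OF submodule_module[OF subcomplexD(1)[OF Sb] M] M this]
    show ?thesis using Suc b by simp
  qed
  have subP: "submodule bP A (P i)" by (rule sub[OF P S dP bP_def])
  have subQ: "submodule bQ B (Q j)" by (rule sub[OF Q S' dQ bQ_def])
  obtain \<phi> where \<phi>: "\<phi> \<in> module_hom K (restrict_scalars A (P i)) (regular_module K)" "\<And>s. s \<in> bP \<Longrightarrow> \<phi> s = \<zero>\<^bsub>K\<^esub>" "\<phi> v = \<one>\<^bsub>K\<^esub>"
    using functional_exists[OF K module_restrict_scalars[OF A P] submodule_restrict_scalars[OF A P subP], of v] vc v(3)
    by (metis restrict_scalars_simps(1))
  obtain \<psi> where \<psi>: "\<psi> \<in> module_hom K (restrict_scalars B (Q j)) (regular_module K)" "\<And>s. s \<in> bQ \<Longrightarrow> \<psi> s = \<zero>\<^bsub>K\<^esub>" "\<psi> w = \<one>\<^bsub>K\<^esub>"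
    using functional_exists[OF K module_restrict_scalars[OF B Q] submodule_restrict_scalars[OF B Q subQ], of w] wc w(3)
    by (metis restrict_scalars_simps(1))
  note \<phi>D = module_homD[OF \<phi>(1), simplified] and \<psi>D = module_homD[OF \<psi>(1), simplified]
  have H: "comm_group (add_monoid K)" by (rule K.a_comm_group)
  \<comment> \<open>This is \<phi> \<otimes> \<psi> on the components i and j. It sends the tensor
    of v and w to 1 and, as shown below, vanishes on all total coboundaries.\<close>
  obtain \<theta> where \<theta>: "\<theta> \<in> hom (tensor_group K VK WK) (add_monoid K)"
    "\<And>x y. \<lbrakk>x \<in> carrier VK; y \<in> carrier WK\<rbrakk> \<Longrightarrow> \<theta> (pt x y) = \<phi> (x i) \<otimes>\<^bsub>K\<^esub> \<psi> (y j)"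
  proof (rule tensor_hom_lift[OF VKm WKm H, of "\<lambda>x y. \<phi> (x i) \<otimes>\<^bsub>K\<^esub> \<psi> (y j)"])
    show "\<And>x y. \<lbrakk>x \<in> carrier VK; y \<in> carrier WK\<rbrakk> \<Longrightarrow> \<phi> (x i) \<otimes>\<^bsub>K\<^esub> \<psi> (y j) \<in> carrier (add_monoid K)"
      using \<phi>D(1) \<psi>D(1) by simp
    show "\<And>x x' y. \<lbrakk>x \<in> carrier VK; x' \<in> carrier VK; y \<in> carrier WK\<rbrakk> \<Longrightarrow>
       \<phi> ((x \<oplus>\<^bsub>VK\<^esub> x') i) \<otimes>\<^bsub>K\<^esub> \<psi> (y j) = (\<phi> (x i) \<otimes>\<^bsub>K\<^esub> \<psi> (y j)) \<otimes>\<^bsub>add_monoid K\<^esub> (\<phi> (x' i) \<otimes>\<^bsub>K\<^esub> \<psi> (y j))"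
      using \<phi>D(1,2) \<psi>D(1) by (simp add: K.l_distr)
    show "\<And>x y y'. \<lbrakk>x \<in> carrier VK; y \<in> carrier WK; y' \<in> carrier WK\<rbrakk> \<Longrightarrow>
       \<phi> (x i) \<otimes>\<^bsub>K\<^esub> \<psi> ((y \<oplus>\<^bsub>WK\<^esub> y') j) = (\<phi> (x i) \<otimes>\<^bsub>K\<^esub> \<psi> (y j)) \<otimes>\<^bsub>add_monoid K\<^esub> (\<phi> (x i) \<otimes>\<^bsub>K\<^esub> \<psi> (y' j))"
      using \<phi>D(1) \<psi>D(1,2) by (simp add: K.r_distr)
    show "\<And>c x y. \<lbrakk>c \<in> carrier K; x \<in> carrier VK; y \<in> carrier WK\<rbrakk> \<Longrightarrow>
       \<phi> ((c \<odot>\<^bsub>VK\<^esub> x) i) \<otimes>\<^bsub>K\<^esub> \<psi> (y j) = \<phi> (x i) \<otimes>\<^bsub>K\<^esub> \<psi> ((c \<odot>\<^bsub>WK\<^esub> y) j)"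
      using \<phi>D(1,3) \<psi>D(1,3) by (simp add: K.m_ac)
  qed (rule that)
  have \<theta>add: "\<theta> (U \<oplus>\<^bsub>T\<^esub> U') = \<theta> U \<oplus>\<^bsub>K\<^esub> \<theta> U'" if "U \<in> carrier T" "U' \<in> carrier T" for U U'
    using hom_mult[OF \<theta>(1)] that by simp
  have \<phi>0: "\<phi> \<zero>\<^bsub>P i\<^esub> = \<zero>\<^bsub>K\<^esub>"
    by (rule \<phi>(2)) (use submodule_facts(2)[OF P subP] in simp)
  have \<psi>0: "\<psi> \<zero>\<^bsub>Q j\<^esub> = \<zero>\<^bsub>K\<^esub>"
    by (rule \<psi>(2)) (use submodule_facts(2)[OF Q subQ] in simp)
  have \<theta>gen: "\<theta> (\<tau> a u b u') = \<phi> (hsingle P a u i) \<otimes>\<^bsub>K\<^esub> \<psi> (hsingle Q b u' j)"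
    if "u \<in> carrier (P a)" "u' \<in> carrier (Q b)" for a u b u'
    using \<theta>(2) hsP[OF that(1)] hsQ[OF that(2)] by simp
  have hsc: "hsingle P a u i \<in> carrier (P i)" if "u \<in> carrier (P a)" for a u using hsP[OF that] by simp
  have hsc': "hsingle Q a u j \<in> carrier (Q j)" if "u \<in> carrier (Q a)" for a u using hsQ[OF that] by simp
  have \<theta>D: "\<theta> (D z) = \<zero>\<^bsub>K\<^esub>" if "z \<in> tot S S' m" for z m
    using that
  proof (induct rule: tot.induct)
    case (gen u a u' b)
    note uc = SD(1)[OF gen(1)] and uc' = SD'(1)[OF gen(2)]
    have "\<phi> (hsingle P (Suc a) (dP a u) i) = \<zero>\<^bsub>K\<^esub>"
    proof (cases "Suc a = i")
      case True
      have "dP a u \<in> bP" using gen(1) True by (auto simp: bP_def split: nat.split)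
      thus ?thesis using True \<phi>(2) by (simp add: hsingle_def)
    qed (use \<phi>0 in \<open>simp add: hsingle_def\<close>)
    moreover have "\<psi> (hsingle Q (Suc b) (dQ b u') j) = \<zero>\<^bsub>K\<^esub>"
    proof (cases "Suc b = j")
      case True
      have "dQ b u' \<in> bQ" using gen(2) True by (auto simp: bQ_def split: nat.split)
      thus ?thesis using True \<psi>(2) by (simp add: hsingle_def)
    qed (use \<psi>0 in \<open>simp add: hsingle_def\<close>)
    ultimately show ?case
      unfolding D_gen[OF uc uc'] \<theta>add[OF gen_closed[OF dP_carrier[OF uc] uc'] gen_closed[OF sign_P[OF uc]
        dQ_carrier[OF uc']]]
        \<theta>gen[OF dP_carrier[OF uc] uc'] \<theta>gen[OF sign_P[OF uc] dQ_carrier[OF uc']]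
      using \<phi>D(1) \<psi>D(1) hsc[OF sign_P[OF uc]] hsc'[OF uc'] by simp
  next
    case (add z z')
    show ?case
      unfolding D_add[OF tc[OF add(1)] tc[OF add(3)]] \<theta>add[OF D_closed[OF tc[OF add(1)]] D_closed[OF tc[OF add(3)]]]
        add(2,4)
      by simp
  qed
  let ?z = "\<tau> i v j w"
  have \<theta>z: "\<theta> ?z = \<one>\<^bsub>K\<^esub>" unfolding \<theta>gen[OF vc wc] using \<phi>(3) \<psi>(3) by (simp add: hsingle_def)
  have z: "?z \<in> tot S S' (i + j)" by (rule tot.gen[of v S i w S' j "i + j", OF v(1) w(1) refl])
  have "D ?z = \<zero>\<^bsub>T\<^esub>"
    unfolding D_gen[OF vc wc] v(2) w(2) gen_zero(1)[OF wc] gen_zero(2)[OF sign_P[OF vc]]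
    by (rule TM.M.l_zero[OF TM.M.zero_closed])
  moreover have "\<not> (case i + j of 0 \<Rightarrow> ?z = \<zero>\<^bsub>T\<^esub> | Suc m \<Rightarrow> \<exists>b\<in>tot S S' m. D b = ?z)"
  proof
    assume *: "case i + j of 0 \<Rightarrow> ?z = \<zero>\<^bsub>T\<^esub> | Suc m \<Rightarrow> \<exists>b\<in>tot S S' m. D b = ?z"
    \<comment> \<open>In degree 0 the element would be zero, that is D 0; so in both cases it would
      be a value of D, on which \<theta> vanishes.\<close>
    have "\<exists>m. \<exists>b\<in>tot S S' m. D b = ?z"
    proof (cases "i + j")
      case 0
      hence "?z = \<zero>\<^bsub>T\<^esub>" using * by (simp only: nat.case)
      thus ?thesis using D_zero tot0[of 0] by metis
    next
      case (Suc m)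
      thus ?thesis using * by (simp only: nat.case) blast
    qed
    hence "\<theta> ?z = \<zero>\<^bsub>K\<^esub>" using \<theta>D by metis
    thus False using \<theta>z by simp
  qed
  ultimately show ?thesis using z by blast
qed

theorem kunneth_exactness:
  "(\<forall>z\<in>tot S S' n. D z = \<zero>\<^bsub>T\<^esub> \<longrightarrow> (case n of 0 \<Rightarrow> z = \<zero>\<^bsub>T\<^esub> | Suc m \<Rightarrow> \<exists>b\<in>tot S S' m. D b = z)) \<longleftrightarrow>
   (\<forall>i\<le>n. exact_at P dP S i \<or> exact_at Q dQ S' (n - i))"
proof
  assume *: "\<forall>z\<in>tot S S' n. D z = \<zero>\<^bsub>T\<^esub> \<longrightarrow> (case n of 0 \<Rightarrow> z = \<zero>\<^bsub>T\<^esub> | Suc m \<Rightarrow> \<exists>b\<in>tot S S' m. D b = z)"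
  show "\<forall>i\<le>n. exact_at P dP S i \<or> exact_at Q dQ S' (n - i)"
  proof (intro allI impI)
    fix i assume "i \<le> n"
    hence n: "i + (n - i) = n" by simp
    show "exact_at P dP S i \<or> exact_at Q dQ S' (n - i)"
    proof (rule ccontr)
      assume "\<not> ?thesis"
      thus False using total_not_exact[of i "n - i", unfolded n] * by blast
    qed
  qed
next
  assume "\<forall>i\<le>n. exact_at P dP S i \<or> exact_at Q dQ S' (n - i)"
  thus "\<forall>z\<in>tot S S' n. D z = \<zero>\<^bsub>T\<^esub> \<longrightarrow> (case n of 0 \<Rightarrow> z = \<zero>\<^bsub>T\<^esub> | Suc m \<Rightarrow> \<exists>b\<in>tot S S' m. D b = z)"
    using total_exact by blast
qed

end

subsection \<open>Torsion in the total complex\<close>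

text \<open>Brings torsion back to the form of a carrier update, in which the statements about
  \<open>tot\<close> are phrased.\<close>

lemma tor_carrier_update:
  "tor R x (M\<lparr>carrier := S\<rparr>) = M\<lparr>carrier := carrier (tor R x (M\<lparr>carrier := S\<rparr>))\<rparr>"
  by (simp add: tor_def)

lemma tors_carrier_update: "tors R xs M = M\<lparr>carrier := carrier (tors R xs M)\<rparr>"
proof (induct xs arbitrary: M)
  case (Cons x xs)
  have "tors R xs (tor R x M) = (tor R x M)\<lparr>carrier := carrier (tors R xs (tor R x M))\<rparr>" by (rule Cons)
  also have "\<dots> = M\<lparr>carrier := carrier (tors R xs (tor R x M))\<rparr>" by (simp add: tor_def)
  finally show ?case by simp
qed simp

lemma submodule_tor_update:
  assumes "module R M" "submodule S R M" "x \<in> carrier R"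
  shows "submodule (carrier (tor R x (M\<lparr>carrier := S\<rparr>))) R M"
proof -
  interpret M: module R M by fact
  have "module R (tor R x (M\<lparr>carrier := S\<rparr>))"
    by (rule module_tor[OF submodule_module[OF assms(2,1)] assms(3)])
  hence "module R (M\<lparr>carrier := carrier (tor R x (M\<lparr>carrier := S\<rparr>))\<rparr>)"
    by (subst (asm) tor_carrier_update)
  moreover have "carrier (tor R x (M\<lparr>carrier := S\<rparr>)) \<subseteq> carrier M"
    using submodule_facts(1)[OF assms(1,2)] by (auto simp: carrier_tor)
  ultimately show ?thesis by (rule M.module_incl_imp_submodule[rotated])
qed

lemma submodule_tors:
  assumes "module R M" "set xs \<subseteq> carrier R"
  shows "submodule (carrier (tors R xs M)) R M"
proof -
  interpret M: module R M by fact
  have "module R (M\<lparr>carrier := carrier (tors R xs M)\<rparr>)"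
    using module_tors[OF assms] tors_carrier_update[of R xs M] by simp
  moreover have "carrier (tors R xs M) \<subseteq> carrier M" by (auto simp: carrier_tors)
  ultimately show ?thesis by (rule M.module_incl_imp_submodule[rotated])
qed

context tensor_complex
begin

abbreviation "total_cx S S' n \<equiv> T\<lparr>carrier := tot S S' n\<rparr>"

lemma pure_tensor_R: "\<lbrakk>a \<in> carrier A; b \<in> carrier B\<rbrakk> \<Longrightarrow> pure_tensor K A B a b \<in> carrier R"
  using pure_tensor_closed[OF algebra_D(3)[OF A] algebra_D(3)[OF B]] by (simp only: tensor_algebra_simps)

lemma total_module:
  assumes "\<And>i. submodule (S i) A (P i)" "\<And>j. submodule (S' j) B (Q j)"
  shows "module R (total_cx S S' n)"
  by (rule submodule_module[OF tot_submodule[of S S', OF assms] TM.module_axioms])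

lemma pow_left:
  assumes x: "x \<in> carrier A"
  shows "(pure_tensor K A B x \<one>\<^bsub>B\<^esub>) [^]\<^bsub>R\<^esub> (k::nat) = pure_tensor K A B (x [^]\<^bsub>A\<^esub> k) \<one>\<^bsub>B\<^esub>"
proof (induct k)
  interpret A: cring A by (rule algebra_D[OF A])
  interpret B: cring B by (rule algebra_D[OF B])
  {
    case 0
    show ?case unfolding TM.R.nat_pow_0 A.nat_pow_0 by (rule tensor_algebra_simps(3))
  next
    case (Suc k)
    have xk: "x [^]\<^bsub>A\<^esub> k \<in> carrier A" by (rule A.nat_pow_closed[OF x])
    show ?case
      unfolding TM.R.nat_pow_Suc A.nat_pow_Suc Suc tensor_algebra_mult_pure[OF A B xk B.one_closed x B.one_closed]
        B.l_one[OF B.one_closed] ..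
  }
qed

lemma act_left:
  assumes a: "a \<in> carrier A" and xy: "x \<in> carrier V" "y \<in> carrier W"
  shows "pure_tensor K A B a \<one>\<^bsub>B\<^esub> \<odot>\<^bsub>T\<^esub> pt x y = pt (a \<odot>\<^bsub>V\<^esub> x) y"
proof -
  interpret A: cring A by (rule algebra_D[OF A])
  interpret B: cring B by (rule algebra_D[OF B])
  interpret V: module A V by (rule Vm)
  interpret W: module B W by (rule Wm)
  show ?thesis unfolding tensor_module_pure(6)[OF A B Vm Wm xy a B.one_closed] W.smult_one[OF xy(2)] ..
qed

lemma act_gen_left:
  assumes a: "a \<in> carrier A" and vw: "v \<in> carrier (P i)" "w \<in> carrier (Q j)"
  shows "pure_tensor K A B a \<one>\<^bsub>B\<^esub> \<odot>\<^bsub>T\<^esub> \<tau> i v j w = \<tau> i (a \<odot>\<^bsub>P i\<^esub> v) j w"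
  unfolding act_left[OF a hsP[OF vw(1)] hsQ[OF vw(2)]]
    module_homD(3)[OF hsingle_hom[of A P, OF P] a vw(1), symmetric] ..

lemma gen_tor_left:
  assumes x: "x \<in> carrier A" and SS: "\<And>i. submodule (S i) A (P i)" "\<And>j. submodule (S' j) B (Q j)"
    and v: "v \<in> carrier (tor A x (P i\<lparr>carrier := S i\<rparr>))" and w: "w \<in> S' j" and n: "i + j = n"
  shows "\<tau> i v j w \<in> carrier (tor R (pure_tensor K A B x \<one>\<^bsub>B\<^esub>) (total_cx S S' n))"
proof -
  obtain k :: nat where k: "v \<in> S i" "(x [^]\<^bsub>A\<^esub> k) \<odot>\<^bsub>P i\<^esub> v = \<zero>\<^bsub>P i\<^esub>" using v by (auto simp: carrier_tor)
  interpret A: cring A by (rule algebra_D[OF A])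
  interpret B: cring B by (rule algebra_D[OF B])
  note c = submodule_facts(1)[OF P SS(1) k(1)] submodule_facts(1)[OF Q SS(2) w]
  have "((pure_tensor K A B x \<one>\<^bsub>B\<^esub>) [^]\<^bsub>R\<^esub> k) \<odot>\<^bsub>T\<^esub> \<tau> i v j w = \<zero>\<^bsub>T\<^esub>"
    unfolding pow_left[OF x] act_gen_left[OF A.nat_pow_closed[OF x] c(1) c(2)] k(2) by (rule gen_zero(1)[OF c(2)])
  moreover have "\<tau> i v j w \<in> tot S S' n" by (rule tot.gen[of v S i w S' j n, OF k(1) w n])
  ultimately show ?thesis unfolding carrier_tor by auto
qed

text \<open>If v = x v' + t, then v \<otimes> w is (x \<otimes> 1) (v' \<otimes> w) plus the torsion
  element t \<otimes> w.\<close>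

lemma divisible_left:
  assumes x: "x \<in> carrier A" and SS: "\<And>i. submodule (S i) A (P i)" "\<And>j. submodule (S' j) B (Q j)"
    and div: "\<And>i. divisible_mod_tor A x (P i\<lparr>carrier := S i\<rparr>)"
  shows "divisible_mod_tor R (pure_tensor K A B x \<one>\<^bsub>B\<^esub>) (total_cx S S' n)"
proof -
  interpret A: cring A by (rule algebra_D[OF A])
  interpret B: cring B by (rule algebra_D[OF B])
  let ?r = "pure_tensor K A B x \<one>\<^bsub>B\<^esub>"
  have r: "?r \<in> carrier R" by (rule pure_tensor_R[OF x B.one_closed])
  interpret X: module R "total_cx S S' n" by (rule total_module[of S S', OF SS])
  interpret XT: module R "tor R ?r (total_cx S S' n)" by (rule module_tor[OF X.module_axioms r])
  have sub: "u \<in> tot S S' n" if "u \<in> carrier (tor R ?r (total_cx S S' n))" for u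
    using that by (simp add: carrier_tor)
  have "\<exists>m'\<in>tot S S' n. \<exists>t\<in>carrier (tor R ?r (total_cx S S' n)). z = (?r \<odot>\<^bsub>T\<^esub> m') \<oplus>\<^bsub>T\<^esub> t" if "z \<in> tot S S' n" for z
    using that
  proof (induct rule: tot.induct)
    case (gen v i w j)
    obtain v' t where v': "v' \<in> S i" "t \<in> carrier (tor A x (P i\<lparr>carrier := S i\<rparr>))"
        "v = (x \<odot>\<^bsub>P i\<^esub> v') \<oplus>\<^bsub>P i\<^esub> t"
      using div[of i] gen(1) unfolding divisible_mod_tor_def by auto
    have tS: "t \<in> S i" using v'(2) by (simp add: carrier_tor)
    note c = submodule_facts(1)[OF P SS(1) v'(1)] submodule_facts(1)[OF P SS(1) tS]
        submodule_facts(1)[OF Q SS(2) gen(2)]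
    have xv: "x \<odot>\<^bsub>P i\<^esub> v' \<in> carrier (P i)" by (rule submodule_facts(1)[OF P SS(1) submodule_facts(6)[OF P SS(1) x v'(1)]])
    have "\<tau> i v j w = \<tau> i (x \<odot>\<^bsub>P i\<^esub> v') j w \<oplus>\<^bsub>T\<^esub> \<tau> i (t) j w"
      unfolding v'(3) module_homD(2)[OF hsingle_hom[of A P, OF P] xv c(2)]
      by (rule pure(2)[OF hsP[OF xv] hsQ[OF c(3)] hsP[OF c(2)]])
    also have "\<tau> i (x \<odot>\<^bsub>P i\<^esub> v') j w = ?r \<odot>\<^bsub>T\<^esub> \<tau> i (v') j w"
      by (rule act_gen_left[OF x c(1) c(3), symmetric])
    finally have eq: "\<tau> i v j w = ?r \<odot>\<^bsub>T\<^esub> \<tau> i (v') j w \<oplus>\<^bsub>T\<^esub> \<tau> i (t) j w" .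
    have 1: "\<tau> i (v') j w \<in> tot S S' n" by (rule tot.gen[of _ S i _ S' j n, OF v'(1) gen(2) gen(3)])
    have 2: "\<tau> i (t) j w \<in> carrier (tor R ?r (total_cx S S' n))"
      by (rule gen_tor_left[of x S S' t i w j n, OF x SS v'(2) gen(2) gen(3)])
    show ?case by (rule bexI[OF _ 1], rule bexI[OF _ 2], rule eq)
  next
    case (add z z')
    obtain m t where m: "m \<in> tot S S' n" "t \<in> carrier (tor R ?r (total_cx S S' n))" "z = ?r \<odot>\<^bsub>T\<^esub> m \<oplus>\<^bsub>T\<^esub> t" using add(2)
        by blast
    obtain m' t' where m': "m' \<in> tot S S' n" "t' \<in> carrier (tor R ?r (total_cx S S' n))" "z' = ?r \<odot>\<^bsub>T\<^esub> m' \<oplus>\<^bsub>T\<^esub> t'"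
        using add(4) by blast
    have tt: "t \<oplus>\<^bsub>T\<^esub> t' \<in> carrier (tor R ?r (total_cx S S' n))" using XT.M.a_closed[OF m(2) m'(2)] by simp
    have Sc: "\<And>i. S i \<subseteq> carrier (P i)" "\<And>j. S' j \<subseteq> carrier (Q j)"
      using submodule_facts(1)[OF P SS(1)] submodule_facts(1)[OF Q SS(2)] by blast+
    have c: "m \<in> carrier T" "m' \<in> carrier T" "t \<in> carrier T" "t' \<in> carrier T"
      by (rule tot_closed[of S S', OF Sc]; rule m(1) m'(1) sub[OF m(2)] sub[OF m'(2)])+
    have ac: "(a \<oplus>\<^bsub>T\<^esub> b) \<oplus>\<^bsub>T\<^esub> (a' \<oplus>\<^bsub>T\<^esub> b') = (a \<oplus>\<^bsub>T\<^esub> a') \<oplus>\<^bsub>T\<^esub> (b \<oplus>\<^bsub>T\<^esub> b')"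
      if "a \<in> carrier T" "b \<in> carrier T" "a' \<in> carrier T" "b' \<in> carrier T" for a b a' b'
      using that by (simp only: TM.M.a_ac TM.M.a_closed)
    have eq: "z \<oplus>\<^bsub>T\<^esub> z' = ?r \<odot>\<^bsub>T\<^esub> (m \<oplus>\<^bsub>T\<^esub> m') \<oplus>\<^bsub>T\<^esub> (t \<oplus>\<^bsub>T\<^esub> t')"
      unfolding m(3) m'(3) TM.smult_r_distr[OF r c(1,2)]
      by (rule ac[OF TM.smult_closed[OF r c(1)] c(3) TM.smult_closed[OF r c(2)] c(4)])
    show ?case by (rule bexI[OF _ tot.add[OF m(1) m'(1)]], rule bexI[OF _ tt], rule eq)
  qed
  thus ?thesis unfolding divisible_mod_tor_def by simp
qed

text \<open>Torsion for x \<otimes> 1 comes from the first factor alone. For a = x^k a generalized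
  inverse s yields the projection 1 - s a onto the kernel of a, so an element killed by a \<otimes>
  1 is a sum of tensors whose first factors are killed by a.\<close>

lemma tor_total_left:
  assumes x: "x \<in> carrier A" and SS: "\<And>i. submodule (S i) A (P i)" "\<And>j. submodule (S' j) B (Q j)"
  defines "S1 \<equiv> \<lambda>i. carrier (tor A x (P i\<lparr>carrier := S i\<rparr>))"
  shows "tor R (pure_tensor K A B x \<one>\<^bsub>B\<^esub>) (total_cx S S' n) = total_cx S1 S' n"
proof -
  interpret A: cring A by (rule algebra_D[OF A])
  interpret B: cring B by (rule algebra_D[OF B])
  interpret V: module A V by (rule Vm)
  interpret W: module B W by (rule Wm)
  let ?r = "pure_tensor K A B x \<one>\<^bsub>B\<^esub>"
  have r: "?r \<in> carrier R" by (rule pure_tensor_R[OF x B.one_closed])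
  interpret X: module R "total_cx S S' n" by (rule total_module[of S S', OF SS])
  interpret XT: module R "tor R ?r (total_cx S S' n)" by (rule module_tor[OF X.module_axioms r])
  have Sc: "\<And>i. S i \<subseteq> carrier (P i)" "\<And>j. S' j \<subseteq> carrier (Q j)"
    using submodule_facts(1)[OF P SS(1)] submodule_facts(1)[OF Q SS(2)] by blast+
  have ceq: "carrier (tor R ?r (total_cx S S' n)) = tot S1 S' n"
  proof (rule Set.equalityI; rule subsetI)
    fix z assume "z \<in> tot S1 S' n"
    thus "z \<in> carrier (tor R ?r (total_cx S S' n))"
    proof (induct rule: tot.induct)
      case (gen v i w j)
      show ?case
        by (rule gen_tor_left[of x S S' v i w j n, OF x SS]) (use gen in \<open>simp_all add: S1_def\<close>)
    next
      case (add z z')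
      show ?case using XT.M.a_closed[OF add(2,4)] by simp
    qed
  next
    fix z assume "z \<in> carrier (tor R ?r (total_cx S S' n))"
    then obtain k :: nat where z: "z \<in> tot S S' n" and k: "(?r [^]\<^bsub>R\<^esub> k) \<odot>\<^bsub>T\<^esub> z = \<zero>\<^bsub>T\<^esub>"
      by (auto simp: carrier_tor)
    define a where "a = x [^]\<^bsub>A\<^esub> k"
    have a: "a \<in> carrier A" unfolding a_def by (rule A.nat_pow_closed[OF x])
    have az: "pure_tensor K A B a \<one>\<^bsub>B\<^esub> \<odot>\<^bsub>T\<^esub> z = \<zero>\<^bsub>T\<^esub>" using k unfolding pow_left[OF x] a_def .
    have ahom: "(\<lambda>v. a \<odot>\<^bsub>P i\<^esub> v) \<in> module_hom A (P i) (P i)" for i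
    proof -
      interpret Pi: module A "P i" by (rule P)
      show ?thesis using a A.m_comm
        by (intro module_homI) (simp_all add: Pi.smult_r_distr Pi.smult_assoc1[symmetric])
    qed
    have aS: "a \<odot>\<^bsub>P i\<^esub> v \<in> S i" if "v \<in> S i" for i v by (rule submodule_facts(6)[OF P SS(1) a that])
    obtain s where s: "\<And>n. s n \<in> module_hom K (restrict_scalars A (P n)) (restrict_scalars A (P n))"
      "\<forall>n. \<forall>w\<in>S n. s n w \<in> S n" "\<forall>n. \<forall>v\<in>S n. a \<odot>\<^bsub>P n\<^esub> s n (a \<odot>\<^bsub>P n\<^esub> v) = a \<odot>\<^bsub>P n\<^esub> v"
      using generalized_inverse_family[of K A P P S S "\<lambda>n v. a \<odot>\<^bsub>P n\<^esub> v", OF K A P P SS(1) SS(1) ahom aS] by blast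
    let ?\<sigma> = "\<lambda>f n. s n (f n)"
    have \<sigma>: "?\<sigma> \<in> module_hom K VK VK" by (rule componentwise_hom[of s K A P, OF s(1)])
    have aV: "(\<lambda>f. a \<odot>\<^bsub>V\<^esub> f) \<in> module_hom A V V"
      using a A.m_comm by (intro module_homI) (simp_all only: V.smult_r_distr V.smult_assoc1[symmetric] V.smult_closed)
    \<comment> \<open>This is 1 - s a. Since z = (\<psi> \<otimes> 1) z + (s \<otimes> 1) (a
      \<otimes> 1) z and the last term is zero, z is fixed by \<psi> \<otimes> 1.\<close>
    define \<psi> where "\<psi> f = f \<oplus>\<^bsub>VK\<^esub> (\<ominus>\<^bsub>VK\<^esub> ?\<sigma> (a \<odot>\<^bsub>V\<^esub> f))" for f
    have \<psi>: "\<psi> \<in> module_hom K VK VK"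
      unfolding \<psi>_def[abs_def]
      by (rule module_hom_sum[OF VKm module_hom_id module_hom_uminus[OF VKm
            module_hom_comp[OF module_hom_restrict_scalars[OF A aV] \<sigma>]]])
    note t\<psi> = tensor_module_map[OF A B Vm Wm Vm Wm \<psi> module_hom_id]
    note t\<sigma> = tensor_module_map[OF A B Vm Wm Vm Wm \<sigma> module_hom_id]
    have rT: "pure_tensor K A B a \<one>\<^bsub>B\<^esub> \<in> carrier R" by (rule pure_tensor_R[OF a B.one_closed])
    have decomp: "z = tmap (\<psi>) (\<lambda>y. y) z \<oplus>\<^bsub>T\<^esub> tmap (?\<sigma>) (\<lambda>y. y) (pure_tensor K A B a \<one>\<^bsub>B\<^esub> \<odot>\<^bsub>T\<^esub> z)"
    proof (rule tot_maps_eq[OF z Sc, of "\<lambda>z. z" "\<lambda>z. tmap (\<psi>) (\<lambda>y. y) z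
        \<oplus>\<^bsub>T\<^esub> tmap (?\<sigma>) (\<lambda>y. y) (pure_tensor K A B a \<one>\<^bsub>B\<^esub> \<odot>\<^bsub>T\<^esub> z)"])
      fix U U' assume U: "U \<in> carrier T" "U' \<in> carrier T"
      have ac: "(p \<oplus>\<^bsub>T\<^esub> q) \<oplus>\<^bsub>T\<^esub> (p' \<oplus>\<^bsub>T\<^esub> q') = (p \<oplus>\<^bsub>T\<^esub> p') \<oplus>\<^bsub>T\<^esub> (q \<oplus>\<^bsub>T\<^esub> q')"
        if "p \<in> carrier T" "p' \<in> carrier T" "q \<in> carrier T" "q' \<in> carrier T" for p q p' q'
        using that by (simp only: TM.M.a_ac TM.M.a_closed)
      note rU = TM.smult_closed[OF rT U(1)] TM.smult_closed[OF rT U(2)]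
      show "tmap (\<psi>) (\<lambda>y. y) (U \<oplus>\<^bsub>T\<^esub> U') \<oplus>\<^bsub>T\<^esub> tmap (?\<sigma>) (\<lambda>y. y) (pure_tensor K A B a \<one>\<^bsub>B\<^esub> \<odot>\<^bsub>T\<^esub> (U \<oplus>\<^bsub>T\<^esub> U')) =
          (tmap (\<psi>) (\<lambda>y. y) U \<oplus>\<^bsub>T\<^esub> tmap (?\<sigma>) (\<lambda>y. y) (pure_tensor K A B a \<one>\<^bsub>B\<^esub> \<odot>\<^bsub>T\<^esub> U)) \<oplus>\<^bsub>T\<^esub>
          (tmap (\<psi>) (\<lambda>y. y) U' \<oplus>\<^bsub>T\<^esub> tmap (?\<sigma>) (\<lambda>y. y) (pure_tensor K A B a \<one>\<^bsub>B\<^esub> \<odot>\<^bsub>T\<^esub> U'))"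
        unfolding t\<psi>(2)[OF U] TM.smult_r_distr[OF rT U] t\<sigma>(2)[OF rU]
        by (rule ac[OF t\<psi>(1)[OF U(1)] t\<psi>(1)[OF U(2)] t\<sigma>(1)[OF rU(1)] t\<sigma>(1)[OF rU(2)], symmetric])
    next
      fix v i w j assume vw: "v \<in> S i" "w \<in> S' j" "i + j = n"
      note x = hsP[OF subsetD[OF Sc(1) vw(1)]] and y = hsQ[OF subsetD[OF Sc(2) vw(2)]]
      let ?x = "hsingle P i v" and ?y = "hsingle Q j w"
      have ax: "a \<odot>\<^bsub>V\<^esub> ?x \<in> carrier V" by (rule V.smult_closed[OF a x])
      have \<sigma>x: "?\<sigma> (a \<odot>\<^bsub>V\<^esub> ?x) \<in> carrier V" and \<psi>x: "\<psi> ?x \<in> carrier V"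
        using module_homD(1)[OF \<sigma>] module_homD(1)[OF \<psi>] ax x unfolding restrict_scalars_simps by blast+
      have "\<psi> ?x \<oplus>\<^bsub>V\<^esub> ?\<sigma> (a \<odot>\<^bsub>V\<^esub> ?x) = ?x"
        unfolding \<psi>_def restrict_scalars_minus(1)[OF A Vm \<sigma>x \<sigma>x] restrict_scalars_simps a_minus_def[symmetric]
        by (rule V.diff_add_cancel[OF x \<sigma>x])
      hence "\<tau> i v j w = pt (\<psi> ?x \<oplus>\<^bsub>V\<^esub> ?\<sigma> (a \<odot>\<^bsub>V\<^esub> ?x)) ?y" by (simp only:)
      also have "\<dots> = pt (\<psi> ?x) ?y \<oplus>\<^bsub>T\<^esub> pt (?\<sigma> (a \<odot>\<^bsub>V\<^esub> ?x)) ?y"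
        by (rule pure(2)[OF \<psi>x y \<sigma>x])
      also have "\<dots> = tmap (\<psi>) (\<lambda>y. y) (\<tau> i v j w) \<oplus>\<^bsub>T\<^esub> tmap (?\<sigma>) (\<lambda>y. y) (pure_tensor K A B a \<one>\<^bsub>B\<^esub> \<odot>\<^bsub>T\<^esub> \<tau> i v j w)"
        unfolding t\<psi>(3)[OF x y] act_left[OF a x y] t\<sigma>(3)[OF ax y] ..
      finally show "\<tau> i v j w = tmap (\<psi>) (\<lambda>y. y) (\<tau> i v j w)
          \<oplus>\<^bsub>T\<^esub> tmap (?\<sigma>) (\<lambda>y. y) (pure_tensor K A B a \<one>\<^bsub>B\<^esub> \<odot>\<^bsub>T\<^esub> \<tau> i v j w)" .
    qed (rule refl)
    have zT: "z \<in> carrier T" by (rule tot_closed[of S S', OF Sc z])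
    have "z = tmap (\<psi>) (\<lambda>y. y) z"
      using decomp unfolding az tmap_zero[OF \<sigma> module_hom_id] TM.M.r_zero[OF t\<psi>(1)[OF zT]] .
    moreover have "tmap (\<psi>) (\<lambda>y. y) z \<in> tot S1 S' n"
    proof (rule tot_map_closed[OF z Sc, of "tmap (\<psi>) (\<lambda>y. y)"])
      fix v i w j assume vw: "v \<in> S i" "w \<in> S' j" "i + j = n"
      note c = subsetD[OF Sc(1) vw(1)] subsetD[OF Sc(2) vw(2)]
      note x = hsP[OF c(1)] and y = hsQ[OF c(2)]
      let ?x = "hsingle P i v"
      interpret Pi: module A "P i" by (rule P)
      let ?e = "s i (a \<odot>\<^bsub>P i\<^esub> v)"
      have e: "?e \<in> S i" using s(2) aS vw(1) by blast
      have ec: "?e \<in> carrier (P i)" by (rule submodule_facts(1)[OF P SS(1) e])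
      define u where "u = v \<ominus>\<^bsub>P i\<^esub> ?e"
      have uS: "u \<in> S i" unfolding u_def by (rule submodule_facts(5)[OF P SS(1) vw(1) e])
      have "a \<odot>\<^bsub>P i\<^esub> u = a \<odot>\<^bsub>P i\<^esub> v \<ominus>\<^bsub>P i\<^esub> a \<odot>\<^bsub>P i\<^esub> ?e"
        unfolding u_def by (rule module_hom_diff[OF P P ahom c(1) ec])
      also have "\<dots> = \<zero>\<^bsub>P i\<^esub>" using s(3) vw(1) Pi.diff_zero_iff Pi.smult_closed[OF a c(1)] by simp
      finally have u1: "u \<in> S1 i" using uS unfolding S1_def carrier_tor a_def by auto
      have s0: "s m \<zero>\<^bsub>P m\<^esub> = \<zero>\<^bsub>P m\<^esub>" for m
        using module_hom_zero[OF module_restrict_scalars[OF A P] module_restrict_scalars[OF A P] s(1)] by simp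
      have a0: "a \<odot>\<^bsub>P m\<^esub> \<zero>\<^bsub>P m\<^esub> = \<zero>\<^bsub>P m\<^esub>" for m by (rule module_hom_zero[OF P P ahom])
      have \<sigma>x: "?\<sigma> (a \<odot>\<^bsub>V\<^esub> ?x) = hsingle P i ?e" by (auto simp: hsingle_def s0 a0)
      have ex: "hsingle P i ?e \<in> carrier V" by (rule hsP[OF ec])
      have "\<psi> ?x = hsingle P i u"
        unfolding \<psi>_def \<sigma>x restrict_scalars_minus(1)[OF A Vm ex ex] restrict_scalars_simps a_minus_def[symmetric] u_def
        by (rule module_hom_diff[OF P Vm hsingle_hom[of A P, OF P] c(1) ec, symmetric])
      hence "tmap (\<psi>) (\<lambda>y. y) (\<tau> i v j w) = \<tau> i (u) j w" unfolding t\<psi>(3)[OF x y] by (simp only:)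
      moreover have "\<tau> i (u) j w \<in> tot S1 S' n" by (rule tot.gen[of _ S1 i _ S' j n, OF u1 vw(2) vw(3)])
      ultimately show "tmap (\<psi>) (\<lambda>y. y) (\<tau> i v j w) \<in> tot S1 S' n" by (simp only:)
    qed (rule t\<psi>(2) tot.add; assumption)+
    ultimately show "z \<in> tot S1 S' n" by (simp only:)
  qed
  show ?thesis by (subst tor_carrier_update) (simp only: ceq)
qed

text \<open>The list \<open>zs\<close> is reserved for the elements that act on the second factor.
  Torsion and acyclicity are carried together because each condition of acyclicity concerns the
  torsion part left by the preceding elements.\<close>

lemma tors_total_left:
  assumes "set xs \<subseteq> carrier A" "\<And>i. submodule (S i) A (P i)" "\<And>j. submodule (S' j) B (Q j)"
    and "\<And>i. tor_acyclic A xs (P i\<lparr>carrier := S i\<rparr>)"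
  shows "tors R (map (\<lambda>x. pure_tensor K A B x \<one>\<^bsub>B\<^esub>) xs @ zs) (total_cx S S' n) =
      tors R zs (total_cx (\<lambda>i. carrier (tors A xs (P i\<lparr>carrier := S i\<rparr>))) S' n) \<and>
    (tor_acyclic R zs (total_cx (\<lambda>i. carrier (tors A xs (P i\<lparr>carrier := S i\<rparr>))) S' n) \<longrightarrow>
     tor_acyclic R (map (\<lambda>x. pure_tensor K A B x \<one>\<^bsub>B\<^esub>) xs @ zs) (total_cx S S' n))"
  using assms
proof (induct xs arbitrary: S)
  case (Cons x xs)
  define S1 where "S1 i = carrier (tor A x (P i\<lparr>carrier := S i\<rparr>))" for i
  have x: "x \<in> carrier A" using Cons(2) by simp
  have up: "tor A x (P i\<lparr>carrier := S i\<rparr>) = P i\<lparr>carrier := S1 i\<rparr>" for i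
    unfolding S1_def by (rule tor_carrier_update)
  have S1: "submodule (S1 i) A (P i)" for i
    unfolding S1_def by (rule submodule_tor_update[OF P Cons(3) x])
  have eq: "tor R (pure_tensor K A B x \<one>\<^bsub>B\<^esub>) (total_cx S S' n) = total_cx S1 S' n"
    unfolding S1_def by (rule tor_total_left[of x S S', OF x Cons(3,4)])
  have div: "divisible_mod_tor R (pure_tensor K A B x \<one>\<^bsub>B\<^esub>) (total_cx S S' n)"
    by (rule divisible_left[of x S S', OF x Cons(3,4)]) (use Cons(5) in simp)
  have ih: "tors R (map (\<lambda>x. pure_tensor K A B x \<one>\<^bsub>B\<^esub>) xs @ zs) (total_cx S1 S' n) =
      tors R zs (total_cx (\<lambda>i. carrier (tors A xs (P i\<lparr>carrier := S1 i\<rparr>))) S' n) \<and>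
    (tor_acyclic R zs (total_cx (\<lambda>i. carrier (tors A xs (P i\<lparr>carrier := S1 i\<rparr>))) S' n) \<longrightarrow>
     tor_acyclic R (map (\<lambda>x. pure_tensor K A B x \<one>\<^bsub>B\<^esub>) xs @ zs) (total_cx S1 S' n))"
    by (rule Cons(1)) (use Cons(2-5) S1 up in simp_all)
  show ?case using ih by (simp only: list.map append.simps tors.simps tor_acyclic.simps eq div up simp_thms) blast
qed simp

section \<open>Torsion from the second tensor factor\<close>

lemma pow_right:
  assumes x: "x \<in> carrier B"
  shows "(pure_tensor K A B \<one>\<^bsub>A\<^esub> x) [^]\<^bsub>R\<^esub> (k::nat) = pure_tensor K A B \<one>\<^bsub>A\<^esub> (x [^]\<^bsub>B\<^esub> k)"
proof (induct k)
  interpret A: cring A by (rule algebra_D[OF A])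
  interpret B: cring B by (rule algebra_D[OF B])
  {
    case 0
    show ?case unfolding TM.R.nat_pow_0 B.nat_pow_0 by (rule tensor_algebra_simps(3))
  next
    case (Suc k)
    have xk: "x [^]\<^bsub>B\<^esub> k \<in> carrier B" by (rule B.nat_pow_closed[OF x])
    show ?case
      unfolding TM.R.nat_pow_Suc B.nat_pow_Suc Suc tensor_algebra_mult_pure[OF A B A.one_closed xk A.one_closed x]
        A.l_one[OF A.one_closed] ..
  }
qed

lemma act_right:
  assumes a: "a \<in> carrier B" and xy: "x \<in> carrier V" "y \<in> carrier W"
  shows "pure_tensor K A B \<one>\<^bsub>A\<^esub> a \<odot>\<^bsub>T\<^esub> pt x y = pt x (a \<odot>\<^bsub>W\<^esub> y)"
proof -
  interpret A: cring A by (rule algebra_D[OF A])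
  interpret B: cring B by (rule algebra_D[OF B])
  interpret V: module A V by (rule Vm)
  interpret W: module B W by (rule Wm)
  show ?thesis unfolding tensor_module_pure(6)[OF A B Vm Wm xy A.one_closed a] V.smult_one[OF xy(1)] ..
qed

lemma act_gen_right:
  assumes a: "a \<in> carrier B" and vw: "v \<in> carrier (P i)" "w \<in> carrier (Q j)"
  shows "pure_tensor K A B \<one>\<^bsub>A\<^esub> a \<odot>\<^bsub>T\<^esub> \<tau> i v j w = \<tau> i v j (a \<odot>\<^bsub>Q j\<^esub> w)"
  unfolding act_right[OF a hsP[OF vw(1)] hsQ[OF vw(2)]]
    module_homD(3)[OF hsingle_hom[of B Q, OF Q] a vw(2), symmetric] ..

lemma gen_tor_right:
  assumes x: "x \<in> carrier B" and SS: "\<And>i. submodule (S i) A (P i)" "\<And>j. submodule (S' j) B (Q j)"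
    and v: "w \<in> carrier (tor B x (Q j\<lparr>carrier := S' j\<rparr>))" and w: "v \<in> S i" and n: "i + j = n"
  shows "\<tau> i v j w \<in> carrier (tor R (pure_tensor K A B \<one>\<^bsub>A\<^esub> x) (total_cx S S' n))"
proof -
  obtain k :: nat where k: "w \<in> S' j" "(x [^]\<^bsub>B\<^esub> k) \<odot>\<^bsub>Q j\<^esub> w = \<zero>\<^bsub>Q j\<^esub>" using v by (auto simp: carrier_tor)
  interpret A: cring A by (rule algebra_D[OF A])
  interpret B: cring B by (rule algebra_D[OF B])
  note c = submodule_facts(1)[OF Q SS(2) k(1)] submodule_facts(1)[OF P SS(1) w]
  have "((pure_tensor K A B \<one>\<^bsub>A\<^esub> x) [^]\<^bsub>R\<^esub> k) \<odot>\<^bsub>T\<^esub> \<tau> i v j w = \<zero>\<^bsub>T\<^esub>"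
    unfolding pow_right[OF x] act_gen_right[OF B.nat_pow_closed[OF x] c(2) c(1)] k(2) by (rule gen_zero(2)[OF c(2)])
  moreover have "\<tau> i v j w \<in> tot S S' n" by (rule tot.gen[of v S i w S' j n, OF w k(1) n])
  ultimately show ?thesis unfolding carrier_tor by auto
qed

lemma divisible_right:
  assumes x: "x \<in> carrier B" and SS: "\<And>i. submodule (S i) A (P i)" "\<And>j. submodule (S' j) B (Q j)"
    and div: "\<And>i. divisible_mod_tor B x (Q i\<lparr>carrier := S' i\<rparr>)"
  shows "divisible_mod_tor R (pure_tensor K A B \<one>\<^bsub>A\<^esub> x) (total_cx S S' n)"
proof -
  interpret A: cring A by (rule algebra_D[OF A])
  interpret B: cring B by (rule algebra_D[OF B])
  let ?r = "pure_tensor K A B \<one>\<^bsub>A\<^esub> x"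
  have r: "?r \<in> carrier R" by (rule pure_tensor_R[OF A.one_closed x])
  interpret X: module R "total_cx S S' n" by (rule total_module[of S S', OF SS])
  interpret XT: module R "tor R ?r (total_cx S S' n)" by (rule module_tor[OF X.module_axioms r])
  have sub: "u \<in> tot S S' n" if "u \<in> carrier (tor R ?r (total_cx S S' n))" for u
    using that by (simp add: carrier_tor)
  have "\<exists>m'\<in>tot S S' n. \<exists>t\<in>carrier (tor R ?r (total_cx S S' n)). z = (?r \<odot>\<^bsub>T\<^esub> m') \<oplus>\<^bsub>T\<^esub> t" if "z \<in> tot S S' n" for z
    using that
  proof (induct rule: tot.induct)
    case (gen v i w j)
    obtain v' t where v': "v' \<in> S' j" "t \<in> carrier (tor B x (Q j\<lparr>carrier := S' j\<rparr>))"
        "w = (x \<odot>\<^bsub>Q j\<^esub> v') \<oplus>\<^bsub>Q j\<^esub> t"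
      using div[of j] gen(2) unfolding divisible_mod_tor_def by auto
    have tS: "t \<in> S' j" using v'(2) by (simp add: carrier_tor)
    note c = submodule_facts(1)[OF Q SS(2) v'(1)] submodule_facts(1)[OF Q SS(2) tS]
        submodule_facts(1)[OF P SS(1) gen(1)]
    have xv: "x \<odot>\<^bsub>Q j\<^esub> v' \<in> carrier (Q j)" by (rule submodule_facts(1)[OF Q SS(2) submodule_facts(6)[OF Q SS(2) x v'(1)]])
    have "\<tau> i v j w = \<tau> i v j (x \<odot>\<^bsub>Q j\<^esub> v') \<oplus>\<^bsub>T\<^esub> \<tau> i v j (t)"
      unfolding v'(3) module_homD(2)[OF hsingle_hom[of B Q, OF Q] xv c(2)]
      by (rule pure(3)[OF hsP[OF c(3)] hsQ[OF xv] hsQ[OF c(2)]])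
    also have "\<tau> i v j (x \<odot>\<^bsub>Q j\<^esub> v') = ?r \<odot>\<^bsub>T\<^esub> \<tau> i v j (v')"
      by (rule act_gen_right[OF x c(3) c(1), symmetric])
    finally have eq: "\<tau> i v j w = ?r \<odot>\<^bsub>T\<^esub> \<tau> i v j (v') \<oplus>\<^bsub>T\<^esub> \<tau> i v j (t)" .
    have 1: "\<tau> i v j (v') \<in> tot S S' n" by (rule tot.gen[of _ S i _ S' j n, OF gen(1) v'(1) gen(3)])
    have 2: "\<tau> i v j (t) \<in> carrier (tor R ?r (total_cx S S' n))"
      by (rule gen_tor_right[of x S S' t j v i n, OF x SS v'(2) gen(1) gen(3)])
    show ?case by (rule bexI[OF _ 1], rule bexI[OF _ 2], rule eq)
  next
    case (add z z')
    obtain m t where m: "m \<in> tot S S' n" "t \<in> carrier (tor R ?r (total_cx S S' n))" "z = ?r \<odot>\<^bsub>T\<^esub> m \<oplus>\<^bsub>T\<^esub> t" using add(2)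
        by blast
    obtain m' t' where m': "m' \<in> tot S S' n" "t' \<in> carrier (tor R ?r (total_cx S S' n))" "z' = ?r \<odot>\<^bsub>T\<^esub> m' \<oplus>\<^bsub>T\<^esub> t'"
        using add(4) by blast
    have tt: "t \<oplus>\<^bsub>T\<^esub> t' \<in> carrier (tor R ?r (total_cx S S' n))" using XT.M.a_closed[OF m(2) m'(2)] by simp
    have Sc: "\<And>i. S i \<subseteq> carrier (P i)" "\<And>j. S' j \<subseteq> carrier (Q j)"
      using submodule_facts(1)[OF P SS(1)] submodule_facts(1)[OF Q SS(2)] by blast+
    have c: "m \<in> carrier T" "m' \<in> carrier T" "t \<in> carrier T" "t' \<in> carrier T"
      by (rule tot_closed[of S S', OF Sc]; rule m(1) m'(1) sub[OF m(2)] sub[OF m'(2)])+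
    have ac: "(a \<oplus>\<^bsub>T\<^esub> b) \<oplus>\<^bsub>T\<^esub> (a' \<oplus>\<^bsub>T\<^esub> b') = (a \<oplus>\<^bsub>T\<^esub> a') \<oplus>\<^bsub>T\<^esub> (b \<oplus>\<^bsub>T\<^esub> b')"
      if "a \<in> carrier T" "b \<in> carrier T" "a' \<in> carrier T" "b' \<in> carrier T" for a b a' b'
      using that by (simp only: TM.M.a_ac TM.M.a_closed)
    have eq: "z \<oplus>\<^bsub>T\<^esub> z' = ?r \<odot>\<^bsub>T\<^esub> (m \<oplus>\<^bsub>T\<^esub> m') \<oplus>\<^bsub>T\<^esub> (t \<oplus>\<^bsub>T\<^esub> t')"
      unfolding m(3) m'(3) TM.smult_r_distr[OF r c(1,2)]
      by (rule ac[OF TM.smult_closed[OF r c(1)] c(3) TM.smult_closed[OF r c(2)] c(4)])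
    show ?case by (rule bexI[OF _ tot.add[OF m(1) m'(1)]], rule bexI[OF _ tt], rule eq)
  qed
  thus ?thesis unfolding divisible_mod_tor_def by simp
qed

text \<open>Symmetric to \<open>tor_total_left\<close>, with the projection 1 - s a acting on the
  second factor.\<close>

lemma tor_total_right:
  assumes x: "x \<in> carrier B" and SS: "\<And>i. submodule (S i) A (P i)" "\<And>j. submodule (S' j) B (Q j)"
  defines "S1 \<equiv> \<lambda>i. carrier (tor B x (Q i\<lparr>carrier := S' i\<rparr>))"
  shows "tor R (pure_tensor K A B \<one>\<^bsub>A\<^esub> x) (total_cx S S' n) = total_cx S S1 n"
proof -
  interpret A: cring A by (rule algebra_D[OF A])
  interpret B: cring B by (rule algebra_D[OF B])
  interpret V: module A V by (rule Vm)
  interpret W: module B W by (rule Wm)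
  let ?r = "pure_tensor K A B \<one>\<^bsub>A\<^esub> x"
  have r: "?r \<in> carrier R" by (rule pure_tensor_R[OF A.one_closed x])
  interpret X: module R "total_cx S S' n" by (rule total_module[of S S', OF SS])
  interpret XT: module R "tor R ?r (total_cx S S' n)" by (rule module_tor[OF X.module_axioms r])
  have Sc: "\<And>i. S i \<subseteq> carrier (P i)" "\<And>j. S' j \<subseteq> carrier (Q j)"
    using submodule_facts(1)[OF P SS(1)] submodule_facts(1)[OF Q SS(2)] by blast+
  have ceq: "carrier (tor R ?r (total_cx S S' n)) = tot S S1 n"
  proof (rule Set.equalityI; rule subsetI)
    fix z assume "z \<in> tot S S1 n"
    thus "z \<in> carrier (tor R ?r (total_cx S S' n))"
    proof (induct rule: tot.induct)
      case (gen v i w j)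
      show ?case
        by (rule gen_tor_right[of x S S' w j v i n, OF x SS]) (use gen in \<open>simp_all add: S1_def\<close>)
    next
      case (add z z')
      show ?case using XT.M.a_closed[OF add(2,4)] by simp
    qed
  next
    fix z assume "z \<in> carrier (tor R ?r (total_cx S S' n))"
    then obtain k :: nat where z: "z \<in> tot S S' n" and k: "(?r [^]\<^bsub>R\<^esub> k) \<odot>\<^bsub>T\<^esub> z = \<zero>\<^bsub>T\<^esub>"
      by (auto simp: carrier_tor)
    define a where "a = x [^]\<^bsub>B\<^esub> k"
    have a: "a \<in> carrier B" unfolding a_def by (rule B.nat_pow_closed[OF x])
    have az: "pure_tensor K A B \<one>\<^bsub>A\<^esub> a \<odot>\<^bsub>T\<^esub> z = \<zero>\<^bsub>T\<^esub>" using k unfolding pow_right[OF x] a_def .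
    have ahom: "(\<lambda>v. a \<odot>\<^bsub>Q i\<^esub> v) \<in> module_hom B (Q i) (Q i)" for i
    proof -
      interpret Pi: module B "Q i" by (rule Q)
      show ?thesis using a B.m_comm
        by (intro module_homI) (simp_all add: Pi.smult_r_distr Pi.smult_assoc1[symmetric])
    qed
    have aS: "a \<odot>\<^bsub>Q i\<^esub> v \<in> S' i" if "v \<in> S' i" for i v by (rule submodule_facts(6)[OF Q SS(2) a that])
    obtain s where s: "\<And>n. s n \<in> module_hom K (restrict_scalars B (Q n)) (restrict_scalars B (Q n))"
      "\<forall>n. \<forall>w\<in>S' n. s n w \<in> S' n" "\<forall>n. \<forall>v\<in>S' n. a \<odot>\<^bsub>Q n\<^esub> s n (a \<odot>\<^bsub>Q n\<^esub> v) = a \<odot>\<^bsub>Q n\<^esub> v"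
      using generalized_inverse_family[of K B Q Q S' S' "\<lambda>n v. a \<odot>\<^bsub>Q n\<^esub> v", OF K B Q Q SS(2) SS(2) ahom aS] by blast
    let ?\<sigma> = "\<lambda>f n. s n (f n)"
    have \<sigma>: "?\<sigma> \<in> module_hom K WK WK" by (rule componentwise_hom[of s K B Q, OF s(1)])
    have aV: "(\<lambda>f. a \<odot>\<^bsub>W\<^esub> f) \<in> module_hom B W W"
      using a B.m_comm by (intro module_homI) (simp_all only: W.smult_r_distr W.smult_assoc1[symmetric] W.smult_closed)
    define \<psi> where "\<psi> f = f \<oplus>\<^bsub>WK\<^esub> (\<ominus>\<^bsub>WK\<^esub> ?\<sigma> (a \<odot>\<^bsub>W\<^esub> f))" for f
    have \<psi>: "\<psi> \<in> module_hom K WK WK"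
      unfolding \<psi>_def[abs_def]
      by (rule module_hom_sum[OF WKm module_hom_id module_hom_uminus[OF WKm
            module_hom_comp[OF module_hom_restrict_scalars[OF B aV] \<sigma>]]])
    note t\<psi> = tensor_module_map[OF A B Vm Wm Vm Wm module_hom_id \<psi>]
    note t\<sigma> = tensor_module_map[OF A B Vm Wm Vm Wm module_hom_id \<sigma>]
    have rT: "pure_tensor K A B \<one>\<^bsub>A\<^esub> a \<in> carrier R" by (rule pure_tensor_R[OF A.one_closed a])
    have decomp: "z = tmap (\<lambda>y. y) (\<psi>) z \<oplus>\<^bsub>T\<^esub> tmap (\<lambda>y. y) (?\<sigma>) (pure_tensor K A B \<one>\<^bsub>A\<^esub> a \<odot>\<^bsub>T\<^esub> z)"
    proof (rule tot_maps_eq[OF z Sc, of "\<lambda>z. z" "\<lambda>z. tmap (\<lambda>y. y) (\<psi>) z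
        \<oplus>\<^bsub>T\<^esub> tmap (\<lambda>y. y) (?\<sigma>) (pure_tensor K A B \<one>\<^bsub>A\<^esub> a \<odot>\<^bsub>T\<^esub> z)"])
      fix U U' assume U: "U \<in> carrier T" "U' \<in> carrier T"
      have ac: "(p \<oplus>\<^bsub>T\<^esub> q) \<oplus>\<^bsub>T\<^esub> (p' \<oplus>\<^bsub>T\<^esub> q') = (p \<oplus>\<^bsub>T\<^esub> p') \<oplus>\<^bsub>T\<^esub> (q \<oplus>\<^bsub>T\<^esub> q')"
        if "p \<in> carrier T" "p' \<in> carrier T" "q \<in> carrier T" "q' \<in> carrier T" for p q p' q'
        using that by (simp only: TM.M.a_ac TM.M.a_closed)
      note rU = TM.smult_closed[OF rT U(1)] TM.smult_closed[OF rT U(2)]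
      show "tmap (\<lambda>y. y) (\<psi>) (U \<oplus>\<^bsub>T\<^esub> U') \<oplus>\<^bsub>T\<^esub> tmap (\<lambda>y. y) (?\<sigma>) (pure_tensor K A B \<one>\<^bsub>A\<^esub> a \<odot>\<^bsub>T\<^esub> (U \<oplus>\<^bsub>T\<^esub> U')) =
          (tmap (\<lambda>y. y) (\<psi>) U \<oplus>\<^bsub>T\<^esub> tmap (\<lambda>y. y) (?\<sigma>) (pure_tensor K A B \<one>\<^bsub>A\<^esub> a \<odot>\<^bsub>T\<^esub> U)) \<oplus>\<^bsub>T\<^esub>
          (tmap (\<lambda>y. y) (\<psi>) U' \<oplus>\<^bsub>T\<^esub> tmap (\<lambda>y. y) (?\<sigma>) (pure_tensor K A B \<one>\<^bsub>A\<^esub> a \<odot>\<^bsub>T\<^esub> U'))"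
        unfolding t\<psi>(2)[OF U] TM.smult_r_distr[OF rT U] t\<sigma>(2)[OF rU]
        by (rule ac[OF t\<psi>(1)[OF U(1)] t\<psi>(1)[OF U(2)] t\<sigma>(1)[OF rU(1)] t\<sigma>(1)[OF rU(2)], symmetric])
    next
      fix v i w j assume vw: "v \<in> S i" "w \<in> S' j" "i + j = n"
      note x = hsP[OF subsetD[OF Sc(1) vw(1)]] and y = hsQ[OF subsetD[OF Sc(2) vw(2)]]
      let ?x = "hsingle Q j w" and ?y = "hsingle P i v"
      have ax: "a \<odot>\<^bsub>W\<^esub> ?x \<in> carrier W" by (rule W.smult_closed[OF a y])
      have \<sigma>x: "?\<sigma> (a \<odot>\<^bsub>W\<^esub> ?x) \<in> carrier W" and \<psi>x: "\<psi> ?x \<in> carrier W"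
        using module_homD(1)[OF \<sigma>] module_homD(1)[OF \<psi>] ax y unfolding restrict_scalars_simps by blast+
      have "\<psi> ?x \<oplus>\<^bsub>W\<^esub> ?\<sigma> (a \<odot>\<^bsub>W\<^esub> ?x) = ?x"
        unfolding \<psi>_def restrict_scalars_minus(1)[OF B Wm \<sigma>x \<sigma>x] restrict_scalars_simps a_minus_def[symmetric]
        by (rule W.diff_add_cancel[OF y \<sigma>x])
      hence "\<tau> i v j w = pt ?y (\<psi> ?x \<oplus>\<^bsub>W\<^esub> ?\<sigma> (a \<odot>\<^bsub>W\<^esub> ?x))" by (simp only:)
      also have "\<dots> = pt ?y (\<psi> ?x) \<oplus>\<^bsub>T\<^esub> pt ?y (?\<sigma> (a \<odot>\<^bsub>W\<^esub> ?x))"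
        by (rule pure(3)[OF x \<psi>x \<sigma>x])
      also have "\<dots> = tmap (\<lambda>y. y) (\<psi>) (\<tau> i v j w) \<oplus>\<^bsub>T\<^esub> tmap (\<lambda>y. y) (?\<sigma>) (pure_tensor K A B \<one>\<^bsub>A\<^esub> a \<odot>\<^bsub>T\<^esub> \<tau> i v j w)"
        unfolding t\<psi>(3)[OF x y] act_right[OF a x y] t\<sigma>(3)[OF x ax] ..
      finally show "\<tau> i v j w = tmap (\<lambda>y. y) (\<psi>) (\<tau> i v j w)
          \<oplus>\<^bsub>T\<^esub> tmap (\<lambda>y. y) (?\<sigma>) (pure_tensor K A B \<one>\<^bsub>A\<^esub> a \<odot>\<^bsub>T\<^esub> \<tau> i v j w)" .
    qed (rule refl)
    have zT: "z \<in> carrier T" by (rule tot_closed[of S S', OF Sc z])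
    have "z = tmap (\<lambda>y. y) (\<psi>) z"
      using decomp unfolding az tmap_zero[OF module_hom_id \<sigma>] TM.M.r_zero[OF t\<psi>(1)[OF zT]] .
    moreover have "tmap (\<lambda>y. y) (\<psi>) z \<in> tot S S1 n"
    proof (rule tot_map_closed[OF z Sc, of "tmap (\<lambda>y. y) (\<psi>)"])
      fix v i w j assume vw: "v \<in> S i" "w \<in> S' j" "i + j = n"
      note c = subsetD[OF Sc(1) vw(1)] subsetD[OF Sc(2) vw(2)]
      note x = hsP[OF c(1)] and y = hsQ[OF c(2)]
      let ?x = "hsingle Q j w"
      interpret Pi: module B "Q j" by (rule Q)
      let ?e = "s j (a \<odot>\<^bsub>Q j\<^esub> w)"
      have e: "?e \<in> S' j" using s(2) aS vw(2) by blast
      have ec: "?e \<in> carrier (Q j)" by (rule submodule_facts(1)[OF Q SS(2) e])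
      define u where "u = w \<ominus>\<^bsub>Q j\<^esub> ?e"
      have uS: "u \<in> S' j" unfolding u_def by (rule submodule_facts(5)[OF Q SS(2) vw(2) e])
      have "a \<odot>\<^bsub>Q j\<^esub> u = a \<odot>\<^bsub>Q j\<^esub> w \<ominus>\<^bsub>Q j\<^esub> a \<odot>\<^bsub>Q j\<^esub> ?e"
        unfolding u_def by (rule module_hom_diff[OF Q Q ahom c(2) ec])
      also have "\<dots> = \<zero>\<^bsub>Q j\<^esub>" using s(3) vw(2) Pi.diff_zero_iff Pi.smult_closed[OF a c(2)] by simp
      finally have u1: "u \<in> S1 j" using uS unfolding S1_def carrier_tor a_def by auto
      have s0: "s m \<zero>\<^bsub>Q m\<^esub> = \<zero>\<^bsub>Q m\<^esub>" for m
        using module_hom_zero[OF module_restrict_scalars[OF B Q] module_restrict_scalars[OF B Q] s(1)] by simp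
      have a0: "a \<odot>\<^bsub>Q m\<^esub> \<zero>\<^bsub>Q m\<^esub> = \<zero>\<^bsub>Q m\<^esub>" for m by (rule module_hom_zero[OF Q Q ahom])
      have \<sigma>x: "?\<sigma> (a \<odot>\<^bsub>W\<^esub> ?x) = hsingle Q j ?e" by (auto simp: hsingle_def s0 a0)
      have ex: "hsingle Q j ?e \<in> carrier W" by (rule hsQ[OF ec])
      have "\<psi> ?x = hsingle Q j u"
        unfolding \<psi>_def \<sigma>x restrict_scalars_minus(1)[OF B Wm ex ex] restrict_scalars_simps a_minus_def[symmetric] u_def
        by (rule module_hom_diff[OF Q Wm hsingle_hom[of B Q, OF Q] c(2) ec, symmetric])
      hence "tmap (\<lambda>y. y) (\<psi>) (\<tau> i v j w) = \<tau> i v j (u)" unfolding t\<psi>(3)[OF x y] by (simp only:)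
      moreover have "\<tau> i v j (u) \<in> tot S S1 n" by (rule tot.gen[of _ S i _ S1 j n, OF vw(1) u1 vw(3)])
      ultimately show "tmap (\<lambda>y. y) (\<psi>) (\<tau> i v j w) \<in> tot S S1 n" by (simp only:)
    qed (rule t\<psi>(2) tot.add; assumption)+
    ultimately show "z \<in> tot S S1 n" by (simp only:)
  qed
  show ?thesis by (subst tor_carrier_update) (simp only: ceq)
qed

lemma tors_total_right:
  assumes "set xs \<subseteq> carrier B" "\<And>i. submodule (S i) A (P i)" "\<And>j. submodule (S' j) B (Q j)"
    and "\<And>i. tor_acyclic B xs (Q i\<lparr>carrier := S' i\<rparr>)"
  shows "tors R (map (\<lambda>x. pure_tensor K A B \<one>\<^bsub>A\<^esub> x) xs @ zs) (total_cx S S' n) =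
      tors R zs (total_cx S (\<lambda>i. carrier (tors B xs (Q i\<lparr>carrier := S' i\<rparr>))) n) \<and>
    (tor_acyclic R zs (total_cx S (\<lambda>i. carrier (tors B xs (Q i\<lparr>carrier := S' i\<rparr>))) n) \<longrightarrow>
     tor_acyclic R (map (\<lambda>x. pure_tensor K A B \<one>\<^bsub>A\<^esub> x) xs @ zs) (total_cx S S' n))"
  using assms
proof (induct xs arbitrary: S')
  case (Cons x xs)
  define S1 where "S1 i = carrier (tor B x (Q i\<lparr>carrier := S' i\<rparr>))" for i
  have x: "x \<in> carrier B" using Cons(2) by simp
  have up: "tor B x (Q i\<lparr>carrier := S' i\<rparr>) = Q i\<lparr>carrier := S1 i\<rparr>" for i
    unfolding S1_def by (rule tor_carrier_update)
  have S1: "submodule (S1 i) B (Q i)" for i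
    unfolding S1_def by (rule submodule_tor_update[OF Q Cons(4) x])
  have eq: "tor R (pure_tensor K A B \<one>\<^bsub>A\<^esub> x) (total_cx S S' n) = total_cx S S1 n"
    unfolding S1_def by (rule tor_total_right[of x S S', OF x Cons(3,4)])
  have div: "divisible_mod_tor R (pure_tensor K A B \<one>\<^bsub>A\<^esub> x) (total_cx S S' n)"
    by (rule divisible_right[of x S S', OF x Cons(3,4)]) (use Cons(5) in simp)
  have ih: "tors R (map (\<lambda>x. pure_tensor K A B \<one>\<^bsub>A\<^esub> x) xs @ zs) (total_cx S S1 n) =
      tors R zs (total_cx S (\<lambda>i. carrier (tors B xs (Q i\<lparr>carrier := S1 i\<rparr>))) n) \<and>
    (tor_acyclic R zs (total_cx S (\<lambda>i. carrier (tors B xs (Q i\<lparr>carrier := S1 i\<rparr>))) n) \<longrightarrow>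
     tor_acyclic R (map (\<lambda>x. pure_tensor K A B \<one>\<^bsub>A\<^esub> x) xs @ zs) (total_cx S S1 n))"
    by (rule Cons(1)) (use Cons(2-5) S1 up in simp_all)
  show ?case using ih by (simp only: list.map append.simps tors.simps tor_acyclic.simps eq div up simp_thms) blast
qed simp

end

section \<open>The degrees of nonvanishing cohomology of a tensor product\<close>

lemma carrier_update_self: "(M :: ('a, 'm) module)\<lparr>carrier := carrier M\<rparr> = M"
  by simp

text \<open>The augmentation is e \<otimes> e' into degree 0. If i + j = n + 1, then i or j is
  positive, and the corresponding factor is exact there; this gives exactness in positive degrees,
  while degree 0 is reduced to tensors of cocycles.\<close>

theorem tensor_resolution:
  fixes K :: "'k ring" and A :: "('k, 'a) module" and B :: "('k, 'b) module"
    and L :: "('a, 'l) module" and N :: "('b, 'n) module"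
    and P :: "nat \<Rightarrow> ('a, 'e) module" and Q :: "nat \<Rightarrow> ('b, 'f) module"
  assumes K: "field K" and A: "algebra K A" and B: "algebra K B"
    and resP: "resolution A L P e dP" and resQ: "resolution B N Q e' dQ"
  shows "\<exists>\<epsilon>. resolution (tensor_algebra K A B) (tensor_module K A B L N)
    (\<lambda>n. (tensor_module K A B (prod_family P) (prod_family Q))
       \<lparr>carrier := tensor_complex.tot K A B P Q (\<lambda>i. carrier (P i)) (\<lambda>j. carrier (Q j)) n\<rparr>)
    \<epsilon> (\<lambda>n. tensor_complex.D K A B P Q dP dQ)"
proof -
  note rP = resolutionD[OF resP] and rQ = resolutionD[OF resQ]
  interpret tensor_complex K A B P Q dP dQ
    by (rule tensor_complex.intro) (rule K A B rP rQ)+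
  have Ssub: "submodule (carrier (P i)) A (P i)" for i by (rule module.carrier_is_submodule[OF P])
  have Ssub': "submodule (carrier (Q j)) B (Q j)" for j by (rule module.carrier_is_submodule[OF Q])
  have S: "subcomplex A P dP (\<lambda>i. carrier (P i))"
    using Ssub dP_carrier rP(9) by (auto simp: subcomplex_def)
  have S': "subcomplex B Q dQ (\<lambda>j. carrier (Q j))"
    using Ssub' dQ_carrier rQ(9) by (auto simp: subcomplex_def)
  interpret X: tensor_subcomplex K A B P Q dP dQ "\<lambda>i. carrier (P i)" "\<lambda>j. carrier (Q j)"
    by unfold_locales (rule S S')+
  let ?tot = "tot (\<lambda>i. carrier (P i)) (\<lambda>j. carrier (Q j))"
  let ?LN = "tensor_module K A B L N" and ?LK = "restrict_scalars A L" and ?NK = "restrict_scalars B N"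
  note Lm = rP(1) and Nm = rQ(1)
  interpret LN: module R ?LN by (rule module_tensor_module[OF A B Lm Nm])
  note LNi = tensor_module_induct'[OF A B Lm Nm, consumes 1, case_names pure add]
  let ?f = "\<lambda>l. hsingle P 0 (e l)" and ?g = "\<lambda>n. hsingle Q 0 (e' n)"
  have f: "?f \<in> module_hom A L V" by (rule module_hom_comp[OF rP(3) hsingle_hom[of A P, OF P]])
  have g: "?g \<in> module_hom B N W" by (rule module_hom_comp[OF rQ(3) hsingle_hom[of B Q, OF Q]])
  note fK = module_hom_restrict_scalars[OF A f] and gK = module_hom_restrict_scalars[OF B g]
  define \<epsilon> where "\<epsilon> = tensor_module_map K A B L N V W ?f ?g"
  note \<epsilon>D = tensor_module_map[OF A B Lm Nm Vm Wm fK gK, folded \<epsilon>_def]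
  have \<epsilon>h: "\<epsilon> \<in> module_hom R ?LN T"
    unfolding \<epsilon>_def by (rule tensor_module_map_hom[OF A B Lm Nm Vm Wm fK gK f g])
  have ec: "e l \<in> carrier (P 0)" if "l \<in> carrier L" for l by (rule module_homD(1)[OF rP(3) that])
  have ec': "e' l \<in> carrier (Q 0)" if "l \<in> carrier N" for l by (rule module_homD(1)[OF rQ(3) that])
  have \<epsilon>tot: "\<epsilon> U \<in> ?tot 0" if "U \<in> carrier ?LN" for U
    using that
  proof (induct U rule: LNi)
    case (pure x y)
    show ?case unfolding \<epsilon>D(3)[OF pure]
      by (rule tot.gen[of "e x" _ 0 "e' y" _ 0 0]) (simp_all add: ec ec' pure)
  next
    case (add U U')
    show ?case unfolding \<epsilon>D(2)[OF add(1,2)] by (rule tot.add[OF add(3,4)])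
  qed
  have D\<epsilon>: "D (\<epsilon> U) = \<zero>\<^bsub>T\<^esub>" if "U \<in> carrier ?LN" for U
    using that
  proof (induct U rule: LNi)
    case (pure x y)
    have d0: "dP 0 (e x) = \<zero>\<^bsub>P (Suc 0)\<^esub>" "dQ 0 (e' y) = \<zero>\<^bsub>Q (Suc 0)\<^esub>"
      using rP(7)[OF pure(1)] rQ(7)[OF pure(2)] by simp_all
    show ?case
      unfolding \<epsilon>D(3)[OF pure] D_gen[OF ec[OF pure(1)] ec'[OF pure(2)]] d0 gen_zero(1)[OF ec'[OF pure(2)]]
        gen_zero(2)[OF sign_P[OF ec[OF pure(1)]]]
      by (rule TM.M.l_zero[OF TM.M.zero_closed])
  next
    case (add U U')
    show ?case
      unfolding \<epsilon>D(2)[OF add(1,2)] D_add[OF \<epsilon>D(1)[OF add(1)] \<epsilon>D(1)[OF add(2)]] add(3,4)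
      by (rule TM.M.l_zero[OF TM.M.zero_closed])
  qed
  \<comment> \<open>Injectivity of a tensor product of maps is obtained from K-linear left
    inverses.\<close>
  have retract: "\<exists>h. h \<in> module_hom K VV MM \<and> (\<forall>v\<in>carrier MM. h (k v) = v)"
    if m: "module K MM" "module K VV" "k \<in> module_hom K MM VV" "inj_on k (carrier MM)"
    for MM :: "('k, 'c) module" and VV :: "('k, 'g) module" and k
  proof -
    have "k \<in> module_hom K (MM\<lparr>carrier := carrier MM\<rparr>) (VV\<lparr>carrier := carrier VV\<rparr>)"
      using m(3) by simp
    then obtain h where h: "h \<in> module_hom K VV MM" "\<And>v. v \<in> carrier MM \<Longrightarrow> k (h (k v)) = k v"
      using pseudo_inverse[OF K m(1,2) module.carrier_is_submodule[OF m(1)] module.carrier_is_submodule[OF m(2)]]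
        by metis
    have "h (k v) = v" if v: "v \<in> carrier MM" for v
      using inj_onD[OF m(4) h(2)[OF v]] v module_homD(1)[OF h(1)] module_homD(1)[OF m(3)] by simp
    thus ?thesis using h(1) by blast
  qed
  have injf: "inj_on ?f (carrier ?LK)"
  proof (rule inj_onI)
    fix x y assume xy: "x \<in> carrier ?LK" "y \<in> carrier ?LK" "?f x = ?f y"
    hence "?f x 0 = ?f y 0" by simp
    thus "x = y" using inj_onD[OF rP(4)] xy by (simp add: hsingle_def)
  qed
  have injg: "inj_on ?g (carrier ?NK)"
  proof (rule inj_onI)
    fix x y assume xy: "x \<in> carrier ?NK" "y \<in> carrier ?NK" "?g x = ?g y"
    hence "?g x 0 = ?g y 0" by simp
    thus "x = y" using inj_onD[OF rQ(4)] xy by (simp add: hsingle_def)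
  qed
  obtain p where p: "p \<in> module_hom K VK ?LK" "\<forall>v\<in>carrier ?LK. p (?f v) = v"
    using retract[OF module_restrict_scalars[OF A Lm] VKm fK injf] by blast
  obtain q where q: "q \<in> module_hom K WK ?NK" "\<forall>v\<in>carrier ?NK. q (?g v) = v"
    using retract[OF module_restrict_scalars[OF B Nm] WKm gK injg] by blast
  note pq = tensor_module_map[OF A B Vm Wm Lm Nm p(1) q(1)]
  have left_inv: "tensor_module_map K A B V W L N p q (\<epsilon> U) = U" if "U \<in> carrier ?LN" for U
    using that
  proof (induct U rule: LNi)
    case (pure x y)
    show ?case
      unfolding \<epsilon>D(3)[OF pure] pq(3)[OF module_homD(1)[OF f pure(1)] module_homD(1)[OF g pure(2)]]
      using p(2) q(2) pure by simp
  next
    case (add U U')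
    show ?case unfolding \<epsilon>D(2)[OF add(1,2)] pq(2)[OF \<epsilon>D(1)[OF add(1)] \<epsilon>D(1)[OF add(2)]] add(3,4) ..
  qed
  have exP: "exact_at P dP (\<lambda>i. carrier (P i)) (Suc k)" for k
    unfolding exact_at_def nat.case using rP(8) by blast
  have exQ: "exact_at Q dQ (\<lambda>i. carrier (Q i)) (Suc k)" for k
    unfolding exact_at_def nat.case using rQ(8) by blast
  \<comment> \<open>A total cocycle of degree 0 is a sum of tensors of cocycles, and these are
    values of \<open>e\<close> and \<open>e'\<close>.\<close>
  have img: "z \<in> \<epsilon> ` carrier ?LN" if "z \<in> ?tot 0" "D z = \<zero>\<^bsub>T\<^esub>" for z
  proof -
    have "z \<in> tot X.Z X.Z' 0" using X.cocycle_decomposition[OF that] by (simp only: nat.case)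
    thus ?thesis
    proof (induct rule: tot.induct)
      case (gen v i w j)
      hence ij: "i = 0" "j = 0" by auto
      have v: "v \<in> carrier (P 0)" "dP 0 v = \<zero>\<^bsub>P 1\<^esub>" and w: "w \<in> carrier (Q 0)" "dQ 0 w = \<zero>\<^bsub>Q 1\<^esub>"
        using gen ij by (auto simp: X.Z_def X.Z'_def)
      obtain l n where l: "l \<in> carrier L" "e l = v" and n: "n \<in> carrier N" "e' n = w"
        using rP(6)[OF v] rQ(6)[OF w] by blast
      have "\<tau> i v j w = \<epsilon> (pure_tensor K ?LK ?NK l n)"
        unfolding ij \<epsilon>D(3)[OF l(1) n(1)] l(2) n(2) ..
      thus ?case by (rule image_eqI[OF _ tensor_module_pure(1)[OF A B Lm Nm l(1) n(1)]])
    next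
      case (add z z')
      obtain U U' where U: "U \<in> carrier ?LN" "z = \<epsilon> U" "U' \<in> carrier ?LN" "z' = \<epsilon> U'" using add(2,4) by blast
      show ?case unfolding U(2,4) \<epsilon>D(2)[OF U(1,3), symmetric] by (rule imageI[OF LN.M.a_closed[OF U(1,3)]])
    qed
  qed
  have "resolution R ?LN (\<lambda>n. total_cx (\<lambda>i. carrier (P i)) (\<lambda>j. carrier (Q j)) n) \<epsilon> (\<lambda>n. D)"
    unfolding resolution_def
  proof (intro conjI allI ballI)
    show "module R ?LN" by (rule LN.module_axioms)
    show "\<And>n. module R (total_cx (\<lambda>i. carrier (P i)) (\<lambda>j. carrier (Q j)) n)"
      by (rule total_module[of "\<lambda>i. carrier (P i)" "\<lambda>j. carrier (Q j)", OF Ssub Ssub'])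
    show "\<epsilon> \<in> module_hom R ?LN (total_cx (\<lambda>i. carrier (P i)) (\<lambda>j. carrier (Q j)) 0)"
      using module_homD(2,3)[OF \<epsilon>h] \<epsilon>tot by (intro module_homI) simp_all
    show "inj_on \<epsilon> (carrier ?LN)" by (rule inj_on_inverseI, rule left_inv)
    show "\<And>n. D \<in> module_hom R (total_cx (\<lambda>i. carrier (P i)) (\<lambda>j. carrier (Q j)) n)
         (total_cx (\<lambda>i. carrier (P i)) (\<lambda>j. carrier (Q j)) (Suc n))"
      using module_homD(2,3)[OF D_hom] X.D_tot X.tc by (intro module_homI) simp_all
    fix x assume x: "x \<in> carrier (total_cx (\<lambda>i. carrier (P i)) (\<lambda>j. carrier (Q j)) 0)"
    show "D x = \<zero>\<^bsub>total_cx (\<lambda>i. carrier (P i)) (\<lambda>j. carrier (Q j)) 1\<^esub> \<longleftrightarrow> x \<in> \<epsilon> ` carrier ?LN"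
      using img[of x] x D\<epsilon> by auto
  next
    fix n x assume x: "x \<in> carrier (total_cx (\<lambda>i. carrier (P i)) (\<lambda>j. carrier (Q j)) (Suc n))"
    hence xt: "x \<in> ?tot (Suc n)" by simp
    have ex: "exact_at P dP (\<lambda>i. carrier (P i)) i \<or> exact_at Q dQ (\<lambda>j. carrier (Q j)) (Suc n - i)" for i
    proof (cases i)
      case 0
      have "exact_at Q dQ (\<lambda>j. carrier (Q j)) (Suc n - i)" unfolding 0 using exQ[of n] by simp
      thus ?thesis ..
    next
      case (Suc k)
      show ?thesis unfolding Suc using exP ..
    qed
    have "\<exists>b\<in>?tot n. D b = x" if "D x = \<zero>\<^bsub>T\<^esub>"
      using X.total_exact[OF xt that ex] by (simp only: nat.case)
    thus "D x = \<zero>\<^bsub>total_cx (\<lambda>i. carrier (P i)) (\<lambda>j. carrier (Q j)) (Suc (Suc n))\<^esub> \<longleftrightarrow>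
        x \<in> D ` carrier (total_cx (\<lambda>i. carrier (P i)) (\<lambda>j. carrier (Q j)) n)"
      using X.D_D by auto
  qed
  thus ?thesis by blast
qed

text \<open>The resolution \<open>G\<close> chosen for L \<otimes> N and the total complex live in
  different types and are linked by \<open>tors_exact_at_comparison\<close>. The formula reflects
  that H^n is the direct sum of the H^i \<otimes> H^j with i + j = n, and that nonzero vector spaces
  have a nonzero tensor product.\<close>

theorem nonvanishing_degrees_tensor:
  fixes K :: "'k ring" and A :: "('k, 'a) module" and B :: "('k, 'b) module"
    and L :: "('a, 'l) module" and N :: "('b, 'n) module"
  assumes K: "field K" and A: "algebra K A" and nA: "noetherian_ring A" and B: "algebra K B" and nB: "noetherian_ring B"
    and nR: "noetherian_ring (tensor_algebra K A B)"
    and I: "ideal I A" and J: "ideal J B" and L: "module A L" and N: "module B N"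
  shows "nonvanishing_degrees (tensor_algebra K A B) (tensor_ideal K A B I J) (tensor_module K A B L N) =
    {i + j | i j. i \<in> nonvanishing_degrees A I L \<and> j \<in> nonvanishing_degrees B J N}"
proof -
  obtain SA where SA: "SA \<subseteq> carrier A" "finite SA" "I = Idl\<^bsub>A\<^esub> SA" using noetherian_ring.finetely_gen[OF nA I] by blast
  obtain xs where xs: "set xs = SA" using finite_list[OF SA(2)] by blast
  obtain SB where SB: "SB \<subseteq> carrier B" "finite SB" "J = Idl\<^bsub>B\<^esub> SB" using noetherian_ring.finetely_gen[OF nB J] by blast
  obtain ys where ys: "set ys = SB" using finite_list[OF SB(2)] by blast
  have xsA: "set xs \<subseteq> carrier A" and ysB: "set ys \<subseteq> carrier B" using SA SB xs ys by auto
  have IJ: "I = Idl\<^bsub>A\<^esub> (set xs)" "J = Idl\<^bsub>B\<^esub> (set ys)" using SA SB xs ys by auto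
  let ?R = "tensor_algebra K A B" and ?LN = "tensor_module K A B L N"
  define zs where "zs = map (\<lambda>x. pure_tensor K A B x \<one>\<^bsub>B\<^esub>) xs @ map (\<lambda>y. pure_tensor K A B \<one>\<^bsub>A\<^esub> y) ys"
  have ideal_eq: "tensor_ideal K A B I J = Idl\<^bsub>?R\<^esub> (set zs)"
    unfolding IJ zs_def tensor_ideal_eq[OF A B xsA ysB] by simp
  have zsR: "set zs \<subseteq> carrier ?R"
  proof -
    interpret A: cring A by (rule algebra_D[OF A])
    interpret B: cring B by (rule algebra_D[OF B])
    have "pure_tensor K A B a b \<in> carrier ?R" if "a \<in> carrier A" "b \<in> carrier B" for a b
      using pure_tensor_closed[OF algebra_D(3)[OF A] algebra_D(3)[OF B] that] by simp
    thus ?thesis using xsA ysB A.one_closed B.one_closed unfolding zs_def set_append set_map by blast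
  qed
  note RA = algebra_tensor_algebra[OF A B] and LNm = module_tensor_module[OF A B L N]
  obtain P :: "nat \<Rightarrow> ('a, ('a \<times> 'l) list set) module" and e dP where rsP: "resolution A L P e dP" "\<And>n. baer A (P n)"
    "nonvanishing_degrees A I L = {n. \<not> tors_exact_at A xs P dP n}"
    by (rule nonvanishing_degrees_eq[OF K A L xsA, folded IJ(1)]) (rule that; assumption)
  obtain Q :: "nat \<Rightarrow> ('b, ('b \<times> 'n) list set) module" and e' dQ where rsQ: "resolution B N Q e' dQ" "\<And>n. baer B (Q n)"
    "nonvanishing_degrees B J N = {n. \<not> tors_exact_at B ys Q dQ n}"
    by (rule nonvanishing_degrees_eq[OF K B N ysB, folded IJ(2)]) (rule that; assumption)
  obtain G :: "nat \<Rightarrow> (('a \<times> 'b \<Rightarrow>\<^sub>0 int) set, (('a \<times> 'b \<Rightarrow>\<^sub>0 int) set \<times> ('l \<times> 'n \<Rightarrow>\<^sub>0 int) set) list set) module"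
    and e'' dG where G: "resolution ?R ?LN G e'' dG" "\<And>n. baer ?R (G n)"
    "nonvanishing_degrees ?R (tensor_ideal K A B I J) ?LN = {n. \<not> tors_exact_at ?R zs G dG n}"
    by (rule nonvanishing_degrees_eq[OF K RA LNm zsR, folded ideal_eq]) (rule that; assumption)
  note rP = resolutionD[OF rsP(1)] and rQ = resolutionD[OF rsQ(1)]
  interpret tensor_complex K A B P Q dP dQ
    by (rule tensor_complex.intro) (rule K A B rP rQ)+
  let ?X = "\<lambda>n. total_cx (\<lambda>i. carrier (P i)) (\<lambda>j. carrier (Q j)) n"
  obtain \<epsilon> where res: "resolution ?R ?LN ?X \<epsilon> (\<lambda>n. D)" using tensor_resolution[OF K A B rsP(1) rsQ(1)] by blast
  have SP: "submodule (carrier (P i)) A (P i)" for i by (rule module.carrier_is_submodule[OF rP(2)])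
  have SQ: "submodule (carrier (Q j)) B (Q j)" for j by (rule module.carrier_is_submodule[OF rQ(2)])
  define S where "S i = carrier (tors A xs (P i))" for i
  define S' where "S' j = carrier (tors B ys (Q j))" for j
  have Ss: "submodule (S i) A (P i)" for i unfolding S_def by (rule submodule_tors[OF rP(2) xsA])
  have acP: "tor_acyclic A xs (P i\<lparr>carrier := carrier (P i)\<rparr>)" for i
    unfolding carrier_update_self by (rule baer_tor_acyclic[OF nA rsP(2) xsA])
  have acQ: "tor_acyclic B ys (Q j\<lparr>carrier := carrier (Q j)\<rparr>)" for j
    unfolding carrier_update_self by (rule baer_tor_acyclic[OF nB rsQ(2) ysB])
  \<comment> \<open>The elements x \<otimes> 1 are taken first. They leave the second factor
    untouched, so the elements 1 \<otimes> y still meet the injective modules \<open>Q j\<close>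
    there.\<close>
  have left: "tors ?R zs (?X n) = tors ?R (map (\<lambda>y. pure_tensor K A B \<one>\<^bsub>A\<^esub> y) ys) (total_cx S (\<lambda>j. carrier (Q j)) n) \<and>
      (tor_acyclic ?R (map (\<lambda>y. pure_tensor K A B \<one>\<^bsub>A\<^esub> y) ys) (total_cx S (\<lambda>j. carrier (Q j)) n) \<longrightarrow> tor_acyclic ?R zs (?X
          n))" for n
    using tors_total_left[of xs "\<lambda>i. carrier (P i)" "\<lambda>j. carrier (Q j)" "map (\<lambda>y. pure_tensor K A B \<one>\<^bsub>A\<^esub> y) ys" n,
      OF xsA SP SQ acP]
    unfolding carrier_update_self zs_def S_def[abs_def] .
  have right: "tors ?R (map (\<lambda>y. pure_tensor K A B \<one>\<^bsub>A\<^esub> y) ys) (total_cx S (\<lambda>j. carrier (Q j)) n) = total_cx S S' n \<and>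
      tor_acyclic ?R (map (\<lambda>y. pure_tensor K A B \<one>\<^bsub>A\<^esub> y) ys) (total_cx S (\<lambda>j. carrier (Q j)) n)" for n
    using tors_total_right[of ys S "\<lambda>j. carrier (Q j)" "[]" n, OF ysB Ss SQ acQ]
    unfolding carrier_update_self S'_def[abs_def] append_Nil2 tors.simps(1) tor_acyclic.simps(1) by blast
  have torsX: "tors ?R zs (?X n) = total_cx S S' n" and acX: "tor_acyclic ?R zs (?X n)" for n
    using left right by simp_all
  have acG: "tor_acyclic ?R zs (G n)" for n by (rule baer_tor_acyclic[OF nR G(2) zsR])
  have cmp: "tors_exact_at ?R zs ?X (\<lambda>n. D) n \<longleftrightarrow> tors_exact_at ?R zs G dG n" for n
    by (rule tors_exact_at_comparison[OF res G(1) G(2) zsR acX acG])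
  have SC: "subcomplex A P dP S"
    unfolding subcomplex_def
  proof (intro conjI allI ballI)
    fix i v assume v: "v \<in> S i"
    show "dP i v \<in> S (Suc i)"
      unfolding S_def by (rule module_homD(1)[OF module_hom_tors[OF rP(2,2,5) xsA] v[unfolded S_def]])
    show "dP (Suc i) (dP i v) = \<zero>\<^bsub>P (Suc (Suc i))\<^esub>"
      by (rule rP(9)) (use v in \<open>simp add: S_def carrier_tors\<close>)
  qed (rule Ss)
  have SC': "subcomplex B Q dQ S'"
    unfolding subcomplex_def
  proof (intro conjI allI ballI)
    fix i v assume v: "v \<in> S' i"
    show "dQ i v \<in> S' (Suc i)"
      unfolding S'_def by (rule module_homD(1)[OF module_hom_tors[OF rQ(2,2,5) ysB] v[unfolded S'_def]])
    show "dQ (Suc i) (dQ i v) = \<zero>\<^bsub>Q (Suc (Suc i))\<^esub>"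
      by (rule rQ(9)) (use v in \<open>simp add: S'_def carrier_tors\<close>)
  next
    show "\<And>i. submodule (S' i) B (Q i)" unfolding S'_def by (rule submodule_tors[OF rQ(2) ysB])
  qed
  interpret Y: tensor_subcomplex K A B P Q dP dQ S S' by unfold_locales (rule SC SC')+
  have eP: "exact_at P dP S i \<longleftrightarrow> tors_exact_at A xs P dP i" for i
    unfolding exact_at_def tors_exact_at_def S_def ..
  have eQ: "exact_at Q dQ S' i \<longleftrightarrow> tors_exact_at B ys Q dQ i" for i
    unfolding exact_at_def tors_exact_at_def S'_def ..
  have "tors_exact_at ?R zs ?X (\<lambda>n. D) n \<longleftrightarrow> (\<forall>i\<le>n. tors_exact_at A xs P dP i \<or> tors_exact_at B ys Q dQ (n - i))" for n
  proof -
    have "tors_exact_at ?R zs ?X (\<lambda>n. D) n \<longleftrightarrow>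
      (\<forall>z\<in>tot S S' n. D z = \<zero>\<^bsub>T\<^esub> \<longrightarrow> (case n of 0 \<Rightarrow> z = \<zero>\<^bsub>T\<^esub> | Suc m \<Rightarrow> \<exists>b\<in>tot S S' m. D b = z))"
      unfolding tors_exact_at_def torsX by (cases n) simp_all
    also have "\<dots> \<longleftrightarrow> (\<forall>i\<le>n. tors_exact_at A xs P dP i \<or> tors_exact_at B ys Q dQ (n - i))"
      unfolding Y.kunneth_exactness eP eQ ..
    finally show ?thesis .
  qed
  hence "tors_exact_at ?R zs G dG n \<longleftrightarrow> (\<forall>i\<le>n. tors_exact_at A xs P dP i \<or> tors_exact_at B ys Q dQ (n - i))" for n
    using cmp by blast
  hence "nonvanishing_degrees ?R (tensor_ideal K A B I J) ?LN =
      {n. \<exists>i\<le>n. \<not> tors_exact_at A xs P dP i \<and> \<not> tors_exact_at B ys Q dQ (n - i)}"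
    unfolding G(3) by auto
  also have "\<dots> = {i + j | i j. \<not> tors_exact_at A xs P dP i \<and> \<not> tors_exact_at B ys Q dQ j}"
  proof (intro Set.equalityI subsetI)
    fix n assume "n \<in> {n. \<exists>i\<le>n. \<not> tors_exact_at A xs P dP i \<and> \<not> tors_exact_at B ys Q dQ (n - i)}"
    then obtain i where "i \<le> n" "\<not> tors_exact_at A xs P dP i" "\<not> tors_exact_at B ys Q dQ (n - i)" by blast
    moreover from this(1) have "n = i + (n - i)" by simp
    ultimately show "n \<in> {i + j | i j. \<not> tors_exact_at A xs P dP i \<and> \<not> tors_exact_at B ys Q dQ j}" by blast
  next
    fix n assume "n \<in> {i + j | i j. \<not> tors_exact_at A xs P dP i \<and> \<not> tors_exact_at B ys Q dQ j}"
    then obtain i j where "n = i + j" "\<not> tors_exact_at A xs P dP i" "\<not> tors_exact_at B ys Q dQ j" by blast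
    thus "n \<in> {n. \<exists>i\<le>n. \<not> tors_exact_at A xs P dP i \<and> \<not> tors_exact_at B ys Q dQ (n - i)}"
      by (auto intro: exI[of _ i])
  qed
  finally show ?thesis unfolding rsP(3) rsQ(3) by simp
qed

section \<open>From degrees of nonvanishing to the Cohen--Macaulay condition\<close>

lemma grade_eq_cohomological_dim_iff:
  "grade R \<aa> M = cohomological_dim R \<aa> M \<longleftrightarrow> (\<exists>n. nonvanishing_degrees R \<aa> M = {n})"
proof
  let ?D = "nonvanishing_degrees R \<aa> M"
  assume eq: "grade R \<aa> M = cohomological_dim R \<aa> M"
  \<comment> \<open>For the empty set the infimum is \<infinity> and the supremum is -\<infinity>,
    so equality excludes it.\<close>
  have "?D \<noteq> {}"
  proof
    assume "?D = {}"
    thus False using eq by (simp add: grade_def cohomological_dim_def top_ereal_def bot_ereal_def)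
  qed
  then obtain n where n: "n \<in> ?D" by blast
  have bounds: "grade R \<aa> M \<le> ereal (real i)" "ereal (real i) \<le> cohomological_dim R \<aa> M" if "i \<in> ?D" for i
    unfolding grade_def cohomological_dim_def using that by (auto intro: INF_lower SUP_upper)
  have "i = n" if "i \<in> ?D" for i
  proof -
    have "ereal (real i) = grade R \<aa> M" "ereal (real n) = grade R \<aa> M"
      using bounds[OF that] bounds[OF n] eq by (auto intro: antisym)
    hence "ereal (real i) = ereal (real n)" by (rule trans[OF _ sym])
    thus ?thesis by simp
  qed
  thus "\<exists>n. ?D = {n}" using n by blast
next
  assume "\<exists>n. nonvanishing_degrees R \<aa> M = {n}"
  thus "grade R \<aa> M = cohomological_dim R \<aa> M" by (auto simp: grade_def cohomological_dim_def)
qed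

text \<open>A one-element sumset forces both sets to be nonempty; then adding a fixed element of one
  set is injective on the other.\<close>

lemma sumset_singleton_iff:
  fixes X' Y' :: "nat set"
  shows "(\<exists>n. {i + j | i j. i \<in> X' \<and> j \<in> Y'} = {n}) \<longleftrightarrow> (\<exists>n. X' = {n}) \<and> (\<exists>n. Y' = {n})"
proof
  assume "\<exists>n. {i + j | i j. i \<in> X' \<and> j \<in> Y'} = {n}"
  then obtain n where n: "{i + j | i j. i \<in> X' \<and> j \<in> Y'} = {n}" by blast
  hence "n \<in> {i + j | i j. i \<in> X' \<and> j \<in> Y'}" by blast
  then obtain a b where ab: "a \<in> X'" "b \<in> Y'" by blast
  have sum: "i + j = n" if "i \<in> X'" "j \<in> Y'" for i j using n that by blast
  have "i = a" if "i \<in> X'" for i using sum[OF that ab(2)] sum[OF ab] by simp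
  moreover have "j = b" if "j \<in> Y'" for j using sum[OF ab(1) that] sum[OF ab] by simp
  ultimately show "(\<exists>n. X' = {n}) \<and> (\<exists>n. Y' = {n})" using ab by blast
qed auto

text \<open>\<open>ideal_smult\<close> is generated as an additive group; closure under scalars is
  what allows separation by a \<open>K\<close>-linear functional.\<close>

lemma submodule_ideal_smult:
  assumes "module R M" "ideal I R"
  shows "submodule (ideal_smult I M) R M"
proof -
  interpret M: module R M by fact
  interpret I: ideal I R by fact
  let ?g = "{r \<odot>\<^bsub>M\<^esub> m | r m. r \<in> I \<and> m \<in> carrier M}"
  have g: "?g \<subseteq> carrier (add_monoid M)" using I.Icarr by auto
  have sub: "subgroup (ideal_smult I M) (add_monoid M)"
    unfolding ideal_smult_def by (rule M.add.generate_is_subgroup) (use g in simp)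
  have incl: "r \<odot>\<^bsub>M\<^esub> m \<in> ideal_smult I M" if "r \<in> I" "m \<in> carrier M" for r m
    unfolding ideal_smult_def by (rule generate.incl) (use that in blast)
  have "a \<odot>\<^bsub>M\<^esub> u \<in> ideal_smult I M" if a: "a \<in> carrier R" and u: "u \<in> ideal_smult I M" for a u
  proof -
    let ?H = "{u \<in> carrier M. a \<odot>\<^bsub>M\<^esub> u \<in> ideal_smult I M}"
    have neg: "\<ominus>\<^bsub>M\<^esub> u \<in> ideal_smult I M" if "u \<in> ideal_smult I M" for u
      using subgroup.m_inv_closed[OF sub that] by (simp add: a_inv_def)
    have "ideal_smult I M \<subseteq> ?H"
      unfolding ideal_smult_def[of I M, THEN arg_cong[of _ _ "\<lambda>G. G \<subseteq> ?H"]]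
    proof (rule M.add.generate_subgroup_incl)
      show "?g \<subseteq> ?H"
      proof
        fix u assume "u \<in> ?g"
        then obtain r m where rm: "u = r \<odot>\<^bsub>M\<^esub> m" "r \<in> I" "m \<in> carrier M" by blast
        have "a \<odot>\<^bsub>M\<^esub> u = (a \<otimes>\<^bsub>R\<^esub> r) \<odot>\<^bsub>M\<^esub> m" using rm a I.Icarr by (simp add: M.smult_assoc1)
        thus "u \<in> ?H" using incl[OF I.I_l_closed[OF rm(2) a] rm(3)] rm I.Icarr by simp
      qed
      show "subgroup ?H (add_monoid M)"
      proof
        show "\<And>x y. \<lbrakk>x \<in> ?H; y \<in> ?H\<rbrakk> \<Longrightarrow> x \<otimes>\<^bsub>add_monoid M\<^esub> y \<in> ?H"
          using a subgroup.m_closed[OF sub] by (simp add: M.smult_r_distr)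
        show "\<one>\<^bsub>add_monoid M\<^esub> \<in> ?H" using a subgroup.one_closed[OF sub] by simp
        fix x assume "x \<in> ?H"
        thus "inv\<^bsub>add_monoid M\<^esub> x \<in> ?H" using a neg by (simp add: a_inv_def[symmetric] M.smult_r_minus)
      qed auto
    qed
    thus ?thesis using u by blast
  qed
  thus ?thesis using sub by (simp add: submodule_def submodule_axioms_def)
qed

text \<open>Functionals that vanish on IL and on JN, but not at l and n, combine to a functional on
  L \<otimes> N that vanishes on the product with the ideal, but not at l \<otimes> n.\<close>

lemma ideal_smult_tensor_proper:
  fixes K :: "'k ring" and A :: "('k, 'a) module" and B :: "('k, 'b) module"
    and L :: "('a, 'l) module" and N :: "('b, 'n) module"
  assumes K: "field K" and A: "algebra K A" and B: "algebra K B" and I: "ideal I A" and J: "ideal J B"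
    and L: "module A L" and N: "module B N"
    and IL: "ideal_smult I L \<noteq> carrier L" and JN: "ideal_smult J N \<noteq> carrier N"
  shows "carrier (tensor_module K A B L N) \<noteq> ideal_smult (tensor_ideal K A B I J) (tensor_module K A B L N)"
proof -
  let ?R = "tensor_algebra K A B" and ?T = "tensor_module K A B L N"
    and ?LK = "restrict_scalars A L" and ?NK = "restrict_scalars B N"
  interpret K: field K by (rule K)
  interpret A: cring A by (rule algebra_D[OF A])
  interpret B: cring B by (rule algebra_D[OF B])
  interpret L: module A L by (rule L)
  interpret N: module B N by (rule N)
  interpret I: ideal I A by (rule I)
  interpret J: ideal J B by (rule J)
  interpret R: cring ?R by (rule cring_tensor_algebra[OF A B])
  interpret T: module ?R ?T by (rule module_tensor_module[OF A B L N])
  note IS = submodule_ideal_smult[OF L I] and JS = submodule_ideal_smult[OF N J]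
  obtain l where l: "l \<in> carrier L" "l \<notin> ideal_smult I L" using IL submodule_facts(1)[OF L IS] by blast
  obtain n where n: "n \<in> carrier N" "n \<notin> ideal_smult J N" using JN submodule_facts(1)[OF N JS] by blast
  obtain \<phi> where \<phi>: "\<phi> \<in> module_hom K ?LK (regular_module K)" "\<And>s. s \<in> ideal_smult I L \<Longrightarrow> \<phi> s = \<zero>\<^bsub>K\<^esub>" "\<phi> l = \<one>\<^bsub>K\<^esub>"
    using functional_exists[OF K module_restrict_scalars[OF A L] submodule_restrict_scalars[OF A L IS], of l] l
    by (metis restrict_scalars_simps(1))
  obtain \<psi> where \<psi>: "\<psi> \<in> module_hom K ?NK (regular_module K)" "\<And>s. s \<in> ideal_smult J N \<Longrightarrow> \<psi> s = \<zero>\<^bsub>K\<^esub>" "\<psi> n = \<one>\<^bsub>K\<^esub>"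
    using functional_exists[OF K module_restrict_scalars[OF B N] submodule_restrict_scalars[OF B N JS], of n] n
    by (metis restrict_scalars_simps(1))
  note \<phi>D = module_homD[OF \<phi>(1), simplified] and \<psi>D = module_homD[OF \<psi>(1), simplified]
  have H: "comm_group (add_monoid K)" by (rule K.a_comm_group)
  obtain \<theta> where \<theta>: "\<theta> \<in> hom (tensor_group K ?LK ?NK) (add_monoid K)"
    "\<And>x y. \<lbrakk>x \<in> carrier ?LK; y \<in> carrier ?NK\<rbrakk> \<Longrightarrow> \<theta> (pure_tensor K ?LK ?NK x y) = \<phi> x \<otimes>\<^bsub>K\<^esub> \<psi> y"
  proof (rule tensor_hom_lift[OF module_restrict_scalars[OF A L] module_restrict_scalars[OF B N] H,
      of "\<lambda>x y. \<phi> x \<otimes>\<^bsub>K\<^esub> \<psi> y"])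
    show "\<And>x y. \<lbrakk>x \<in> carrier ?LK; y \<in> carrier ?NK\<rbrakk> \<Longrightarrow> \<phi> x \<otimes>\<^bsub>K\<^esub> \<psi> y \<in> carrier (add_monoid K)"
      using \<phi>D(1) \<psi>D(1) by simp
    show "\<And>x x' y. \<lbrakk>x \<in> carrier ?LK; x' \<in> carrier ?LK; y \<in> carrier ?NK\<rbrakk> \<Longrightarrow>
       \<phi> (x \<oplus>\<^bsub>?LK\<^esub> x') \<otimes>\<^bsub>K\<^esub> \<psi> y = (\<phi> x \<otimes>\<^bsub>K\<^esub> \<psi> y) \<otimes>\<^bsub>add_monoid K\<^esub> (\<phi> x' \<otimes>\<^bsub>K\<^esub> \<psi> y)"
      using \<phi>D(1,2) \<psi>D(1) by (simp add: K.l_distr)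
    show "\<And>x y y'. \<lbrakk>x \<in> carrier ?LK; y \<in> carrier ?NK; y' \<in> carrier ?NK\<rbrakk> \<Longrightarrow>
       \<phi> x \<otimes>\<^bsub>K\<^esub> \<psi> (y \<oplus>\<^bsub>?NK\<^esub> y') = (\<phi> x \<otimes>\<^bsub>K\<^esub> \<psi> y) \<otimes>\<^bsub>add_monoid K\<^esub> (\<phi> x \<otimes>\<^bsub>K\<^esub> \<psi> y')"
      using \<phi>D(1) \<psi>D(1,2) by (simp add: K.r_distr)
    show "\<And>c x y. \<lbrakk>c \<in> carrier K; x \<in> carrier ?LK; y \<in> carrier ?NK\<rbrakk> \<Longrightarrow>
       \<phi> (c \<odot>\<^bsub>?LK\<^esub> x) \<otimes>\<^bsub>K\<^esub> \<psi> y = \<phi> x \<otimes>\<^bsub>K\<^esub> \<psi> (c \<odot>\<^bsub>?NK\<^esub> y)"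
      using \<phi>D(1,3) \<psi>D(1,3) by (simp add: K.m_ac)
  qed (rule that)
  have \<theta>p: "\<theta> (pure_tensor K ?LK ?NK x y) = \<phi> x \<otimes>\<^bsub>K\<^esub> \<psi> y" if "x \<in> carrier L" "y \<in> carrier N" for x y
    using \<theta>(2) that by simp
  have \<theta>a: "\<theta> (U \<oplus>\<^bsub>?T\<^esub> U') = \<theta> U \<oplus>\<^bsub>K\<^esub> \<theta> U'" if "U \<in> carrier ?T" "U' \<in> carrier ?T" for U U'
    using hom_mult[OF \<theta>(1)] that by simp
  have \<theta>c: "\<theta> U \<in> carrier K" if "U \<in> carrier ?T" for U using hom_in_carrier[OF \<theta>(1)] that by simp
  have \<theta>0: "\<theta> \<zero>\<^bsub>?T\<^esub> = \<zero>\<^bsub>K\<^esub>"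
    using \<theta>a[OF T.M.zero_closed T.M.zero_closed] \<theta>c[OF T.M.zero_closed]
    unfolding T.M.l_zero[OF T.M.zero_closed] by (metis K.add.r_cancel_one')
  have zero_ext: "\<theta> (r \<odot>\<^bsub>?T\<^esub> m) = \<zero>\<^bsub>K\<^esub>"
    if r: "r \<in> carrier ?R" and m: "m \<in> carrier ?T"
      and p: "\<And>x y. \<lbrakk>x \<in> carrier L; y \<in> carrier N\<rbrakk> \<Longrightarrow> \<theta> (r \<odot>\<^bsub>?T\<^esub> pure_tensor K ?LK ?NK x y) = \<zero>\<^bsub>K\<^esub>" for r m
    using A B L N m
  proof (induct m rule: tensor_module_induct')
    case (pure x y)
    thus ?case by (rule p)
  next
    case (add U U')
    show ?case
      unfolding T.smult_r_distr[OF r add(1,2)] \<theta>a[OF T.smult_closed[OF r add(1)] T.smult_closed[OF r add(2)]] add(3,4)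
      by simp
  qed
  \<comment> \<open>The ring elements whose action has image in the kernel of \<theta>. They form a
    subgroup that contains the pure tensors with a factor in \<open>I\<close> or \<open>J\<close>,
    hence the whole ideal.\<close>
  let ?Z = "{r \<in> carrier ?R. \<forall>m\<in>carrier ?T. \<theta> (r \<odot>\<^bsub>?T\<^esub> m) = \<zero>\<^bsub>K\<^esub>}"
  have Zadd: "r \<oplus>\<^bsub>?R\<^esub> s \<in> ?Z" if "r \<in> ?Z" "s \<in> ?Z" for r s
  proof -
    have rs: "r \<in> carrier ?R" "s \<in> carrier ?R" using that by blast+
    have "\<theta> ((r \<oplus>\<^bsub>?R\<^esub> s) \<odot>\<^bsub>?T\<^esub> m) = \<zero>\<^bsub>K\<^esub>" if m: "m \<in> carrier ?T" for m
      unfolding T.smult_l_distr[OF rs m] \<theta>a[OF T.smult_closed[OF rs(1) m] T.smult_closed[OF rs(2) m]]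
      using \<open>r \<in> ?Z\<close> \<open>s \<in> ?Z\<close> m by (simp del: tensor_algebra_simps tensor_module_simps)
    thus ?thesis using R.a_closed[OF rs] by blast
  qed
  have Zneg: "\<ominus>\<^bsub>?R\<^esub> r \<in> ?Z" if "r \<in> ?Z" for r
  proof -
    have r: "r \<in> carrier ?R" using that by blast
    have "\<theta> ((\<ominus>\<^bsub>?R\<^esub> r) \<odot>\<^bsub>?T\<^esub> m) = \<zero>\<^bsub>K\<^esub>" if m: "m \<in> carrier ?T" for m
    proof -
      have "\<theta> (r \<odot>\<^bsub>?T\<^esub> (\<ominus>\<^bsub>?T\<^esub> m)) = \<zero>\<^bsub>K\<^esub>" using \<open>r \<in> ?Z\<close> T.M.a_inv_closed[OF m] by blast
      thus ?thesis unfolding T.smult_l_minus[OF r m] T.smult_r_minus[OF r m] .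
    qed
    thus ?thesis using R.a_inv_closed[OF r] by blast
  qed
  have Zsub: "subgroup ?Z (add_monoid ?R)"
  proof
    show "?Z \<subseteq> carrier (add_monoid ?R)" by auto
    show "\<And>x y. \<lbrakk>x \<in> ?Z; y \<in> ?Z\<rbrakk> \<Longrightarrow> x \<otimes>\<^bsub>add_monoid ?R\<^esub> y \<in> ?Z" using Zadd by simp
    show "\<one>\<^bsub>add_monoid ?R\<^esub> \<in> ?Z"
      using R.zero_closed T.smult_l_null \<theta>0 by (simp del: tensor_algebra_simps tensor_module_simps)
    show "\<And>x. x \<in> ?Z \<Longrightarrow> inv\<^bsub>add_monoid ?R\<^esub> x \<in> ?Z" using Zneg by (simp add: a_inv_def)
  qed
  have pR: "pure_tensor K A B a b \<in> carrier ?R" if "a \<in> carrier A" "b \<in> carrier B" for a b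
    using pure_tensor_closed[OF algebra_D(3)[OF A] algebra_D(3)[OF B] that] by simp
  have pZ: "pure_tensor K A B a b \<in> ?Z" if ab: "a \<in> carrier A" "b \<in> carrier B" "a \<in> I \<or> b \<in> J" for a b
  proof -
    have "\<theta> (pure_tensor K A B a b \<odot>\<^bsub>?T\<^esub> pure_tensor K ?LK ?NK x y) = \<zero>\<^bsub>K\<^esub>"
      if xy: "x \<in> carrier L" "y \<in> carrier N" for x y
    proof -
      have c: "a \<odot>\<^bsub>L\<^esub> x \<in> carrier L" "b \<odot>\<^bsub>N\<^esub> y \<in> carrier N" using ab xy by auto
      have "\<phi> (a \<odot>\<^bsub>L\<^esub> x) = \<zero>\<^bsub>K\<^esub>" if "a \<in> I"
        by (rule \<phi>(2)) (use that xy in \<open>auto simp: ideal_smult_def intro: generate.incl\<close>)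
      moreover have "\<psi> (b \<odot>\<^bsub>N\<^esub> y) = \<zero>\<^bsub>K\<^esub>" if "b \<in> J"
        by (rule \<psi>(2)) (use that xy in \<open>auto simp: ideal_smult_def intro: generate.incl\<close>)
      ultimately show ?thesis
        unfolding tensor_module_pure(6)[OF A B L N xy ab(1,2)] \<theta>p[OF c]
        using ab(3) \<phi>D(1)[OF c(1)] \<psi>D(1)[OF c(2)] by auto
    qed
    thus ?thesis using zero_ext[OF pR[OF ab(1,2)]] pR[OF ab(1,2)] by blast
  qed
  have image_Z: "tensor_image K A B C D \<subseteq> ?Z" if "C \<subseteq> carrier A" "D \<subseteq> carrier B" "C \<subseteq> I \<or> D \<subseteq> J" for C D
    unfolding tensor_image_def
  proof (rule R.add.generate_subgroup_incl[OF _ Zsub], rule subsetI)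
    fix u assume "u \<in> {tensor_class K A B (frag_of (s, t)) | s t. s \<in> C \<and> t \<in> D}"
    then obtain s t where st: "u = pure_tensor K A B s t" "s \<in> C" "t \<in> D" by (auto simp: pure_tensor_def)
    show "u \<in> ?Z" unfolding st(1) by (rule pZ) (use st that in blast)+
  qed
  have aZ: "tensor_ideal K A B I J \<subseteq> ?Z"
  proof
    fix r assume "r \<in> tensor_ideal K A B I J"
    then obtain u v where uv: "r = u \<oplus>\<^bsub>?R\<^esub> v" "u \<in> tensor_image K A B I (carrier B)"
        "v \<in> tensor_image K A B (carrier A) J"
      unfolding tensor_ideal_def set_add_def' by blast
    have "u \<in> ?Z" by (rule subsetD[OF image_Z uv(2)]) (use I.Icarr in auto)
    moreover have "v \<in> ?Z" by (rule subsetD[OF image_Z uv(3)]) (use J.Icarr in auto)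
    ultimately show "r \<in> ?Z" unfolding uv(1) by (rule Zadd)
  qed
  let ?Y = "{m \<in> carrier ?T. \<theta> m = \<zero>\<^bsub>K\<^esub>}"
  have "subgroup ?Y (add_monoid ?T)"
  proof
    show "?Y \<subseteq> carrier (add_monoid ?T)" by auto
    fix x assume x: "x \<in> ?Y"
    hence xc: "x \<in> carrier ?T" by blast
    show "inv\<^bsub>add_monoid ?T\<^esub> x \<in> ?Y"
    proof -
      have "\<theta> (\<ominus>\<^bsub>?T\<^esub> x) \<oplus>\<^bsub>K\<^esub> \<theta> x = \<zero>\<^bsub>K\<^esub>"
        unfolding \<theta>a[OF T.M.a_inv_closed[OF xc] xc, symmetric] T.M.l_neg[OF xc] by (rule \<theta>0)
      moreover have "\<theta> x = \<zero>\<^bsub>K\<^esub>" using x by blast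
      ultimately have "\<theta> (\<ominus>\<^bsub>?T\<^esub> x) = \<zero>\<^bsub>K\<^esub>" using \<theta>c[OF T.M.a_inv_closed[OF xc]] by (simp del: tensor_module_simps)
      hence "\<ominus>\<^bsub>?T\<^esub> x \<in> ?Y" using T.M.a_inv_closed[OF xc] by blast
      thus ?thesis by (simp only: a_inv_def)
    qed
    fix y assume y: "y \<in> ?Y"
    hence yc: "y \<in> carrier ?T" by blast
    have "\<theta> (x \<oplus>\<^bsub>?T\<^esub> y) = \<zero>\<^bsub>K\<^esub>" unfolding \<theta>a[OF xc yc] using x y by simp
    hence "x \<oplus>\<^bsub>?T\<^esub> y \<in> ?Y" using T.M.a_closed[OF xc yc] by blast
    thus "x \<otimes>\<^bsub>add_monoid ?T\<^esub> y \<in> ?Y" by simp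
  next
    have "\<zero>\<^bsub>?T\<^esub> \<in> ?Y" using \<theta>0 T.M.zero_closed by blast
    thus "\<one>\<^bsub>add_monoid ?T\<^esub> \<in> ?Y" by simp
  qed
  hence "ideal_smult (tensor_ideal K A B I J) ?T \<subseteq> ?Y"
    unfolding ideal_smult_def
  proof (rule T.M.add.generate_subgroup_incl[rotated], intro subsetI)
    fix u assume "u \<in> {r \<odot>\<^bsub>?T\<^esub> m | r m. r \<in> tensor_ideal K A B I J \<and> m \<in> carrier ?T}"
    then obtain r m where u: "u = r \<odot>\<^bsub>?T\<^esub> m" "r \<in> tensor_ideal K A B I J" "m \<in> carrier ?T" by blast
    have r: "r \<in> carrier ?R" "\<theta> (r \<odot>\<^bsub>?T\<^esub> m) = \<zero>\<^bsub>K\<^esub>" using subsetD[OF aZ u(2)] u(3) by blast+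
    show "u \<in> ?Y" using T.smult_closed[OF r(1) u(3)] r(2) unfolding u(1) by blast
  qed
  moreover have "pure_tensor K ?LK ?NK l n \<in> carrier ?T" by (rule tensor_module_pure(1)[OF A B L N l(1) n(1)])
  moreover have "\<theta> (pure_tensor K ?LK ?NK l n) = \<one>\<^bsub>K\<^esub>" using \<theta>p[OF l(1) n(1)] \<phi>(3) \<psi>(3) by simp
  ultimately show ?thesis using K.one_not_zero by force
qed

theorem corollary2p7:
  fixes K :: "'k ring" and A :: "('k, 'a) module" and B :: "('k, 'b) module"
    and L :: "('a, 'l) module" and N :: "('b, 'n) module"
    and I :: "'a set" and J :: "'b set"
  assumes "field K"
    and "algebra K A" and "noetherian_ring A"
    and "algebra K B" and "noetherian_ring B"
    and "noetherian_ring (tensor_algebra K A B)"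
    and "ideal I A" and "ideal J B"
    and "fin_gen_module A L" and "carrier L \<noteq> {\<zero>\<^bsub>L\<^esub>}"
    and "fin_gen_module B N" and "carrier N \<noteq> {\<zero>\<^bsub>N\<^esub>}"
    and "ideal_smult I L \<noteq> carrier L" and "ideal_smult J N \<noteq> carrier N"
  shows "relative_Cohen_Macaulay (tensor_algebra K A B) (tensor_ideal K A B I J)
           (tensor_module K A B L N)
         \<longleftrightarrow> relative_Cohen_Macaulay A I L \<and> relative_Cohen_Macaulay B J N"
proof -
  have L: "module A L" and N: "module B N" using assms(9,11) by (auto simp: fin_gen_module_def)
  \<comment> \<open>Together with the hypotheses on IL and JN this excludes the first alternative of
    \<open>relative_Cohen_Macaulay\<close> for all three modules; what remains is that the sets of
    degrees are singletons.\<close>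
  have "carrier (tensor_module K A B L N) \<noteq> ideal_smult (tensor_ideal K A B I J) (tensor_module K A B L N)"
    by (rule ideal_smult_tensor_proper[OF assms(1,2,4,7,8) L N assms(13,14)])
  thus ?thesis
    unfolding relative_Cohen_Macaulay_def grade_eq_cohomological_dim_iff
      nonvanishing_degrees_tensor[OF assms(1-8) L N] sumset_singleton_iff
    using assms(13,14) by auto
qed

end
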